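(* Consider the closed-loop system consisting of the plant (P) for $(w,u)$ on $0\le x\le l(t)$ and the state-feedback control law (C) for $U_1,U_2$ (both written out in the context, under the standing assumptions listed there). If the initial values satisfy $(w(x,0),w_t(x,0))\in H^2(0,L)\times H^1(0,L)$ and $(u(x,0),u_t(x,0))\in H^2(0,L)\times H^1(0,L)$, then the closed-loop system is exponentially stable in the sense that there exist positive constants $\Upsilon_1,\sigma_1$ such that $$\begin{aligned}&\Big(\|w_t(\cdot,t)\|^2+\|w_x(\cdot,t)\|^2+\|u_t(\cdot,t)\|^2+\|u_x(\cdot,t)\|^2+|w(0,t)|^2+|w_t(0,t)|^2+|u(0,t)|^2+|u_t(0,t)|^2\Big)^{1/2}\\ &\le\Upsilon_1\Big(\|w_t(\cdot,0)\|^2+\|w_x(\cdot,0)\|^2+\|u_t(\cdot,0)\|^2+\|u_x(\cdot,0)\|^2+|w(0,0)|^2+|w_t(0,0)|^2+|u(0,0)|^2+|u_t(0,0)|^2\Big)^{1/2}e^{-\sigma_1t}.\end{aligned}$$ The convergence rate $\sigma_1$ is adjustable by the control parameters.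
   Context: Notation: $\|f(\cdot,t)\|^2=\int_0^{l(t)}f(x,t)^2dx$; $|\cdot|$ is the Euclidean norm. Plant (P), for $t\ge 0$, $0\le x\le l(t)$: $w_{tt}=d_1(x)w_{xx}+d_2(x)w_x+d_3(x)u_x+d_4(x)w_t+d_5(x)u_t$, $u_{tt}=d_6(x)u_{xx}+d_7(x)w_x+d_8(x)u_x+d_9(x)w_t+d_{10}(x)u_t$, $w_{tt}(0,t)=d_{11}w_t(0,t)+d_{12}w_x(0,t)+d_{13}u_t(0,t)+d_{14}u_x(0,t)$, $u_{tt}(0,t)=d_{15}u_t(0,t)+d_{16}u_x(0,t)+d_{17}w_t(0,t)+d_{18}w_x(0,t)$, $u_x(l(t),t)=d_{19}(l(t))U_1(t)$, $w_x(l(t),t)=d_{20}(l(t))U_2(t)$. Standing assumptions: $d_{11},\dots,d_{18}$ are arbitrary constants; $d_{19}(l(t)),d_{20}(l(t))$ are nonzero; $d_1,\dots,d_{10}$ are bounded on $[0,L]$; $d_1,d_6\in C^1$ are positive with $d_1(x)\ne d_6(x)$ for all $x\in[0,L]$; $0<l(t)\le L$ for all $t\ge0$; $\dot l(t)\in[\underline M,\overline M]$ with $\overline M<\min_{0\le x\le L}\{\sqrt{d_1(x)},\sqrt{d_6(x)}\}$ and $\underline M\in(-\infty,\overline M)$ arbitrary; $(\bar A-\bar BC_3,\bar B)$ is controllable (matrices defined next). Matrices: $Q(x)=\mathrm{diag}(\sqrt{d_6(x)},\sqrt{d_1(x)})$; $s_1=\frac{d_8-\sqrt{d_6}(\sqrt{d_6})'}{2\sqrt{d_6}}$,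 $s_2=\frac{d_2-\sqrt{d_1}(\sqrt{d_1})'}{2\sqrt{d_1}}$ (functions of $x$); $T_a=\begin{pmatrix}s_1+\frac{d_{10}}2&\frac{d_7}{2\sqrt{d_1}}+\frac{d_9}2\\ \frac{d_3}{2\sqrt{d_6}}+\frac{d_5}2&s_2+\frac{d_4}2\end{pmatrix}$, $T_b=\begin{pmatrix}\frac{d_{10}}2-s_1&\frac{d_9}2-\frac{d_7}{2\sqrt{d_1}}\\ \frac{d_5}2-\frac{d_3}{2\sqrt{d_6}}&\frac{d_4}2-s_2\end{pmatrix}$; $\bar T_a$ is the diagonal matrix formed by the diagonal entries of $T_a$; $\bar A=\begin{pmatrix}0&1&0&0\\0&d_{11}&0&d_{13}\\0&0&0&1\\0&d_{17}&0&d_{15}\end{pmatrix}$, $C_3=2\begin{pmatrix}0&0&0&1\\0&1&0&0\end{pmatrix}$, $\bar B=\begin{pmatrix}0&0\\ \frac{d_{14}}{2\sqrt{d_6(0)}}&\frac{d_{12}}{2\sqrt{d_1(0)}}\\0&0\\ \frac{d_{16}}{2\sqrt{d_6(0)}}&\frac{d_{18}}{2\sqrt{d_1(0)}}\end{pmatrix}$. Controller kernels: choose the control parameter $\kappa\in\mathbb R^{2\times4}$ such that $\bar A-\bar BC_3+2\bar B\kappa$ is Hurwitz. $F=(F_{ij})$, $N=(N_{ij})$ ($2\times2$, on $0\le y\le x\le L$) and $\lambda=(\lambda_{ij})$ ($2\times4$, on $[0,L]$), of class $L^\infty$, solve $Q(x)F(x,x)+F(x,x)Q(x)=-T_b(x)$,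 $Q(x)N(x,x)-N(x,x)Q(x)=\bar T_a(x)-T_a(x)$, $N(x,0)Q(0)=-F(x,0)Q(0)+2\lambda(x)\bar B+g(x)$, $Q(x)N_x+N_yQ(y)+NQ'(y)-NT_a(y)+\bar T_a(x)N-FT_a(y)=0$, $Q(x)F_x-F_yQ(y)-FQ'(y)-FT_b(y)+\bar T_a(x)F-NT_b(y)=0$, $Q(x)\lambda'(x)-\lambda(x)(\bar A-\bar BC_3)+\bar T_a(x)\lambda(x)-F(x,0)Q(0)C_3+g(x)\lambda(0)=0$, $\lambda(0)=\kappa$, with the artificial boundary condition $N_{21}(L,y)=0$, where $g(x)=\begin{pmatrix}0&0\\ g_a(x)&0\end{pmatrix}$, $g_a(x)=\sqrt{d_6(0)}\,(F_{21}(x,0)+N_{21}(x,0))-\frac{d_{14}\lambda_{22}(x)+d_{16}\lambda_{24}(x)}{\sqrt{d_6(0)}}$. State-feedback control law (C): with $p=[u_t-\sqrt{d_6}u_x,\ w_t-\sqrt{d_1}w_x]^T$, $r=[u_t+\sqrt{d_6}u_x,\ w_t+\sqrt{d_1}w_x]^T$, $W(t)=[w(0,t),w_t(0,t),u(0,t),u_t(0,t)]^T$ and $(\cdot)_i$ denoting the $i$-th component, $U_1(t)=-\frac{1}{d_{19}(l(t))\sqrt{d_6(l(t))}}\Big[u_t(l(t),t)-\Big(\int_0^{l(t)}F(l(t),y)p(y,t)dy+\int_0^{l(t)}N(l(t),y)r(y,t)dy+\lambda(l(t))W(t)\Big)_1\Big]$, $U_2(t)=-\frac{1}{d_{20}(l(t))\sqrt{d_1(l(t))}}\Big[w_t(l(t),t)-\Big(\int_0^{l(t)}F(l(t),y)p(y,t)dy+\int_0^{l(t)}N(l(t),y)r(y,t)dy+\lambda(l(t))W(t)\Big)_2\Big]$.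 *)

theory Defs
  imports "HOL-Analysis.Analysis"
begin

section \<open>Sobolev spaces on open sets\<close>

definition L2_on :: "'a::euclidean_space set \<Rightarrow> ('a \<Rightarrow> real) \<Rightarrow> bool" where
  "L2_on S f \<longleftrightarrow> f \<in> borel_measurable (lebesgue_on S) \<and> integrable (lebesgue_on S) (\<lambda>z. (f z)\<^sup>2)"

definition test_function ::
  "'a::euclidean_space set \<Rightarrow> ('a \<Rightarrow> real) \<Rightarrow> ('a \<Rightarrow> 'a \<Rightarrow> real) \<Rightarrow> bool" where
  "test_function S \<phi> \<phi>' \<longleftrightarrow>
     (\<forall>z. (\<phi> has_derivative \<phi>' z) (at z)) \<and>
     (\<forall>v. continuous_on UNIV (\<lambda>z. \<phi>' z v)) \<and>
     (\<exists>K. compact K \<and> K \<subseteq> S \<and> (\<forall>z. z \<notin> K \<longrightarrow> \<phi> z = 0))"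

text \<open>\<open>g\<close> is the weak derivative of \<open>f\<close> in direction \<open>v\<close> on the open set \<open>S\<close>. Test functions are
  \<open>C\<^sup>1\<close> with compact support, which gives the same first-order weak derivatives as \<open>C\<^sup>\<infinity>\<close> ones.\<close>

definition weak_derivative ::
  "'a::euclidean_space set \<Rightarrow> 'a \<Rightarrow> ('a \<Rightarrow> real) \<Rightarrow> ('a \<Rightarrow> real) \<Rightarrow> bool" where
  "weak_derivative S v f g \<longleftrightarrow>
     (\<forall>K. compact K \<and> K \<subseteq> S \<longrightarrow> set_integrable lebesgue K f \<and> set_integrable lebesgue K g) \<and>
     (\<forall>\<phi> \<phi>'. test_function S \<phi> \<phi>' \<longrightarrow>
        (LINT z:S|lebesgue. f z * \<phi>' z v) = - (LINT z:S|lebesgue. g z * \<phi> z))"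

primrec sobolev :: "nat \<Rightarrow> 'a::euclidean_space set \<Rightarrow> ('a \<Rightarrow> real) \<Rightarrow> bool" where
  "sobolev 0 S f = L2_on S f"
| "sobolev (Suc k) S f =
     (L2_on S f \<and> (\<forall>v\<in>Basis. \<exists>g. weak_derivative S v f g \<and> sobolev k S g))"


section \<open>Linear systems\<close>

definition hurwitz :: "real^'n^'n \<Rightarrow> bool" where
  "hurwitz A \<longleftrightarrow>
     (\<forall>(z::complex) (v::complex^'n). v \<noteq> 0 \<and> map_matrix complex_of_real A *v v = z *s v \<longrightarrow> Re z < 0)"

definition controllable :: "real^'n^'n \<Rightarrow> real^'m^'n \<Rightarrow> bool" where
  "controllable A B \<longleftrightarrow>
     (\<forall>x0 x1 T. 0 < T \<longrightarrow>
        (\<exists>(v :: real \<Rightarrow> real^'m) (x :: real \<Rightarrow> real^'n).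
           continuous_on {0..T} v \<and> x 0 = x0 \<and> x T = x1 \<and>
           (\<forall>t\<in>{0..T}. (x has_vector_derivative (A *v x t + B *v v t)) (at t within {0..T}))))"


section \<open>Plant data\<close>

text \<open>\<open>bdry\<close> is the moving boundary \<open>l\<close>, and \<open>Lmax\<close> is its upper bound \<open>L\<close>.\<close>

record plant =
  d1 :: "real \<Rightarrow> real"
  d2 :: "real \<Rightarrow> real"
  d3 :: "real \<Rightarrow> real"
  d4 :: "real \<Rightarrow> real"
  d5 :: "real \<Rightarrow> real"
  d6 :: "real \<Rightarrow> real"
  d7 :: "real \<Rightarrow> real"
  d8 :: "real \<Rightarrow> real"
  d9 :: "real \<Rightarrow> real"
  d10 :: "real \<Rightarrow> real"
  d11 :: real
  d12 :: real
  d13 :: real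
  d14 :: real
  d15 :: real
  d16 :: real
  d17 :: real
  d18 :: real
  d19 :: "real \<Rightarrow> real"
  d20 :: "real \<Rightarrow> real"
  Lmax :: real
  bdry :: "real \<Rightarrow> real"

definition C1_on_interval :: "real \<Rightarrow> real \<Rightarrow> (real \<Rightarrow> real) \<Rightarrow> bool" where
  "C1_on_interval a b f \<longleftrightarrow>
     (\<exists>f'. continuous_on {a..b} f' \<and>
           (\<forall>x\<in>{a..b}. (f has_real_derivative f' x) (at x within {a..b})))"

definition Qmat :: "plant \<Rightarrow> real \<Rightarrow> real^2^2" where
  "Qmat P x = vector [vector [sqrt (d6 P x), 0],
                      vector [0, sqrt (d1 P x)]]"

text \<open>Derivatives on \<open>[0, L]\<close> are one-sided at the end points.\<close>

definition sqrt_d1' :: "plant \<Rightarrow> real \<Rightarrow> real" where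
  "sqrt_d1' P x = vector_derivative (\<lambda>y. sqrt (d1 P y)) (at x within {0..Lmax P})"

definition sqrt_d6' :: "plant \<Rightarrow> real \<Rightarrow> real" where
  "sqrt_d6' P x = vector_derivative (\<lambda>y. sqrt (d6 P y)) (at x within {0..Lmax P})"

definition Qmat' :: "plant \<Rightarrow> real \<Rightarrow> real^2^2" where
  "Qmat' P x = vector [vector [sqrt_d6' P x, 0],
                       vector [0, sqrt_d1' P x]]"

definition s1 :: "plant \<Rightarrow> real \<Rightarrow> real" where
  "s1 P x = (d8 P x - sqrt (d6 P x) * sqrt_d6' P x) / (2 * sqrt (d6 P x))"

definition s2 :: "plant \<Rightarrow> real \<Rightarrow> real" where
  "s2 P x = (d2 P x - sqrt (d1 P x) * sqrt_d1' P x) / (2 * sqrt (d1 P x))"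

definition Ta :: "plant \<Rightarrow> real \<Rightarrow> real^2^2" where
  "Ta P x = vector
     [vector [s1 P x + d10 P x / 2, d7 P x / (2 * sqrt (d1 P x)) + d9 P x / 2],
      vector [d3 P x / (2 * sqrt (d6 P x)) + d5 P x / 2, s2 P x + d4 P x / 2]]"

definition Tb :: "plant \<Rightarrow> real \<Rightarrow> real^2^2" where
  "Tb P x = vector
     [vector [d10 P x / 2 - s1 P x, d9 P x / 2 - d7 P x / (2 * sqrt (d1 P x))],
      vector [d5 P x / 2 - d3 P x / (2 * sqrt (d6 P x)), d4 P x / 2 - s2 P x]]"

definition Ta_diag :: "plant \<Rightarrow> real \<Rightarrow> real^2^2" where
  "Ta_diag P x = (\<chi> i j. if i = j then Ta P x $ i $ j else 0)"

definition Abar :: "plant \<Rightarrow> real^4^4" where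
  "Abar P = vector
     [vector [0, 1, 0, 0],
      vector [0, d11 P, 0, d13 P],
      vector [0, 0, 0, 1],
      vector [0, d17 P, 0, d15 P]]"

definition C3 :: "real^4^2" where
  "C3 = 2 *\<^sub>R vector [vector [0, 0, 0, 1],
                      vector [0, 1, 0, 0]]"

definition Bbar :: "plant \<Rightarrow> real^2^4" where
  "Bbar P = vector
     [vector [0, 0],
      vector [d14 P / (2 * sqrt (d6 P 0)), d12 P / (2 * sqrt (d1 P 0))],
      vector [0, 0],
      vector [d16 P / (2 * sqrt (d6 P 0)), d18 P / (2 * sqrt (d1 P 0))]]"

definition standing_assumptions :: "plant \<Rightarrow> real \<Rightarrow> real \<Rightarrow> bool" where
  "standing_assumptions P Mlo Mhi \<longleftrightarrow>
     (\<forall>d \<in> {d1 P, d2 P, d3 P, d4 P, d5 P, d6 P, d7 P, d8 P, d9 P, d10 P}.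
        d \<in> borel_measurable (lebesgue_on {0..Lmax P}) \<and> bounded (d ` {0..Lmax P})) \<and>
     C1_on_interval 0 (Lmax P) (d1 P) \<and> C1_on_interval 0 (Lmax P) (d6 P) \<and>
     (\<forall>x\<in>{0..Lmax P}. 0 < d1 P x \<and> 0 < d6 P x \<and> d1 P x \<noteq> d6 P x) \<and>
     (\<forall>t\<ge>0. 0 < bdry P t \<and> bdry P t \<le> Lmax P) \<and>
     (\<forall>t\<ge>0. d19 P (bdry P t) \<noteq> 0 \<and> d20 P (bdry P t) \<noteq> 0) \<and>
     (\<forall>t\<ge>0. \<exists>m\<in>{Mlo..Mhi}. (bdry P has_real_derivative m) (at t within {0..})) \<and>
     Mlo < Mhi \<and>
     (\<forall>x\<in>{0..Lmax P}. Mhi < sqrt (d1 P x) \<and> Mhi < sqrt (d6 P x)) \<and>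
     controllable (Abar P - Bbar P ** C3) (Bbar P)"


section \<open>Controller kernels\<close>

definition triangle :: "real \<Rightarrow> (real \<times> real) set" where
  "triangle b = {(x, y). 0 \<le> y \<and> y \<le> x \<and> x \<le> b}"

text \<open>Bounded kernels need not be differentiable, so a transport equation
  \<open>a(x) f\<^sub>x + b(y) f\<^sub>y = h\<close> on the triangle is understood along its characteristics
  \<open>X' = a(X)\<close>, \<open>Y' = b(Y)\<close>: \<open>f\<close> is the integral of \<open>h\<close> along each of them.\<close>

definition transport_solution ::
  "real \<Rightarrow> (real \<Rightarrow> real) \<Rightarrow> (real \<Rightarrow> real) \<Rightarrow> (real \<Rightarrow> real \<Rightarrow> real) \<Rightarrow> (real \<Rightarrow> real \<Rightarrow> real) \<Rightarrow> bool"
  where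
  "transport_solution c a b f h \<longleftrightarrow>
     (\<forall>s X Y. 0 \<le> s \<and>
        (\<forall>\<tau>\<in>{0..s}. (X \<tau>, Y \<tau>) \<in> triangle c \<and>
           (X has_real_derivative a (X \<tau>)) (at \<tau> within {0..s}) \<and>
           (Y has_real_derivative b (Y \<tau>)) (at \<tau> within {0..s})) \<longrightarrow>
        ((\<lambda>\<tau>. h (X \<tau>) (Y \<tau>)) has_integral (f (X s) (Y s) - f (X 0) (Y 0))) {0..s})"

definition kernel_g ::
  "plant \<Rightarrow> (real \<Rightarrow> real \<Rightarrow> real^2^2) \<Rightarrow> (real \<Rightarrow> real \<Rightarrow> real^2^2) \<Rightarrow> (real \<Rightarrow> real^4^2)
    \<Rightarrow> real \<Rightarrow> real^2^2" where
  "kernel_g P F N lam x = vector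
     [vector [0, 0],
      vector [sqrt (d6 P 0) * (F x 0 $ 2 $ 1 + N x 0 $ 2 $ 1)
                - (d14 P * lam x $ 2 $ 2 + d16 P * lam x $ 2 $ 4) / sqrt (d6 P 0), 0]]"

text \<open>The two transport clauses are the \<open>(i, j)\<close> entries of the matrix equations for \<open>N\<close> and \<open>F\<close>
  with the zero-order terms moved to the right-hand side. The boundary conditions hold almost
  everywhere: at the corners of the triangle they are in general incompatible with each other.
  The equation for \<open>\<lambda>\<close> is a Caratheodory equation, with \<open>lam'\<close> the derivative of \<open>lam\<close>.\<close>

definition kernels ::
  "plant \<Rightarrow> real^4^2 \<Rightarrow> (real \<Rightarrow> real \<Rightarrow> real^2^2) \<Rightarrow> (real \<Rightarrow> real \<Rightarrow> real^2^2) \<Rightarrow> (real \<Rightarrow> real^4^2)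
    \<Rightarrow> bool" where
  "kernels P \<kappa> F N lam \<longleftrightarrow>
     (\<forall>K\<in>{F, N}. (\<lambda>(x, y). K x y) \<in> borel_measurable (restrict_space borel (triangle (Lmax P))) \<and>
                  bounded ((\<lambda>(x, y). K x y) ` triangle (Lmax P))) \<and>
     bounded (lam ` {0..Lmax P}) \<and>
     (AE x in lebesgue_on {0..Lmax P}.
        Qmat P x ** F x x + F x x ** Qmat P x = - Tb P x) \<and>
     (AE x in lebesgue_on {0..Lmax P}.
        Qmat P x ** N x x - N x x ** Qmat P x = Ta_diag P x - Ta P x) \<and>
     (AE x in lebesgue_on {0..Lmax P}.
        N x 0 ** Qmat P 0
          = - (F x 0 ** Qmat P 0) + 2 *\<^sub>R (lam x ** Bbar P) + kernel_g P F N lam x) \<and>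
     (\<forall>i j. transport_solution (Lmax P) (\<lambda>x. Qmat P x $ i $ i) (\<lambda>y. Qmat P y $ j $ j)
        (\<lambda>x y. N x y $ i $ j)
        (\<lambda>x y. (- (N x y ** Qmat' P y) + N x y ** Ta P y
                 - Ta_diag P x ** N x y + F x y ** Ta P y) $ i $ j)) \<and>
     (\<forall>i j. transport_solution (Lmax P) (\<lambda>x. Qmat P x $ i $ i) (\<lambda>y. - (Qmat P y $ j $ j))
        (\<lambda>x y. F x y $ i $ j)
        (\<lambda>x y. (F x y ** Qmat' P y + F x y ** Tb P y
                 - Ta_diag P x ** F x y + N x y ** Tb P y) $ i $ j)) \<and>
     (\<exists>lam'. (\<forall>x\<in>{0..Lmax P}. (lam' has_integral (lam x - lam 0)) {0..x}) \<and>
        (AE x in lebesgue_on {0..Lmax P}.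
           Qmat P x ** lam' x - lam x ** (Abar P - Bbar P ** C3) + Ta_diag P x ** lam x
             - F x 0 ** Qmat P 0 ** C3 + kernel_g P F N lam x ** lam 0 = 0)) \<and>
     lam 0 = \<kappa> \<and>
     (AE y in lebesgue_on {0..Lmax P}. N (Lmax P) y $ 2 $ 1 = 0)"


section \<open>Closed-loop system\<close>

text \<open>A motion consists of the two displacements \<open>w\<close>, \<open>u\<close> and their first partial derivatives,
  as functions of \<open>x\<close> and \<open>t\<close>.\<close>

record motion =
  disp_w :: "real \<Rightarrow> real \<Rightarrow> real"
  w_x :: "real \<Rightarrow> real \<Rightarrow> real"
  w_t :: "real \<Rightarrow> real \<Rightarrow> real"
  disp_u :: "real \<Rightarrow> real \<Rightarrow> real"
  u_x :: "real \<Rightarrow> real \<Rightarrow> real"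
  u_t :: "real \<Rightarrow> real \<Rightarrow> real"

definition motion_diff :: "motion \<Rightarrow> motion \<Rightarrow> motion" where
  "motion_diff Z Y = \<lparr>
     disp_w = (\<lambda>x t. disp_w Z x t - disp_w Y x t),
     w_x = (\<lambda>x t. w_x Z x t - w_x Y x t),
     w_t = (\<lambda>x t. w_t Z x t - w_t Y x t),
     disp_u = (\<lambda>x t. disp_u Z x t - disp_u Y x t),
     u_x = (\<lambda>x t. u_x Z x t - u_x Y x t),
     u_t = (\<lambda>x t. u_t Z x t - u_t Y x t)\<rparr>"

definition sq_norm :: "plant \<Rightarrow> (real \<Rightarrow> real \<Rightarrow> real) \<Rightarrow> real \<Rightarrow> real" where
  "sq_norm P f t = integral {0..bdry P t} (\<lambda>x. (f x t)\<^sup>2)"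

definition energy :: "plant \<Rightarrow> motion \<Rightarrow> real \<Rightarrow> real" where
  "energy P Z t =
     sq_norm P (w_t Z) t + sq_norm P (w_x Z) t + sq_norm P (u_t Z) t + sq_norm P (u_x Z) t +
     \<bar>disp_w Z 0 t\<bar>\<^sup>2 + \<bar>w_t Z 0 t\<bar>\<^sup>2 + \<bar>disp_u Z 0 t\<bar>\<^sup>2 + \<bar>u_t Z 0 t\<bar>\<^sup>2"

definition riemann_p :: "plant \<Rightarrow> motion \<Rightarrow> real \<Rightarrow> real \<Rightarrow> real^2" where
  "riemann_p P Z x t = vector [u_t Z x t - sqrt (d6 P x) * u_x Z x t,
                               w_t Z x t - sqrt (d1 P x) * w_x Z x t]"

definition riemann_r :: "plant \<Rightarrow> motion \<Rightarrow> real \<Rightarrow> real \<Rightarrow> real^2" where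
  "riemann_r P Z x t = vector [u_t Z x t + sqrt (d6 P x) * u_x Z x t,
                               w_t Z x t + sqrt (d1 P x) * w_x Z x t]"

definition ode_state :: "motion \<Rightarrow> real \<Rightarrow> real^4" where
  "ode_state Z t = vector [disp_w Z 0 t, w_t Z 0 t, disp_u Z 0 t, u_t Z 0 t]"

definition feedback ::
  "plant \<Rightarrow> (real \<Rightarrow> real \<Rightarrow> real^2^2) \<Rightarrow> (real \<Rightarrow> real \<Rightarrow> real^2^2) \<Rightarrow> (real \<Rightarrow> real^4^2)
    \<Rightarrow> motion \<Rightarrow> real \<Rightarrow> real^2" where
  "feedback P F N lam Z t =
     integral {0..bdry P t} (\<lambda>y. F (bdry P t) y *v riemann_p P Z y t) +
     integral {0..bdry P t} (\<lambda>y. N (bdry P t) y *v riemann_r P Z y t) +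
     lam (bdry P t) *v ode_state Z t"

definition control_U1 where
  "control_U1 P F N lam Z t =
     - (1 / (d19 P (bdry P t) * sqrt (d6 P (bdry P t)))) *
       (u_t Z (bdry P t) t - feedback P F N lam Z t $ 1)"

definition control_U2 where
  "control_U2 P F N lam Z t =
     - (1 / (d20 P (bdry P t) * sqrt (d1 P (bdry P t)))) *
       (w_t Z (bdry P t) t - feedback P F N lam Z t $ 2)"

definition domain :: "plant \<Rightarrow> (real \<times> real) set" where
  "domain P = {(x, t). 0 \<le> t \<and> 0 \<le> x \<and> x \<le> bdry P t}"

definition open_domain :: "plant \<Rightarrow> real \<Rightarrow> (real \<times> real) set" where
  "open_domain P T = {(x, t). 0 < t \<and> t < T \<and> 0 < x \<and> x < bdry P t}"

definition C1_on ::
  "(real \<times> real) set \<Rightarrow> (real \<Rightarrow> real \<Rightarrow> real) \<Rightarrow> (real \<Rightarrow> real \<Rightarrow> real) \<Rightarrow> (real \<Rightarrow> real \<Rightarrow> real) \<Rightarrow> bool"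
  where
  "C1_on S f fx ft \<longleftrightarrow>
     (\<forall>(x, t)\<in>S. ((\<lambda>(x, t). f x t) has_derivative (\<lambda>(h, k). fx x t * h + ft x t * k))
        (at (x, t) within S)) \<and>
     continuous_on S (\<lambda>(x, t). fx x t) \<and> continuous_on S (\<lambda>(x, t). ft x t)"

text \<open>\<open>fxx\<close>, \<open>fxt\<close>, \<open>ftt\<close> are the second-order weak derivatives, in \<open>L\<^sup>2\<close>, of a function with first
  partial derivatives \<open>fx\<close> and \<open>ft\<close>.\<close>

definition second_derivatives ::
  "(real \<times> real) set \<Rightarrow> (real \<Rightarrow> real \<Rightarrow> real) \<Rightarrow> (real \<Rightarrow> real \<Rightarrow> real)
    \<Rightarrow> (real \<Rightarrow> real \<Rightarrow> real) \<Rightarrow> (real \<Rightarrow> real \<Rightarrow> real) \<Rightarrow> (real \<Rightarrow> real \<Rightarrow> real) \<Rightarrow> bool" where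
  "second_derivatives S fx ft fxx fxt ftt \<longleftrightarrow>
     L2_on S (\<lambda>(x, t). fxx x t) \<and> L2_on S (\<lambda>(x, t). fxt x t) \<and> L2_on S (\<lambda>(x, t). ftt x t) \<and>
     weak_derivative S (1, 0) (\<lambda>(x, t). fx x t) (\<lambda>(x, t). fxx x t) \<and>
     weak_derivative S (0, 1) (\<lambda>(x, t). fx x t) (\<lambda>(x, t). fxt x t) \<and>
     weak_derivative S (1, 0) (\<lambda>(x, t). ft x t) (\<lambda>(x, t). fxt x t) \<and>
     weak_derivative S (0, 1) (\<lambda>(x, t). ft x t) (\<lambda>(x, t). ftt x t)"

text \<open>Strong solutions are \<open>C\<^sup>1\<close> up to the boundary and \<open>H\<^sup>2\<close> on every bounded time interval. The
  wave equations hold almost everywhere and the boundary conditions at every time.\<close>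

definition strong_solution ::
  "plant \<Rightarrow> (real \<Rightarrow> real \<Rightarrow> real^2^2) \<Rightarrow> (real \<Rightarrow> real \<Rightarrow> real^2^2) \<Rightarrow> (real \<Rightarrow> real^4^2)
    \<Rightarrow> motion \<Rightarrow> bool" where
  "strong_solution P F N lam Z \<longleftrightarrow>
     C1_on (domain P) (disp_w Z) (w_x Z) (w_t Z) \<and>
     C1_on (domain P) (disp_u Z) (u_x Z) (u_t Z) \<and>
     (\<exists>wxx wxt wtt uxx uxt utt. \<forall>T>0.
        second_derivatives (open_domain P T) (w_x Z) (w_t Z) wxx wxt wtt \<and>
        second_derivatives (open_domain P T) (u_x Z) (u_t Z) uxx uxt utt \<and>
        (AE (x, t) in lebesgue_on (open_domain P T).
           wtt x t = d1 P x * wxx x t + d2 P x * w_x Z x t + d3 P x * u_x Z x t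
                       + d4 P x * w_t Z x t + d5 P x * u_t Z x t \<and>
           utt x t = d6 P x * uxx x t + d7 P x * w_x Z x t + d8 P x * u_x Z x t
                       + d9 P x * w_t Z x t + d10 P x * u_t Z x t)) \<and>
     (\<forall>t\<ge>0.
        (w_t Z 0 has_real_derivative
           d11 P * w_t Z 0 t + d12 P * w_x Z 0 t + d13 P * u_t Z 0 t + d14 P * u_x Z 0 t)
          (at t within {0..}) \<and>
        (u_t Z 0 has_real_derivative
           d15 P * u_t Z 0 t + d16 P * u_x Z 0 t + d17 P * w_t Z 0 t + d18 P * w_x Z 0 t)
          (at t within {0..}) \<and>
        u_x Z (bdry P t) t = d19 P (bdry P t) * control_U1 P F N lam Z t \<and>
        w_x Z (bdry P t) t = d20 P (bdry P t) * control_U2 P F N lam Z t)"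

text \<open>Initial data in \<open>H\<^sup>2 \<times> H\<^sup>1\<close> that violate the compatibility condition with the feedback at
  \<open>x = l(0)\<close> do not start a strong solution. Solutions are therefore taken in the generalized
  sense, as limits of strong solutions in the energy norm, locally uniformly in time. Strong
  solutions are included (constant sequences).\<close>

definition closed_loop_solution ::
  "plant \<Rightarrow> (real \<Rightarrow> real \<Rightarrow> real^2^2) \<Rightarrow> (real \<Rightarrow> real \<Rightarrow> real^2^2) \<Rightarrow> (real \<Rightarrow> real^4^2)
    \<Rightarrow> motion \<Rightarrow> bool" where
  "closed_loop_solution P F N lam Z \<longleftrightarrow>
     (\<forall>t\<ge>0. \<forall>f\<in>{w_x Z, w_t Z, u_x Z, u_t Z}. L2_on {0..bdry P t} (\<lambda>x. f x t)) \<and>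
     (\<exists>Zs :: nat \<Rightarrow> motion.
        (\<forall>n. strong_solution P F N lam (Zs n)) \<and>
        (\<forall>(x, t)\<in>domain P. (\<lambda>n. disp_w (Zs n) x t) \<longlonglongrightarrow> disp_w Z x t \<and>
                            (\<lambda>n. disp_u (Zs n) x t) \<longlonglongrightarrow> disp_u Z x t) \<and>
        (\<forall>T\<ge>0. uniform_limit {0..T} (\<lambda>n t. energy P (motion_diff (Zs n) Z) t) (\<lambda>_. 0) sequentially))"

definition initial_regularity :: "plant \<Rightarrow> motion \<Rightarrow> bool" where
  "initial_regularity P Z \<longleftrightarrow>
     (\<exists>w0 w1 u0 u1.
        sobolev 2 {0<..<Lmax P} w0 \<and> sobolev 1 {0<..<Lmax P} w1 \<and>
        sobolev 2 {0<..<Lmax P} u0 \<and> sobolev 1 {0<..<Lmax P} u1 \<and>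
        (\<forall>x\<in>{0..bdry P 0}. disp_w Z x 0 = w0 x \<and> w_t Z x 0 = w1 x \<and>
                            disp_u Z x 0 = u0 x \<and> u_t Z x 0 = u1 x))"

definition exp_stable_with ::
  "plant \<Rightarrow> (real \<Rightarrow> real \<Rightarrow> real^2^2) \<Rightarrow> (real \<Rightarrow> real \<Rightarrow> real^2^2) \<Rightarrow> (real \<Rightarrow> real^4^2)
    \<Rightarrow> real \<Rightarrow> real \<Rightarrow> bool" where
  "exp_stable_with P F N lam \<Upsilon> \<sigma> \<longleftrightarrow>
     (\<forall>Z. closed_loop_solution P F N lam Z \<and> initial_regularity P Z \<longrightarrow>
        (\<forall>t\<ge>0. sqrt (energy P Z t) \<le> \<Upsilon> * sqrt (energy P Z 0) * exp (- \<sigma> * t)))"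

end

theory Submission
 imports Defs "HOL-Computational_Algebra.Fundamental_Theorem_Algebra"
begin

text \<open>In the Riemann coordinates \<open>p\<close>, \<open>r\<close> the plant is a transport system coupled to an ODE for the boundary state \<open>W\<close>.
The kernel equations say that \<open>\<beta> = r - \<integral>F p - \<integral>N r - \<lambda> W\<close> is driven along left-going characteristics
only by itself (through the diagonal of \<open>Ta\<close> and \<open>g\<close>), and the control law is \<open>\<beta>(l t, t) = 0\<close>; as \<open>N\<close> and \<open>F\<close>
are merely bounded, this is checked in integrated form. Every left-going characteristic meets the moving
boundary in the past, so \<open>\<beta>\<close> vanishes after a finite time, whatever \<open>l\<close> does. From then on \<open>W\<close> obeys the
Hurwitz ODE, and a weighted supremum estimate carries its decay to \<open>p\<close> along right-going characteristics, which start
at \<open>x = 0\<close> because the boundary is slower, and to \<open>r\<close> by inverting the Volterra transformation. Before that time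
Gronwall estimates in \<open>L\<^sup>2\<close> bound the growth. The transport identities for \<open>H\<^sup>2\<close> data come from mollified test
functions; other solutions are limits in the energy norm.\<close>

text \<open>The initial energy bounds L2 norms but no point values, while decay is propagated
  pointwise along characteristics. Hence two regimes: while initial values still matter, squares are
  integrated over the feet of characteristics, whose Jacobians are controlled by ratios of speeds;
  later every value goes back to data at x = 0 that \<open>W\<close> governs, and suprema become
  available. Each transfer takes a bounded time, so the rate of \<open>W\<close> is inherited
  without loss: it is any s for which the closed-loop matrix shifted by s is Hurwitz. The components
  of \<beta> die out in turn, because g is strictly lower triangular: the first is autonomous, the
  second has only the trace of the first at x = 0 as a driving term. Coefficients are merely
  measurable and kernel boundary conditions hold almost everywhere, whereas a characteristic is a
  null set of the plane. Hence everything is expressed by everywhere defined Borel functions, and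
  the exceptional times on each characteristic are shown to be negligible. The rate can be
  prescribed because controllability makes the input rows of the two velocities independent.\<close>

lemmas borel_contI = borel_measurable_continuous_onI

section \<open>Bounded Borel functions\<close>

text \<open>Boundedness and Borel measurability hold everywhere, not almost everywhere, so that
  restrictions to characteristics, which are null sets of the plane, stay in the class and are
  integrable on bounded intervals.\<close>

definition bm :: "('a::topological_space => real) => bool" where
 "bm f \<longleftrightarrow> f \<in> borel_measurable borel \<and> (\<exists>B. \<forall>x. \<bar>f x\<bar> <= B)"

lemma bm_measurable: "bm f ==> f \<in> borel_measurable borel"
 by (simp add: bm_def)

lemma bm_bound:
 assumes "bm f" obtains B where "0 <= B" "\<And>x. \<bar>f x\<bar> <= B"
proof -
 obtain B where B: "\<And>x. \<bar>f x\<bar> <= B" using assms unfolding bm_def by blast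
 have "0 <= B" using B[of undefined] abs_ge_zero order_trans by blast
 then show ?thesis using that B by blast
qed

lemma bmI: "f \<in> borel_measurable borel ==> (\<And>x. \<bar>f x\<bar> <= B) ==> bm f"
 unfolding bm_def by blast

lemma bm_const [simp]: "bm (\<lambda>x. c)"
 by (rule bmI[where B="\<bar>c\<bar>"]) auto

lemma bm_add: "bm f ==> bm g ==> bm (\<lambda>x. f x + g x)"
proof -
 assume "bm f" "bm g"
 then obtain B C where "\<And>x. \<bar>f x\<bar> <= B" "\<And>x. \<bar>g x\<bar> <= C" unfolding bm_def by blast
 then have "\<bar>f x + g x\<bar> <= B + C" for x by (meson abs_triangle_ineq add_mono order_trans)
 then show ?thesis using \<open>bm f\<close> \<open>bm g\<close> unfolding bm_def by auto
qed

lemma bm_mult: "bm f ==> bm g ==> bm (\<lambda>x. f x * g x)"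
proof -
 assume a: "bm f" "bm g"
 obtain B where B: "0 <= B" "\<And>x. \<bar>f x\<bar> <= B" using bm_bound a by metis
 obtain C where C: "0 <= C" "\<And>x. \<bar>g x\<bar> <= C" using bm_bound a by metis
 have "\<bar>f x * g x\<bar> <= B * C" for x using B C by (simp add: abs_mult mult_mono')
 then show ?thesis using a unfolding bm_def by auto
qed

lemma bm_uminus: "bm f ==> bm (\<lambda>x. - f x)"
 using bm_mult[of "\<lambda>x. -1" f] by simp

lemma bm_diff: "bm f ==> bm g ==> bm (\<lambda>x. f x - g x)"
 using bm_add[of f "\<lambda>x. - g x"] bm_uminus by auto

lemma bm_abs: "bm f ==> bm (\<lambda>x. \<bar>f x\<bar>)"
 unfolding bm_def by auto

lemma bm_sum: "(\<And>i. i \<in> I ==> bm (f i)) ==> bm (\<lambda>x. \<Sum>i\<in>I. f i x)"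
 by (induction I rule: infinite_finite_induct) (auto intro: bm_add)

lemma bm_power: "bm f ==> bm (\<lambda>x. f x ^ n)"
 by (induction n) (auto intro: bm_mult)

lemma bm_comp: "bm f ==> g \<in> borel_measurable borel ==> bm (\<lambda>x. f (g x))"
 unfolding bm_def by auto

lemma bm_indicator: "S \<in> sets borel ==> bm (indicator S)"
 by (rule bmI[where B=1]) (auto simp: indicator_def)

text \<open>Extension by zero brings functions that are continuous only on the part of the moving
  domain up to a given time into the class \<open>bm\<close>.\<close>

lemma bm_continuous_on_compact:
 fixes k :: "'a::t2_space => real"
 assumes S: "compact S" and k: "continuous_on S k"
 shows "bm (\<lambda>x. if x \<in> S then k x else 0)"
proof -
 obtain K where K: "\<forall>y\<in>k ` S. norm y <= K"
  using compact_imp_bounded[OF compact_continuous_image[OF k S]] unfolding bounded_iff by blast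
 have "S \<in> sets borel" using S by (simp add: borel_closed compact_imp_closed)
 then have "(\<lambda>x. if x \<in> S then k x else 0) \<in> borel_measurable borel"
  using k by (intro borel_measurable_continuous_on_if) auto
 then show ?thesis by (rule bmI[where B="max K 0"]) (use K in \<open>auto simp: le_max_iff_disj\<close>)
qed

lemma bm_swap: "bm f ==> bm (\<lambda>z. f (snd z, fst z))" for f :: "real \<times> real => real"
 by (rule bm_comp) (auto simp: borel_prod[symmetric])

lemma bm_pair1: "bm f ==> bm (\<lambda>x. f (x, y))" for f :: "real \<times> real => real"
 by (rule bm_comp) (auto simp: borel_prod[symmetric])

lemma bm_pair2: "bm f ==> bm (\<lambda>y. f (x, y))" for f :: "'a::second_countable_topology \<times> real => real"
 by (rule bm_comp) (auto simp: borel_prod[symmetric])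

lemma bm_set_integrable: "bm f ==> set_integrable lborel {a..b} f" for f :: "real => real"
proof -
 assume f: "bm f"
 then obtain B where "\<And>x. \<bar>f x\<bar> <= B" unfolding bm_def by blast
 then show ?thesis unfolding set_integrable_def
  by (intro integrableI_bounded_set_indicator[where B=B]) (use f bm_measurable in \<open>auto simp: emeasure_lborel_Icc_eq\<close>)
qed

lemma bm_set_integral: "bm f ==> (LINT x:{a..b}|lborel. f x) = integral {a..b} f" for f :: "real => real"
 by (rule set_borel_integral_eq_integral(2)[OF bm_set_integrable])

lemma bm_integrable_on: "bm f ==> f integrable_on {a..b}" for f :: "real => real"
 by (rule set_borel_integral_eq_integral(1)[OF bm_set_integrable])

lemma bm_has_integral: "bm f ==> (f has_integral integral {a..b} f) {a..b}" for f :: "real => real"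
 using bm_integrable_on by blast

lemma integral_bound_real:
 fixes f :: "real => real"
 assumes "a <= b" "f integrable_on {a..b}" "\<And>x. x \<in> {a..b} ==> \<bar>f x\<bar> <= B"
 shows "\<bar>integral {a..b} f\<bar> <= B * (b - a)"
proof -
 have "\<bar>integral {a..b} f\<bar> <= integral {a..b} (\<lambda>x. B)"
  using integral_norm_bound_integral[of f "{a..b}" "\<lambda>x. B"] assms by auto
 then show ?thesis using assms by (simp add: mult.commute)
qed

text \<open>The moving limits enter the integrand as a condition on \<open>y\<close>, so joint
  measurability gives measurability in the parameter; confining the limits to a fixed range gives
  the bound.\<close>

lemma bm_integral_param:
 fixes f :: "'a::second_countable_topology \<times> real => real"
 assumes f: "bm f" and al: "\<alpha> \<in> borel_measurable borel" "\<beta> \<in> borel_measurable borel"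
  and bd: "\<And>x. m <= \<alpha> x" "\<And>x. \<beta> x <= M"
 shows "bm (\<lambda>x. integral {\<alpha> x..\<beta> x} (\<lambda>y. f (x, y)))"
proof -
 obtain B where B: "0 <= B" "\<And>z. \<bar>f z\<bar> <= B" using bm_bound[OF f] by blast
 note [measurable] = al
 have [measurable]: "f \<in> borel_measurable (borel \<Otimes>\<^sub>M borel)" using f by (simp add: bm_def borel_prod)
 have eq: "integral {\<alpha> x..\<beta> x} (\<lambda>y. f (x, y)) = (LINT y|lborel. (if \<alpha> x <= y \<and> y <= \<beta> x then f (x, y) else 0))" for x
  using bm_set_integral[OF bm_pair2[OF f], of "\<alpha> x" "\<beta> x" x]
  unfolding set_lebesgue_integral_def
  by (auto intro!: Bochner_Integration.integral_cong simp: indicator_def elim!: trans[OF sym])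
 have "(\<lambda>x. LINT y|lborel. (if \<alpha> x <= y \<and> y <= \<beta> x then f (x, y) else 0)) \<in> borel_measurable borel"
  by measurable
 moreover have "\<bar>integral {\<alpha> x..\<beta> x} (\<lambda>y. f (x, y))\<bar> <= B * \<bar>M - m\<bar>" for x
 proof (cases "\<alpha> x <= \<beta> x")
  case True
  have "\<bar>integral {\<alpha> x..\<beta> x} (\<lambda>y. f (x, y))\<bar> <= B * (\<beta> x - \<alpha> x)"
   by (rule integral_bound_real[OF True bm_integrable_on[OF bm_pair2[OF f]]]) (use B in auto)
  also have "... <= B * \<bar>M - m\<bar>" by (rule mult_left_mono) (use bd[of x] B in auto)
  finally show ?thesis .
 qed (use B in simp)
 ultimately show ?thesis unfolding eq[symmetric] by (intro bmI) auto
qed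

lemma bm_fubini:
 fixes f :: "real \<times> real => real"
 assumes f: "bm f"
 shows "integral {a..b} (\<lambda>x. integral {c..d} (\<lambda>y. f (x, y))) = integral {c..d} (\<lambda>y. integral {a..b} (\<lambda>x. f (x, y)))"
proof -
 obtain B where B: "0 <= B" "\<And>z. \<bar>f z\<bar> <= B" using bm_bound[OF f] by blast
 have [measurable]: "f \<in> borel_measurable (borel \<Otimes>\<^sub>M borel)" using f by (simp add: bm_def borel_prod)
 let ?g = "\<lambda>z. indicator ({a..b} \<times> {c..d}) z *\<^sub>R f z"
 have int: "integrable (lborel \<Otimes>\<^sub>M lborel) ?g"
 proof (rule integrableI_bounded_set_indicator[where B=B])
  show "emeasure (lborel \<Otimes>\<^sub>M lborel) ({a..b} \<times> {c..d}) < \<infinity>"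
   by (subst lborel.emeasure_pair_measure_Times) (auto simp: ennreal_mult_less_top emeasure_lborel_Icc_eq)
 qed (use B in \<open>auto\<close>)
 have i2: "bm (\<lambda>y. integral {a..b} (\<lambda>x. f (x, y)))"
  using bm_integral_param[OF bm_swap[OF f], of "\<lambda>_. a" "\<lambda>_. b" a b] by simp
 have i1: "bm (\<lambda>x. integral {c..d} (\<lambda>y. f (x, y)))"
  using bm_integral_param[OF f, of "\<lambda>_. c" "\<lambda>_. d" c d] by simp
 have "(LINT y|lborel. (LINT x|lborel. ?g (x, y))) = (LINT x|lborel. (LINT y|lborel. ?g (x, y)))"
  by (rule lborel_pair.Fubini_integral) (use int in \<open>simp add: case_prod_unfold\<close>)
 moreover have "(LINT x|lborel. ?g (x, y)) = indicator {c..d} y *\<^sub>R integral {a..b} (\<lambda>x. f (x, y))" for y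
  using bm_set_integral[OF bm_pair1[OF f], of a b y] unfolding set_lebesgue_integral_def
  by (cases "y \<in> {c..d}") (auto simp: indicator_times algebra_simps)
 moreover have "(LINT y|lborel. ?g (x, y)) = indicator {a..b} x *\<^sub>R integral {c..d} (\<lambda>y. f (x, y))" for x
  using bm_set_integral[OF bm_pair2[OF f], of c d x] unfolding set_lebesgue_integral_def
  by (cases "x \<in> {a..b}") (auto simp: indicator_times algebra_simps)
 ultimately show ?thesis
  using bm_set_integral[OF i1, of a b] bm_set_integral[OF i2, of c d] unfolding set_lebesgue_integral_def by simp
qed

lemma bm_substitution:
 fixes f g g' :: "real => real"
 assumes f: "bm f" and ab: "a <= b"
  and g: "\<And>x. x \<in> {a..b} ==> (g has_real_derivative g' x) (at x)"
  and g': "continuous_on {a..b} g'" and nn: "\<And>x. x \<in> {a..b} ==> 0 <= g' x"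
 shows "((\<lambda>x. f (g x) * g' x) has_integral integral {g a..g b} f) {a..b}"
proof -
 note s = integral_substitution[OF bm_set_integrable[OF f] g g' nn ab]
 have 1: "set_integrable lborel {a..b} (\<lambda>x. f (g x) * g' x)" by (rule s(1)) auto
 have "(LINT x:{a..b}|lborel. f (g x) * g' x) = integral {g a..g b} f"
  using s(2) bm_set_integral[OF f, of "g a" "g b"] unfolding set_lebesgue_integral_def
  by (simp add: mult.commute mult.left_commute)
 then show ?thesis using set_borel_integral_eq_integral[OF 1] by (metis integrable_integral)
qed

lemma bm_substitution_neg:
 fixes f g g' :: "real => real"
 assumes f: "bm f" and ab: "a <= b"
  and g: "\<And>x. x \<in> {a..b} ==> (g has_real_derivative g' x) (at x)"
  and g': "continuous_on {a..b} g'" and nn: "\<And>x. x \<in> {a..b} ==> g' x <= 0"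
 shows "((\<lambda>x. f (g x) * - g' x) has_integral integral {g b..g a} f) {a..b}"
proof -
 have m: "bm (\<lambda>x. f (- x))" by (rule bm_comp[OF f]) auto
 have "((\<lambda>x. f (- (- g x)) * - g' x) has_integral integral {- g a..- g b} (\<lambda>x. f (- x))) {a..b}"
  by (rule bm_substitution[OF m ab, of "\<lambda>x. - g x"])
    (use g g' nn in \<open>auto intro!: derivative_eq_intros continuous_intros\<close>)
 then show ?thesis by (simp add: Henstock_Kurzweil_Integration.integral_reflect_real)
qed

lemmas HK_combine = Henstock_Kurzweil_Integration.integral_combine

lemma DERIV_continuous_on_at: "(\<And>x. (f has_real_derivative f' x) (at x)) ==> continuous_on S f"
 by (meson DERIV_continuous_on has_field_derivative_at_within)

section \<open>Product rules along moving limits\<close>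

text \<open>Replaces differentiation in this part: the functions concerned are only Lipschitz, with
  a bounded Borel derivative. Each product or transport rule is therefore shown for the defect
  \<open>G\<close> between its two sides, whose increments turn out to be of second order.\<close>

lemma const_if_quadratic_increments:
 fixes G :: "real => real"
 assumes ab: "a <= b" and G: "\<And>s t. a <= s ==> s <= t ==> t <= b ==> \<bar>G t - G s\<bar> <= C * (t - s)\<^sup>2"
 shows "G b = G a"
proof -
 have "(G has_real_derivative 0) (at x within {a..b})" if x: "x \<in> {a..b}" for x
 proof -
  have "((\<lambda>y. (G y - G x) / (y - x)) \<longlongrightarrow> 0) (at x within {a..b})"
  proof (rule Lim_null_comparison)
   show "((\<lambda>y. \<bar>C\<bar> * \<bar>y - x\<bar>) \<longlongrightarrow> 0) (at x within {a..b})"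
    by (rule tendsto_eq_intros refl | simp)+
   have "\<bar>(G y - G x) / (y - x)\<bar> <= \<bar>C\<bar> * \<bar>y - x\<bar>" if y: "y \<in> {a..b}" "y \<noteq> x" for y
   proof -
    have "\<bar>G y - G x\<bar> <= C * (y - x)\<^sup>2"
     using G[of x y] G[of y x] x y by (cases "x <= y") (auto simp: abs_minus_commute power2_commute)
    also have "... <= \<bar>C\<bar> * \<bar>y - x\<bar> * \<bar>y - x\<bar>"
     by (simp add: power2_eq_square mult_right_mono mult.assoc)
    finally show ?thesis using y by (simp add: abs_divide divide_le_eq)
   qed
   then show "\<forall>\<^sub>F y in at x within {a..b}. norm ((G y - G x) / (y - x)) <= \<bar>C\<bar> * \<bar>y - x\<bar>"
    by (auto simp: eventually_at intro!: exI[of _ 1])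
  qed
  then show ?thesis by (simp add: has_field_derivative_iff)
 qed
 then have "\<exists>c. \<forall>x\<in>{a..b}. G x = c"
  by (intro has_field_derivative_zero_constant) auto
 then show ?thesis using ab by force
qed

lemma continuous_on_ordered_lipschitz:
 fixes f :: "real => real"
 assumes C: "0 <= C" and f: "\<And>s t. a <= s ==> s <= t ==> t <= b ==> \<bar>f t - f s\<bar> <= C * (t - s)"
 shows "continuous_on {a..b} f"
proof (rule lipschitz_on_continuous_on[of C], rule lipschitz_onI)
 fix x y assume xy: "x \<in> {a..b}" "y \<in> {a..b}"
 show "dist (f x) (f y) <= C * dist x y"
 proof (cases "x <= y")
  case True
  then show ?thesis using f[of x y] xy by (simp add: dist_real_def abs_minus_commute)
 next
  case False
  then show ?thesis using f[of y x] xy by (simp add: dist_real_def)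
 qed
qed (rule C)

lemma has_integral_product_rule:
 fixes f g f' g' :: "real => real"
 assumes ab: "a <= b" and f': "bm f'" and g': "bm g'"
  and f: "\<And>s t. a <= s ==> s <= t ==> t <= b ==> (f' has_integral (f t - f s)) {s..t}"
  and g: "\<And>s t. a <= s ==> s <= t ==> t <= b ==> (g' has_integral (g t - g s)) {s..t}"
 shows "((\<lambda>x. f' x * g x + f x * g' x) has_integral (f b * g b - f a * g a)) {a..b}"
proof -
 obtain A where A: "0 <= A" "\<And>x. \<bar>f' x\<bar> <= A" using bm_bound[OF f'] by blast
 obtain B where B: "0 <= B" "\<And>x. \<bar>g' x\<bar> <= B" using bm_bound[OF g'] by blast
 have lf: "\<bar>f t - f s\<bar> <= A * (t - s)" if "a <= s" "s <= t" "t <= b" for s t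
  using has_integral_bound[OF A(1), of f' "f t - f s" s t] f[OF that] A(2) that by auto
 have lg: "\<bar>g t - g s\<bar> <= B * (t - s)" if "a <= s" "s <= t" "t <= b" for s t
  using has_integral_bound[OF B(1), of g' "g t - g s" s t] g[OF that] B(2) that by auto
 have cf: "continuous_on {a..b} f" and cg: "continuous_on {a..b} g"
  using continuous_on_ordered_lipschitz[OF A(1) lf] continuous_on_ordered_lipschitz[OF B(1) lg] by auto
 let ?h = "\<lambda>x. f' x * g x + f x * g' x"
 define fe where "fe x = (if x \<in> {a..b} then f x else 0)" for x
 define ge where "ge x = (if x \<in> {a..b} then g x else 0)" for x
 have bmh: "bm (\<lambda>x. f' x * ge x + fe x * g' x)"
  unfolding fe_def ge_def by (intro bm_add bm_mult f' g' bm_continuous_on_compact cf cg compact_Icc)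
 have hint: "?h integrable_on {s..t}" if "a <= s" "t <= b" for s t
  using bm_integrable_on[OF bmh, of s t]
  by (rule integrable_eq) (use that in \<open>auto simp: fe_def ge_def\<close>)
 define G where "G t = f t * g t - integral {a..t} ?h" for t
 \<comment> \<open>The increment of \<open>G\<close> is the product of the increments of
   \<open>f\<close> and \<open>g\<close>, at most \<open>A * B * (t - s)\<^sup>2\<close>, minus the
   integral of \<open>?h\<close> with the values at \<open>s\<close> subtracted from
   \<open>f\<close> and \<open>g\<close>, at most twice that.\<close>
 have "\<bar>G t - G s\<bar> <= (3 * A * B) * (t - s)\<^sup>2" if st: "a <= s" "s <= t" "t <= b" for s t
 proof -
  have c: "integral {a..t} ?h - integral {a..s} ?h = integral {s..t} ?h"
   using HK_combine[of a s t ?h] hint st by auto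
  have hs: "((\<lambda>x. f' x * g s + f s * g' x) has_integral ((f t - f s) * g s + f s * (g t - g s))) {s..t}"
   by (intro has_integral_add has_integral_mult_left has_integral_mult_right f g st)
  have "integral {s..t} (\<lambda>x. f' x * (g x - g s) + (f x - f s) * g' x) = integral {s..t} ?h - ((f t - f s) * g s + f s * (g t - g s))"
  proof (rule integral_unique)
   have "((\<lambda>x. ?h x - (f' x * g s + f s * g' x)) has_integral (integral {s..t} ?h - ((f t - f s) * g s + f s * (g t - g s)))) {s..t}"
    by (rule has_integral_diff[OF _ hs]) (use hint st in \<open>auto\<close>)
   then show "((\<lambda>x. f' x * (g x - g s) + (f x - f s) * g' x) has_integral (integral {s..t} ?h - ((f t - f s) * g s + f s * (g t - g s)))) {s..t}"
    by (simp add: algebra_simps)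
  qed
  moreover have "\<bar>integral {s..t} (\<lambda>x. f' x * (g x - g s) + (f x - f s) * g' x)\<bar> <= (2 * A * B * (t - s)) * (t - s)"
  proof (rule integral_bound_real[OF st(2)])
   have "(\<lambda>x. ?h x - (f' x * g s + f s * g' x)) integrable_on {s..t}"
    by (rule integrable_diff) (use hint st hs in \<open>auto\<close>)
   then show "(\<lambda>x. f' x * (g x - g s) + (f x - f s) * g' x) integrable_on {s..t}" by (simp add: algebra_simps)
   fix x assume x: "x \<in> {s..t}"
   have "\<bar>f' x * (g x - g s)\<bar> <= A * (B * (t - s))"
    unfolding abs_mult by (rule mult_mono) (use A B lg[of s x] x st in \<open>auto intro: order_trans[OF lg mult_left_mono]\<close>)
   moreover have "\<bar>(f x - f s) * g' x\<bar> <= (A * (t - s)) * B"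
    unfolding abs_mult by (rule mult_mono) (use A B lf[of s x] x st in \<open>auto intro: order_trans[OF lf mult_left_mono]\<close>)
   ultimately show "\<bar>f' x * (g x - g s) + (f x - f s) * g' x\<bar> <= 2 * A * B * (t - s)"
    by (simp add: abs_le_iff algebra_simps)
  qed
  moreover have "\<bar>(f t - f s) * (g t - g s)\<bar> <= (A * (t - s)) * (B * (t - s))"
   unfolding abs_mult by (rule mult_mono) (use lf lg st A B in auto)
  moreover have "G t - G s = (f t - f s) * (g t - g s) - (integral {s..t} ?h - ((f t - f s) * g s + f s * (g t - g s)))"
   unfolding G_def using c by (simp add: algebra_simps)
  ultimately show ?thesis by (simp add: power2_eq_square algebra_simps)
 qed
 from const_if_quadratic_increments[OF ab this]
 have "integral {a..b} ?h = f b * g b - f a * g a" unfolding G_def by simp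
 then show ?thesis using hint[of a b] by (metis integrable_integral order_refl)
qed

section \<open>Gronwall's inequality for integrable functions\<close>

lemma gronwall:
 fixes f :: "real => real"
 assumes f: "f integrable_on {a..b}" and C: "0 <= C"
  and le: "\<And>t. t \<in> {a..b} ==> f t <= A + C * integral {a..t} f"
  and t: "t \<in> {a..b}"
 shows "f t <= A * exp (C * (t - a))"
proof -
 \<comment> \<open>\<open>f\<close> need not be continuous. Its majorant \<open>g\<close> is, and
   \<open>U\<close> is differentiable with derivative \<open>C * g\<close>, which is at most
   \<open>C * U\<close>; hence \<open>V\<close> decreases.\<close>
 define g where "g t = A + C * integral {a..t} f" for t
 define U where "U t = A + C * integral {a..t} g" for t
 have cg: "continuous_on {a..b} g" unfolding g_def
  by (intro continuous_intros indefinite_integral_continuous_1 f)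
 have gU: "g x <= U x" if "x \<in> {a..b}" for x
  unfolding U_def
  unfolding g_def[of x]
  unfolding atLeastAtMost_iff
  by (intro add_left_mono mult_left_mono C integral_le integrable_continuous_real continuous_on_subset[OF cg]
     integrable_on_subinterval[OF f]) (use that le g_def in auto)
 have dU: "(U has_real_derivative C * g x) (at x within {a..b})" if "x \<in> {a..b}" for x
  unfolding U_def using integral_has_real_derivative[OF cg that]
  by (auto intro!: derivative_eq_intros)
 define V where "V x = U x * exp (- C * (x - a))" for x
 have dV: "(V has_real_derivative (C * (g x - U x) * exp (- C * (x - a)))) (at x within {a..b})" if "x \<in> {a..b}" for x
  unfolding V_def using dU[OF that] by (auto intro!: derivative_eq_intros simp: algebra_simps)
 have "V t <= V a"
 proof (cases "t = a")
  case False
  then have at: "a < t" using t by auto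
  show ?thesis
  proof (rule DERIV_nonpos_imp_decreasing_open[of a t V])
   show "continuous_on {a..t} V"
    using dV t by (intro continuous_on_subset[OF DERIV_continuous_on[of "{a..b}" V]]) auto
   fix x assume x: "a < x" "x < t"
   have "at x within {a..b} = at x" by (rule at_within_interior) (use x t in auto)
   then have "(V has_real_derivative (C * (g x - U x) * exp (- C * (x - a)))) (at x)"
    using dV[of x] x t by auto
   moreover have "C * (g x - U x) * exp (- C * (x - a)) <= 0"
    using gU[of x] C x t by (simp add: mult_nonneg_nonpos mult_le_0_iff)
   ultimately show "\<exists>y. DERIV V x :> y \<and> y <= 0" by blast
  qed (use at in auto)
 qed auto
 then have "U t * exp (- C * (t - a)) <= A" unfolding V_def by (simp add: U_def)
 then have "U t * exp (- C * (t - a)) * exp (C * (t - a)) <= A * exp (C * (t - a))"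
  by (rule mult_right_mono) simp
 then have "U t <= A * exp (C * (t - a))" by (simp add: mult.assoc flip: exp_add)
 moreover have "f t <= g t" using le[OF t] unfolding g_def .
 ultimately show ?thesis using gU[OF t] by linarith
qed

text \<open>For a receding upper limit every \<open>c\<close> with \<open>c <= n t\<close> stays in
  the region throughout \<open>{s..t}\<close>, so the increment of \<open>f (c, _)\<close> is the
  integral of \<open>h\<close>; the strip between \<open>n t\<close> and \<open>n s\<close> is
  turned into a time integral by substitution. The other cases are reduced to this one.\<close>

lemma reynolds_decreasing:
 fixes f h :: "real \<times> real => real" and n n' :: "real => real"
 assumes s12: "sa <= sb" and f: "bm f" and hb: "bm h" and n'b: "bm n'" and n'c: "continuous_on UNIV n'"
  and n: "\<And>s. (n has_real_derivative n' s) (at s)"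
  and neg: "\<And>s. s \<in> {sa..sb} ==> n' s <= 0" and an: "\<And>s. s \<in> {sa..sb} ==> a <= n s"
  and ac: "\<And>c s t. sa <= s ==> s <= t ==> t <= sb ==> (\<And>u. u \<in> {s..t} ==> a <= c \<and> c <= n u) ==>
        ((\<lambda>u. h (c, u)) has_integral (f (c, t) - f (c, s))) {s..t}"
 shows "((\<lambda>u. integral {a..n u} (\<lambda>c. h (c, u)) + n' u * f (n u, u)) has_integral
      (integral {a..n sb} (\<lambda>c. f (c, sb)) - integral {a..n sa} (\<lambda>c. f (c, sa)))) {sa..sb}"
proof -
 obtain K where K: "0 <= K" "\<And>x. \<bar>h x\<bar> <= K" using bm_bound[OF hb] by blast
 obtain N where N: "0 <= N" "\<And>x. \<bar>n' x\<bar> <= N" using bm_bound[OF n'b] by blast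
 have cn: "continuous_on S n" for S by (meson DERIV_continuous_on has_field_derivative_at_within n)
 have [measurable]: "n \<in> borel_measurable borel" by (rule borel_contI[OF cn])
 have mono: "n t <= n s" if "sa <= s" "s <= t" "t <= sb" for s t
  by (rule DERIV_nonpos_imp_nonincreasing[OF that(2)]) (use n neg that in \<open>meson atLeastAtMost_iff order_trans\<close>)
 have lip: "n s - n t <= N * (t - s)" if "sa <= s" "s <= t" "t <= sb" for s t
 proof -
  have "N * s + n s <= N * t + n t"
  proof (rule DERIV_nonneg_imp_nondecreasing[OF that(2), of "\<lambda>x. N * x + n x"])
   fix x
   have "((\<lambda>x. N * x + n x) has_real_derivative (N + n' x)) (at x)" using n by (auto intro!: derivative_eq_intros)
   moreover have "0 <= N + n' x" using N(2)[of x] by linarith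
   ultimately show "\<exists>y. ((\<lambda>x. N * x + n x) has_real_derivative y) (at x) \<and> 0 <= y" by blast
  qed
  then show ?thesis by (simp add: algebra_simps)
 qed
 let ?R = "\<lambda>u. integral {a..n u} (\<lambda>c. h (c, u)) + n' u * f (n u, u)"
 have bmf: "bm (\<lambda>u. f (n u, u))" "bm (\<lambda>u. f (n u, s))" for s
  by (rule bm_comp[OF f], measurable)+
 have bmnf: "bm (\<lambda>u. n' u * f (n u, u))" by (intro bm_mult n'b bmf)
 have bmi': "bm (\<lambda>u. integral {c..d} (\<lambda>c. h (c, u)))" for c d
  using bm_integral_param[OF bm_swap[OF hb], of "\<lambda>_. c" "\<lambda>u. d" c d] by simp
 have bmi'': "bm (\<lambda>u. integral {c..min (n u) (n sa)} (\<lambda>c. h (c, u)))" for c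
  using bm_integral_param[OF bm_swap[OF hb], of "\<lambda>_. c" "\<lambda>u. min (n u) (n sa)" c "n sa"] by simp
 have Rint: "?R integrable_on {s..t}" if "sa <= s" "t <= sb" for s t
  by (rule integrable_eq[OF bm_integrable_on[OF bm_add[OF bmi''[of a] bmnf]]])
    (use that mono in \<open>auto simp: min_absorb1\<close>)
 define G where "G t = integral {a..n t} (\<lambda>c. f (c, t)) - integral {sa..t} ?R" for t
 have "\<bar>G t - G s\<bar> <= (2 * K * N) * (t - s)\<^sup>2" if st: "sa <= s" "s <= t" "t <= sb" for s t
 proof -
  have ans: "a <= n t" "n t <= n s" using an[of t] mono st by auto
  have 1: "integral {a..n s} (\<lambda>c. f (c, s)) = integral {a..n t} (\<lambda>c. f (c, s)) + integral {n t..n s} (\<lambda>c. f (c, s))"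
   by (rule HK_combine[symmetric]) (use ans bm_integrable_on[OF bm_pair1[OF f]] in auto)
  have 2: "integral {n t..n s} (\<lambda>c. f (c, s)) = integral {s..t} (\<lambda>u. f (n u, s) * - n' u)"
   by (rule integral_unique[symmetric], rule bm_substitution_neg[OF bm_pair1[OF f] st(2) n])
     (use neg st in \<open>auto intro: continuous_on_subset[OF n'c]\<close>)
  have "integral {a..n t} (\<lambda>c. f (c, t)) - integral {a..n t} (\<lambda>c. f (c, s)) = integral {a..n t} (\<lambda>c. f (c, t) - f (c, s))"
   by (rule integral_diff[symmetric]) (rule bm_integrable_on bm_pair1 f)+
  also have "... = integral {a..n t} (\<lambda>c. integral {s..t} (\<lambda>u. h (c, u)))"
  proof (rule integral_cong)
   fix c assume c: "c \<in> {a..n t}"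
   show "f (c, t) - f (c, s) = integral {s..t} (\<lambda>u. h (c, u))"
    by (rule integral_unique[symmetric], rule ac[OF st]) (use c mono st in \<open>auto intro: order_trans\<close>)
  qed
  also have "... = integral {s..t} (\<lambda>u. integral {a..n t} (\<lambda>c. h (c, u)))" by (rule bm_fubini[OF hb])
  finally have 3: "integral {a..n t} (\<lambda>c. f (c, t)) - integral {a..n t} (\<lambda>c. f (c, s))
    = integral {s..t} (\<lambda>u. integral {a..n t} (\<lambda>c. h (c, u)))" .
  have 4: "integral {sa..t} ?R - integral {sa..s} ?R = integral {s..t} ?R"
   using HK_combine[of sa s t ?R] Rint st by auto
  \<comment> \<open>\<open>D\<close> is what the first-order expansion leaves: \<open>h\<close> on
    the strip between \<open>n t\<close> and \<open>n u\<close>, and the change of \<open>f\<close>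
    on the edge since time \<open>s\<close>. Both are of order \<open>t - s\<close>.\<close>
  define D where "D u = integral {n t..n u} (\<lambda>c. h (c, u)) + n' u * (f (n u, u) - f (n u, s))" for u
  have Deq: "D u = ?R u - (integral {a..n t} (\<lambda>c. h (c, u)) - f (n u, s) * - n' u)" if "u \<in> {s..t}" for u
  proof -
   have "integral {a..n u} (\<lambda>c. h (c, u)) = integral {a..n t} (\<lambda>c. h (c, u)) + integral {n t..n u} (\<lambda>c. h (c, u))"
    by (rule HK_combine[symmetric])
      (use ans mono[of u t] that st bm_integrable_on[OF bm_pair1[OF hb]] in auto)
   then show ?thesis unfolding D_def by (simp add: algebra_simps)
  qed
  have i5: "(\<lambda>u. f (n u, s) * - n' u) integrable_on {s..t}"
   by (intro bm_integrable_on bm_mult bmf bm_uminus n'b)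
  have Dint: "D integrable_on {s..t}"
   by (rule integrable_eq[OF integrable_diff[OF Rint integrable_diff[OF bm_integrable_on[OF bmi'[of a "n t"]] i5]]])
     (use st Deq in auto)
  have "integral {s..t} D = integral {s..t} (\<lambda>u. ?R u - (integral {a..n t} (\<lambda>c. h (c, u)) - f (n u, s) * - n' u))"
   by (rule integral_cong) (use Deq in auto)
  also have "... = integral {s..t} ?R - (integral {s..t} (\<lambda>u. integral {a..n t} (\<lambda>c. h (c, u))) - integral {s..t} (\<lambda>u. f (n u, s) * - n' u))"
   using st by (subst integral_diff[OF Rint integrable_diff[OF bm_integrable_on[OF bmi'] i5]])
    (simp_all only: integral_diff[OF bm_integrable_on[OF bmi'] i5])
  finally have "G t - G s = - integral {s..t} D"
   unfolding G_def using 1 2 3 4 by linarith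
  moreover have "\<bar>integral {s..t} D\<bar> <= (2 * K * N * (t - s)) * (t - s)"
  proof (rule integral_bound_real[OF st(2) Dint])
   fix u assume u: "u \<in> {s..t}"
   have "\<bar>integral {n t..n u} (\<lambda>c. h (c, u))\<bar> <= K * (n u - n t)"
    by (rule integral_bound_real[OF _ bm_integrable_on[OF bm_pair1[OF hb]]]) (use K mono[of u t] u st in auto)
   also have "... <= K * (N * (t - s))"
    using lip[of u t] u st N K by (intro mult_left_mono) (auto intro: order_trans[OF _ mult_left_mono])
   finally have e1: "\<bar>integral {n t..n u} (\<lambda>c. h (c, u))\<bar> <= K * (N * (t - s))" .
   have "((\<lambda>x. h (n u, x)) has_integral (f (n u, u) - f (n u, s))) {s..u}"
    by (rule ac) (use u st an[of u] mono in auto)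
   then have "\<bar>f (n u, u) - f (n u, s)\<bar> <= K * (u - s)"
    using has_integral_bound[OF K(1), of "\<lambda>x. h (n u, x)" "f (n u, u) - f (n u, s)" s u] K(2) u by auto
   also have "... <= K * (t - s)" using u K by (intro mult_left_mono) auto
   finally have "\<bar>n' u * (f (n u, u) - f (n u, s))\<bar> <= N * (K * (t - s))"
    unfolding abs_mult by (intro mult_mono N) auto
   with e1 show "\<bar>D u\<bar> <= 2 * K * N * (t - s)" unfolding D_def by (simp add: algebra_simps)
  qed
  ultimately show ?thesis by (simp add: power2_eq_square algebra_simps)
 qed
 from const_if_quadratic_increments[OF s12 this]
 have "integral {sa..sb} ?R = integral {a..n sb} (\<lambda>c. f (c, sb)) - integral {a..n sa} (\<lambda>c. f (c, sa))"
  unfolding G_def by simp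
 then show ?thesis using integrable_integral[OF Rint[OF order_refl order_refl]] by (simp only:)
qed

text \<open>Time reversal \<open>u \<mapsto> - u\<close> makes an increasing limit decreasing and
  changes the sign of \<open>h\<close>.\<close>

lemma reynolds_increasing:
 fixes v h :: "real \<times> real => real" and n n' :: "real => real"
 assumes s12: "sa <= sb" and v: "bm v" and hb: "bm h" and n'b: "bm n'" and n'c: "continuous_on UNIV n'"
  and n: "\<And>s. (n has_real_derivative n' s) (at s)"
  and pos: "\<And>s. s \<in> {sa..sb} ==> 0 <= n' s" and an: "\<And>s. s \<in> {sa..sb} ==> a <= n s"
  and ac: "\<And>c s t. sa <= s ==> s <= t ==> t <= sb ==> (\<And>u. u \<in> {s..t} ==> a <= c \<and> c <= n u) ==>
        ((\<lambda>u. h (c, u)) has_integral (v (c, t) - v (c, s))) {s..t}"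
 shows "((\<lambda>u. integral {a..n u} (\<lambda>c. h (c, u)) + n' u * v (n u, u)) has_integral
      (integral {a..n sb} (\<lambda>c. v (c, sb)) - integral {a..n sa} (\<lambda>c. v (c, sa)))) {sa..sb}"
proof -
 have mp: "(\<lambda>z::real\<times>real. (fst z, - snd z)) \<in> borel_measurable borel"
  by (intro borel_contI continuous_intros)
 have "((\<lambda>u. integral {a..n (-u)} (\<lambda>c. - h (fst (c, u), - snd (c, u))) + - n' (-u) * v (fst (n (-u), u), - snd (n (-u), u)))
     has_integral
      (integral {a..n (- (- sa))} (\<lambda>c. v (fst (c, - sa), - snd (c, - sa)))
       - integral {a..n (- (- sb))} (\<lambda>c. v (fst (c, -sb), - snd (c, -sb))))) {-sb..-sa}"
 proof (rule reynolds_decreasing[where f="\<lambda>z. v (fst z, - snd z)" and h="\<lambda>z. - h (fst z, - snd z)" and n="\<lambda>u. n (- u)" and n'="\<lambda>u. - n' (- u)"])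
  show "bm (\<lambda>z. v (fst z, - snd z))" by (rule bm_comp[OF v mp])
  show "bm (\<lambda>z. - h (fst z, - snd z))" by (intro bm_uminus bm_comp[OF hb mp])
  show "bm (\<lambda>u. - n' (- u))" by (intro bm_uminus bm_comp[OF n'b]) auto
  show "continuous_on UNIV (\<lambda>u. - n' (- u))"
   by (intro continuous_intros continuous_on_compose2[OF n'c]) auto
  show "((\<lambda>u. n (- u)) has_real_derivative - n' (- s)) (at s)" for s
   by (rule iffD1[OF DERIV_mirror n])
  fix c s t assume st: "- sb <= s" "s <= t" "t <= - sa" and *: "\<And>u. u \<in> {s..t} ==> a <= c \<and> c <= n (- u)"
  have "((\<lambda>u. h (c, u)) has_integral (v (c, -s) - v (c, -t))) {-t..-s}"
  proof (rule ac)
   fix u assume "u \<in> {-t..-s}"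
   then have "- u \<in> {s..t}" by auto
   from *[OF this] show "a <= c \<and> c <= n u" by simp
  qed (use st in auto)
  then have "((\<lambda>u. h (c, - u)) has_integral (v (c, -s) - v (c, -t))) {-(-s)..-(-t)}"
   by (rule iffD2[OF has_integral_reflect_real[where f="\<lambda>u. h (c, u)"]])
  then show "((\<lambda>u. - h (fst (c, u), - snd (c, u))) has_integral v (fst (c, t), - snd (c, t)) - v (fst (c, s), - snd (c, s))) {s..t}"
   using has_integral_neg[of "\<lambda>u. h (c, - u)" "v (c, -s) - v (c, -t)" "{s..t}"]
   by (simp only: fst_conv snd_conv minus_minus minus_diff_eq)
 qed (use s12 pos an in auto)
 then have "((\<lambda>u. - (integral {a..n (-u)} (\<lambda>c. h (c, -u)) + n' (-u) * v (n (-u), -u))) has_integral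
      - (integral {a..n sb} (\<lambda>c. v (c, sb)) - integral {a..n sa} (\<lambda>c. v (c, sa)))) {-sb..-sa}"
  by (simp only: fst_conv snd_conv minus_minus integral_neg minus_add_distrib minus_diff_eq mult_minus_left)
 then have "((\<lambda>u. - (integral {a..n u} (\<lambda>c. h (c, u)) + n' u * v (n u, u))) has_integral
      - (integral {a..n sb} (\<lambda>c. v (c, sb)) - integral {a..n sa} (\<lambda>c. v (c, sa)))) {sa..sb}"
  by (rule iffD1[OF has_integral_reflect_real[where f="\<lambda>u. - (integral {a..n u} (\<lambda>c. h (c, u)) + n' u * v (n u, u))"]])
 then show ?thesis by (simp only: has_integral_neg_iff minus_minus)
qed

lemma reynolds_upper:
 fixes f h :: "real \<times> real => real" and n n' :: "real => real"
 assumes "sa <= sb" and "bm f" and "bm h" and "bm n'" and "continuous_on UNIV n'"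
  and "\<And>s. (n has_real_derivative n' s) (at s)"
  and sg: "(\<forall>s\<in>{sa..sb}. 0 <= n' s) \<or> (\<forall>s\<in>{sa..sb}. n' s <= 0)" and "\<And>s. s \<in> {sa..sb} ==> a <= n s"
  and "\<And>c s t. sa <= s ==> s <= t ==> t <= sb ==> (\<And>u. u \<in> {s..t} ==> a <= c \<and> c <= n u) ==>
        ((\<lambda>u. h (c, u)) has_integral (f (c, t) - f (c, s))) {s..t}"
 shows "((\<lambda>u. integral {a..n u} (\<lambda>c. h (c, u)) + n' u * f (n u, u)) has_integral
      (integral {a..n sb} (\<lambda>c. f (c, sb)) - integral {a..n sa} (\<lambda>c. f (c, sa)))) {sa..sb}"
 using sg
proof
 assume "\<forall>s\<in>{sa..sb}. 0 <= n' s"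
 then show ?thesis by (intro reynolds_increasing assms) auto
next
 assume "\<forall>s\<in>{sa..sb}. n' s <= 0"
 then show ?thesis by (intro reynolds_decreasing assms) auto
qed

text \<open>The reflection \<open>c \<mapsto> - c\<close> exchanges lower and upper limits.\<close>

lemma reynolds_lower:
 fixes v h :: "real \<times> real => real" and m m' :: "real => real"
 assumes s12: "sa <= sb" and v: "bm v" and hb: "bm h" and m'b: "bm m'" and m'c: "continuous_on UNIV m'"
  and m: "\<And>s. (m has_real_derivative m' s) (at s)"
  and sg: "(\<forall>s\<in>{sa..sb}. 0 <= m' s) \<or> (\<forall>s\<in>{sa..sb}. m' s <= 0)" and ma: "\<And>s. s \<in> {sa..sb} ==> m s <= a"
  and ac: "\<And>c s t. sa <= s ==> s <= t ==> t <= sb ==> (\<And>u. u \<in> {s..t} ==> m u <= c \<and> c <= a) ==>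
        ((\<lambda>u. h (c, u)) has_integral (v (c, t) - v (c, s))) {s..t}"
 shows "((\<lambda>u. integral {m u..a} (\<lambda>c. h (c, u)) - m' u * v (m u, u)) has_integral
      (integral {m sb..a} (\<lambda>c. v (c, sb)) - integral {m sa..a} (\<lambda>c. v (c, sa)))) {sa..sb}"
proof -
 have mp: "(\<lambda>z::real\<times>real. (- fst z, snd z)) \<in> borel_measurable borel"
  by (intro borel_contI continuous_intros)
 have "((\<lambda>u. integral {-a..- m u} (\<lambda>c. h (- fst (c, u), snd (c, u))) + - m' u * v (- fst (- m u, u), snd (- m u, u)))
     has_integral
      (integral {-a..- m sb} (\<lambda>c. v (- fst (c, sb), snd (c, sb)))
       - integral {-a..- m sa} (\<lambda>c. v (- fst (c, sa), snd (c, sa))))) {sa..sb}"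
 proof (rule reynolds_upper[where f="\<lambda>z. v (- fst z, snd z)" and h="\<lambda>z. h (- fst z, snd z)" and n="\<lambda>u. - m u" and n'="\<lambda>u. - m' u"])
  show "bm (\<lambda>z. v (- fst z, snd z))" by (rule bm_comp[OF v mp])
  show "bm (\<lambda>z. h (- fst z, snd z))" by (rule bm_comp[OF hb mp])
  show "bm (\<lambda>u. - m' u)" by (intro bm_uminus m'b)
  show "continuous_on UNIV (\<lambda>u. - m' u)" by (intro continuous_intros m'c)
  show "((\<lambda>u. - m u) has_real_derivative - m' s) (at s)" for s
   using m by (auto intro!: derivative_eq_intros)
  fix c s t assume st: "sa <= s" "s <= t" "t <= sb" and *: "\<And>u. u \<in> {s..t} ==> -a <= c \<and> c <= - m u"
  have "((\<lambda>u. h (-c, u)) has_integral (v (-c, t) - v (-c, s))) {s..t}"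
  proof (rule ac[OF st])
   fix u assume "u \<in> {s..t}"
   from *[OF this] show "m u <= - c \<and> - c <= a" by simp
  qed
  then show "((\<lambda>u. h (- fst (c, u), snd (c, u))) has_integral v (- fst (c, t), snd (c, t)) - v (- fst (c, s), snd (c, s))) {s..t}"
   by simp
 qed (use s12 sg ma in auto)
 moreover have A: "integral {-a..- b} (\<lambda>c. h (- c, u)) = integral {b..a} (\<lambda>c. h (c, u))" for b u
  by (rule Henstock_Kurzweil_Integration.integral_reflect_real[where f="\<lambda>c. h (c, u)"])
 moreover have B: "integral {-a..- b} (\<lambda>c. v (- c, u)) = integral {b..a} (\<lambda>c. v (c, u))" for b u
  by (rule Henstock_Kurzweil_Integration.integral_reflect_real[where f="\<lambda>c. v (c, u)"])
 ultimately show ?thesis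
  by (simp only: fst_conv snd_conv minus_minus A B mult_minus_left diff_conv_add_uminus)
qed

text \<open>A fixed interior point \<open>a\<close> splits the integral into one with a moving upper
  and one with a moving lower limit. The interval may travel, so such a point is available only for
  short times; there the midpoint at one time serves, and Bolzano's principle glues the short
  intervals.\<close>

lemma reynolds:
 fixes w h :: "real \<times> real => real" and m m' n n' :: "real => real"
 assumes s12: "sa <= sb" and w: "bm w" and hb: "bm h"
  and m': "bm m'" "continuous_on UNIV m'" and n': "bm n'" "continuous_on UNIV n'"
  and m: "\<And>s. (m has_real_derivative m' s) (at s)" and n: "\<And>s. (n has_real_derivative n' s) (at s)"
  and sm: "(\<forall>s\<in>{sa..sb}. 0 <= m' s) \<or> (\<forall>s\<in>{sa..sb}. m' s <= 0)"
  and sn: "(\<forall>s\<in>{sa..sb}. 0 <= n' s) \<or> (\<forall>s\<in>{sa..sb}. n' s <= 0)"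
  and mn: "\<And>s. s \<in> {sa..sb} ==> m s < n s"
  and ac: "\<And>c s t. sa <= s ==> s <= t ==> t <= sb ==> (\<And>v. v \<in> {s..t} ==> m v <= c \<and> c <= n v) ==>
        ((\<lambda>v. h (c, v)) has_integral (w (c, t) - w (c, s))) {s..t}"
 shows "((\<lambda>v. integral {m v..n v} (\<lambda>c. h (c, v)) + n' v * w (n v, v) - m' v * w (m v, v)) has_integral
      (integral {m sb..n sb} (\<lambda>c. w (c, sb)) - integral {m sa..n sa} (\<lambda>c. w (c, sa)))) {sa..sb}"
proof -
 define I where "I s = integral {m s..n s} (\<lambda>c. w (c, s))" for s
 let ?R = "\<lambda>v. integral {m v..n v} (\<lambda>c. h (c, v)) + n' v * w (n v, v) - m' v * w (m v, v)"
 have cn: "continuous_on S n" "continuous_on S m" for S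
  by (rule DERIV_continuous_on_at[OF n],
    rule DERIV_continuous_on_at[OF m])
 have loc: "(?R has_integral (I t2 - I t1)) {t1..t2}"
  if t: "sa <= t1" "t1 <= t2" "t2 <= sb" and a: "\<And>s. s \<in> {t1..t2} ==> m s <= a \<and> a <= n s" for t1 t2 a
 proof -
  have u: "((\<lambda>v. integral {a..n v} (\<lambda>c. h (c, v)) + n' v * w (n v, v)) has_integral
      (integral {a..n t2} (\<lambda>c. w (c, t2)) - integral {a..n t1} (\<lambda>c. w (c, t1)))) {t1..t2}"
  proof (rule reynolds_upper[OF t(2) w hb n' n])
   show "(\<forall>s\<in>{t1..t2}. 0 <= n' s) \<or> (\<forall>s\<in>{t1..t2}. n' s <= 0)" using sn t by auto
   fix c s t assume "t1 <= s" "s <= t" "t <= t2" "\<And>v. v \<in> {s..t} ==> a <= c \<and> c <= n v"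
   then show "((\<lambda>v. h (c, v)) has_integral w (c, t) - w (c, s)) {s..t}"
    using a \<open>sa <= t1\<close> \<open>t2 <= sb\<close> by (intro ac) (auto intro: order_trans)
  qed (use a in auto)
  have l: "((\<lambda>v. integral {m v..a} (\<lambda>c. h (c, v)) - m' v * w (m v, v)) has_integral
      (integral {m t2..a} (\<lambda>c. w (c, t2)) - integral {m t1..a} (\<lambda>c. w (c, t1)))) {t1..t2}"
  proof (rule reynolds_lower[OF t(2) w hb m' m])
   show "(\<forall>s\<in>{t1..t2}. 0 <= m' s) \<or> (\<forall>s\<in>{t1..t2}. m' s <= 0)" using sm t by auto
   fix c s t assume "t1 <= s" "s <= t" "t <= t2" "\<And>v. v \<in> {s..t} ==> m v <= c \<and> c <= a"
   then show "((\<lambda>v. h (c, v)) has_integral w (c, t) - w (c, s)) {s..t}"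
    using a \<open>sa <= t1\<close> \<open>t2 <= sb\<close> by (intro ac) (auto intro: order_trans)
  qed (use a in auto)
  have c: "integral {m s..a} (\<lambda>c. f (c, s)) + integral {a..n s} (\<lambda>c. f (c, s)) = integral {m s..n s} (\<lambda>c. f (c, s))"
   if "s \<in> {t1..t2}" "bm f" for s and f :: "real \<times> real => real"
   by (rule HK_combine) (use a[OF that(1)] bm_integrable_on[OF bm_pair1[OF that(2)]] in auto)
  have "((\<lambda>v. (integral {m v..a} (\<lambda>c. h (c, v)) - m' v * w (m v, v)) + (integral {a..n v} (\<lambda>c. h (c, v)) + n' v * w (n v, v)))
    has_integral (I t2 - I t1)) {t1..t2}"
   using has_integral_add[OF l u] c[OF _ w, of t1] c[OF _ w, of t2] t by (simp add: I_def algebra_simps)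
  then show ?thesis
  proof (rule has_integral_eq[rotated])
   fix v assume "v \<in> {t1..t2}"
   from c[OF this hb] show "(integral {m v..a} (\<lambda>c. h (c, v)) - m' v * w (m v, v)) + (integral {a..n v} (\<lambda>c. h (c, v)) + n' v * w (n v, v)) = ?R v"
    by simp
  qed
 qed
 have near: "\<exists>d>0. \<forall>s. \<bar>s - x\<bar> < d \<longrightarrow> m s <= (m x + n x) / 2 \<and> (m x + n x) / 2 <= n s" if x: "x \<in> {sa..sb}" for x
 proof -
  define e where "e = (n x - m x) / 2"
  have e: "0 < e" using mn[OF x] by (simp add: e_def)
  obtain d1 where d1: "0 < d1" "\<And>y. \<bar>y - x\<bar> < d1 ==> \<bar>m y - m x\<bar> < e"
   using cn(2)[of UNIV] e unfolding continuous_on_iff dist_real_def by blast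
  obtain d2 where d2: "0 < d2" "\<And>y. \<bar>y - x\<bar> < d2 ==> \<bar>n y - n x\<bar> < e"
   using cn(1)[of UNIV] e unfolding continuous_on_iff dist_real_def by blast
  have "m x + e = (m x + n x) / 2" "n x - e = (m x + n x) / 2" by (simp_all add: e_def field_simps)
  then have "m s <= (m x + n x) / 2 \<and> (m x + n x) / 2 <= n s" if "\<bar>s - x\<bar> < min d1 d2" for s
   using d1(2)[of s] d2(2)[of s] that by linarith
  then show ?thesis using d1(1) d2(1) by (intro exI[of _ "min d1 d2"]) auto
 qed
 have "sa <= sa \<and> sb <= sb \<longrightarrow> (?R has_integral (I sb - I sa)) {sa..sb}"
 proof (rule Bolzano[OF s12, of "\<lambda>t1 t2. sa <= t1 \<and> t2 <= sb \<longrightarrow> (?R has_integral (I t2 - I t1)) {t1..t2}"])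
  fix a b c assume *: "sa <= a \<and> b <= sb \<longrightarrow> (?R has_integral (I b - I a)) {a..b}"
   "sa <= b \<and> c <= sb \<longrightarrow> (?R has_integral (I c - I b)) {b..c}" "a <= b" "b <= c"
  show "sa <= a \<and> c <= sb \<longrightarrow> (?R has_integral (I c - I a)) {a..c}"
  proof
   assume "sa <= a \<and> c <= sb"
   then have "(?R has_integral ((I b - I a) + (I c - I b))) {a..c}"
    using * by (intro has_integral_combine[of a b c]) auto
   then show "(?R has_integral (I c - I a)) {a..c}" by simp
  qed
 next
  fix x assume x: "sa <= x" "x <= sb"
  then obtain d where d: "d > 0" "\<And>s. \<bar>s - x\<bar> < d ==> m s <= (m x + n x) / 2 \<and> (m x + n x) / 2 <= n s"
   using near[of x] by auto
  have "(?R has_integral (I b - I a)) {a..b}" if "a <= x" "x <= b" "b - a < d" "sa <= a" "b <= sb" for a b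
   by (rule loc[of _ _ "(m x + n x) / 2"]) (use that d(2) in auto)
  then show "\<exists>d>0. \<forall>a b. a <= x \<and> x <= b \<and> b - a < d \<longrightarrow> (sa <= a \<and> b <= sb \<longrightarrow> (?R has_integral (I b - I a)) {a..b})"
   using d(1) by blast
 qed
 then show ?thesis unfolding I_def by simp
qed

section \<open>Exponential decay of linear systems\<close>

definition poly_mat :: "complex poly => complex^'n^'n => complex^'n => complex^'n" where
 "poly_mat p B v = fold_coeffs (\<lambda>a w. a *s v + B *v w) p 0"

lemma poly_mat_0 [simp]: "poly_mat 0 B v = 0"
 by (simp add: poly_mat_def)

lemma poly_mat_pCons [simp]: "poly_mat (pCons a p) B v = a *s v + B *v poly_mat p B v"
 by (cases "p = 0 \<and> a = 0") (auto simp: poly_mat_def)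

lemma poly_mat_add: "poly_mat (p + q) B v = poly_mat p B v + poly_mat q B v"
 by (induction p q rule: poly_induct2) (simp_all add: matrix_vector_right_distrib vector_sadd_rdistrib)

lemma poly_mat_sum: "poly_mat (\<Sum>i\<in>I. p i) B v = (\<Sum>i\<in>I. poly_mat (p i) B v)"
 by (induction I rule: infinite_finite_induct) (simp_all add: poly_mat_add)

lemma poly_mat_smult: "poly_mat (smult a p) B v = a *s poly_mat p B v"
 by (induction p) (simp_all add: vector_smult_assoc vector_add_ldistrib vector_scalar_commute)

lemma poly_mat_linear_factor: "poly_mat ([:- z, 1:] * p) B v = B *v poly_mat p B v - z *s poly_mat p B v"
proof -
 have "[:- z, 1:] * p = smult (- z) p + pCons 0 p" by (simp add: mult_pCons_left)
 then show ?thesis by (simp only: poly_mat_add poly_mat_smult poly_mat_pCons) (simp add: vector_smult_lneg)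
qed

lemma poly_mat_commute: "B *v poly_mat p B v = poly_mat p B (B *v v)"
 by (induction p) (simp_all add: matrix_vector_right_distrib vector_scalar_commute)

lemma poly_mat_add_right: "poly_mat p B (v + w) = poly_mat p B v + poly_mat p B w"
 by (induction p) (simp_all add: matrix_vector_right_distrib vector_add_ldistrib)

lemma poly_mat_smult_right: "poly_mat p B (a *s v) = a *s poly_mat p B v"
 by (induction p) (simp_all add: vector_scalar_commute vector_add_ldistrib vector_smult_assoc mult.commute)

text \<open>Here the factor \<open>B - z\<close> acts first and \<open>p\<close> last, so that
  \<open>p\<close> is applied to vectors of the form \<open>B *v v - z *s v\<close>.\<close>

lemma poly_mat_linear_factor': "poly_mat ([:- z, 1:] * p) B v = poly_mat p B (B *v v - z *s v)"
proof -
 have "poly_mat p B (B *v v - z *s v) = poly_mat p B (B *v v + (- z) *s v)" by (simp add: vector_smult_lneg)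
 then show ?thesis unfolding poly_mat_linear_factor poly_mat_add_right poly_mat_smult_right poly_mat_commute
  by (simp add: vector_smult_lneg)
qed

lemma poly_mat_eigenvector: "B *v v = z *s v ==> poly_mat p B v = poly p z *s v"
 by (induction p) (simp_all add: vector_scalar_commute vector_sadd_rdistrib vector_smult_assoc mult.commute)

text \<open>The family has one member more than the dimension. It need not be injective: if two
  members coincide, their difference already is a relation.\<close>

lemma sequence_dependent:
 fixes f :: "nat => 'a::euclidean_space"
 obtains c where "\<exists>i\<le>DIM('a). c i \<noteq> 0" "(\<Sum>i\<le>DIM('a). c i *\<^sub>R f i) = 0"
proof (cases "inj_on f {..DIM('a)}")
 case True
 then have "card (f ` {..DIM('a)}) = DIM('a) + 1" by (simp add: card_image)
 then have "dependent (f ` {..DIM('a)})" by (intro dependent_biggerset) auto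
 then obtain u where u: "\<exists>v\<in>f ` {..DIM('a)}. u v \<noteq> 0" "(\<Sum>v\<in>f ` {..DIM('a)}. u v *\<^sub>R v) = 0"
  by (subst (asm) dependent_finite) auto
 show ?thesis
  by (rule that[of "\<lambda>i. u (f i)"]) (use u True in \<open>auto simp: sum.reindex\<close>)
next
 case False
 then obtain i j where ij: "i <= DIM('a)" "j <= DIM('a)" "i \<noteq> j" "f i = f j" by (auto simp: inj_on_def)
 let ?c = "\<lambda>k. if k = i then 1 else if k = j then - 1 else (0::real)"
 have "(\<Sum>k\<le>DIM('a). ?c k *\<^sub>R f k) = (\<Sum>k\<in>{i, j}. ?c k *\<^sub>R f k)"
  by (rule sum.mono_neutral_right) (use ij in auto)
 also have "... = 0" using ij by simp
 finally show ?thesis using ij by (intro that[of ?c]) auto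
qed

lemma matrix_vector_mult_sum: "(\<Sum>i\<in>I. M i) *v v = (\<Sum>i\<in>I. M i *v v)" for M :: "'i => complex^'n^'m"
 by (induction I rule: infinite_finite_induct) (simp_all add: matrix_vector_mult_add_rdistrib)

text \<open>The powers of \<open>B\<close> up to the real dimension of the matrix space are linearly
  dependent, and the coefficients of a relation are those of an annihilating polynomial.\<close>

lemma annihilating_poly_exists:
 fixes B :: "complex^'n^'n"
 obtains p where "p \<noteq> 0" "\<And>v. poly_mat p B v = 0"
proof -
 let ?n = "DIM(complex^'n^'n)"
 define f where "f i = ((**) B ^^ i) (mat 1)" for i
 obtain c where c: "\<exists>i\<le>?n. c i \<noteq> 0" "(\<Sum>i\<le>?n. c i *\<^sub>R f i) = 0" by (rule sequence_dependent)
 define p where "p = (\<Sum>i\<le>?n. monom (complex_of_real (c i)) i)"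
 have co: "coeff p i = complex_of_real (c i)" if "i <= ?n" for i
  unfolding p_def using that by (simp add: coeff_sum)
 have mon: "poly_mat (monom a i) B v = a *s (f i *v v)" for a i v
  by (induction i) (simp_all add: monom_0 monom_Suc f_def vector_scalar_commute matrix_vector_mul_assoc[symmetric])
 show thesis
 proof (rule that[of p])
  show "p \<noteq> 0" using c(1) co by (metis coeff_0 of_real_eq_0_iff)
  fix v
  have "poly_mat p B v = (\<Sum>i\<le>?n. complex_of_real (c i) *s (f i *v v))" unfolding p_def poly_mat_sum mon ..
  also have "... = (\<Sum>i\<le>?n. (c i *\<^sub>R f i) *v v)"
  proof (rule sum.cong)
   show "complex_of_real (c i) *s (f i *v v) = (c i *\<^sub>R f i) *v v" for i
    unfolding vec_eq_iff matrix_vector_mult_def by (simp add: sum_distrib_left scaleR_conv_of_real[where 'a=complex] mult.assoc)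
  qed simp
  also have "... = (\<Sum>i\<le>?n. c i *\<^sub>R f i) *v v"
   by (rule matrix_vector_mult_sum[symmetric])
  finally show "poly_mat p B v = 0" unfolding c(2) by simp
 qed
qed

lemma minimal_poly_exists:
 fixes B :: "complex^'n^'n"
 obtains p where "p \<noteq> 0" "\<And>v. poly_mat p B v = 0" "\<And>z. poly p z = 0 \<longleftrightarrow> (\<exists>v. v \<noteq> 0 \<and> B *v v = z *s v)"
proof -
 define S where "S = (\<lambda>p. p \<noteq> 0 \<and> (\<forall>v. poly_mat p B v = 0))"
 obtain p0 where "p0 \<noteq> 0" "\<And>v. poly_mat p0 B v = 0" by (rule annihilating_poly_exists[of B]) (rule that)
 then have "S p0" by (simp add: S_def)
 then obtain p where p: "S p" and min: "\<And>q. S q ==> degree p <= degree q"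
  using ex_has_least_nat[of S p0 degree] by blast
 show thesis
 proof (rule that[of p])
  show "p \<noteq> 0" "poly_mat p B v = 0" for v using p by (auto simp: S_def)
  show "poly p z = 0 \<longleftrightarrow> (\<exists>v. v \<noteq> 0 \<and> B *v v = z *s v)" for z
  proof
   assume "poly p z = 0"
   then obtain q where q: "p = [:- z, 1:] * q" using poly_eq_0_iff_dvd by blast
   then have "q \<noteq> 0" using p by (auto simp: S_def)
   then have "degree p = Suc (degree q)" unfolding q by (subst degree_mult_eq) auto
   then have "\<not> S q" using min[of q] by auto
   then obtain v where v: "poly_mat q B v \<noteq> 0" using \<open>q \<noteq> 0\<close> by (auto simp: S_def)
   have "B *v poly_mat q B v - z *s poly_mat q B v = 0"
    using p unfolding S_def q poly_mat_linear_factor by blast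
   then show "\<exists>v. v \<noteq> 0 \<and> B *v v = z *s v" using v by (intro exI[of _ "poly_mat q B v"]) simp
  next
   assume "\<exists>v. v \<noteq> 0 \<and> B *v v = z *s v"
   then obtain v where v: "v \<noteq> 0" "B *v v = z *s v" by blast
   have "poly p z *s v = 0" using poly_mat_eigenvector[OF v(2), of p] p by (simp add: S_def)
   then show "poly p z = 0" using v(1) by (auto simp: vec_eq_iff)
  qed
 qed
qed

lemma map_matrix_shift:
 fixes A :: "real^'n^'n"
 shows "map_matrix complex_of_real (A + s *\<^sub>R mat 1) *v v = map_matrix complex_of_real A *v v + complex_of_real s *s v"
proof -
 have "map_matrix complex_of_real (A + s *\<^sub>R mat 1) = map_matrix complex_of_real A + mat (complex_of_real s)"
  by (simp add: vec_eq_iff map_matrix_def mat_def)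
 moreover have "mat (complex_of_real s) *v v = complex_of_real s *s v"
  by (simp add: vec_eq_iff matrix_vector_mult_def mat_def if_distrib[of "\<lambda>x. x * _"] cong: if_cong)
 ultimately show ?thesis by (simp add: matrix_vector_mult_add_rdistrib)
qed

text \<open>The eigenvalues are the finitely many roots of a polynomial, so they keep a positive
  distance from the imaginary axis; half of it is given away.\<close>

lemma hurwitz_margin:
 fixes A :: "real^'n^'n"
 assumes "hurwitz A" obtains s where "0 < s" "hurwitz (A + s *\<^sub>R mat 1)"
proof -
 let ?B = "map_matrix complex_of_real A"
 obtain p where p: "p \<noteq> 0" "\<And>v. poly_mat p ?B v = 0" "\<And>z. poly p z = 0 \<longleftrightarrow> (\<exists>v. v \<noteq> 0 \<and> ?B *v v = z *s v)"
  by (rule minimal_poly_exists[of ?B]) (rule that)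
 define R where "R = {z. poly p z = 0}"
 have fin: "finite R" unfolding R_def by (rule poly_roots_finite[OF p(1)])
 have neg: "Re z < 0" if "z \<in> R" for z using that assms p(3)[of z] unfolding R_def hurwitz_def by blast
 \<comment> \<open>Inserting 1 keeps the set nonempty, so that \<open>Min\<close> is meaningful
   without knowing that an eigenvalue exists.\<close>
 define m where "m = Min (insert 1 ((\<lambda>z. - Re z) ` R))"
 have m: "0 < m" "\<And>z. z \<in> R ==> m <= - Re z" unfolding m_def using fin neg by auto
 show thesis
 proof (rule that[of "m / 2"])
  show "0 < m / 2" using m by simp
  show "hurwitz (A + (m / 2) *\<^sub>R mat 1)" unfolding hurwitz_def map_matrix_shift
  proof (intro allI impI)
   fix z v assume v: "v \<noteq> 0 \<and> ?B *v v + complex_of_real (m / 2) *s v = z *s v"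
   then have "?B *v v = (z - complex_of_real (m / 2)) *s v" by (simp add: vec_eq_iff algebra_simps)
   then have "z - complex_of_real (m / 2) \<in> R" using v unfolding R_def mem_Collect_eq p(3) by blast
   from m(2)[OF this] m(1) show "Re z < 0" by simp
  qed
 qed
qed

section \<open>Bounded and decaying trajectories of linear differential equations\<close>

lemma scalar_ode_bound:
 fixes x y :: "real => complex"
 assumes x: "\<And>t. a <= t ==> (x has_vector_derivative (z * x t + y t)) (at t within {a..})"
  and y: "\<And>t. a <= t ==> norm (y t) <= Y" and z: "Re z < 0" and t: "a <= t"
 shows "norm (x t) <= norm (x a) + Y / (- Re z)"
proof -
 define \<mu> where "\<mu> = - Re z"
 have mu: "0 < \<mu>" using z by (simp add: \<mu>_def)
 have Y: "0 <= Y" using norm_ge_zero[of "y a"] y[of a] by linarith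
 define h where "h s = exp (- z * of_real (s - a)) * x s" for s
 have dexp: "((\<lambda>s. exp (- z * of_real (s - a))) has_vector_derivative (- z * exp (- z * of_real (s - a)))) (at s within X)" for s X
 proof -
  have "((\<lambda>w. exp (- z * (w - of_real a))) has_field_derivative (- z * exp (- z * (of_real s - of_real a)))) (at (of_real s))"
   by (auto intro!: derivative_eq_intros)
  from has_vector_derivative_real_field[OF this] have "((\<lambda>s. exp (- z * of_real (s - a))) has_vector_derivative (- z * exp (- z * of_real (s - a)))) (at s)"
   by (simp add: o_def)
  then show ?thesis by (rule has_vector_derivative_at_within)
 qed
 have hd: "(h has_vector_derivative exp (- z * of_real (s - a)) * y s) (at s within {a..})" if "a <= s" for s
  unfolding h_def[abs_def]
  by (rule has_vector_derivative_eq_rhs[OF has_vector_derivative_mult[OF dexp x[OF that]]]) (simp add: algebra_simps)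
 have hn: "norm (exp (- z * of_real (s - a)) * w) = exp (\<mu> * (s - a)) * norm w" for s w
  by (simp add: norm_mult norm_exp_eq_Re \<mu>_def)
 \<comment> \<open>An antiderivative of the bound for the derivative of \<open>h\<close>, so that
   increments of \<open>h\<close> are dominated by those of \<open>f\<close>.\<close>
 define f where "f s = Y / \<mu> * exp (\<mu> * (s - a))" for s
 have fd: "(f has_vector_derivative exp (\<mu> * (s - a)) * Y) (at s)" for s
 proof -
  have "(f has_real_derivative exp (\<mu> * (s - a)) * Y) (at s)"
   unfolding f_def[abs_def] using mu by (auto intro!: derivative_eq_intros)
  then show ?thesis by (simp add: has_real_derivative_iff_has_vector_derivative)
 qed
 have "norm (h t - h a) <= f t - f a"
 proof (cases "a < t")
  case True
  show ?thesis
  proof (rule differentiable_bound_general[OF True])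
   show "continuous_on {a..t} h"
    by (rule continuous_on_subset[OF continuous_on_vector_derivative[OF hd]]) auto
   show "continuous_on {a..t} f" unfolding f_def by (intro continuous_intros)
   fix s assume s: "a < s" "s < t"
   have "at s within {a..} = at s" using s by (intro at_within_interior) auto
   then show "(h has_vector_derivative exp (- z * of_real (s - a)) * y s) (at s)" using hd[of s] s by simp
   show "(f has_vector_derivative exp (\<mu> * (s - a)) * Y) (at s)" by (rule fd)
   show "norm (exp (- z * of_real (s - a)) * y s) <= exp (\<mu> * (s - a)) * Y"
    unfolding hn using y[of s] s by (intro mult_left_mono) auto
  qed
 qed (use t in simp)
 then have "norm (h t) <= norm (h a) + f t"
  using norm_triangle_ineq2[of "h t" "h a"] divide_nonneg_pos[OF Y mu] unfolding f_def by simp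
 then have "exp (\<mu> * (t - a)) * norm (x t) <= norm (x a) + Y / \<mu> * exp (\<mu> * (t - a))"
  unfolding h_def hn f_def by simp
 also have "... <= exp (\<mu> * (t - a)) * (norm (x a) + Y / \<mu>)"
  using mult_right_mono[of 1 "exp (\<mu> * (t - a))" "norm (x a)"] mu t by (simp add: algebra_simps)
 finally show ?thesis unfolding \<mu>_def by simp
qed

lemma sum_norm_matrix_le:
 fixes B :: "complex^'n^'n"
 shows "norm ((B *v v) $ k) <= (\<Sum>i\<in>UNIV. \<Sum>j\<in>UNIV. norm (B $ i $ j)) * (\<Sum>m\<in>UNIV. norm (v $ m))"
proof -
 have "norm ((B *v v) $ k) <= (\<Sum>j\<in>UNIV. norm (B $ k $ j) * norm (v $ j))"
  unfolding matrix_vector_mult_def by (simp add: order_trans[OF norm_sum] norm_mult)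
 also have "... <= (\<Sum>j\<in>UNIV. norm (B $ k $ j) * (\<Sum>m\<in>UNIV. norm (v $ m)))"
  by (intro sum_mono mult_left_mono member_le_sum) auto
 also have "... = (\<Sum>j\<in>UNIV. norm (B $ k $ j)) * (\<Sum>m\<in>UNIV. norm (v $ m))" by (simp add: sum_distrib_right)
 also have "... <= (\<Sum>i\<in>UNIV. \<Sum>j\<in>UNIV. norm (B $ i $ j)) * (\<Sum>m\<in>UNIV. norm (v $ m))"
  by (intro mult_right_mono member_le_sum[of k UNIV "\<lambda>i. \<Sum>j\<in>UNIV. norm (B $ i $ j)"]) (auto intro: sum_nonneg)
 finally show ?thesis .
qed

text \<open>The polynomial records which trajectories are covered: those annihilated by
  \<open>poly_mat p B\<close> at all times. \<open>C\<close> depends neither on the starting time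
  nor on the trajectory.\<close>

definition ode_bound :: "complex poly => complex^'n^'n => real => bool" where
 "ode_bound p B C \<longleftrightarrow> (\<forall>a x k t. (\<forall>k. \<forall>t\<ge>a. ((\<lambda>t. x t $ k) has_vector_derivative (B *v x t) $ k) (at t within {a..})) \<longrightarrow>
   (\<forall>t\<ge>a. poly_mat p B (x t) = 0) \<longrightarrow> a <= t \<longrightarrow> norm (x t $ k) <= C * (\<Sum>m\<in>UNIV. norm (x a $ m)))"

lemma ode_boundI:
 assumes "\<And>a x k t. (\<And>k t. a <= t ==> ((\<lambda>t. x t $ k) has_vector_derivative (B *v x t) $ k) (at t within {a..})) ==>
    (\<And>t. a <= t ==> poly_mat p B (x t) = 0) ==> a <= t ==> norm (x t $ k) <= C * (\<Sum>m\<in>UNIV. norm (x a $ m))"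
 shows "ode_bound p B C"
 unfolding ode_bound_def by (intro allI impI assms) blast+

lemma ode_boundD:
 assumes "ode_bound p B C" "\<And>k t. a <= t ==> ((\<lambda>t. x t $ k) has_vector_derivative (B *v x t) $ k) (at t within {a..})"
  "\<And>t. a <= t ==> poly_mat p B (x t) = 0" "a <= t"
 shows "norm (x t $ k) <= C * (\<Sum>m\<in>UNIV. norm (x a $ m))"
 using assms unfolding ode_bound_def by blast

text \<open>Induction on the degree. When a root \<open>z\<close> is split off from
  \<open>p\<close>, the trajectory \<open>y = B *v x - z *s x\<close> solves the same equation and
  is annihilated by the cofactor \<open>q\<close>, hence is bounded; each component of
  \<open>x\<close> then solves a scalar equation with coefficient \<open>z\<close>, whose real part
  is negative, and bounded forcing.\<close>

lemma linear_ode_bounded: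
 fixes B :: "complex^'n^'n"
 assumes "p \<noteq> 0" "\<And>z. poly p z = 0 ==> Re z < 0"
 shows "\<exists>C\<ge>0. ode_bound p B C"
 using assms
proof (induction "degree p" arbitrary: p)
 case 0
 then obtain c where c: "p = [:c:]" "c \<noteq> 0" by (metis degree_eq_zeroE pCons_0_0)
 have "ode_bound p B 0"
 proof (rule ode_boundI)
  fix a and x :: "real => complex^'n" and k t
  assume "\<And>t. a <= t ==> poly_mat p B (x t) = 0" "a <= t"
  then have "c *s x t = 0" by (simp add: c)
  then have "c * x t $ k = 0" by (auto simp: vec_eq_iff)
  then show "norm (x t $ k) <= 0 * (\<Sum>m\<in>UNIV. norm (x a $ m))" using c(2) by simp
 qed
 then show ?case by blast
next
 case (Suc d)
 obtain z where z: "poly p z = 0"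
  using fundamental_theorem_of_algebra[of p] Suc.hyps(2) by (auto simp: constant_degree)
 then obtain q where q: "p = [:- z, 1:] * q" using poly_eq_0_iff_dvd by blast
 then have q0: "q \<noteq> 0" using Suc.prems by auto
 then have dq: "d = degree q" using Suc.hyps(2) unfolding q by (subst (asm) degree_mult_eq) auto
 have rq: "Re w < 0" if "poly q w = 0" for w using that Suc.prems(2)[of w] by (simp add: q)
 have rz: "Re z < 0" using Suc.prems(2)[OF z] .
 obtain C where C: "0 <= C" "ode_bound q B C"
  using Suc.hyps(1)[OF dq q0 rq] by blast
 define b where "b = (\<Sum>i\<in>UNIV. \<Sum>j\<in>UNIV. norm (B $ i $ j)) + norm z"
 have b0: "0 <= b" unfolding b_def by (intro add_nonneg_nonneg sum_nonneg) auto
 have "ode_bound p B (1 + C * (CARD('n) * b) / (- Re z))"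
 proof (rule ode_boundI)
  fix a and x :: "real => complex^'n" and k t
  assume x: "\<And>k t. a <= t ==> ((\<lambda>t. x t $ k) has_vector_derivative (B *v x t) $ k) (at t within {a..})"
   and px: "\<And>t. a <= t ==> poly_mat p B (x t) = 0" and t: "a <= t"
  define S where "S = (\<Sum>m\<in>UNIV. norm (x a $ m))"
  define y where "y s = B *v x s - z *s x s" for s
  have yd: "((\<lambda>s. y s $ k) has_vector_derivative (B *v y s) $ k) (at s within {a..})" if s: "a <= s" for k s
  proof -
   have "((\<lambda>s. (\<Sum>j\<in>UNIV. B $ k $ j * x s $ j) - z * x s $ k) has_vector_derivative
    (\<Sum>j\<in>UNIV. B $ k $ j * (B *v x s) $ j) - z * (B *v x s) $ k) (at s within {a..})"
    by (intro has_vector_derivative_diff has_vector_derivative_sum has_vector_derivative_mult_right x s)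
   moreover have "(\<Sum>j\<in>UNIV. B $ k $ j * (B *v x s) $ j) - z * (B *v x s) $ k = (B *v y s) $ k"
    unfolding y_def by (simp add: matrix_vector_mult_diff_distrib vector_scalar_commute[symmetric]) (simp add: matrix_vector_mult_def sum_distrib_left mult_ac)
   moreover have "(\<lambda>s. y s $ k) = (\<lambda>s. (\<Sum>j\<in>UNIV. B $ k $ j * x s $ j) - z * x s $ k)"
    unfolding y_def by (simp add: matrix_vector_mult_def)
   ultimately show ?thesis by simp
  qed
  have yq: "poly_mat q B (y s) = 0" if "a <= s" for s
   using px[OF that] unfolding q poly_mat_linear_factor' y_def .
  have ya: "norm (y a $ m) <= b * S" for m
  proof -
   have "norm (y a $ m) <= norm ((B *v x a) $ m) + norm (z * x a $ m)" unfolding y_def by (simp add: norm_triangle_ineq4)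
   also have "... <= (\<Sum>i\<in>UNIV. \<Sum>j\<in>UNIV. norm (B $ i $ j)) * S + norm z * S"
    unfolding S_def norm_mult by (intro add_mono sum_norm_matrix_le mult_left_mono member_le_sum) auto
   finally show ?thesis by (simp add: b_def algebra_simps)
  qed
  have ySum: "(\<Sum>m\<in>UNIV. norm (y a $ m)) <= CARD('n) * b * S"
   using sum_mono[of UNIV "\<lambda>m. norm (y a $ m)" "\<lambda>m. b * S", OF ya] by simp
  have "norm (x t $ k) <= norm (x a $ k) + C * (CARD('n) * b * S) / (- Re z)"
  proof (rule scalar_ode_bound[OF _ _ rz t, of "\<lambda>t. x t $ k" "\<lambda>t. y t $ k"])
   fix s assume s: "a <= s"
   show "((\<lambda>t. x t $ k) has_vector_derivative z * x s $ k + y s $ k) (at s within {a..})"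
    using x[OF s, of k] unfolding y_def by simp
   show "norm (y s $ k) <= C * (CARD('n) * b * S)"
    using order_trans[OF ode_boundD[OF C(2) yd yq s, of k] mult_left_mono[OF ySum C(1)]] by simp
  qed
  also have "norm (x a $ k) <= S" unfolding S_def by (rule member_le_sum) auto
  finally show "norm (x t $ k) <= (1 + C * (CARD('n) * b) / (- Re z)) * (\<Sum>m\<in>UNIV. norm (x a $ m))"
   unfolding S_def[symmetric] by (simp add: algebra_simps add_divide_distrib)
 qed
 moreover have "0 <= 1 + C * (CARD('n) * b) / (- Re z)"
  using C(1) b0 rz by (intro add_nonneg_nonneg divide_nonneg_nonneg) auto
 ultimately show ?case by blast
qed

text \<open>The rescaled trajectory \<open>exp (s * (t - a)) * W k t\<close> solves the shifted
  system, for which boundedness is enough; so the rate \<open>s\<close> is reached without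
  loss.\<close>

lemma hurwitz_decay:
 fixes A :: "real^'n^'n"
 assumes "hurwitz (A + s *\<^sub>R mat 1)"
 obtains D where "0 <= D"
  "\<And>a (W :: 'n => real => real) t. (\<And>k t. a <= t ==> (W k has_real_derivative (\<Sum>m\<in>UNIV. A $ k $ m * W m t)) (at t within {a..})) ==>
    a <= t ==> (\<Sum>k\<in>UNIV. \<bar>W k t\<bar>) <= D * exp (- s * (t - a)) * (\<Sum>k\<in>UNIV. \<bar>W k a\<bar>)"
proof -
 let ?B = "map_matrix complex_of_real (A + s *\<^sub>R mat 1)"
 obtain p where p: "p \<noteq> 0" "\<And>v. poly_mat p ?B v = 0" "\<And>z. poly p z = 0 \<longleftrightarrow> (\<exists>v. v \<noteq> 0 \<and> ?B *v v = z *s v)"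
  by (rule minimal_poly_exists[of ?B]) (rule that)
 have neg: "Re z < 0" if "poly p z = 0" for z using that assms unfolding p(3) hurwitz_def by blast
 obtain C where C: "0 <= C" "ode_bound p ?B C"
  using linear_ode_bounded[OF p(1) neg, of ?B] by blast
 show thesis
 proof (rule that[of "CARD('n) * C"])
  show "0 <= real CARD('n) * C" using C(1) by simp
  fix a and W :: "'n => real => real" and t
  assume W: "\<And>k t. a <= t ==> (W k has_real_derivative (\<Sum>m\<in>UNIV. A $ k $ m * W m t)) (at t within {a..})" and t: "a <= t"
  define V where "V k u = exp (s * (u - a)) * W k u" for k u
  define x where "x u = (\<chi> k. complex_of_real (V k u))" for u
  have Vd: "(V k has_real_derivative (\<Sum>m\<in>UNIV. A $ k $ m * V m u) + s * V k u) (at u within {a..})" if u: "a <= u" for k u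
  proof -
   have e: "((\<lambda>u. exp (s * (u - a))) has_real_derivative s * exp (s * (u - a))) (at u within {a..})"
    by (auto intro!: derivative_eq_intros)
   show ?thesis unfolding V_def[abs_def]
    by (rule DERIV_cong[OF DERIV_mult[OF e W[OF u]]]) (simp add: sum_distrib_left mult_ac)
  qed
  have xd: "((\<lambda>t. x t $ k) has_vector_derivative (?B *v x u) $ k) (at u within {a..})" if u: "a <= u" for k u
  proof -
   have "((\<lambda>t. complex_of_real (V k t)) has_vector_derivative complex_of_real ((\<Sum>m\<in>UNIV. A $ k $ m * V m u) + s * V k u)) (at u within {a..})"
    using Vd[OF u, of k] by (intro has_vector_derivative_of_real)
   moreover have "(?B *v x u) $ k = complex_of_real ((\<Sum>m\<in>UNIV. A $ k $ m * V m u) + s * V k u)"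
    unfolding map_matrix_shift by (simp add: x_def matrix_vector_mult_def map_matrix_def)
   ultimately show ?thesis by (simp add: x_def)
  qed
  have "\<bar>V k t\<bar> <= C * (\<Sum>m\<in>UNIV. \<bar>W m a\<bar>)" for k
   using ode_boundD[OF C(2) xd p(2) t, of k] by (simp add: x_def V_def norm_mult abs_mult)
  then have "(\<Sum>k\<in>UNIV. \<bar>V k t\<bar>) <= CARD('n) * (C * (\<Sum>m\<in>UNIV. \<bar>W m a\<bar>))"
   using sum_mono[of UNIV "\<lambda>k. \<bar>V k t\<bar>"] by (metis (no_types, lifting) sum_constant)
  then have "exp (- s * (t - a)) * (\<Sum>k\<in>UNIV. \<bar>V k t\<bar>) <= exp (- s * (t - a)) * (CARD('n) * (C * (\<Sum>m\<in>UNIV. \<bar>W m a\<bar>)))"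
   by (rule mult_left_mono) simp
  moreover have "exp (- s * (t - a)) * (\<Sum>k\<in>UNIV. \<bar>V k t\<bar>) = (\<Sum>k\<in>UNIV. \<bar>W k t\<bar>)"
  proof -
   have "exp (- s * (t - a)) * \<bar>V k t\<bar> = \<bar>W k t\<bar>" for k
    unfolding V_def abs_mult by (simp add: mult.assoc[symmetric] exp_add[symmetric])
   then show ?thesis by (simp add: sum_distrib_left)
  qed
  ultimately have "(\<Sum>k\<in>UNIV. \<bar>W k t\<bar>) <= exp (- s * (t - a)) * (CARD('n) * (C * (\<Sum>m\<in>UNIV. \<bar>W m a\<bar>)))" by (simp only:)
  then show "(\<Sum>k\<in>UNIV. \<bar>W k t\<bar>) <= real CARD('n) * C * exp (- s * (t - a)) * (\<Sum>k\<in>UNIV. \<bar>W k a\<bar>)"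
   by (simp only: mult_ac)
 qed
qed

section \<open>Transport identities from weak derivatives\<close>

text \<open>A nonnegative mollifier supported in \<open>{-1..1}\<close>; the factor 15/16 normalises
  its integral. Class C1 is the regularity that \<open>test_function\<close> demands.\<close>

definition bump :: "real => real" where
 "bump z = 15/16 * (max 0 (1 - z\<^sup>2))\<^sup>2"

abbreviation approx_unit :: "nat => real => real" where "approx_unit n x \<equiv> real (Suc n) * bump (real (Suc n) * x)"

abbreviation pr :: "(real => real => real) => real \<times> real => real" where "pr f z \<equiv> f (fst z) (snd z)"

definition bump' :: "real => real" where
 "bump' z = - (15/4) * z * max 0 (1 - z\<^sup>2)"

text \<open>Squaring removes the kink of the positive part; this makes \<open>bump\<close>
  differentiable at the ends of its support.\<close>

lemma DERIV_pos_part_square: "((\<lambda>y. (max 0 y)\<^sup>2) has_real_derivative 2 * max 0 y) (at y)" for y :: real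
proof -
 consider "y > 0" | "y < 0" | "y = 0" by linarith
 then show ?thesis
 proof cases
  case 1
  have "((\<lambda>y. y\<^sup>2) has_real_derivative 2 * max 0 y) (at y)"
   using 1 by (auto intro!: derivative_eq_intros)
  then show ?thesis
   by (rule has_field_derivative_transform_within_open[of _ _ _ "{0<..}"]) (use 1 in auto)
 next
  case 2
  have "((\<lambda>y. 0) has_real_derivative 2 * max 0 y) (at y)"
   using 2 by auto
  then show ?thesis
   by (rule has_field_derivative_transform_within_open[of _ _ _ "{..<0}"]) (use 2 in auto)
 next
  case 3
  have "((\<lambda>h. ((max 0 (0 + h))\<^sup>2 - (max 0 0)\<^sup>2) / h) \<longlongrightarrow> 0) (at (0::real))"
  proof (rule Lim_null_comparison)
   show "((\<lambda>h. \<bar>h\<bar>) \<longlongrightarrow> 0) (at (0::real))" by (rule tendsto_eq_intros refl | simp)+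
   have "\<bar>((max 0 h)\<^sup>2) / h\<bar> <= \<bar>h\<bar>" for h :: real
    by (cases "h > 0") (auto simp: power2_eq_square max_def)
   then show "\<forall>\<^sub>F h in at 0. norm (((max 0 (0 + h))\<^sup>2 - (max 0 0)\<^sup>2) / h) <= \<bar>h::real\<bar>"
    by (intro always_eventually) simp
  qed
  then show ?thesis using 3 by (simp add: DERIV_def)
 qed
qed

lemma bump_deriv: "(bump has_real_derivative bump' z) (at z)"
 unfolding bump_def bump'_def
 by (rule derivative_eq_intros refl DERIV_chain2[OF DERIV_pos_part_square] | simp)+

lemma bump_continuous: "continuous_on S bump" "continuous_on S bump'"
 unfolding bump_def bump'_def by (intro continuous_intros)+

lemma bump_nonneg: "0 <= bump z" by (simp add: bump_def)

lemma bump_zero: "1 <= \<bar>z\<bar> ==> bump z = 0"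
proof -
 assume "1 <= \<bar>z\<bar>"
 then have "1 <= z\<^sup>2" by (metis abs_le_square_iff abs_one one_power2)
 then show ?thesis by (simp add: bump_def)
qed

lemma bump_le: "bump z <= 1"
proof -
 have "(max 0 (1 - z\<^sup>2))\<^sup>2 <= 1\<^sup>2" by (intro power_mono) auto
 then show ?thesis by (simp add: bump_def)
qed

lemma bump_bm: "bm bump"
 by (rule bmI[where B=1]) (use bump_continuous bump_nonneg bump_le in \<open>auto intro: borel_contI\<close>)

lemma bump_integral: "(bump has_integral 1) {-1..1}"
proof -
 have "((\<lambda>z. 15/16 * (1 - 2 * z^2 + z^4)) has_integral
   (15/16 * (1 - 2 * 1^3/3 + 1^5/5) - 15/16 * ((-1) - 2 * (-1)^3/3 + (-1)^5/5))) {-1..1::real}"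
  by (rule fundamental_theorem_of_calculus)
    (auto intro!: derivative_eq_intros simp flip: has_real_derivative_iff_has_vector_derivative)
 then have "((\<lambda>z. 15/16 * (1 - 2 * z^2 + z^4)) has_integral 1) {-1..1::real}" by simp
 then show ?thesis
 proof (rule has_integral_eq[rotated])
  fix z :: real assume "z \<in> {-1..1}"
  then have "z\<^sup>2 <= 1" by (auto simp: abs_square_le_1 abs_le_iff)
  then show "15/16 * (1 - 2 * z^2 + z^4) = bump z"
   unfolding bump_def by (simp add: max_absorb2 power2_eq_square power4_eq_xxxx algebra_simps)
 qed
qed

text \<open>Differences of rescaled translates of this antiderivative of \<open>bump\<close> are C1
  cutoffs, and their derivatives are differences of approximate units.\<close>

definition step :: "real => real" where
 "step z = integral {-1..max (-1) z} bump"

lemma bump_integrable: "bump integrable_on {a..b}"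
 by (rule bm_integrable_on[OF bump_bm])

lemma step_zero: "z <= -1 ==> step z = 0"
 unfolding step_def by (simp add: max_absorb1)

lemma step_one: "1 <= z ==> step z = 1"
proof -
 assume z: "1 <= z"
 have "integral {-1..1} bump + integral {1..z} bump = integral {-1..z} bump"
  by (rule HK_combine) (use z bump_integrable in auto)
 moreover have "integral {1..z} bump = integral {1..z} (\<lambda>_. 0)"
  by (rule integral_cong) (use bump_zero in auto)
 ultimately show ?thesis using z integral_unique[OF bump_integral] unfolding step_def by (auto simp: max_absorb2)
qed

lemma step_deriv: "(step has_real_derivative bump z) (at z)"
proof -
 define R where "R = \<bar>z\<bar> + 2"
 have R: "-R < z" "z < R" "-R <= -1" unfolding R_def by auto
 have eq: "step y = integral {-R..y} bump" if "y \<in> {-R<..<R}" for y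
 proof (cases "-1 <= y")
  case True
  have "integral {-R..-1} bump + integral {-1..y} bump = integral {-R..y} bump"
   by (rule HK_combine) (use R True bump_integrable in auto)
  moreover have "integral {-R..-1} bump = integral {-R..-1} (\<lambda>_. 0)"
   by (rule integral_cong) (use bump_zero in auto)
  ultimately show ?thesis using True unfolding step_def by (simp add: max_absorb2)
 next
  case False
  have "integral {-R..y} bump = integral {-R..y} (\<lambda>_. 0)"
   by (rule integral_cong) (use bump_zero False in auto)
  then show ?thesis using False unfolding step_def by (simp add: max_absorb1)
 qed
 have "((\<lambda>y. integral {-R..y} bump) has_real_derivative bump z) (at z within {-R..R})"
  by (rule integral_has_real_derivative) (use bump_continuous R in auto)
 moreover have "at z within {-R..R} = at z" by (rule at_within_interior) (use R in auto)
 ultimately have "((\<lambda>y. integral {-R..y} bump) has_real_derivative bump z) (at z)" by simp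
 then show ?thesis
  by (rule has_field_derivative_transform_within_open[of _ _ _ "{-R<..<R}"]) (use R eq in auto)
qed

lemma step_bounds: "0 <= step z" "step z <= 1"
proof -
 have nd: "x <= y ==> step x <= step y" for x y
  by (rule DERIV_nonneg_imp_nondecreasing) (use step_deriv bump_nonneg in \<open>blast+\<close>)
 show "0 <= step z" using nd[of "min z (-1)" z] step_zero[of "min z (-1)"] by simp
 show "step z <= 1" using nd[of z "max z 1"] step_one[of "max z 1"] by simp
qed

lemma step_continuous: "continuous_on S step"
 by (rule DERIV_continuous_on_at[OF step_deriv])

lemma step_bm: "bm step"
 by (rule bmI[where B=1]) (use step_continuous step_bounds in \<open>auto intro: borel_contI\<close>)

text \<open>Rescaling to \<open>{-1..1}\<close> leaves the fixed weight \<open>bump\<close>, so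
  dominated convergence needs continuity of \<open>f\<close> at \<open>t0\<close> alone.\<close>

lemma mollify:
 fixes f :: "real => real"
 assumes f: "bm f" and c: "isCont f t0"
 shows "(\<lambda>n. integral {t0 - 1 / real (Suc n)..t0 + 1 / real (Suc n)} (\<lambda>t. f t * (approx_unit n (t - t0)))) \<longlonglongrightarrow> f t0"
proof -
 obtain B where B: "0 <= B" "\<And>x. \<bar>f x\<bar> <= B" using bm_bound[OF f] by blast
 have eq: "integral {t0 - 1 / real (Suc n)..t0 + 1 / real (Suc n)} (\<lambda>t. f t * (approx_unit n (t - t0)))
    = integral {-1..1} (\<lambda>z. f (t0 + z / real (Suc n)) * bump z)" for n
 proof -
  define N where "N = real (Suc n)"
  have N: "0 < N" by (simp add: N_def)
  have "bm (\<lambda>t. f t * (N * bump (N * (t - t0))))"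
   by (intro bm_mult f bm_const bm_comp[OF bump_bm]) auto
  then have "((\<lambda>z. f (t0 + z / N) * (N * bump (N * (t0 + z / N - t0))) * (1 / N)) has_integral
   integral {t0 + -1 / N..t0 + 1 / N} (\<lambda>t. f t * (N * bump (N * (t - t0))))) {-1..1}"
   by (rule bm_substitution) (use N in \<open>auto intro!: derivative_eq_intros\<close>)
  then have "((\<lambda>z. f (t0 + z / N) * bump z) has_integral
   integral {t0 - 1 / N..t0 + 1 / N} (\<lambda>t. f t * (N * bump (N * (t - t0))))) {-1..1}"
   using N by simp
  then have "((\<lambda>z. f (t0 + z / real (Suc n)) * bump z) has_integral
   integral {t0 - 1 / real (Suc n)..t0 + 1 / real (Suc n)} (\<lambda>t. f t * (approx_unit n (t - t0)))) {-1..1}"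
   unfolding N_def .
  then show ?thesis by (simp add: integral_unique)
 qed
 have "(\<lambda>n. integral {-1..1} (\<lambda>z. f (t0 + z / real (Suc n)) * bump z)) \<longlonglongrightarrow> integral {-1..1} (\<lambda>z. f t0 * bump z)"
 proof (rule dominated_convergence(2))
  show "(\<lambda>z. f (t0 + z / real (Suc n)) * bump z) integrable_on {-1..1}" for n
   by (intro bm_integrable_on bm_mult bump_bm bm_comp[OF f]) auto
  show "(\<lambda>z. B) integrable_on {-1..1::real}" by (rule integrable_const_ivl)
  show "norm (f (t0 + z / real (Suc n)) * bump z) <= B" for n z
   using mult_mono[OF B(2) bump_le[of z] B(1) bump_nonneg] bump_nonneg[of z]
   by (simp add: abs_mult del: of_nat_Suc)
  fix z :: real
  have "(\<lambda>n. t0 + z / real (Suc n)) \<longlonglongrightarrow> t0 + 0"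
   by (intro tendsto_intros LIMSEQ_Suc[OF lim_const_over_n])
  then have "(\<lambda>n. f (t0 + z / real (Suc n))) \<longlonglongrightarrow> f t0"
   using isCont_tendsto_compose[OF c] by (simp del: of_nat_Suc)
  then show "(\<lambda>n. f (t0 + z / real (Suc n)) * bump z) \<longlonglongrightarrow> f t0 * bump z"
   by (intro tendsto_intros)
 qed
 moreover have "integral {-1..1} (\<lambda>z. f t0 * bump z) = f t0"
  using integral_unique[OF bump_integral] by simp
 ultimately show ?thesis unfolding eq by (simp only:)
qed

section \<open>Test functions concentrated on a characteristic\<close>

lemma lebesgue_integral_iterated:
 fixes f :: "real \<times> real => real"
 assumes f: "bm f" and z: "\<And>x y. f (x, y) \<noteq> 0 ==> x \<in> {a..b} \<and> y \<in> {c..d}"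
 shows "(LINT z|lebesgue. f z) = integral {a..b} (\<lambda>x. integral {c..d} (\<lambda>y. f (x, y)))"
proof -
 obtain B where B: "0 <= B" "\<And>z. \<bar>f z\<bar> <= B" using bm_bound[OF f] by blast
 have fm: "f \<in> borel_measurable borel" using f by (simp add: bm_def)
 then have [measurable]: "f \<in> borel_measurable (borel \<Otimes>\<^sub>M borel)" by (simp add: borel_prod)
 have fi: "f = (\<lambda>z. indicator ({a..b} \<times> {c..d}) z *\<^sub>R f z)"
  using z by (fastforce simp: indicator_def)
 have int: "integrable (lborel \<Otimes>\<^sub>M lborel) f"
  by (subst fi, rule integrableI_bounded_set_indicator[where B=B])
    (use B in \<open>auto simp: lborel.emeasure_pair_measure_Times ennreal_mult_less_top emeasure_lborel_Icc_eq\<close>)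
 have i1: "bm (\<lambda>x. integral {c..d} (\<lambda>y. f (x, y)))"
  using bm_integral_param[OF f, of "\<lambda>_. c" "\<lambda>_. d" c d] by simp
 have "(LINT z|lebesgue. f z) = (LINT z|lborel. f z)"
  by (rule integral_completion) (use fm in simp)
 also have "... = (LINT z|(lborel \<Otimes>\<^sub>M lborel). f z)" by (simp add: lborel_prod)
 also have "... = (LINT x|lborel. (LINT y|lborel. f (x, y)))"
  by (rule lborel_pair.integral_fst'[symmetric]) (rule int)
 also have "... = (LINT x|lborel. indicator {a..b} x *\<^sub>R integral {c..d} (\<lambda>y. f (x, y)))"
 proof (rule Bochner_Integration.integral_cong[OF refl])
  fix x
  have "(LINT y|lborel. f (x, y)) = (LINT y|lborel. indicator {a..b} x *\<^sub>R (indicator {c..d} y *\<^sub>R f (x, y)))"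
   using z by (intro Bochner_Integration.integral_cong) (auto simp: indicator_def)
  also have "... = indicator {a..b} x *\<^sub>R (LINT y:{c..d}|lborel. f (x, y))"
   unfolding set_lebesgue_integral_def by simp
  finally show "(LINT y|lborel. f (x, y)) = indicator {a..b} x *\<^sub>R integral {c..d} (\<lambda>y. f (x, y))"
   using bm_set_integral[OF bm_pair2[OF f]] by simp
 qed
 also have "... = integral {a..b} (\<lambda>x. integral {c..d} (\<lambda>y. f (x, y)))"
  using bm_set_integral[OF i1] unfolding set_lebesgue_integral_def by simp
 finally show ?thesis .
qed

lemma set_integrable_mult_continuous:
 fixes f g :: "real \<times> real => real"
 assumes K: "compact K" and f: "set_integrable lebesgue K f" and g: "continuous_on K g"
 shows "set_integrable lebesgue K (\<lambda>z. f z * g z)"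
proof -
 let ?g = "\<lambda>z. if z \<in> K then g z else 0"
 have bg: "bm ?g" by (rule bm_continuous_on_compact[OF K g])
 then obtain B where B: "0 <= B" "\<And>x. \<bar>?g x\<bar> <= B" using bm_bound by blast
 have gm: "?g \<in> borel_measurable lebesgue" using bm_measurable[OF bg] by (intro measurable_completion) simp
 have fm: "(\<lambda>z. indicator K z *\<^sub>R f z) \<in> borel_measurable lebesgue" using f unfolding set_integrable_def by auto
 have "integrable lebesgue (\<lambda>z. B * (indicator K z *\<^sub>R f z))" using f unfolding set_integrable_def by auto
 then have "integrable lebesgue (\<lambda>z. (indicator K z *\<^sub>R f z) * ?g z)"
 proof (rule Bochner_Integration.integrable_bound)
  show "(\<lambda>z. (indicator K z *\<^sub>R f z) * ?g z) \<in> borel_measurable lebesgue" using fm gm by (rule borel_measurable_times)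
  show "AE z in lebesgue. norm ((indicator K z *\<^sub>R f z) * ?g z) <= norm (B * (indicator K z *\<^sub>R f z))"
  proof (intro AE_I2)
   fix z
   show "norm ((indicator K z *\<^sub>R f z) * ?g z) <= norm (B * (indicator K z *\<^sub>R f z))"
    using mult_left_mono[OF B(2)[of z], of "\<bar>indicator K z *\<^sub>R f z\<bar>"] B(1) by (simp only: real_norm_def abs_mult abs_of_nonneg mult.commute abs_ge_zero)
  qed
 qed
 then show ?thesis unfolding set_integrable_def
  by (rule Bochner_Integration.integrable_cong[THEN iffD1, rotated -1]) (auto simp: indicator_def)
qed

text \<open>The test functions are products of \<open>c\<close> and \<open>a\<close> at
  \<open>x\<close> with \<open>b\<close> at \<open>t + e * \<Phi> x\<close>: \<open>a\<close>
  localises in space, \<open>b\<close> localises near a characteristic and is constant along it, and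
  \<open>c\<close> supplies the factors \<open>q\<close>, \<open>1\<close> and \<open>1 / q\<close>
  needed below. The direction \<open>v\<close> stays open, so that both partial derivatives are
  covered.\<close>

lemma weak_derivative_test:
 assumes S: "open S" "S \<subseteq> {0<..<L} \<times> UNIV"
  and \<Phi>: "\<And>x. (\<Phi> has_real_derivative 1 / q x) (at x)" and qc: "continuous_on UNIV q" and q0: "\<And>x. 0 < q x"
  and c: "\<forall>x\<in>{0<..<L}. (c has_real_derivative c' x) (at x)" "continuous_on {0<..<L} c'"
  and a: "\<And>x. (a has_real_derivative a' x) (at x)" "continuous_on UNIV a'"
  and b: "\<And>x. (b has_real_derivative b' x) (at x)" "continuous_on UNIV b'"
  and a0: "\<forall>x. x \<notin> {y1..y2} \<longrightarrow> a x = 0 \<and> a' x = 0"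
  and b0: "\<forall>x. x \<notin> {e1..e2} \<longrightarrow> b x = 0 \<and> b' x = 0"
  and K: "K = {z. fst z \<in> {y1..y2} \<and> snd z + e * \<Phi> (fst z) \<in> {e1..e2}}" "compact K" "K \<subseteq> S"
  and wd: "weak_derivative S v f g"
 shows "(LINT z:K|lebesgue. f z * ((c' (fst z) * a (fst z) * b (snd z + e * \<Phi> (fst z))
      + c (fst z) * a' (fst z) * b (snd z + e * \<Phi> (fst z))
      + c (fst z) * a (fst z) * b' (snd z + e * \<Phi> (fst z)) * e / q (fst z)) * fst v
      + c (fst z) * a (fst z) * b' (snd z + e * \<Phi> (fst z)) * snd v))
    = - (LINT z:K|lebesgue. g z * (c (fst z) * a (fst z) * b (snd z + e * \<Phi> (fst z))))" (is "(LINT z:K|_. f z * ?w' z v) = - (LINT z:K|_. g z * ?w z)")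
proof -
 let ?th = "\<lambda>z::real\<times>real. snd z + e * \<Phi> (fst z)"
 \<comment> \<open>The formula for the derivative involves \<open>c'\<close>, which is known only
   over \<open>{0<..<L}\<close>. It vanishes off \<open>K\<close>, which lies in \<open>S\<close>,
   so cutting it off at \<open>S\<close> gives the derivative everywhere.\<close>
 let ?D = "\<lambda>z v. if z \<in> S then ?w' z v else 0"
 have off: "?w z = 0" "?w' z v = 0" if "z \<notin> K" for z v
 proof -
  have "fst z \<notin> {y1..y2} \<or> ?th z \<notin> {e1..e2}" using that unfolding K(1) by blast
  then have "(a (fst z) = 0 \<and> a' (fst z) = 0) \<or> (b (?th z) = 0 \<and> b' (?th z) = 0)"
   using a0 b0 by blast
  then show "?w z = 0" "?w' z v = 0" by (elim disjE; simp)+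
 qed
 have cont: "continuous_on S (\<lambda>z. ?w' z v)" for v
 proof -
  have fS: "fst ` S \<subseteq> {0<..<L}" using S(2) by auto
  have cc: "continuous_on {0<..<L} c"
   by (rule DERIV_continuous_on[OF has_field_derivative_at_within[OF bspec[OF c(1)]]])
  have c\<Phi>: "continuous_on UNIV \<Phi>" by (rule DERIV_continuous_on_at[OF \<Phi>])
  have ca: "continuous_on UNIV a" by (rule DERIV_continuous_on_at[OF a(1)])
  have cb: "continuous_on UNIV b" by (rule DERIV_continuous_on_at[OF b(1)])
  have "continuous_on S (\<lambda>z. c (fst z))" "continuous_on S (\<lambda>z. c' (fst z))"
   using fS by (auto intro!: continuous_on_compose2[OF cc] continuous_on_compose2[OF c(2)] continuous_intros)
  moreover have "continuous_on S (\<lambda>z. a (fst z))" "continuous_on S (\<lambda>z. a' (fst z))" "continuous_on S (\<lambda>z. q (fst z))"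
   by (auto intro!: continuous_on_compose2[OF ca] continuous_on_compose2[OF a(2)] continuous_on_compose2[OF qc] continuous_intros)
  moreover have "continuous_on S (\<lambda>z. b (snd z + e * \<Phi> (fst z)))" "continuous_on S (\<lambda>z. b' (snd z + e * \<Phi> (fst z)))"
   by (auto intro!: continuous_on_compose2[OF cb] continuous_on_compose2[OF b(2)] continuous_on_compose2[OF c\<Phi>] continuous_intros)
  ultimately show ?thesis using q0 by (intro continuous_intros) (auto simp: less_imp_neq[symmetric])
 qed
 have op: "open (- K)" using K(2) by (simp add: compact_imp_closed open_Compl)
 have tf: "test_function S ?w ?D"
  unfolding test_function_def
 proof (intro conjI allI)
  fix z
  show "(?w has_derivative ?D z) (at z)"
  proof (cases "z \<in> S")
   case True
   then have fz: "fst z \<in> {0<..<L}" using S(2) by auto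
   have 1: "((\<lambda>z. h (fst z)) has_derivative (\<lambda>v. h' * fst v)) (at z)" if "(h has_real_derivative h') (at (fst z))" for h h'
    using has_derivative_compose[OF has_derivative_fst[OF has_derivative_ident] that[unfolded has_field_derivative_def]] by simp
   have 2: "((\<lambda>z. snd z + e * \<Phi> (fst z)) has_derivative (\<lambda>v. snd v + e * (1 / q (fst z) * fst v))) (at z)"
    by (intro derivative_intros 1[OF \<Phi>])
   have 3: "((\<lambda>z. b (snd z + e * \<Phi> (fst z))) has_derivative (\<lambda>v. b' (snd z + e * \<Phi> (fst z)) * (snd v + e * (1 / q (fst z) * fst v)))) (at z)"
    using has_derivative_compose[OF 2 b(1)[unfolded has_field_derivative_def]] by simp
   have "(?w has_derivative ?w' z) (at z)"
    by (rule has_derivative_eq_rhs[OF has_derivative_mult[OF has_derivative_mult[OF 1[OF bspec[OF c(1) fz]] 1[OF a(1)]] 3]])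
      (auto simp: field_simps add_divide_distrib)
   then show ?thesis using True by (simp add: if_distrib cong: if_cong)
  next
   case False
   then have zK: "z \<in> - K" using K(3) by auto
   have "((\<lambda>z. 0) has_derivative (\<lambda>v. 0)) (at z)" by simp
   then have "(?w has_derivative (\<lambda>v. 0)) (at z)"
    by (rule has_derivative_transform_within_open[OF _ op zK]) (use off in auto)
   then show ?thesis using False by simp
  qed
 next
  fix v
  have "continuous_on S (\<lambda>z. ?D z v)" using cont[of v] by (rule continuous_on_eq) auto
  moreover have "continuous_on (- K) (\<lambda>z. ?D z v)"
   using continuous_on_const[of "- K" 0] by (rule continuous_on_eq) (use off in auto)
  ultimately have "continuous_on (S \<union> - K) (\<lambda>z. ?D z v)"
   using S(1) op by (intro continuous_on_open_Un) auto
  moreover have "S \<union> - K = UNIV" using K(3) by auto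
  ultimately show "continuous_on UNIV (\<lambda>z. ?D z v)" by simp
 next
  show "\<exists>K. compact K \<and> K \<subseteq> S \<and> (\<forall>z. z \<notin> K \<longrightarrow> ?w z = 0)" using K(2,3) off by blast
 qed
 have "(LINT z:S|lebesgue. f z * ?D z v) = - (LINT z:S|lebesgue. g z * ?w z)"
  using wd tf unfolding weak_derivative_def by blast
 moreover have "(LINT z:S|lebesgue. f z * ?D z v) = (LINT z:K|lebesgue. f z * ?w' z v)"
  unfolding set_lebesgue_integral_def
  by (intro Bochner_Integration.integral_cong) (use off K(3) in \<open>auto simp: indicator_def\<close>)
 moreover have "(LINT z:S|lebesgue. g z * ?w z) = (LINT z:K|lebesgue. g z * ?w z)"
  unfolding set_lebesgue_integral_def
  by (intro Bochner_Integration.integral_cong) (use off K(3) in \<open>auto simp: indicator_def\<close>)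
 ultimately show ?thesis by simp
qed

text \<open>Four weak identities are combined. The mixed derivative \<open>fxt\<close> occurs in two
  of them and cancels, the terms with \<open>b'\<close> cancel because \<open>b\<close> is constant
  along the characteristics, and the wave equation trades \<open>ftt\<close> for \<open>fxx\<close>.
  What remains is the weak transport equation of the Riemann variable
  \<open>ft + d q fx\<close>.\<close>

lemma weak_transport:
 fixes d :: real
 assumes S: "open S" "S \<subseteq> {0<..<L} \<times> UNIV"
  and \<Phi>: "\<And>x. (\<Phi> has_real_derivative 1 / q x) (at x)" and qc: "continuous_on UNIV q" and q0: "\<And>x. 0 < q x"
  and q: "\<forall>x\<in>{0<..<L}. (q has_real_derivative q' x) (at x)" "continuous_on {0<..<L} q'"
  and sd: "second_derivatives S fx ft fxx fxt ftt"
  and eq: "AE z in lebesgue_on S. pr ftt z = (q (fst z))\<^sup>2 * pr fxx z + k z"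
  and eps: "d * d = 1"
  and a: "\<And>x. (a has_real_derivative a' x) (at x)" "continuous_on UNIV a'"
  and b: "\<And>x. (b has_real_derivative b' x) (at x)" "continuous_on UNIV b'"
  and a0: "\<forall>x. x \<notin> {y1..y2} \<longrightarrow> a x = 0 \<and> a' x = 0"
  and b0: "\<forall>x. x \<notin> {e1..e2} \<longrightarrow> b x = 0 \<and> b' x = 0"
  and K: "K = {z. fst z \<in> {y1..y2} \<and> snd z + d * \<Phi> (fst z) \<in> {e1..e2}}" "compact K" "K \<subseteq> S"
  and km: "(\<lambda>z. indicator K z *\<^sub>R ((k z - q (fst z) * q' (fst z) * pr fx z) / q (fst z))) \<in> borel_measurable lebesgue"
 shows "(LINT z:K|lebesgue. d * (pr ft z + d * q (fst z) * pr fx z) * (a' (fst z) * b (snd z + d * \<Phi> (fst z))))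
    = (LINT z:K|lebesgue. (k z - q (fst z) * q' (fst z) * pr fx z) / q (fst z) * (a (fst z) * b (snd z + d * \<Phi> (fst z))))"
proof -
 have wd: "weak_derivative S (1, 0) (\<lambda>z. pr fx z) (\<lambda>z. pr fxx z)"
   "weak_derivative S (0, 1) (\<lambda>z. pr fx z) (\<lambda>z. pr fxt z)"
   "weak_derivative S (1, 0) (\<lambda>z. pr ft z) (\<lambda>z. pr fxt z)"
   "weak_derivative S (0, 1) (\<lambda>z. pr ft z) (\<lambda>z. pr ftt z)"
  using sd unfolding second_derivatives_def by (simp_all add: case_prod_unfold)
 have int: "set_integrable lebesgue K (\<lambda>z. pr fx z)" "set_integrable lebesgue K (\<lambda>z. pr ft z)"
  "set_integrable lebesgue K (\<lambda>z. pr fxx z)" "set_integrable lebesgue K (\<lambda>z. pr fxt z)"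
  "set_integrable lebesgue K (\<lambda>z. pr ftt z)"
  using wd K(2,3) unfolding weak_derivative_def by (simp_all del: split_paired_All)
 let ?th = "\<lambda>z::real\<times>real. snd z + d * \<Phi> (fst z)"
 have fK: "fst ` K \<subseteq> {0<..<L}" using K(3) S(2) by auto
 have c\<Phi>: "continuous_on UNIV \<Phi>" by (rule DERIV_continuous_on_at[OF \<Phi>])
 have ca: "continuous_on UNIV a" by (rule DERIV_continuous_on_at[OF a(1)])
 have cb: "continuous_on UNIV b" by (rule DERIV_continuous_on_at[OF b(1)])
 have cts: "continuous_on K (\<lambda>z. q (fst z))" "continuous_on K (\<lambda>z. q' (fst z))" "continuous_on K (\<lambda>z. a (fst z))" "continuous_on K (\<lambda>z. a' (fst z))"
   "continuous_on K (\<lambda>z. b (?th z))" "continuous_on K (\<lambda>z. b' (?th z))"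
  using fK by (auto intro!: continuous_on_compose2[OF qc] continuous_on_compose2[OF q(2)] continuous_on_compose2[OF ca] continuous_on_compose2[OF a(2)]
    continuous_on_compose2[OF cb] continuous_on_compose2[OF b(2)] continuous_on_compose2[OF c\<Phi>] continuous_intros)
 have qne: "q x \<noteq> 0" for x using q0[of x] by simp
 note test = weak_derivative_test[OF S \<Phi> qc q0 _ _ a b a0 b0 K]
 define J where "J f m = (LINT z:K|lebesgue. pr f z * m z)" for f :: "real => real => real" and m
 have d1q: "\<forall>x\<in>{0<..<L}. ((\<lambda>x. 1 / q x) has_real_derivative - q' x / (q x)\<^sup>2) (at x)"
  using q(1) qne by (auto intro!: derivative_eq_intros simp: power2_eq_square)
 have c1q: "continuous_on {0<..<L} (\<lambda>x. - q' x / (q x)\<^sup>2)"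
  using qne by (intro continuous_intros q(2) continuous_on_subset[OF qc]) auto
 have t1: "J ft (\<lambda>z. a (fst z) * b' (?th z) / q (fst z)) = - J ftt (\<lambda>z. a (fst z) * b (?th z) / q (fst z))"
  using test[OF d1q c1q wd(4)] unfolding J_def by simp
 have t2: "J ft (\<lambda>z. a' (fst z) * b (?th z) + d * (a (fst z) * b' (?th z) / q (fst z))) = - J fxt (\<lambda>z. a (fst z) * b (?th z))"
  using test[where c="\<lambda>_. 1" and c'="\<lambda>_. 0", OF _ _ wd(3)] unfolding J_def by (simp add: mult.commute mult.left_commute)
 have t3: "J fx (\<lambda>z. a (fst z) * b' (?th z)) = - J fxt (\<lambda>z. a (fst z) * b (?th z))"
  using test[where c="\<lambda>_. 1" and c'="\<lambda>_. 0", OF _ _ wd(2)] unfolding J_def by simp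
 have t4: "J fx (\<lambda>z. q' (fst z) * a (fst z) * b (?th z) + q (fst z) * (a' (fst z) * b (?th z)) + d * (a (fst z) * b' (?th z)))
   = - J fxx (\<lambda>z. q (fst z) * (a (fst z) * b (?th z)))"
  using test[OF q wd(1)] qne unfolding J_def by (simp add: mult.commute mult.left_commute mult.assoc)
 have add: "J f (\<lambda>z. m1 z + m2 z) = J f m1 + J f m2"
  if "set_integrable lebesgue K (\<lambda>z. pr f z)" "continuous_on K m1" "continuous_on K m2" for f m1 m2
  unfolding J_def distrib_left
  by (rule set_integral_add) (intro set_integrable_mult_continuous K that)+
 have scale: "J f (\<lambda>z. r * m z) = r * J f m" for f m r
  unfolding J_def by (simp add: mult.left_commute)
 have t2': "J ft (\<lambda>z. a' (fst z) * b (?th z)) + d * J ft (\<lambda>z. a (fst z) * b' (?th z) / q (fst z)) = - J fxt (\<lambda>z. a (fst z) * b (?th z))"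
  unfolding t2[symmetric] unfolding scale[symmetric] using qne by (subst add[OF int(2)]) (auto intro!: continuous_intros cts)
 have t4': "J fx (\<lambda>z. q' (fst z) * a (fst z) * b (?th z)) + J fx (\<lambda>z. q (fst z) * (a' (fst z) * b (?th z))) + d * J fx (\<lambda>z. a (fst z) * b' (?th z))
   = - J fxx (\<lambda>z. q (fst z) * (a (fst z) * b (?th z)))"
  unfolding t4[symmetric] scale[symmetric]
  by (subst add[OF int(1)], intro continuous_intros cts, intro continuous_intros cts, subst add[OF int(1)]) (auto intro!: continuous_intros cts)
 have L: "(LINT z:K|lebesgue. d * (pr ft z + d * q (fst z) * pr fx z) * (a' (fst z) * b (?th z)))
   = d * J ft (\<lambda>z. a' (fst z) * b (?th z)) + J fx (\<lambda>z. q (fst z) * (a' (fst z) * b (?th z)))"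
 proof -
  have "(LINT z:K|lebesgue. d * (pr ft z + d * q (fst z) * pr fx z) * (a' (fst z) * b (?th z)))
   = (LINT z:K|lebesgue. pr ft z * (d * (a' (fst z) * b (?th z))) + pr fx z * (q (fst z) * (a' (fst z) * b (?th z))))"
  proof -
   have "d * (u + d * q x * v) * (m * n) = u * (d * (m * n)) + v * (q x * (m * n))" for u v m n x
   proof -
    have "d * (u + d * q x * v) * (m * n) = u * (d * (m * n)) + (d * d) * (v * (q x * (m * n)))" by (simp add: algebra_simps)
    then show ?thesis by (simp add: eps)
   qed
   then show ?thesis by (simp only:)
  qed
  also have "... = J ft (\<lambda>z. d * (a' (fst z) * b (?th z))) + J fx (\<lambda>z. q (fst z) * (a' (fst z) * b (?th z)))"
   unfolding J_def by (rule set_integral_add) (intro set_integrable_mult_continuous K int continuous_intros cts)+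
  finally show ?thesis by (simp add: scale)
 qed
 have R: "(LINT z:K|lebesgue. (k z - q (fst z) * q' (fst z) * pr fx z) / q (fst z) * (a (fst z) * b (?th z)))
   = J ftt (\<lambda>z. a (fst z) * b (?th z) / q (fst z)) + J fxx (\<lambda>z. - (q (fst z) * (a (fst z) * b (?th z)))) + J fx (\<lambda>z. - (q' (fst z) * a (fst z) * b (?th z)))"
 proof -
  have i1: "set_integrable lebesgue K (\<lambda>z. pr ftt z * (a (fst z) * b (?th z) / q (fst z)))"
   and i2: "set_integrable lebesgue K (\<lambda>z. pr fxx z * - (q (fst z) * (a (fst z) * b (?th z))))"
   and i3: "set_integrable lebesgue K (\<lambda>z. pr fx z * - (q' (fst z) * a (fst z) * b (?th z)))"
   using qne by (intro set_integrable_mult_continuous K int continuous_intros cts; simp)+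
  have Km: "K \<in> sets lebesgue" "S \<in> sets lebesgue" using K(2) S(1) by (auto simp: compact_imp_closed)
  have "AE z in lebesgue. z \<in> S \<longrightarrow> pr ftt z = (q (fst z))\<^sup>2 * pr fxx z + k z"
   using eq Km by (simp add: AE_restrict_space_iff)
  then have "AE z in lebesgue. z \<in> K \<longrightarrow> (k z - q (fst z) * q' (fst z) * pr fx z) / q (fst z) * (a (fst z) * b (?th z))
    = pr ftt z * (a (fst z) * b (?th z) / q (fst z)) + pr fxx z * - (q (fst z) * (a (fst z) * b (?th z)))
     + pr fx z * - (q' (fst z) * a (fst z) * b (?th z))"
  proof eventually_elim
   case (elim z)
   show ?case
   proof
    assume "z \<in> K"
    then have e: "k z = pr ftt z - (q (fst z))\<^sup>2 * pr fxx z" using K(3) elim by auto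
    show "(k z - q (fst z) * q' (fst z) * pr fx z) / q (fst z) * (a (fst z) * b (?th z))
     = pr ftt z * (a (fst z) * b (?th z) / q (fst z)) + pr fxx z * - (q (fst z) * (a (fst z) * b (?th z)))
     + pr fx z * - (q' (fst z) * a (fst z) * b (?th z))"
     unfolding e using qne[of "fst z"] by (simp add: field_simps power2_eq_square)
   qed
  qed
  moreover have int3: "set_integrable lebesgue K (\<lambda>z. pr ftt z * (a (fst z) * b (?th z) / q (fst z)) + pr fxx z * - (q (fst z) * (a (fst z) * b (?th z)))
     + pr fx z * - (q' (fst z) * a (fst z) * b (?th z)))"
   by (intro set_integral_add i1 i2 i3)
  ultimately have "(LINT z:K|lebesgue. (k z - q (fst z) * q' (fst z) * pr fx z) / q (fst z) * (a (fst z) * b (?th z)))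
    = (LINT z:K|lebesgue. pr ftt z * (a (fst z) * b (?th z) / q (fst z)) + pr fxx z * - (q (fst z) * (a (fst z) * b (?th z)))
     + pr fx z * - (q' (fst z) * a (fst z) * b (?th z)))"
   unfolding set_lebesgue_integral_def
  proof (intro Bochner_Integration.integral_cong_AE)
   have "continuous_on K (\<lambda>z. a (fst z) * b (?th z))" by (intro continuous_intros cts)
   from bm_measurable[OF bm_continuous_on_compact[OF K(2) this]]
   have "(\<lambda>z. if z \<in> K then a (fst z) * b (?th z) else 0) \<in> borel_measurable lebesgue" by (intro measurable_completion) simp
   from borel_measurable_times[OF km this]
   show "(\<lambda>z. indicator K z *\<^sub>R ((k z - q (fst z) * q' (fst z) * pr fx z) / q (fst z) * (a (fst z) * b (?th z)))) \<in> borel_measurable lebesgue"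
    by (rule measurable_cong[THEN iffD1, rotated]) (auto simp: indicator_def)
   show "(\<lambda>z. indicator K z *\<^sub>R (pr ftt z * (a (fst z) * b (?th z) / q (fst z)) + pr fxx z * - (q (fst z) * (a (fst z) * b (?th z)))
     + pr fx z * - (q' (fst z) * a (fst z) * b (?th z)))) \<in> borel_measurable lebesgue"
    using int3 unfolding set_integrable_def by auto
  qed (auto simp: indicator_def elim!: eventually_mono simp del: split_paired_All)
  also have "... = J ftt (\<lambda>z. a (fst z) * b (?th z) / q (fst z)) + J fxx (\<lambda>z. - (q (fst z) * (a (fst z) * b (?th z)))) + J fx (\<lambda>z. - (q' (fst z) * a (fst z) * b (?th z)))"
   unfolding J_def using i1 i2 i3 by (simp only: set_integral_add)
  finally show ?thesis .
 qed
 have n1: "J fxx (\<lambda>z. - (q (fst z) * (a (fst z) * b (?th z)))) = - J fxx (\<lambda>z. q (fst z) * (a (fst z) * b (?th z)))"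
  and n2: "J fx (\<lambda>z. - (q' (fst z) * a (fst z) * b (?th z))) = - J fx (\<lambda>z. q' (fst z) * a (fst z) * b (?th z))"
  using scale[of _ "-1"] by auto
 have "d * (J ft (\<lambda>z. a' (fst z) * b (?th z)) + d * J ft (\<lambda>z. a (fst z) * b' (?th z) / q (fst z))) = d * J fx (\<lambda>z. a (fst z) * b' (?th z))"
  unfolding t2' t3 ..
 then have "d * J ft (\<lambda>z. a' (fst z) * b (?th z)) + J ft (\<lambda>z. a (fst z) * b' (?th z) / q (fst z)) = d * J fx (\<lambda>z. a (fst z) * b' (?th z))"
  using eps by (simp add: distrib_left flip: mult.assoc)
 then show ?thesis unfolding L R n1 n2 using t1 t4' by linarith
qed

lemma bm_integral_shrink:
 fixes F :: "real => real"
 assumes F: "bm F" and z: "\<And>x. x \<notin> {u..v} ==> F x = 0" and sub: "{u..v} \<subseteq> {a..b}"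
 shows "integral {a..b} F = integral {u..v} F"
 by (rule integral_unique[OF has_integral_on_superset[OF bm_has_integral[OF F] _ sub]]) (use z in auto)

text \<open>A shear flattens the graph of \<open>\<Theta>\<close> to a compact segment, and this has
  a uniform neighbourhood in the open preimage \<open>U\<close>.\<close>

lemma tube_subset:
 fixes S :: "(real \<times> real) set" and \<Theta> :: "real => real"
 assumes S: "open S" and c: "continuous_on UNIV \<Theta>" and seg: "\<And>x. x \<in> {x1..x2} ==> (x, \<Theta> x) \<in> S"
  and x12: "x1 <= x2"
 obtains d where "0 < d" "\<And>x t. x \<in> {x1 - d..x2 + d} ==> \<bar>t - \<Theta> x\<bar> <= d ==> (x, t) \<in> S"
proof -
 define U where "U = (\<lambda>z. (fst z, \<Theta> (fst z) + snd z)) -` S"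
 have "open U" unfolding U_def
  by (rule open_vimage[OF S]) (intro continuous_intros continuous_on_compose2[OF c], auto)
 moreover have "compact ({x1..x2} \<times> {0::real})" by (intro compact_Times) auto
 moreover have "{x1..x2} \<times> {0} \<subseteq> U" using seg by (auto simp: U_def)
 moreover have "{x1..x2} \<times> {0::real} \<noteq> {}" using x12 by auto
 ultimately obtain e where e: "0 < e" "(\<Union>z\<in>{x1..x2} \<times> {0}. cball z e) \<subseteq> U"
  using compact_subset_open_imp_cball_epsilon_subset[of "{x1..x2} \<times> {0::real}" U] by blast
 show ?thesis
 proof (rule that[of "e / 2"])
  fix x t assume x: "x \<in> {x1 - e / 2..x2 + e / 2}" and t: "\<bar>t - \<Theta> x\<bar> <= e / 2"
  \<comment> \<open>The point of \<open>{x1..x2}\<close> nearest to \<open>x\<close>.\<close>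
  define y where "y = max x1 (min x x2)"
  have y: "y \<in> {x1..x2}" "\<bar>x - y\<bar> <= e / 2" using x x12 e(1) by (auto simp: y_def max_def min_def abs_if)
  have "dist (y, 0) (x, t - \<Theta> x) <= \<bar>y - x\<bar> + \<bar>t - \<Theta> x\<bar>"
   unfolding dist_Pair_Pair dist_real_def using sqrt_sum_squares_le_sum_abs[of "y - x" "0 - (t - \<Theta> x)"] by simp
  then have "(x, t - \<Theta> x) \<in> cball (y, 0) e" using y(2) t by (simp add: abs_minus_commute)
  then have "(x, t - \<Theta> x) \<in> U" using e(2) y(1) by blast
  then show "(x, t) \<in> S" by (simp add: U_def)
 qed (use e in auto)
qed

text \<open>For each \<open>x\<close> the inner integral is a mollification at \<open>u x\<close>
  and converges by continuity in \<open>t\<close> alone. The outer limit is dominated, since the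
  approximate unit has height at most \<open>Suc n\<close> on an interval of length
  \<open>2 / Suc n\<close>.\<close>

lemma mollified_integral:
 fixes f :: "real \<times> real => real" and u a :: "real => real"
 assumes f: "bm f" and a: "bm a" and tm: "continuous_on UNIV u"
  and tb: "\<And>x. x \<in> {y1..y2} ==> t1 + 1 <= u x \<and> u x + 1 <= t2"
  and fc: "\<And>x. x \<in> {y1..y2} ==> isCont (\<lambda>t. f (x, t)) (u x)"
 shows "(\<lambda>n. integral {y1..y2} (\<lambda>x. integral {t1..t2} (\<lambda>t. f (x, t) * (a x * (approx_unit n (t - u x))))))
      \<longlonglongrightarrow> integral {y1..y2} (\<lambda>x. f (x, u x) * a x)"
proof -
 obtain B where B: "0 <= B" "\<And>x. \<bar>f x\<bar> <= B" using bm_bound[OF f] by blast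
 obtain A where A: "0 <= A" "\<And>x. \<bar>a x\<bar> <= A" using bm_bound[OF a] by blast
 define M where "M n x = integral {t1..t2} (\<lambda>t. f (x, t) * (a x * (approx_unit n (t - u x))))" for n x
 have um: "u \<in> borel_measurable borel" using tm by (rule borel_contI)
 have Mbm: "bm (M n)" for n
 proof -
  have [measurable]: "u \<in> borel_measurable borel" by (rule um)
  have m1: "(\<lambda>z::real\<times>real. fst z) \<in> borel_measurable borel" by (simp add: borel_prod[symmetric])
  have m2: "(\<lambda>z::real\<times>real. real (Suc n) * (snd z - u (fst z))) \<in> borel_measurable borel"
   by (simp add: borel_prod[symmetric] del: of_nat_Suc)
  have "bm (\<lambda>z. f z * (a (fst z) * (approx_unit n (snd z - u (fst z)))))"
   by (intro bm_mult f bm_const bm_comp[OF a m1] bm_comp[OF bump_bm m2])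
  from bm_integral_param[OF this, of "\<lambda>_. t1" "\<lambda>_. t2" t1 t2] show ?thesis
   unfolding M_def by simp
 qed
 have Meq: "M n x = a x * integral {u x - 1 / real (Suc n)..u x + 1 / real (Suc n)} (\<lambda>t. f (x, t) * (approx_unit n (t - u x)))"
  if x: "x \<in> {y1..y2}" for n x
 proof -
  have m: "bm (\<lambda>t. f (x, t) * (a x * (approx_unit n (t - u x))))"
   by (intro bm_mult bm_pair2[OF f] bm_const bm_comp[OF bump_bm]) (auto simp del: of_nat_Suc)
  have n1: "0 < real (Suc n)" "1 / real (Suc n) <= 1" by (auto simp: divide_le_eq_1)
  have "M n x = integral {u x - 1 / real (Suc n)..u x + 1 / real (Suc n)} (\<lambda>t. f (x, t) * (a x * (approx_unit n (t - u x))))"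
   unfolding M_def
  proof (rule bm_integral_shrink[OF m])
   fix t assume "t \<notin> {u x - 1 / real (Suc n)..u x + 1 / real (Suc n)}"
   then have "1 / real (Suc n) <= \<bar>t - u x\<bar>" by auto
   then have "real (Suc n) * (1 / real (Suc n)) <= real (Suc n) * \<bar>t - u x\<bar>" using n1 by (intro mult_left_mono) auto
   then have "1 <= \<bar>real (Suc n) * (t - u x)\<bar>" using n1 by (simp add: abs_mult del: of_nat_Suc)
   then show "f (x, t) * (a x * (approx_unit n (t - u x))) = 0" by (simp add: bump_zero)
  next
   show "{u x - 1 / real (Suc n)..u x + 1 / real (Suc n)} \<subseteq> {t1..t2}"
    unfolding atLeastatMost_subset_iff using tb[OF x] n1(2) by linarith
  qed
  then show ?thesis by (simp add: mult.left_commute del: of_nat_Suc)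
 qed
 have "(\<lambda>n. integral {y1..y2} (M n)) \<longlonglongrightarrow> integral {y1..y2} (\<lambda>x. f (x, u x) * a x)"
 proof (rule dominated_convergence(2))
  show "M n integrable_on {y1..y2}" for n by (rule bm_integrable_on[OF Mbm])
  show "(\<lambda>x. A * (2 * B)) integrable_on {y1..y2}" by (rule integrable_const_ivl)
  fix x assume x: "x \<in> {y1..y2}"
  show "norm (M n x) <= A * (2 * B)" for n
  proof -
   let ?I = "integral {u x - 1 / real (Suc n)..u x + 1 / real (Suc n)} (\<lambda>t. f (x, t) * (approx_unit n (t - u x)))"
   have "\<bar>?I\<bar> <= (B * (real (Suc n) * 1)) * (u x + 1 / real (Suc n) - (u x - 1 / real (Suc n)))"
   proof (rule integral_bound_real)
    show "(\<lambda>t. f (x, t) * (approx_unit n (t - u x))) integrable_on {u x - 1 / real (Suc n)..u x + 1 / real (Suc n)}"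
     by (intro bm_integrable_on bm_mult bm_pair2[OF f] bm_const bm_comp[OF bump_bm]) (auto simp del: of_nat_Suc)
    show "\<bar>f (x, t) * (approx_unit n (t - u x))\<bar> <= B * (real (Suc n) * 1)" for t
     unfolding abs_mult using bump_le bump_nonneg B by (intro mult_mono) (auto simp del: of_nat_Suc)
   qed (simp add: divide_nonneg_nonneg)
   also have "... = 2 * B * (real (Suc n) * (1 / real (Suc n)))" by (simp only: algebra_simps mult_2 distrib_left distrib_right)
   also have "... = 2 * B" by simp
   finally show ?thesis unfolding Meq[OF x] using A by (simp add: abs_mult mult_mono' del: of_nat_Suc)
  qed
  show "(\<lambda>n. M n x) \<longlonglongrightarrow> f (x, u x) * a x"
   unfolding Meq[OF x] mult.commute[of _ "a x"]
   by (intro tendsto_intros mollify bm_pair2[OF f] fc[OF x])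
 qed
 then show ?thesis unfolding M_def .
qed

text \<open>Letting \<open>b\<close> shrink to the characteristic and then \<open>a\<close> to the
  indicator of \<open>{x1..x2}\<close> turns the weak equation into an exact integral along the
  curve. With coefficients that are only measurable in \<open>x\<close>, the integrand
  \<open>H\<close> is continuous in \<open>t\<close> but not in \<open>x\<close>; this is why the
  curve is parametrised by \<open>x\<close> and mollification acts in \<open>t\<close>.\<close>

lemma interior_characteristic:
 fixes \<epsilon> :: real
 assumes S: "open S" "S \<subseteq> {0<..<L} \<times> UNIV"
  and \<Phi>: "\<And>x. (\<Phi> has_real_derivative 1 / q x) (at x)" and qc: "continuous_on UNIV q" and q0: "\<And>x. 0 < q x"
  and q: "\<forall>x\<in>{0<..<L}. (q has_real_derivative q' x) (at x)" "continuous_on {0<..<L} q'"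
  and sd: "second_derivatives S fx ft fxx fxt ftt"
  and eq: "AE z in lebesgue_on S. pr ftt z = (q (fst z))\<^sup>2 * pr fxx z + k z"
  and eps: "\<epsilon> * \<epsilon> = 1"
  and r: "\<And>z. z \<in> S ==> r z = pr ft z + \<epsilon> * q (fst z) * pr fx z" and rc: "continuous_on S r"
  and H: "\<And>z. z \<in> S ==> H z = (k z - q (fst z) * q' (fst z) * pr fx z) / q (fst z)"
  and Hb: "\<And>K. compact K ==> K \<subseteq> S ==> bm (\<lambda>z. if z \<in> K then H z else 0)"
  and Hc: "\<And>x t. (x, t) \<in> S ==> isCont (\<lambda>t. H (x, t)) t"
  and x12: "x1 < x2" and seg: "\<And>x. x \<in> {x1..x2} ==> (x, c - \<epsilon> * \<Phi> x) \<in> S"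
 shows "((\<lambda>x. H (x, c - \<epsilon> * \<Phi> x)) has_integral \<epsilon> * (r (x1, c - \<epsilon> * \<Phi> x1) - r (x2, c - \<epsilon> * \<Phi> x2))) {x1..x2}"
proof -
 define u where "u x = c - \<epsilon> * \<Phi> x" for x
 have c\<Phi>: "continuous_on UNIV \<Phi>" by (rule DERIV_continuous_on_at[OF \<Phi>])
 have cu: "continuous_on X u" for X unfolding u_def by (intro continuous_intros continuous_on_subset[OF c\<Phi>]) auto
 obtain \<delta>' where \<delta>': "0 < \<delta>'" "\<And>x t. x \<in> {x1 - \<delta>'..x2 + \<delta>'} ==> \<bar>t - u x\<bar> <= \<delta>' ==> (x, t) \<in> S"
  using tube_subset[OF S(1) cu, of x1 x2] seg x12 unfolding u_def by (metis less_imp_le)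
 \<comment> \<open>The bound by 1 keeps the tube inside the time window
   \<open>{t1..t2}\<close>.\<close>
 define \<delta> where "\<delta> = min \<delta>' 1"
 have \<delta>: "0 < \<delta>" "\<delta> <= 1" "\<And>x t. x \<in> {x1 - \<delta>..x2 + \<delta>} ==> \<bar>t - u x\<bar> <= \<delta> ==> (x, t) \<in> S"
  using \<delta>'(1) by (auto simp: \<delta>_def intro!: \<delta>'(2))
 define y1 where "y1 = x1 - \<delta>"
 define y2 where "y2 = x2 + \<delta>"
 define K where "K = {z. fst z \<in> {y1..y2} \<and> snd z + \<epsilon> * \<Phi> (fst z) \<in> {c - \<delta>..c + \<delta>}}"
 have Kiff: "(x, t) \<in> K \<longleftrightarrow> x \<in> {y1..y2} \<and> \<bar>t - u x\<bar> <= \<delta>" for x t unfolding K_def u_def by auto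
 have KS: "K \<subseteq> S" using \<delta>(3) Kiff unfolding y1_def y2_def by (auto simp del: atLeastAtMost_iff)
 have "K = (\<lambda>z. (fst z, u (fst z) + snd z)) ` ({y1..y2} \<times> {-\<delta>..\<delta>})"
 proof (rule set_eqI)
  fix z :: "real \<times> real"
  obtain x t where z: "z = (x, t)" by fastforce
  show "z \<in> K \<longleftrightarrow> z \<in> (\<lambda>z. (fst z, u (fst z) + snd z)) ` ({y1..y2} \<times> {-\<delta>..\<delta>})"
   unfolding z Kiff by (auto simp: image_iff intro!: bexI[of _ "t - u x"])
 qed
 moreover have "compact ((\<lambda>z. (fst z, u (fst z) + snd z)) ` ({y1..y2} \<times> {-\<delta>..\<delta>}))"
  by (intro compact_continuous_image compact_Times compact_Icc continuous_intros continuous_on_compose2[OF cu]) auto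
 ultimately have Kc: "compact K" by simp
 obtain m where m: "\<And>x. x \<in> {y1..y2} ==> \<bar>u x\<bar> <= m"
  using compact_imp_bounded[OF compact_continuous_image[OF cu compact_Icc[of y1 y2]]] unfolding bounded_iff
  by (auto simp del: atLeastAtMost_iff)
 define t1 where "t1 = - m - 1"
 define t2 where "t2 = m + 1"
 have tb: "t1 + 1 <= u x \<and> u x + 1 <= t2" if "x \<in> {y1..y2}" for x
  using m[OF that] unfolding t1_def t2_def by auto
 define rb where "rb z = \<epsilon> * (if z \<in> K then r z else 0)" for z
 define Hb' where "Hb' z = (if z \<in> K then H z else 0)" for z
 have rbm: "bm rb" unfolding rb_def by (intro bm_mult bm_const bm_continuous_on_compact Kc continuous_on_subset[OF rc KS])
 have Hbm: "bm Hb'" using Hb[OF Kc KS] unfolding Hb'_def .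
 have ev: "\<forall>\<^sub>F t in nhds (u x). (x, t) \<in> K" if "x \<in> {y1..y2}" for x
  unfolding eventually_nhds_metric using that \<delta>(1) by (auto simp: Kiff dist_real_def intro!: exI[of _ \<delta>])
 have inS: "(x, u x) \<in> S" if "x \<in> {y1..y2}" for x using that Kiff[of x "u x"] \<delta>(1) KS by auto
 have rbc: "isCont (\<lambda>t. rb (x, t)) (u x)" if x: "x \<in> {y1..y2}" for x
 proof -
  have "isCont r (x, u x)" using rc inS[OF x] S(1) by (simp add: continuous_on_eq_continuous_at)
  then have "isCont (\<lambda>t. r (x, t)) (u x)"
   by (rule isCont_o2[where f="\<lambda>t. (x, t)", rotated]) (intro continuous_intros)
  then have 1: "isCont (\<lambda>t. \<epsilon> * r (x, t)) (u x)" by (rule isCont_mult[OF continuous_const])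
  have "\<forall>\<^sub>F t in nhds (u x). rb (x, t) = \<epsilon> * r (x, t)"
   using ev[OF x] by eventually_elim (simp add: rb_def)
  from iffD2[OF isCont_cong[OF this] 1] show ?thesis .
 qed
 have Hbc: "isCont (\<lambda>t. Hb' (x, t)) (u x)" if x: "x \<in> {y1..y2}" for x
 proof -
  have "\<forall>\<^sub>F t in nhds (u x). Hb' (x, t) = H (x, t)"
   using ev[OF x] by eventually_elim (simp add: Hb'_def)
  from iffD2[OF isCont_cong[OF this] Hc[OF inS[OF x]]] show ?thesis .
 qed
 \<comment> \<open>From \<open>N0\<close> on, the approximate units have support of radius at most
   \<open>\<delta>\<close> and stay in the tube.\<close>
 define N0 where "N0 = nat \<lceil>1 / \<delta>\<rceil>"
 have N0: "1 <= real (Suc n) * \<delta>" if "N0 <= n" for n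
 proof -
  have "1 / \<delta> <= real N0" unfolding N0_def using \<delta>(1) by (simp add: of_nat_nat)
  also have "... <= real (Suc n)" using that by simp
  finally show ?thesis using \<delta>(1) by (simp add: field_simps)
 qed
 \<comment> \<open>\<open>a n\<close> tends to the indicator of \<open>{x1..x2}\<close>, while its
   derivative \<open>a' n\<close> tends to the point mass at \<open>x1\<close> minus the point mass
   at \<open>x2\<close>.\<close>
 define a where "a n x = step (real (Suc n) * (x - x1)) - step (real (Suc n) * (x - x2))" for n x
 define a' where "a' n x = approx_unit n (x - x1) - approx_unit n (x - x2)" for n x
 define b where "b n x = approx_unit n (x - c)" for n x
 define b' where "b' n x = real (Suc n) * (bump' (real (Suc n) * (x - c)) * real (Suc n))" for n x
 have da: "(a n has_real_derivative a' n x) (at x)" for n x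
  unfolding a_def[abs_def] a'_def
  by (rule derivative_eq_intros DERIV_chain2[OF step_deriv] refl | simp)+
 have db: "(b n has_real_derivative b' n x) (at x)" for n x
  unfolding b_def[abs_def] b'_def
  by (rule derivative_eq_intros DERIV_chain2[OF bump_deriv] refl | simp)+
 have ca': "continuous_on UNIV (a' n)" for n
  unfolding a'_def by (intro continuous_intros continuous_on_compose2[OF bump_continuous(1)]) auto
 have cb': "continuous_on UNIV (b' n)" for n
  unfolding b'_def by (intro continuous_intros continuous_on_compose2[OF bump_continuous(2)]) auto
 have big: "1 <= \<bar>real (Suc n) * (x - y)\<bar>" if "N0 <= n" "\<delta> <= \<bar>x - y\<bar>" for n x y
  using order_trans[OF N0[OF that(1)] mult_left_mono[OF that(2), of "real (Suc n)"]] by (simp add: abs_mult del: of_nat_Suc)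
 have big1: "1 <= real (Suc n) * (x - y)" if "N0 <= n" "\<delta> <= x - y" for n x y
  using order_trans[OF N0[OF that(1)] mult_left_mono[OF that(2), of "real (Suc n)"]] by (simp del: of_nat_Suc)
 have big2: "real (Suc n) * (x - y) <= -1" if "N0 <= n" "\<delta> <= y - x" for n x y
  using big1[OF that] by (simp add: right_diff_distrib del: of_nat_Suc)
 have a0: "\<forall>x. x \<notin> {y1..y2} \<longrightarrow> a n x = 0 \<and> a' n x = 0" if n: "N0 <= n" for n
 proof (intro allI impI)
  fix x assume "x \<notin> {y1..y2}"
  then consider "x < y1" | "y2 < x" by fastforce
  then show "a n x = 0 \<and> a' n x = 0"
  proof cases
   case 1
   then have "\<delta> <= x1 - x" "\<delta> <= x2 - x" using x12 unfolding y1_def by auto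
   then show ?thesis using big2[OF n] step_zero big[OF n] bump_zero unfolding a_def a'_def by auto
  next
   case 2
   then have "\<delta> <= x - x1" "\<delta> <= x - x2" using x12 unfolding y2_def by auto
   then show ?thesis using big1[OF n] step_one big[OF n] bump_zero unfolding a_def a'_def by auto
  qed
 qed
 have bump'0: "bump' z = 0" if "1 <= \<bar>z\<bar>" for z
 proof -
  have "1 <= z\<^sup>2" using that by (metis abs_le_square_iff abs_one one_power2)
  then show ?thesis by (simp add: bump'_def)
 qed
 have b0: "\<forall>x. x \<notin> {c - \<delta>..c + \<delta>} \<longrightarrow> b n x = 0 \<and> b' n x = 0" if n: "N0 <= n" for n
 proof (intro allI impI)
  fix x assume "x \<notin> {c - \<delta>..c + \<delta>}"
  then have "\<delta> <= \<bar>x - c\<bar>" by auto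
  then show "b n x = 0 \<and> b' n x = 0" using big[OF n] bump_zero bump'0 unfolding b_def b'_def by auto
 qed
 have abm: "bm (a n)" "bm (a' n)" for n
  unfolding a_def a'_def
  by (intro bm_diff bm_mult bm_const bm_comp[OF step_bm] bm_comp[OF bump_bm]; simp del: of_nat_Suc)+
 have beq: "b n (t + \<epsilon> * \<Phi> x) = approx_unit n (t - u x)" for n t x
  unfolding b_def u_def by (simp add: algebra_simps)
 have iter: "(LINT z:K|lebesgue. g z * (d (fst z) * b n (snd z + \<epsilon> * \<Phi> (fst z))))
   = integral {y1..y2} (\<lambda>x. integral {t1..t2} (\<lambda>t. g (x, t) * (d x * (approx_unit n (t - u x)))))"
  if d: "bm d" and g: "bm g" and g0: "\<And>z. z \<notin> K ==> g z = 0" for g d n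
 proof -
  let ?f = "\<lambda>z. g z * (d (fst z) * (approx_unit n (snd z - u (fst z))))"
  have "(LINT z:K|lebesgue. g z * (d (fst z) * b n (snd z + \<epsilon> * \<Phi> (fst z)))) = (LINT z|lebesgue. ?f z)"
   unfolding set_lebesgue_integral_def beq
   by (rule Bochner_Integration.integral_cong[OF refl]) (use g0 in \<open>auto simp: indicator_def\<close>)
  also have "... = integral {y1..y2} (\<lambda>x. integral {t1..t2} (\<lambda>t. ?f (x, t)))"
  proof (rule lebesgue_integral_iterated)
   have m1: "(\<lambda>z::real\<times>real. fst z) \<in> borel_measurable borel" by (simp add: borel_prod[symmetric])
   have m2: "(\<lambda>z::real\<times>real. real (Suc n) * (snd z - u (fst z))) \<in> borel_measurable borel"
    by (intro borel_contI continuous_intros continuous_on_compose2[OF cu]) auto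
   show "bm ?f" by (intro bm_mult g bm_const bm_comp[OF d m1] bm_comp[OF bump_bm m2])
   fix x t assume "?f (x, t) \<noteq> 0"
   then have "(x, t) \<in> K" using g0[of "(x, t)"] by auto
   then show "x \<in> {y1..y2} \<and> t \<in> {t1..t2}" using tb[of x] \<delta>(2) unfolding Kiff by auto
  qed
  finally show ?thesis by simp
 qed
 have main1: "integral {y1..y2} (\<lambda>x. integral {t1..t2} (\<lambda>t. rb (x, t) * (a' j x * (approx_unit n (t - u x)))))
   = integral {y1..y2} (\<lambda>x. integral {t1..t2} (\<lambda>t. Hb' (x, t) * (a j x * (approx_unit n (t - u x)))))"
  if jn: "N0 <= j" "N0 <= n" for j n
 proof -
  have "Hb' \<in> borel_measurable lebesgue" using bm_measurable[OF Hbm] by (intro measurable_completion) simp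
  then have km: "(\<lambda>z. indicator K z *\<^sub>R ((k z - q (fst z) * q' (fst z) * pr fx z) / q (fst z))) \<in> borel_measurable lebesgue"
   by (rule measurable_cong[THEN iffD1, rotated]) (use KS H in \<open>auto simp: Hb'_def indicator_def\<close>)
  have w: "(LINT z:K|lebesgue. \<epsilon> * (pr ft z + \<epsilon> * q (fst z) * pr fx z) * (a' j (fst z) * b n (snd z + \<epsilon> * \<Phi> (fst z))))
    = (LINT z:K|lebesgue. (k z - q (fst z) * q' (fst z) * pr fx z) / q (fst z) * (a j (fst z) * b n (snd z + \<epsilon> * \<Phi> (fst z))))"
   by (rule weak_transport[OF S \<Phi> qc q0 q sd eq eps da ca' db cb' a0[OF jn(1)] b0[OF jn(2)] K_def Kc KS km])
  have "(LINT z:K|lebesgue. rb z * (a' j (fst z) * b n (snd z + \<epsilon> * \<Phi> (fst z))))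
    = (LINT z:K|lebesgue. Hb' z * (a j (fst z) * b n (snd z + \<epsilon> * \<Phi> (fst z))))"
  proof (rule trans[OF _ trans[OF w]])
   show "(LINT z:K|lebesgue. rb z * (a' j (fst z) * b n (snd z + \<epsilon> * \<Phi> (fst z))))
    = (LINT z:K|lebesgue. \<epsilon> * (pr ft z + \<epsilon> * q (fst z) * pr fx z) * (a' j (fst z) * b n (snd z + \<epsilon> * \<Phi> (fst z))))"
    unfolding set_lebesgue_integral_def
    by (rule Bochner_Integration.integral_cong[OF refl]) (use KS r in \<open>auto simp: rb_def indicator_def\<close>)
   show "(LINT z:K|lebesgue. (k z - q (fst z) * q' (fst z) * pr fx z) / q (fst z) * (a j (fst z) * b n (snd z + \<epsilon> * \<Phi> (fst z))))
    = (LINT z:K|lebesgue. Hb' z * (a j (fst z) * b n (snd z + \<epsilon> * \<Phi> (fst z))))"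
    unfolding set_lebesgue_integral_def
    by (rule Bochner_Integration.integral_cong[OF refl]) (use KS H in \<open>auto simp: Hb'_def indicator_def\<close>)
  qed
  moreover have z: "rb z = 0" "Hb' z = 0" if "z \<notin> K" for z using that by (simp_all add: rb_def Hb'_def)
  ultimately show ?thesis
   using trans[OF iter[OF abm(2) rbm z(1), of j n, symmetric] trans[OF _ iter[OF abm(1) Hbm z(2), of j n]]] by blast
 qed
 \<comment> \<open>First limit: \<open>n\<close> grows at fixed \<open>j\<close>, and the identity
   in the plane becomes one on the curve.\<close>
 have main2: "integral {y1..y2} (\<lambda>x. rb (x, u x) * a' j x) = integral {y1..y2} (\<lambda>x. Hb' (x, u x) * a j x)" if j: "N0 <= j" for j
 proof (rule LIMSEQ_unique)
  show "(\<lambda>n. integral {y1..y2} (\<lambda>x. integral {t1..t2} (\<lambda>t. rb (x, t) * (a' j x * (approx_unit n (t - u x))))))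
    \<longlonglongrightarrow> integral {y1..y2} (\<lambda>x. rb (x, u x) * a' j x)"
   by (rule mollified_integral[OF rbm abm(2) cu tb rbc])
  have "(\<lambda>n. integral {y1..y2} (\<lambda>x. integral {t1..t2} (\<lambda>t. Hb' (x, t) * (a j x * (approx_unit n (t - u x))))))
    \<longlonglongrightarrow> integral {y1..y2} (\<lambda>x. Hb' (x, u x) * a j x)"
   by (rule mollified_integral[OF Hbm abm(1) cu tb Hbc])
  then show "(\<lambda>n. integral {y1..y2} (\<lambda>x. integral {t1..t2} (\<lambda>t. rb (x, t) * (a' j x * (approx_unit n (t - u x))))))
    \<longlonglongrightarrow> integral {y1..y2} (\<lambda>x. Hb' (x, u x) * a j x)"
   by (rule Lim_transform_eventually) (use main1[OF j] in \<open>auto simp: eventually_sequentially intro!: exI[of _ N0]\<close>)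
 qed
 define rt where "rt x = (if x \<in> {y1..y2} then rb (x, u x) else 0)" for x
 have rteq: "rt x = \<epsilon> * (if x \<in> {y1..y2} then r (x, u x) else 0)" for x
  using \<delta>(1) by (auto simp: rt_def rb_def Kiff)
 have crt: "continuous_on {y1..y2} (\<lambda>x. r (x, u x))"
  by (rule continuous_on_compose2[OF rc]) (use inS in \<open>auto intro!: continuous_intros cu\<close>)
 have rtbm: "bm rt" unfolding rteq by (intro bm_mult bm_const bm_continuous_on_compact crt compact_Icc)
 have rtc: "isCont rt y" if y: "y1 < y" "y < y2" for y
 proof -
  have "isCont (\<lambda>x. \<epsilon> * r (x, u x)) y"
   using continuous_on_interior[OF crt, of y] y by (intro continuous_intros) auto
  then have 1: "isCont (\<lambda>x. \<epsilon> * r (x, u x)) y" .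
  have "\<forall>\<^sub>F x in nhds y. x \<in> {y1<..<y2}" using y by (intro eventually_nhds_in_open) auto
  then have "\<forall>\<^sub>F x in nhds y. rt x = \<epsilon> * r (x, u x)" by eventually_elim (simp add: rteq)
  from iffD2[OF isCont_cong[OF this] 1] show ?thesis .
 qed
 have lim1: "(\<lambda>j. integral {y1..y2} (\<lambda>x. rt x * (approx_unit j (x - y)))) \<longlonglongrightarrow> rt y"
  if y: "y \<in> {x1, x2}" for y
 proof -
  have y': "y1 < y" "y < y2" "y1 <= y - \<delta>" "y + \<delta> <= y2" using y x12 \<delta>(1) unfolding y1_def y2_def by auto
  from mollify[OF rtbm rtc[OF y'(1,2)]] show ?thesis
  proof (rule Lim_transform_eventually)
   show "\<forall>\<^sub>F n in sequentially. integral {y - 1 / real (Suc n)..y + 1 / real (Suc n)} (\<lambda>t. rt t * (approx_unit n (t - y)))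
     = integral {y1..y2} (\<lambda>x. rt x * (approx_unit n (x - y)))"
    unfolding eventually_sequentially
   proof (intro exI allI impI)
    fix n assume n: "N0 <= n"
    have n1: "0 < real (Suc n)" by simp
    have n2: "1 / real (Suc n) <= \<delta>" using N0[OF n] n1 by (simp add: divide_le_eq mult.commute del: of_nat_Suc)
    show "integral {y - 1 / real (Suc n)..y + 1 / real (Suc n)} (\<lambda>t. rt t * (approx_unit n (t - y)))
     = integral {y1..y2} (\<lambda>x. rt x * (approx_unit n (x - y)))"
    proof (rule bm_integral_shrink[symmetric])
     show "bm (\<lambda>t. rt t * (approx_unit n (t - y)))"
      by (intro bm_mult rtbm bm_const bm_comp[OF bump_bm]) (simp del: of_nat_Suc)
     fix t assume "t \<notin> {y - 1 / real (Suc n)..y + 1 / real (Suc n)}"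
     then have "1 / real (Suc n) <= \<bar>t - y\<bar>" by auto
     then have "real (Suc n) * (1 / real (Suc n)) <= real (Suc n) * \<bar>t - y\<bar>" using n1 by (intro mult_left_mono) auto
     then have "1 <= \<bar>real (Suc n) * (t - y)\<bar>" using n1 by (simp add: abs_mult del: of_nat_Suc)
     then show "rt t * (approx_unit n (t - y)) = 0" by (simp add: bump_zero)
    qed (use y' n2 in auto)
   qed
  qed
 qed
 have "(\<lambda>j. integral {y1..y2} (\<lambda>x. rt x * (approx_unit j (x - x1))) - integral {y1..y2} (\<lambda>x. rt x * (approx_unit j (x - x2))))
   \<longlonglongrightarrow> rt x1 - rt x2"
  by (intro tendsto_diff lim1) auto
 moreover have "integral {y1..y2} (\<lambda>x. rt x * (approx_unit j (x - x1))) - integral {y1..y2} (\<lambda>x. rt x * (approx_unit j (x - x2)))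
   = integral {y1..y2} (\<lambda>x. rb (x, u x) * a' j x)" for j
 proof -
  have i: "(\<lambda>x. rt x * (approx_unit j (x - y))) integrable_on {y1..y2}" for y
   by (intro bm_integrable_on bm_mult rtbm bm_const bm_comp[OF bump_bm]) (simp del: of_nat_Suc)
  show ?thesis unfolding integral_diff[OF i i, symmetric]
   by (rule integral_cong) (simp add: rt_def a'_def right_diff_distrib del: of_nat_Suc)
 qed
 ultimately have L1: "(\<lambda>j. integral {y1..y2} (\<lambda>x. rb (x, u x) * a' j x)) \<longlonglongrightarrow> rt x1 - rt x2" by simp
 have Htbm: "bm (\<lambda>x. Hb' (x, u x))"
  by (rule bm_comp[OF Hbm]) (intro borel_contI continuous_intros cu)
 obtain C where C: "0 <= C" "\<And>z. \<bar>Hb' z\<bar> <= C" using bm_bound[OF Hbm] by blast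
 \<comment> \<open>The pointwise limit of \<open>a j\<close>: at an end point one of the two
   \<open>step\<close> terms is evaluated at 0 for every \<open>j\<close>.\<close>
 define ai where "ai x = (if x < x1 then 0 else if x = x1 then step 0 else if x < x2 then 1 else if x = x2 then 1 - step 0 else (0::real))" for x
 have "(\<lambda>j. integral {y1..y2} (\<lambda>x. Hb' (x, u x) * a j x)) \<longlonglongrightarrow> integral {y1..y2} (\<lambda>x. Hb' (x, u x) * ai x)"
 proof (rule dominated_convergence(2))
  show "(\<lambda>x. Hb' (x, u x) * a j x) integrable_on {y1..y2}" for j
   by (intro bm_integrable_on bm_mult Htbm abm)
  show "(\<lambda>x. C * 1) integrable_on {y1..y2}" by (rule integrable_const_ivl)
  show "norm (Hb' (x, u x) * a j x) <= C * 1" for j x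
  proof -
   have "\<bar>a j x\<bar> <= 1" using step_bounds[of "real (Suc j) * (x - x1)"] step_bounds[of "real (Suc j) * (x - x2)"] unfolding a_def by linarith
   then show ?thesis unfolding real_norm_def abs_mult using C by (intro mult_mono) auto
  qed
  fix x
  have st: "\<forall>\<^sub>F j in sequentially. step (real (Suc j) * (x - y)) = (if x < y then 0 else if x = y then step 0 else 1)" for y
  proof (cases "x = y")
   case False
   define N where "N = nat \<lceil>1 / \<bar>x - y\<bar>\<rceil>"
   have *: "1 <= real (Suc n) * \<bar>x - y\<bar>" if "N <= n" for n
   proof -
    have "1 / \<bar>x - y\<bar> <= real N" unfolding N_def by (simp add: of_nat_nat)
    also have "... <= real (Suc n)" using that by simp
    finally show ?thesis using False by (simp add: field_simps)
   qed
   have "step (real (Suc n) * (x - y)) = (if x < y then 0 else if x = y then step 0 else 1)" if "N <= n" for n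
   proof (cases "x < y")
    case True
    then have "\<bar>x - y\<bar> = - (x - y)" by simp
    then have "real (Suc n) * \<bar>x - y\<bar> = - (real (Suc n) * (x - y))" by (simp only: mult_minus_right)
    with *[OF that] have "real (Suc n) * (x - y) <= -1" by linarith
    with True show ?thesis by (simp only: step_zero if_True)
   next
    case F: False
    then have "\<bar>x - y\<bar> = x - y" by simp
    with *[OF that] have "1 <= real (Suc n) * (x - y)" by (simp only:)
    with F False show ?thesis by (simp only: step_one if_False)
   qed
   then show ?thesis unfolding eventually_sequentially by blast
  qed auto
  have "\<forall>\<^sub>F j in sequentially. a j x = ai x"
   using st[of x1] st[of x2] by eventually_elim (use x12 in \<open>auto simp: a_def ai_def\<close>)
  then have "(\<lambda>j. a j x) \<longlonglongrightarrow> ai x" by (rule tendsto_eventually)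
  then show "(\<lambda>j. Hb' (x, u x) * a j x) \<longlonglongrightarrow> Hb' (x, u x) * ai x" by (intro tendsto_intros)
 qed
 moreover have "((\<lambda>x. Hb' (x, u x) * ai x) has_integral integral {x1..x2} (\<lambda>x. Hb' (x, u x))) {y1..y2}"
 proof (rule has_integral_on_superset)
  show "((\<lambda>x. Hb' (x, u x) * ai x) has_integral integral {x1..x2} (\<lambda>x. Hb' (x, u x))) {x1..x2}"
   by (rule has_integral_spike_finite[OF _ _ bm_has_integral[OF Htbm], of "{x1, x2}"]) (auto simp: ai_def)
  show "{x1..x2} \<subseteq> {y1..y2}" using \<delta>(1) unfolding y1_def y2_def by auto
 qed (use x12 in \<open>auto simp: ai_def\<close>)
 ultimately have L2: "(\<lambda>j. integral {y1..y2} (\<lambda>x. Hb' (x, u x) * a j x)) \<longlonglongrightarrow> integral {x1..x2} (\<lambda>x. Hb' (x, u x))"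
  by (simp add: integral_unique)
 have "(\<lambda>j. integral {y1..y2} (\<lambda>x. rb (x, u x) * a' j x)) \<longlonglongrightarrow> integral {x1..x2} (\<lambda>x. Hb' (x, u x))"
  by (rule Lim_transform_eventually[OF L2]) (use main2 in \<open>auto simp: eventually_sequentially intro!: exI[of _ N0]\<close>)
 with L1 have e: "rt x1 - rt x2 = integral {x1..x2} (\<lambda>x. Hb' (x, u x))" by (rule LIMSEQ_unique)
 have xs: "x \<in> {y1..y2}" if "x \<in> {x1..x2}" for x using that \<delta>(1) unfolding y1_def y2_def by auto
 have "((\<lambda>x. Hb' (x, u x)) has_integral rt x1 - rt x2) {x1..x2}" unfolding e by (rule bm_has_integral[OF Htbm])
 then have "((\<lambda>x. H (x, u x)) has_integral rt x1 - rt x2) {x1..x2}"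
  by (rule has_integral_eq[rotated]) (use xs \<delta>(1) in \<open>auto simp: Hb'_def Kiff\<close>)
 moreover have "rt x1 - rt x2 = \<epsilon> * (r (x1, u x1) - r (x2, u x2))"
  using xs[of x1] xs[of x2] x12 by (simp add: rteq right_diff_distrib)
 ultimately show ?thesis unfolding u_def by simp
qed

section \<open>Characteristics up to the boundary of the moving domain\<close>

lemma has_integral_extend_endpoints:
 fixes f F :: "real => real"
 assumes x12: "x1 < x2" and f: "f integrable_on {x1..x2}" and F: "continuous_on {x1..x2} F"
  and int: "\<And>y1 y2. x1 < y1 ==> y1 < y2 ==> y2 < x2 ==> (f has_integral (F y2 - F y1)) {y1..y2}"
 shows "(f has_integral (F x2 - F x1)) {x1..x2}"
proof -
 define G where "G y = F y - integral {x1..y} f" for y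
 have cG: "continuous_on {x1..x2} G"
  unfolding G_def by (intro continuous_intros F indefinite_integral_continuous_1 f)
 define m where "m = (x1 + x2) / 2"
 have m: "x1 < m" "m < x2" using x12 by (auto simp: m_def)
 have comb: "G y1 = G y2" if "x1 < y1" "y1 < y2" "y2 < x2" for y1 y2
 proof -
  have "integral {x1..y1} f + integral {y1..y2} f = integral {x1..y2} f"
   by (rule HK_combine) (use that in \<open>auto intro: integrable_on_subinterval[OF f]\<close>)
  then show ?thesis using int[OF that] by (simp add: G_def integral_unique)
 qed
 have Gm: "G y = G m" if "y \<in> {x1<..<x2}" for y
 proof (cases y m rule: linorder_cases)
  case less
  then show ?thesis using that m by (intro comb) auto
 next
  case greater
  then show ?thesis using that m by (intro comb[symmetric]) auto
 qed simp
 have cl: "closure {x1<..<x2} = {x1..x2}" using x12 by simp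
 have "G y = G m" if "y \<in> {x1..x2}" for y
  by (rule continuous_constant_on_closure[of "{x1<..<x2}"]) (use cG cl Gm that in auto)
 then have "G x2 = G x1" using x12 by force
 then have "integral {x1..x2} f = F x2 - F x1" by (simp add: G_def)
 then show ?thesis using integrable_integral[OF f] by (simp only:)
qed

definition tdomain :: "(real => real) => (real \<times> real) set" where
 "tdomain l = {(x, t). 0 <= t \<and> 0 <= x \<and> x <= l t}"

lemma tdomain_iff: "(x, t) \<in> tdomain l \<longleftrightarrow> 0 <= t \<and> 0 <= x \<and> x <= l t"
 by (simp add: tdomain_def)

lemma tdomain_closed:
 assumes l: "continuous_on {0..} l"
 shows "closed (tdomain l)"
proof -
 have "tdomain l = {z. 0 <= snd z} \<inter> {z. 0 <= fst z} \<inter> {z. fst z <= l (max 0 (snd z))}"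
  by (auto simp: tdomain_def max_def)
 moreover have "closed {z::real\<times>real. fst z <= l (max 0 (snd z))}"
  by (intro closed_Collect_le continuous_intros continuous_on_compose2[OF l]) auto
 ultimately show ?thesis by (auto intro!: closed_Int closed_Collect_le continuous_intros)
qed

lemma tdomain_compact:
 assumes l: "continuous_on {0..} l" and L: "\<And>t. 0 <= t ==> l t <= L"
 shows "compact (tdomain l \<inter> {z. snd z <= T})"
proof -
 have "tdomain l \<inter> {z. snd z <= T} = tdomain l \<inter> ({0..L} \<times> {0..T})"
  using L by (fastforce simp: tdomain_def)
 then show ?thesis by (simp add: closed_Int_compact tdomain_closed[OF l] compact_Times)
qed

text \<open>The segment may touch the boundary of the domain, where the open-set argument says
  nothing. A small shift in time, in the direction given by \<open>b\<close>, moves its interior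
  points strictly inside, and dominated convergence undoes the shift; the end points follow by
  continuity of \<open>r\<close>.\<close>

lemma closed_characteristic:
 fixes b :: real and A :: "'j => real => real" and f :: "'j => real \<times> real => real"
 assumes l: "continuous_on {0..} l" and L: "\<And>t. 0 <= t ==> l t <= L"
  and \<Phi>: "\<And>x. (\<Phi> has_real_derivative w x) (at x)" and w: "\<And>x. 0 < w x"
  and eps: "b = 1 \<or> b = -1"
  and rc: "continuous_on (tdomain l) r"
  and J: "finite J" "\<And>j. j \<in> J ==> bm (A j)" "\<And>j. j \<in> J ==> continuous_on (tdomain l) (f j)"
  and H: "\<And>z. H z = (\<Sum>j\<in>J. A j (fst z) * f j z)"
  and int: "\<And>x1 x2 c. x1 < x2 ==> (\<And>x. x \<in> {x1..x2} ==> 0 < c - b * \<Phi> x \<and> 0 < x \<and> x < l (c - b * \<Phi> x)) ==>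
    ((\<lambda>x. H (x, c - b * \<Phi> x)) has_integral b * (r (x1, c - b * \<Phi> x1) - r (x2, c - b * \<Phi> x2))) {x1..x2}"
  and x12: "x1 <= x2" and seg: "\<And>x. x \<in> {x1..x2} ==> (x, c - b * \<Phi> x) \<in> tdomain l"
 shows "((\<lambda>x. H (x, c - b * \<Phi> x)) has_integral b * (r (x1, c - b * \<Phi> x1) - r (x2, c - b * \<Phi> x2))) {x1..x2}"
proof (cases "x1 = x2")
 case False
 then have x12: "x1 < x2" using x12 by simp
 have c\<Phi>: "continuous_on X \<Phi>" for X by (rule DERIV_continuous_on_at[OF \<Phi>])
 have mono: "\<Phi> x < \<Phi> y" if "x < y" for x y
  by (rule DERIV_pos_imp_increasing[OF that]) (use \<Phi> w in blast)
 define u where "u x = c - b * \<Phi> x" for x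
 have cu: "continuous_on X u" for X unfolding u_def by (intro continuous_intros c\<Phi>)
 have ctr: "continuous_on {x1..x2} (\<lambda>x. g (x, u x))" if "continuous_on (tdomain l) g" for g :: "real \<times> real => real"
  by (rule continuous_on_compose2[OF that]) (use seg in \<open>auto simp: u_def[symmetric] intro!: continuous_intros cu\<close>)
 define T where "T = \<bar>c\<bar> + \<bar>\<Phi> x1\<bar> + \<bar>\<Phi> x2\<bar> + 1"
 have uT: "u x - b * e <= T" if "x \<in> {x1..x2}" "0 <= e" "e <= 1" for x e
 proof -
  have "\<Phi> x1 <= \<Phi> x" "\<Phi> x <= \<Phi> x2" using mono that(1) by (auto simp: le_less)
  then show ?thesis using eps that(2,3) unfolding u_def T_def by auto
 qed
 have Hb: "\<exists>B. \<forall>z\<in>tdomain l \<inter> {z. snd z <= T}. \<bar>H z\<bar> <= B"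
 proof -
  have "bm (\<lambda>z. \<Sum>j\<in>J. A j (fst z) * (if z \<in> tdomain l \<inter> {z. snd z <= T} then f j z else 0))"
   by (intro bm_sum bm_mult bm_comp[OF J(2)] bm_continuous_on_compact tdomain_compact[OF l L] continuous_on_subset[OF J(3)])
     (auto simp: borel_prod[symmetric])
  then obtain B where B: "\<And>z. \<bar>\<Sum>j\<in>J. A j (fst z) * (if z \<in> tdomain l \<inter> {z. snd z <= T} then f j z else 0)\<bar> <= B"
   using bm_bound by blast
  then have "\<bar>H z\<bar> <= B" if "z \<in> tdomain l \<inter> {z. snd z <= T}" for z
   using B[of z] that unfolding H by (simp only: if_True)
  then show ?thesis by blast
 qed
 then obtain B where B: "\<And>z. z \<in> tdomain l ==> snd z <= T ==> \<bar>H z\<bar> <= B" by auto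
 have inner: "((\<lambda>x. H (x, u x)) has_integral (- b * r (y2, u y2) - - b * r (y1, u y1))) {y1..y2}"
  if y: "x1 < y1" "y1 < y2" "y2 < x2" for y1 y2
 proof -
  define e0 where "e0 = min 1 ((\<Phi> x2 - \<Phi> y2) / 2)"
  have e0: "0 < e0" "e0 <= 1" "e0 < \<Phi> x2 - \<Phi> y2" using mono[OF y(3)] by (auto simp: e0_def min_def)
  define e where "e n = e0 / real (Suc n)" for n
  have e: "0 < e n" "e n <= e0" for n using e0 by (auto simp: e_def divide_le_eq)
  have elim: "e \<longlonglongrightarrow> 0" unfolding e_def[abs_def] by (rule LIMSEQ_Suc[OF lim_const_over_n])
  \<comment> \<open>The shift by \<open>e n\<close> assigns to \<open>x\<close> the time of the
    original curve at some \<open>xh > x\<close>. At that time \<open>l\<close> is at least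
    \<open>xh\<close>, so \<open>x\<close> lies strictly below the boundary; and the time is
    positive, being strictly between the nonnegative times at the two ends.\<close>
  have ins: "0 < u x - b * e n \<and> 0 < x \<and> x < l (u x - b * e n)" if x: "x \<in> {y1..y2}" for x n
  proof -
   have "\<Phi> x + e n <= \<Phi> y2 + e n" using mono[of x y2] x by (auto simp: le_less)
   then have "\<Phi> x + e n < \<Phi> x2" using e[of n] e0 by linarith
   then obtain xh where xh: "x <= xh" "xh <= x2" "\<Phi> xh = \<Phi> x + e n"
    using IVT'[of \<Phi> x "\<Phi> x + e n" x2] e(1)[of n] x y c\<Phi> by (auto simp: less_imp_le)
   have "x \<noteq> xh" "xh \<noteq> x2" using xh(3) e(1)[of n] \<open>\<Phi> x + e n < \<Phi> x2\<close> by auto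
   then have xh': "x < xh" "xh < x2" using xh by auto
   have "(xh, c - b * \<Phi> xh) \<in> tdomain l" by (rule seg) (use xh' x y in auto)
   then have d: "xh <= l (u x - b * e n)" unfolding tdomain_iff xh(3) u_def by (simp add: algebra_simps)
   have "0 < c - b * \<Phi> xh"
   proof -
    have "0 <= c - b * \<Phi> x1" "0 <= c - b * \<Phi> x2" using seg[of x1] seg[of x2] x12 by (auto simp: tdomain_iff)
    moreover have "\<Phi> x1 < \<Phi> xh" "\<Phi> xh < \<Phi> x2" using mono xh' x y by auto
    ultimately show ?thesis using eps by auto
   qed
   then have "0 < u x - b * e n" unfolding xh(3) u_def by (simp add: algebra_simps)
   moreover have "0 < x" using seg[of x1] x y x12 by (auto simp: tdomain_iff)
   ultimately show ?thesis using d xh' by auto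
  qed
  have inD: "(x, u x - b * e n) \<in> tdomain l" if "x \<in> {y1..y2}" for x n
   using ins[OF that, of n] by (auto simp: tdomain_iff)
  have In: "((\<lambda>x. H (x, u x - b * e n)) has_integral b * (r (y1, u y1 - b * e n) - r (y2, u y2 - b * e n))) {y1..y2}" for n
  proof -
   have eq: "u x - b * e n = c - b * e n - b * \<Phi> x" for x by (simp add: u_def)
   show ?thesis using ins[of _ n] unfolding eq by (intro int y) auto
  qed
  have lim: "(\<lambda>n. g (x, u x - b * e n)) \<longlonglongrightarrow> g (x, u x)" if g: "continuous_on (tdomain l) g" and x: "x \<in> {y1..y2}" for g :: "real \<times> real => real" and x
  proof -
   have xD: "(x, u x) \<in> tdomain l" using seg[of x] x y by (simp add: u_def)
   have "(\<lambda>n. (x, u x - b * e n)) \<longlonglongrightarrow> (x, u x - b * 0)" by (intro tendsto_intros elim)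
   then have t: "(\<lambda>n. (x, u x - b * e n)) \<longlonglongrightarrow> (x, u x)" by simp
   show ?thesis
    by (rule continuous_on_tendsto_compose[OF g t xD]) (use inD[OF x] in auto)
  qed
  have dc: "(\<lambda>x. H (x, u x)) integrable_on {y1..y2}"
    "(\<lambda>n. integral {y1..y2} (\<lambda>x. H (x, u x - b * e n))) \<longlonglongrightarrow> integral {y1..y2} (\<lambda>x. H (x, u x))"
  proof -
   have h1: "(\<lambda>x. H (x, u x - b * e n)) integrable_on {y1..y2}" for n using In by blast
   have h2: "(\<lambda>x. B) integrable_on {y1..y2}" by (rule integrable_const_ivl)
   have h3: "norm (H (x, u x - b * e n)) <= B" if "x \<in> {y1..y2}" for n x
    using B[OF inD[OF that, of n]] uT[of x "e n"] e[of n] e0 y that by auto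
   have h4: "(\<lambda>n. H (x, u x - b * e n)) \<longlonglongrightarrow> H (x, u x)" if "x \<in> {y1..y2}" for x
    unfolding H fst_conv by (intro tendsto_intros lim J that)
   show "(\<lambda>x. H (x, u x)) integrable_on {y1..y2}"
    by (rule dominated_convergence(1)[OF h1 h2 h3 h4])
   show "(\<lambda>n. integral {y1..y2} (\<lambda>x. H (x, u x - b * e n))) \<longlonglongrightarrow> integral {y1..y2} (\<lambda>x. H (x, u x))"
    by (rule dominated_convergence(2)[OF h1 h2 h3 h4])
  qed
  have "(\<lambda>n. b * (r (y1, u y1 - b * e n) - r (y2, u y2 - b * e n))) \<longlonglongrightarrow> b * (r (y1, u y1) - r (y2, u y2))"
   by (intro tendsto_intros lim[OF rc]) (use y in auto)
  moreover have "integral {y1..y2} (\<lambda>x. H (x, u x - b * e n)) = b * (r (y1, u y1 - b * e n) - r (y2, u y2 - b * e n))" for n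
   by (rule integral_unique[OF In])
  ultimately have "integral {y1..y2} (\<lambda>x. H (x, u x)) = b * (r (y1, u y1) - r (y2, u y2))"
   using LIMSEQ_unique[OF dc(2)] by simp
  then have "integral {y1..y2} (\<lambda>x. H (x, u x)) = - b * r (y2, u y2) - - b * r (y1, u y1)" by (simp add: algebra_simps)
  then show ?thesis using integrable_integral[OF dc(1)] by (simp only:)
 qed
 have "bm (\<lambda>x. \<Sum>j\<in>J. A j x * (if x \<in> {x1..x2} then f j (x, u x) else 0))"
  by (intro bm_sum bm_mult J bm_continuous_on_compact compact_Icc ctr)
 then have "(\<lambda>x. \<Sum>j\<in>J. A j x * (if x \<in> {x1..x2} then f j (x, u x) else 0)) integrable_on {x1..x2}"
  by (rule bm_integrable_on)
 then have Hint: "(\<lambda>x. H (x, u x)) integrable_on {x1..x2}"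
  by (rule integrable_eq) (auto simp: H)
 have "((\<lambda>x. H (x, u x)) has_integral (- b * r (x2, u x2) - - b * r (x1, u x1))) {x1..x2}"
  by (rule has_integral_extend_endpoints[OF x12 Hint _ inner]) (intro continuous_intros ctr rc)
 then show ?thesis unfolding u_def by (simp add: algebra_simps)
qed (use has_integral_refl in auto)

lemma inverse_DERIV:
 fixes \<Phi> \<Psi> q :: "real => real"
 assumes \<Phi>: "\<And>x. (\<Phi> has_real_derivative 1 / q x) (at x)" and q: "\<And>x. 0 < q x"
  and inv: "\<And>x. \<Psi> (\<Phi> x) = x" "\<And>y. \<Phi> (\<Psi> y) = y"
 shows "(\<Psi> has_real_derivative q (\<Psi> y)) (at y)"
proof -
 have mono: "x < y ==> \<Phi> x < \<Phi> y" for x y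
  by (rule DERIV_pos_imp_increasing) (use \<Phi> q in \<open>auto intro!: exI\<close>)
 have "\<Psi> x < \<Psi> y" if "x < y" for x y
  using mono[of "\<Psi> y" "\<Psi> x"] that inv by (metis linorder_less_linear less_asym)
 then have sm: "strict_mono \<Psi>" by (simp add: strict_mono_def)
 have cont: "isCont \<Psi> y"
 proof -
  have "isCont \<Psi> (\<Phi> (\<Psi> y))"
   by (rule isCont_inverse_function[where d=1]) (use inv \<Phi> in \<open>auto intro: DERIV_isCont\<close>)
  then show ?thesis by (simp add: inv)
 qed
 have "(\<Psi> has_real_derivative inverse (1 / q (\<Psi> y))) (at y)"
  by (rule DERIV_inverse_function[where f=\<Phi> and a="y - 1" and b="y + 1"]) (use \<Phi> q[of "\<Psi> y"] inv cont in auto)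
 then show ?thesis by simp
qed

lemma below_graph_open:
 fixes l :: "real => real"
 assumes "continuous_on {0..} l"
 shows "open {(x, t). 0 < t \<and> t < T \<and> 0 < x \<and> x < l t}"
proof -
 have c: "continuous_on UNIV (\<lambda>t. l (max 0 t))" by (intro continuous_on_compose2[OF assms] continuous_intros) auto
 have "{(x, t). 0 < t \<and> t < T \<and> 0 < x \<and> x < l t} = {z. 0 < snd z} \<inter> {z. snd z < T} \<inter> {z. 0 < fst z} \<inter> {z. fst z < l (max 0 (snd z))}"
  by auto
 moreover have "open {z::real\<times>real. fst z < l (max 0 (snd z))}"
  by (intro open_Collect_less continuous_intros continuous_on_compose2[OF c]) auto
 ultimately show ?thesis by (auto intro!: open_Int open_Collect_less continuous_intros)
qed

text \<open>The identity in \<open>x\<close> becomes one in time through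
  \<open>x = \<Psi> (c - d * u)\<close>, whose speed is \<open>- d * q\<close>; the orientation
  depends on \<open>d\<close>, hence the two cases at the end. Writing \<open>h\<close> as a finite
  sum of bounded coefficients in \<open>x\<close> times continuous functions yields continuity in
  \<open>t\<close> and measurability at once.\<close>

lemma strong_characteristic:
 fixes d :: real and A :: "'j => real => real" and f :: "'j => real \<times> real => real"
 assumes l: "continuous_on {0..} l" and L: "\<And>t. 0 <= t ==> l t <= L"
  and \<Phi>: "\<And>x. (\<Phi> has_real_derivative 1 / q x) (at x)" and qc: "continuous_on UNIV q" and qa: "0 < qa" "\<And>x. qa <= q x"
  and inv: "\<And>x. \<Psi> (\<Phi> x) = x" "\<And>y. \<Phi> (\<Psi> y) = y"
  and q: "\<forall>x\<in>{0<..<L}. (q has_real_derivative q' x) (at x)" "continuous_on {0<..<L} q'"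
  and eps: "d = 1 \<or> d = -1"
  and sd: "\<And>T. 0 < T ==> second_derivatives {(x, t). 0 < t \<and> t < T \<and> 0 < x \<and> x < l t} fx ft fxx fxt ftt"
  and eq: "\<And>T. 0 < T ==> AE z in lebesgue_on {(x, t). 0 < t \<and> t < T \<and> 0 < x \<and> x < l t}.
        pr ftt z = (q (fst z))\<^sup>2 * pr fxx z + k z"
  and fc: "continuous_on (tdomain l) (\<lambda>z. pr fx z)" "continuous_on (tdomain l) (\<lambda>z. pr ft z)"
  and r: "\<And>z. r z = pr ft z + d * q (fst z) * pr fx z"
  and J: "finite J" "\<And>j. j \<in> J ==> bm (A j)" "\<And>j. j \<in> J ==> continuous_on (tdomain l) (f j)"
  and h: "\<And>z. h z = (\<Sum>j\<in>J. A j (fst z) * f j z)"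
  and hk: "\<And>z. z \<in> tdomain l ==> h z = k z - q (fst z) * q' (fst z) * pr fx z"
  and st: "s <= t" and seg: "\<And>u. u \<in> {s..t} ==> (\<Psi> (c - d * u), u) \<in> tdomain l"
 shows "((\<lambda>u. h (\<Psi> (c - d * u), u)) has_integral r (\<Psi> (c - d * t), t) - r (\<Psi> (c - d * s), s)) {s..t}"
proof -
 have q0: "0 < q x" for x using qa(1) qa(2)[of x] by linarith
 have eps2: "d * d = 1" using eps by auto
 have rc: "continuous_on (tdomain l) r"
  unfolding r[abs_def] by (intro continuous_intros fc continuous_on_compose2[OF qc]) auto
 define B where "B j x = A j x / q x" for j x
 have qbm: "bm (\<lambda>x. 1 / q x)"
 proof (rule bmI)
  show "(\<lambda>x. 1 / q x) \<in> borel_measurable borel"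
   by (intro borel_contI continuous_intros qc) (use q0 in \<open>auto simp: less_imp_neq[symmetric]\<close>)
  show "\<bar>1 / q x\<bar> <= 1 / qa" for x using qa(1) qa(2)[of x] by (simp add: frac_le abs_of_pos)
 qed
 have Bbm: "bm (B j)" if "j \<in> J" for j
  using bm_mult[OF J(2)[OF that] qbm] unfolding B_def by simp
 define H where "H z = h z / q (fst z)" for z
 have Hs: "H z = (\<Sum>j\<in>J. B j (fst z) * f j z)" for z
  unfolding H_def h B_def by (simp add: sum_divide_distrib)
 have xint: "((\<lambda>x. H (x, C - d * \<Phi> x)) has_integral d * (r (x1, C - d * \<Phi> x1) - r (x2, C - d * \<Phi> x2))) {x1..x2}"
  if x12: "x1 <= x2" and sg: "\<And>x. x \<in> {x1..x2} ==> (x, C - d * \<Phi> x) \<in> tdomain l" for x1 x2 C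
 proof (rule closed_characteristic[OF l L \<Phi> _ eps rc J(1) Bbm J(3) Hs _ x12 sg])
  show "0 < 1 / q x" for x using q0 by simp
  fix x1 x2 c assume x12: "x1 < x2" and ins: "\<And>x. x \<in> {x1..x2} ==> 0 < c - d * \<Phi> x \<and> 0 < x \<and> x < l (c - d * \<Phi> x)"
  have mono: "\<Phi> x <= \<Phi> y" if "x <= y" for x y
   by (rule DERIV_nonneg_imp_nondecreasing[OF that]) (use \<Phi> q0 in \<open>auto intro!: exI simp: less_imp_le\<close>)
  define T where "T = \<bar>c\<bar> + \<bar>\<Phi> x1\<bar> + \<bar>\<Phi> x2\<bar> + 1"
  have T: "0 < T" "\<And>x. x \<in> {x1..x2} ==> c - d * \<Phi> x < T"
  proof -
   show "0 < T" unfolding T_def by linarith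
   fix x assume "x \<in> {x1..x2}"
   then have "\<Phi> x1 <= \<Phi> x" "\<Phi> x <= \<Phi> x2" using mono by auto
   then show "c - d * \<Phi> x < T" using eps unfolding T_def by auto
  qed
  define S where "S = {(x, t). 0 < t \<and> t < T \<and> 0 < x \<and> x < l t}"
  have SD: "S \<subseteq> tdomain l" unfolding S_def tdomain_def by auto
  have So: "open S" unfolding S_def by (rule below_graph_open[OF l])
  show "((\<lambda>x. H (x, c - d * \<Phi> x)) has_integral d * (r (x1, c - d * \<Phi> x1) - r (x2, c - d * \<Phi> x2))) {x1..x2}"
  proof (rule interior_characteristic[OF So _ \<Phi> qc q0 q sd[OF T(1), folded S_def] eq[OF T(1), folded S_def] eps2 r])
   show "S \<subseteq> {0<..<L} \<times> UNIV"
   proof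
    fix z assume "z \<in> S"
    then show "z \<in> {0<..<L} \<times> UNIV" unfolding S_def using L[of "snd z"] by auto
   qed
   show "continuous_on S r" by (rule continuous_on_subset[OF rc SD])
   show "H z = (k z - q (fst z) * q' (fst z) * pr fx z) / q (fst z)" if "z \<in> S" for z
    unfolding H_def using hk[of z] that SD by auto
   show "bm (\<lambda>z. if z \<in> K then H z else 0)" if "compact K" "K \<subseteq> S" for K
   proof -
    have "bm (\<lambda>z. \<Sum>j\<in>J. B j (fst z) * (if z \<in> K then f j z else 0))"
     using that SD
     by (intro bm_sum bm_mult bm_comp[OF Bbm] bm_continuous_on_compact continuous_on_subset[OF J(3)])
       (auto simp: borel_prod[symmetric])
    moreover have "(\<lambda>z. \<Sum>j\<in>J. B j (fst z) * (if z \<in> K then f j z else 0)) = (\<lambda>z. if z \<in> K then H z else 0)"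
     by (auto simp: Hs fun_eq_iff)
    ultimately show ?thesis by (simp only:)
   qed
   show "isCont (\<lambda>t. H (x, t)) t" if "(x, t) \<in> S" for x t
   proof -
    have "isCont (\<lambda>t. f j (x, t)) t" if "j \<in> J" for j
    proof -
     have "isCont (f j) (x, t)" using continuous_on_subset[OF J(3)[OF that] SD] So \<open>(x, t) \<in> S\<close>
      by (simp add: continuous_on_eq_continuous_at)
     then show ?thesis
      by (rule isCont_o2[where f="\<lambda>t. (x, t)", rotated]) (intro continuous_intros)
    qed
    then show ?thesis unfolding Hs fst_conv by (intro continuous_intros)
   qed
   show "(x, c - d * \<Phi> x) \<in> S" if "x \<in> {x1..x2}" for x
    using ins[OF that] T(2)[OF that] unfolding S_def by auto
  qed (rule x12)
 qed
 note d\<Psi> = inverse_DERIV[OF \<Phi> q0 inv]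
 have c\<Psi>: "continuous_on X \<Psi>" for X by (rule DERIV_continuous_on_at[OF d\<Psi>])
 define X where "X u = \<Psi> (c - d * u)" for u
 have cX: "continuous_on UNIV X" unfolding X_def by (intro continuous_on_compose2[OF c\<Psi>] continuous_intros) auto
 have dX: "(X has_real_derivative (- d * q (X u))) (at u)" for u
 proof -
  have "((\<lambda>u. c - d * u) has_real_derivative - d) (at u)" by (auto intro!: derivative_eq_intros)
  from DERIV_chain2[OF d\<Psi> this] show ?thesis unfolding X_def[abs_def] by (simp add: mult.commute)
 qed
 have uX: "d * c - d * \<Phi> (X u) = u" for u
  unfolding X_def inv using eps by auto
 have \<Psi>mono: "\<Psi> x <= \<Psi> y" if "x <= y" for x y
  by (rule DERIV_nonneg_imp_nondecreasing[OF that]) (use d\<Psi> q0 in \<open>auto intro!: exI simp: less_imp_le\<close>)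
 define lo where "lo = min (X s) (X t)"
 define hi where "hi = max (X s) (X t)"
 have lohi: "lo <= hi" by (simp add: lo_def hi_def)
 have range: "\<exists>u\<in>{s..t}. x = X u" if x: "x \<in> {lo..hi}" for x
 proof -
  have "s <= d * c - d * \<Phi> x \<and> d * c - d * \<Phi> x <= t"
  proof -
   have mono: "\<Phi> x <= \<Phi> y" if "x <= y" for x y
    by (rule DERIV_nonneg_imp_nondecreasing[OF that]) (use \<Phi> q0 in \<open>auto intro!: exI simp: less_imp_le\<close>)
   have o: "d = 1 ==> lo = X t \<and> hi = X s" "d = -1 ==> lo = X s \<and> hi = X t"
    using st \<Psi>mono unfolding lo_def hi_def X_def by auto
   have "\<Phi> lo <= \<Phi> x" "\<Phi> x <= \<Phi> hi" using mono x by auto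
   then show ?thesis using eps o by (auto simp: X_def inv)
  qed
  moreover have "x = X (d * c - d * \<Phi> x)"
  proof -
   have "c - d * (d * c - d * \<Phi> x) = c - (d * d) * c + (d * d) * \<Phi> x" by (simp add: algebra_simps)
   then show ?thesis unfolding X_def using eps2 inv by simp
  qed
  ultimately show ?thesis by (intro bexI[of _ "d * c - d * \<Phi> x"]) auto
 qed
 have sg: "(x, d * c - d * \<Phi> x) \<in> tdomain l" if "x \<in> {lo..hi}" for x
  using range[OF that] seg uX unfolding X_def[symmetric] by auto
 define G where "G x = (\<Sum>j\<in>J. B j x * (if x \<in> {lo..hi} then f j (x, d * c - d * \<Phi> x) else 0))" for x
 have c\<Phi>: "continuous_on X \<Phi>" for X by (rule DERIV_continuous_on_at[OF \<Phi>])
 have Gbm: "bm G" unfolding G_def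
  by (intro bm_sum bm_mult Bbm bm_continuous_on_compact compact_Icc continuous_on_compose2[OF J(3)] continuous_intros c\<Phi>)
    (use sg in auto)
 have Gint: "integral {lo..hi} G = d * (r (lo, d * c - d * \<Phi> lo) - r (hi, d * c - d * \<Phi> hi))"
 proof (rule integral_unique)
  show "(G has_integral d * (r (lo, d * c - d * \<Phi> lo) - r (hi, d * c - d * \<Phi> hi))) {lo..hi}"
   by (rule has_integral_eq[OF _ xint[OF lohi sg]]) (auto simp: G_def Hs)
 qed
 have inside: "X u \<in> {lo..hi}" if "u \<in> {s..t}" for u
  using eps that \<Psi>mono unfolding lo_def hi_def X_def by (auto simp: le_max_iff_disj min_le_iff_disj)
 have Gh: "G (X u) * q (X u) = h (X u, u)" if "u \<in> {s..t}" for u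
 proof -
  have "G (X u) = H (X u, u)" unfolding G_def Hs uX using inside[OF that] by simp
  then show ?thesis unfolding H_def using q0[of "X u"] by simp
 qed
 have "((\<lambda>u. G (X u) * q (X u)) has_integral r (X t, t) - r (X s, s)) {s..t}"
  using eps
 proof
  assume e: "d = 1"
  have lh: "lo = X t" "hi = X s" using st \<Psi>mono unfolding lo_def hi_def X_def e by auto
  have "((\<lambda>u. G (X u) * - (- d * q (X u))) has_integral integral {X t..X s} G) {s..t}"
   by (rule bm_substitution_neg[OF Gbm st dX])
     (use e q0 in \<open>auto simp: less_imp_le intro!: continuous_intros continuous_on_compose2[OF qc] continuous_on_subset[OF cX]\<close>)
  then show ?thesis using Gint uX unfolding lh using e by simp
 next
  assume e: "d = -1"
  have lh: "lo = X s" "hi = X t" using st \<Psi>mono unfolding lo_def hi_def X_def e by auto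
  have "((\<lambda>u. G (X u) * (- d * q (X u))) has_integral integral {X s..X t} G) {s..t}"
   by (rule bm_substitution[OF Gbm st dX])
     (use e q0 in \<open>auto simp: less_imp_le intro!: continuous_intros continuous_on_compose2[OF qc] continuous_on_subset[OF cX]\<close>)
  then show ?thesis using Gint uX unfolding lh using e by simp
 qed
 then show ?thesis unfolding X_def[symmetric]
  by (rule has_integral_eq[rotated]) (use Gh in auto)
qed

type_synonym field = "2 => real \<times> real => real"

section \<open>The Volterra transformation along characteristics\<close>

text \<open>\<open>\<Phi> i x\<close> is the time needed to travel from 0 to \<open>x\<close> at
  speed \<open>q i\<close>, and \<open>\<Psi> i\<close> inverts it. The speeds are given on the
  whole line, so characteristics are \<open>\<Psi> i (c - t)\<close> and
  \<open>\<Psi> i (c + t)\<close> for all times.\<close>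

locale speeds =
 fixes q \<Phi> \<Psi> :: "2 => real => real" and qa qb L :: real
 assumes qa: "0 < qa" and L0: "0 < L"
  and q_ge: "\<And>i x. qa <= q i x" and q_le: "\<And>i x. q i x <= qb"
  and q_cont: "\<And>i. continuous_on UNIV (q i)"
  and q_sep: "(\<forall>x. q 1 x < q 2 x) \<or> (\<forall>x. q 2 x < q 1 x)"
  and \<Phi>_deriv: "\<And>i x. (\<Phi> i has_real_derivative 1 / q i x) (at x)" and \<Phi>_0: "\<And>i. \<Phi> i 0 = 0"
  and \<Psi>\<Phi> [simp]: "\<And>i x. \<Psi> i (\<Phi> i x) = x" and \<Phi>\<Psi> [simp]: "\<And>i x. \<Phi> i (\<Psi> i x) = x"
begin

lemma q_pos: "0 < q i x"
 using qa q_ge[of i x] by linarith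

lemma q_ne: "q i x \<noteq> 0"
 using q_pos[of i x] by simp

lemma qb: "0 < qb"
 using q_pos[of 1 0] q_le[of 1 0] by linarith

lemma q_bm: "bm (q i)"
proof (rule bmI)
 show "q i \<in> borel_measurable borel" by (rule borel_contI[OF q_cont])
 show "\<bar>q i x\<bar> <= qb" for x using q_pos[of i x] q_le[of i x] by simp
qed

lemma \<Psi>_0 [simp]: "\<Psi> i 0 = 0"
 using \<Psi>\<Phi>[of i 0] \<Phi>_0 by simp

lemma \<Psi>_deriv: "(\<Psi> i has_real_derivative q i (\<Psi> i y)) (at y)"
 by (rule inverse_DERIV[OF \<Phi>_deriv q_pos]) auto

lemma \<Phi>_continuous: "continuous_on X (\<Phi> i)"
 by (rule DERIV_continuous_on_at[OF \<Phi>_deriv])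

lemma \<Psi>_continuous: "continuous_on X (\<Psi> i)"
 by (rule DERIV_continuous_on_at[OF \<Psi>_deriv])

lemma \<Phi>_mono: "x < y ==> \<Phi> i x < \<Phi> i y"
 by (rule DERIV_pos_imp_increasing) (use \<Phi>_deriv q_pos in \<open>auto intro!: exI\<close>)

lemma \<Phi>_less_iff [simp]: "\<Phi> i x < \<Phi> i y \<longleftrightarrow> x < y"
 using \<Phi>_mono[of x y i] \<Phi>_mono[of y x i] by (cases x y rule: linorder_cases) auto

lemma \<Phi>_le_iff [simp]: "\<Phi> i x <= \<Phi> i y \<longleftrightarrow> x <= y"
 by (simp add: not_less[symmetric])

lemma \<Psi>_less_iff [simp]: "\<Psi> i x < \<Psi> i y \<longleftrightarrow> x < y"
 using \<Phi>_less_iff[of i "\<Psi> i x" "\<Psi> i y"] by simp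

lemma \<Psi>_le_iff [simp]: "\<Psi> i x <= \<Psi> i y \<longleftrightarrow> x <= y"
 by (simp add: not_less[symmetric])

lemma \<Phi>_pos_iff [simp]: "0 < \<Phi> i y \<longleftrightarrow> 0 < y"
 using \<Phi>_less_iff[of i 0 y] by (simp add: \<Phi>_0)

lemma \<Psi>_nonneg_iff [simp]: "0 <= \<Psi> i y \<longleftrightarrow> 0 <= y"
 using \<Psi>_le_iff[of i 0 y] by simp

lemma \<Psi>_le_iff_\<Phi>: "\<Psi> i y <= x \<longleftrightarrow> y <= \<Phi> i x"
 using \<Psi>_le_iff[of i y "\<Phi> i x"] by simp

lemma \<Phi>_nonneg_iff [simp]: "0 <= \<Phi> i y \<longleftrightarrow> 0 <= y"
 using \<Phi>_le_iff[of i 0 y] by (simp add: \<Phi>_0)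

text \<open>Travel-time coordinate: \<open>dy = q j d\<eta>\<close>.\<close>

lemma travel_time_integral:
 assumes f: "bm f" and x: "0 <= x"
 shows "integral {a..\<Phi> j x + a} (\<lambda>c. f (\<Psi> j (c - a)) * q j (\<Psi> j (c - a))) = integral {0..x} f"
proof -
 have "((\<lambda>c. f (\<Psi> j (c - a)) * q j (\<Psi> j (c - a))) has_integral integral {\<Psi> j (a - a)..\<Psi> j (\<Phi> j x + a - a)} f) {a..\<Phi> j x + a}"
 proof (rule bm_substitution[OF f])
  show "((\<lambda>c. \<Psi> j (c - a)) has_real_derivative q j (\<Psi> j (c - a))) (at c)" for c
  proof -
   have "((\<lambda>c. c - a) has_real_derivative 1) (at c)" by (auto intro!: derivative_eq_intros)
   from DERIV_chain2[where f="\<Psi> j" and g="\<lambda>c. c - a", OF \<Psi>_deriv this] show ?thesis by simp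
  qed
  show "continuous_on {a..\<Phi> j x + a} (\<lambda>c. q j (\<Psi> j (c - a)))"
   by (intro continuous_on_compose2[OF q_cont] continuous_on_compose2[OF \<Psi>_continuous] continuous_intros) auto
 qed (use x q_pos in \<open>auto simp: less_imp_le\<close>)
 then show ?thesis by (simp add: integral_unique)
qed

text \<open>Differentiates a Volterra term along a characteristic \<open>X\<close> of the \<open>i\<close>-th component,
 pairing the kernel with the \<open>j\<close>-th component of the state transported with speed \<open>e q j\<close>.\<close>

lemma volterra_term:
 fixes e :: real and K hK :: "real \<times> real => real" and w hw :: "real \<times> real => real"
 assumes s12: "u1 <= u2" and e: "e = 1 \<or> e = -1"
  and bms: "bm K" "bm hK" "bm w" "bm hw"
  and sgn: "(\<forall>x. 0 <= q i x + e * q j x) \<or> (\<forall>x. q i x + e * q j x <= 0)"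
  and X: "\<And>s. X s = \<Psi> i (c0 - s)" and Xpos: "\<And>s. s \<in> {u1..u2} ==> 0 < X s"
  and Kc: "\<And>c s t. u1 <= s ==> s <= t ==> t <= u2 ==> (\<And>u. u \<in> {s..t} ==> 0 <= \<Psi> j (c + e * u) \<and> \<Psi> j (c + e * u) <= X u) ==>
    ((\<lambda>u. - (q j (\<Psi> j (c + e * u)) * hK (X u, \<Psi> j (c + e * u)))) has_integral
      (K (X t, \<Psi> j (c + e * t)) * q j (\<Psi> j (c + e * t)) - K (X s, \<Psi> j (c + e * s)) * q j (\<Psi> j (c + e * s)))) {s..t}"
  and wc: "\<And>c s t. u1 <= s ==> s <= t ==> t <= u2 ==> (\<And>u. u \<in> {s..t} ==> 0 <= \<Psi> j (c + e * u) \<and> \<Psi> j (c + e * u) <= X u) ==>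
    ((\<lambda>u. hw (\<Psi> j (c + e * u), u)) has_integral (w (\<Psi> j (c + e * t), t) - w (\<Psi> j (c + e * s), s))) {s..t}"
 shows "((\<lambda>u. integral {0..X u} (\<lambda>y. K (X u, y) * hw (y, u) - hK (X u, y) * w (y, u))
       + e * q j 0 * K (X u, 0) * w (0, u) - (q i (X u) + e * q j (X u)) * K (X u, X u) * w (X u, u))
     has_integral (integral {0..X u2} (\<lambda>y. K (X u2, y) * w (y, u2)) - integral {0..X u1} (\<lambda>y. K (X u1, y) * w (y, u1)))) {u1..u2}"
proof -
 \<comment> \<open>For fixed \<open>c\<close> both \<open>K (X s, Y c s)\<close> and
   \<open>w (Y c s, s)\<close> are followed along characteristics. In the variable \<open>c\<close>
   the Volterra term is the integral of their product, times \<open>q j\<close>, over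
   \<open>{m s..n s}\<close>, to which the Reynolds rule applies although neither factor is
   differentiable in space.\<close>
 define Y where "Y c s = \<Psi> j (c + e * s)" for c s
 have cX: "continuous_on S X" for S unfolding X[abs_def]
  by (intro continuous_on_compose2[OF \<Psi>_continuous] continuous_intros) auto
 have dX: "(X has_real_derivative - q i (X s)) (at s)" for s
 proof -
  have "((\<lambda>s. c0 - s) has_real_derivative -1) (at s)" by (auto intro!: derivative_eq_intros)
  from DERIV_chain2[where f="\<Psi> i" and g="\<lambda>s. c0 - s", OF \<Psi>_deriv this] show ?thesis unfolding X[abs_def] by simp
 qed
 have mY2: "(\<lambda>z. Y (fst z) (snd z)) \<in> borel_measurable borel" unfolding Y_def
  by (intro borel_contI continuous_on_compose2[OF \<Psi>_continuous] continuous_intros) auto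
 have mY1: "(\<lambda>s. Y c s) \<in> borel_measurable borel" for c unfolding Y_def
  by (intro borel_contI continuous_on_compose2[OF \<Psi>_continuous] continuous_intros) auto
 have m1: "(\<lambda>z. (X (snd z), Y (fst z) (snd z))) \<in> borel_measurable borel" "(\<lambda>z. (Y (fst z) (snd z), snd z)) \<in> borel_measurable borel"
  unfolding Y_def
  by (intro borel_contI continuous_on_compose2[OF \<Psi>_continuous[of UNIV]] continuous_on_compose2[OF cX[of UNIV]] continuous_intros; simp)+
 have m2: "(\<lambda>s. (X s, Y c s)) \<in> borel_measurable borel" "(\<lambda>s. (Y c s, s)) \<in> borel_measurable borel" for c
  unfolding Y_def
  by (intro borel_contI continuous_on_compose2[OF \<Psi>_continuous[of UNIV]] continuous_on_compose2[OF cX[of UNIV]] continuous_intros; simp)+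
 have m3: "(\<lambda>y. (x, y)) \<in> borel_measurable borel" "(\<lambda>y. (y, t)) \<in> borel_measurable borel" for x t :: real
  by (intro borel_contI continuous_intros)+
 define v where "v z = K (X (snd z), Y (fst z) (snd z)) * q j (Y (fst z) (snd z)) * w (Y (fst z) (snd z), snd z)" for z
 define h where "h z = - (q j (Y (fst z) (snd z)) * hK (X (snd z), Y (fst z) (snd z))) * w (Y (fst z) (snd z), snd z)
   + K (X (snd z), Y (fst z) (snd z)) * q j (Y (fst z) (snd z)) * hw (Y (fst z) (snd z), snd z)" for z
 have vbm: "bm v" unfolding v_def
  by (intro bm_mult bm_comp[OF bms(1) m1(1)] bm_comp[OF bms(3) m1(2)] bm_comp[OF q_bm mY2])
 have hbm: "bm h" unfolding h_def
  by (intro bm_add bm_uminus bm_mult bm_comp[OF bms(1) m1(1)] bm_comp[OF bms(2) m1(1)] bm_comp[OF bms(3) m1(2)] bm_comp[OF bms(4) m1(2)] bm_comp[OF q_bm mY2])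
 define m where "m s = - (e * s)" for s
 define n where "n s = \<Phi> j (X s) + - (e * s)" for s
 define n' where "n' s = - q i (X s) / q j (X s) - e" for s
 have dm: "(m has_real_derivative - e) (at s)" for s unfolding m_def[abs_def] by (auto intro!: derivative_eq_intros)
 have dn: "(n has_real_derivative n' s) (at s)" for s
  unfolding n_def[abs_def] n'_def using DERIV_chain2[where f="\<Phi> j" and g=X, OF \<Phi>_deriv dX, of s]
  by (auto intro!: derivative_eq_intros)
 have bn': "bm n'"
 proof (rule bmI)
  show "n' \<in> borel_measurable borel" unfolding n'_def
   by (intro borel_contI continuous_intros continuous_on_compose2[OF q_cont] cX) (auto simp: q_ne)
  fix s
  have "\<bar>q i (X s) / q j (X s)\<bar> <= qb / qa"
   using q_pos[of i "X s"] q_pos[of j "X s"] q_le[of i "X s"] q_ge[of j "X s"] qa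
   by (simp add: abs_of_pos frac_le)
  moreover have "\<bar>n' s\<bar> <= \<bar>q i (X s) / q j (X s)\<bar> + 1" unfolding n'_def minus_divide_left[symmetric] using e by linarith
  ultimately show "\<bar>n' s\<bar> <= qb / qa + 1" by linarith
 qed
 have cn': "continuous_on UNIV n'" unfolding n'_def
  by (intro continuous_intros continuous_on_compose2[OF q_cont] cX) (auto simp: q_ne)
 have n'_eq: "n' s = - (q i (X s) + e * q j (X s)) / q j (X s)" for s
  unfolding n'_def using q_ne by (simp add: field_simps)
 \<comment> \<open>The constant sign of the relative speed \<open>q i + e * q j\<close> makes the
   upper limit monotone, as the Reynolds rule requires.\<close>
 have sn: "(\<forall>s\<in>{u1..u2}. 0 <= n' s) \<or> (\<forall>s\<in>{u1..u2}. n' s <= 0)"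
  using sgn
 proof
  assume a: "\<forall>x. 0 <= q i x + e * q j x"
  have "n' s <= 0" for s unfolding n'_eq using q_pos[of j "X s"] a[rule_format, of "X s"] by (simp add: divide_le_0_iff)
  then show ?thesis by blast
 next
  assume a: "\<forall>x. q i x + e * q j x <= 0"
  have "0 <= n' s" for s unfolding n'_eq using q_pos[of j "X s"] a[rule_format, of "X s"] by (simp add: zero_le_divide_iff)
  then show ?thesis by blast
 qed
 have region: "0 <= Y c u \<and> Y c u <= X u \<longleftrightarrow> m u <= c \<and> c <= n u" for c u
  unfolding Y_def m_def n_def by (auto simp: \<Psi>_le_iff_\<Phi>)
 have R: "((\<lambda>u. integral {m u..n u} (\<lambda>c. h (c, u)) + n' u * v (n u, u) - - e * v (m u, u)) has_integral
      (integral {m u2..n u2} (\<lambda>c. v (c, u2)) - integral {m u1..n u1} (\<lambda>c. v (c, u1)))) {u1..u2}"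
 proof (rule reynolds[OF s12 vbm hbm _ _ bn' cn' dm dn _ sn])
  show "bm (\<lambda>s. - e)" "continuous_on UNIV (\<lambda>s. - e)" by auto
  show "(\<forall>s\<in>{u1..u2}. 0 <= - e) \<or> (\<forall>s\<in>{u1..u2}. - e <= 0)" using e by auto
  show "m s < n s" if "s \<in> {u1..u2}" for s using Xpos[OF that] unfolding m_def n_def by simp
  fix c s t assume st: "u1 <= s" "s <= t" "t <= u2" and reg: "\<And>u. u \<in> {s..t} ==> m u <= c \<and> c <= n u"
  have reg': "0 <= Y c u \<and> Y c u <= X u" if "u \<in> {s..t}" for u using reg[OF that] region by blast
  have "((\<lambda>u. - (q j (Y c u) * hK (X u, Y c u)) * w (Y c u, u) + (K (X u, Y c u) * q j (Y c u)) * hw (Y c u, u)) has_integral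
    ((K (X t, Y c t) * q j (Y c t)) * w (Y c t, t) - (K (X s, Y c s) * q j (Y c s)) * w (Y c s, s))) {s..t}"
  proof (rule has_integral_product_rule[OF st(2)])
   show "bm (\<lambda>u. - (q j (Y c u) * hK (X u, Y c u)))"
    by (intro bm_uminus bm_mult bm_comp[OF bms(2) m2(1)] bm_comp[OF q_bm mY1])
   show "bm (\<lambda>u. hw (Y c u, u))" by (rule bm_comp[OF bms(4) m2(2)])
   fix s' t' assume st': "s <= s'" "s' <= t'" "t' <= t"
   have reg'': "0 <= Y c u \<and> Y c u <= X u" if "u \<in> {s'..t'}" for u using that st' by (intro reg') auto
   show "((\<lambda>u. - (q j (Y c u) * hK (X u, Y c u))) has_integral (K (X t', Y c t') * q j (Y c t') - K (X s', Y c s') * q j (Y c s'))) {s'..t'}"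
    unfolding Y_def by (rule Kc) (use st st' reg'' in \<open>auto simp: Y_def\<close>)
   show "((\<lambda>u. hw (Y c u, u)) has_integral w (Y c t', t') - w (Y c s', s')) {s'..t'}"
    unfolding Y_def by (rule wc) (use st st' reg'' in \<open>auto simp: Y_def\<close>)
  qed
  then show "((\<lambda>u. h (c, u)) has_integral v (c, t) - v (c, s)) {s..t}"
   unfolding h_def v_def by simp
 qed
 have tt: "integral {m s..n s} (\<lambda>c. f (Y c s) * q j (Y c s)) = integral {0..X s} f" if "bm f" "s \<in> {u1..u2}" for f s
  using travel_time_integral[OF that(1), of "X s" "- (e * s)" j] Xpos[OF that(2)] unfolding m_def n_def Y_def by simp
 have e1: "integral {m s..n s} (\<lambda>c. v (c, s)) = integral {0..X s} (\<lambda>y. K (X s, y) * w (y, s))" if s: "s \<in> {u1..u2}" for s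
 proof -
  have "bm (\<lambda>y. K (X s, y) * w (y, s))" by (intro bm_mult bm_comp[OF bms(1) m3(1)] bm_comp[OF bms(3) m3(2)])
  from tt[OF this s] show ?thesis unfolding v_def by (simp add: mult.commute mult.left_commute)
 qed
 have e2: "integral {m s..n s} (\<lambda>c. h (c, s)) = integral {0..X s} (\<lambda>y. K (X s, y) * hw (y, s) - hK (X s, y) * w (y, s))" if s: "s \<in> {u1..u2}" for s
 proof -
  have "bm (\<lambda>y. K (X s, y) * hw (y, s) - hK (X s, y) * w (y, s))"
   by (intro bm_diff bm_mult bm_comp[OF bms(1) m3(1)] bm_comp[OF bms(2) m3(1)] bm_comp[OF bms(3) m3(2)] bm_comp[OF bms(4) m3(2)])
  from tt[OF this s] have "integral {m s..n s} (\<lambda>c. (K (X s, Y c s) * hw (Y c s, s) - hK (X s, Y c s) * w (Y c s, s)) * q j (Y c s))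
    = integral {0..X s} (\<lambda>y. K (X s, y) * hw (y, s) - hK (X s, y) * w (y, s))" .
  moreover have "h (c, s) = (K (X s, Y c s) * hw (Y c s, s) - hK (X s, Y c s) * w (Y c s, s)) * q j (Y c s)" for c
   unfolding h_def by (simp add: algebra_simps)
  ultimately show ?thesis by simp
 qed
 have Yn: "Y (n s) s = X s" "Y (m s) s = 0" for s unfolding Y_def n_def m_def by simp_all
 have e3: "n' s * v (n s, s) = - ((q i (X s) + e * q j (X s)) * K (X s, X s) * w (X s, s))" for s
  unfolding v_def n'_eq fst_conv snd_conv Yn using q_ne[of j "X s"] by (simp add: field_simps)
 have e4: "- e * v (m s, s) = - (e * q j 0 * K (X s, 0) * w (0, s))" for s
  unfolding v_def fst_conv snd_conv Yn by simp
 have "u1 \<in> {u1..u2}" "u2 \<in> {u1..u2}" using s12 by auto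
 note R' = R[unfolded e1[OF \<open>u1 \<in> {u1..u2}\<close>] e1[OF \<open>u2 \<in> {u1..u2}\<close>]]
 show ?thesis
 proof (rule has_integral_eq[OF _ R'])
  fix x assume x: "x \<in> {u1..u2}"
  show "integral {m x..n x} (\<lambda>c. h (c, x)) + n' x * v (n x, x) - - e * v (m x, x) =
    integral {0..X x} (\<lambda>y. K (X x, y) * hw (y, x) - hK (X x, y) * w (y, x))
     + e * q j 0 * K (X x, 0) * w (0, x) - (q i (X x) + e * q j (X x)) * K (X x, X x) * w (X x, x)"
   unfolding e2[OF x] e3 e4 by simp
 qed
qed

end

text \<open>The kernel equations in the form in which they are used. The transport equations are
  integrated along characteristics for the product of the kernel with \<open>q j\<close>, whose
  derivative absorbs the term with the derivative of \<open>Q\<close>; \<open>F\<close> and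
  \<open>N\<close> are treated together by the sign \<open>e\<close>. Conditions that hold almost
  everywhere hold here off one negligible set.\<close>

locale kernel_system = speeds +
 fixes TA TB :: "2 => 2 => real => real" and F N :: "2 => 2 => real \<times> real => real"
  and lam lam' :: "2 => 4 => real => real" and g :: "2 => 2 => real => real"
  and Am :: "4 => 4 => real" and Bm :: "4 => 2 => real" and Cm :: "2 => 4 => real"
  and l :: "real => real" and mh :: real
 assumes T_bm: "\<And>i j. bm (TA i j)" "\<And>i j. bm (TB i j)" and K_bm: "\<And>i j. bm (F i j)" "\<And>i j. bm (N i j)"
  and lam_bm: "\<And>i k. bm (lam i k)" "\<And>i k. bm (lam' i k)" and g_bm: "\<And>i j. bm (g i j)"
  and g_zero: "\<And>j x. g 1 j x = 0" "\<And>x. g 2 2 x = 0"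
  and K_char: "\<And>e K T i j c d s t. (e, K, T) \<in> {(1, F, TB), (- 1, N, TA)} ==> s <= t ==>
   (\<And>u. u \<in> {s..t} ==> 0 <= \<Psi> j (d + e * u) \<and> \<Psi> j (d + e * u) <= \<Psi> i (c - u) \<and> \<Psi> i (c - u) <= L) ==>
   ((\<lambda>u. - (q j (\<Psi> j (d + e * u)) *
     ((\<Sum>k\<in>UNIV. (F i k (\<Psi> i (c - u), \<Psi> j (d + e * u)) + N i k (\<Psi> i (c - u), \<Psi> j (d + e * u))) * T k j (\<Psi> j (d + e * u)))
      - TA i i (\<Psi> i (c - u)) * K i j (\<Psi> i (c - u), \<Psi> j (d + e * u)))))
    has_integral (K i j (\<Psi> i (c - t), \<Psi> j (d + e * t)) * q j (\<Psi> j (d + e * t)) - K i j (\<Psi> i (c - s), \<Psi> j (d + e * s)) * q j (\<Psi> j (d + e * s)))) {s..t}"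
  and bc: "\<exists>Z. negligible Z \<and> (\<forall>x\<in>{0..L} - Z. \<forall>i.
    (\<forall>j. (q i x + q j x) * F i j (x, x) = - TB i j x) \<and>
    (\<forall>j. j \<noteq> i \<longrightarrow> (q i x - q j x) * N i j (x, x) = - TA i j x) \<and>
    (\<forall>j. N i j (x, 0) * q j 0 = - (F i j (x, 0) * q j 0) + 2 * (\<Sum>k\<in>UNIV. lam i k x * Bm k j) + g i j x) \<and>
    (\<forall>k. q i x * lam' i k x = (\<Sum>m\<in>UNIV. lam i m x * Am m k) - TA i i x * lam i k x
      + (\<Sum>j\<in>UNIV. F i j (x, 0) * q j 0 * Cm j k) - (\<Sum>j\<in>UNIV. g i j x * lam j k 0)))"
  and lam_int: "\<And>i k x y. 0 <= x ==> x <= y ==> y <= L ==> (lam' i k has_integral (lam i k y - lam i k x)) {x..y}"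
  and l_cont: "continuous_on {0..} l" and l_bound: "\<And>t. 0 <= t ==> 0 < l t \<and> l t <= L"
  and l_lip: "\<And>s t. 0 <= s ==> s <= t ==> l t - l s <= mh * (t - s)" and mh: "mh < qa"
begin

section \<open>The transformed state along left-going characteristics\<close>

definition source :: "field => field => 2 => real \<times> real => real" where
 "source p r i z = (\<Sum>j\<in>UNIV. TA i j (fst z) * r j z + TB i j (fst z) * p j z)"

definition beta :: "field => field => (4 => real => real) => 2 => real \<times> real => real" where
 "beta p r W i z = r i z
   - (\<Sum>j\<in>UNIV. integral {0..fst z} (\<lambda>y. F i j (fst z, y) * p j (y, snd z)))
   - (\<Sum>j\<in>UNIV. integral {0..fst z} (\<lambda>y. N i j (fst z, y) * r j (y, snd z)))
   - (\<Sum>k\<in>UNIV. lam i k (fst z) * W k (snd z))"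

text \<open>All that the estimates use of a strong solution. The equations for \<open>p\<close> and
  \<open>r\<close> are integrated along characteristics, since these functions are only continuous;
  the last clause is the control law.\<close>

definition sol :: "field => field => (4 => real => real) => bool" where
 "sol p r W \<longleftrightarrow>
   (\<forall>i. continuous_on (tdomain l) (p i) \<and> continuous_on (tdomain l) (r i)) \<and>
   (\<forall>i c s t. s <= t \<longrightarrow> (\<forall>u\<in>{s..t}. (\<Psi> i (c + u), u) \<in> tdomain l) \<longrightarrow>
    ((\<lambda>u. source p r i (\<Psi> i (c + u), u)) has_integral (p i (\<Psi> i (c + t), t) - p i (\<Psi> i (c + s), s))) {s..t}) \<and>
   (\<forall>i c s t. s <= t \<longrightarrow> (\<forall>u\<in>{s..t}. (\<Psi> i (c - u), u) \<in> tdomain l) \<longrightarrow>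
    ((\<lambda>u. source p r i (\<Psi> i (c - u), u)) has_integral (r i (\<Psi> i (c - t), t) - r i (\<Psi> i (c - s), s))) {s..t}) \<and>
   (\<forall>k. \<forall>t\<ge>0. (W k has_real_derivative (\<Sum>m\<in>UNIV. Am k m * W m t) + 2 * (\<Sum>j\<in>UNIV. Bm k j * r j (0, t))) (at t within {0..})) \<and>
   (\<forall>j. \<forall>t\<ge>0. p j (0, t) = (\<Sum>k\<in>UNIV. Cm j k * W k t) - r j (0, t)) \<and>
   (\<forall>i. \<forall>t\<ge>0. beta p r W i (l t, t) = 0)"

lemmas sol_1 = sol_def[THEN iffD1]
lemmas sol_3 = sol_1[THEN conjunct2, THEN conjunct2]
lemmas sol_5 = sol_3[THEN conjunct2, THEN conjunct2]
lemmas solD = sol_1[THEN conjunct1, THEN spec, THEN conjunct1] sol_1[THEN conjunct1, THEN spec, THEN conjunct2]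
 sol_1[THEN conjunct2, THEN conjunct1, rule_format] sol_3[THEN conjunct1, rule_format] sol_3[THEN conjunct2, THEN conjunct1, rule_format]
 sol_5[THEN conjunct1, rule_format] sol_5[THEN conjunct2, rule_format]

text \<open>Values outside the domain or after \<open>T\<close> count as zero. This gives
  \<open>bm\<close> functions from continuous ones, and also disposes of feet of characteristics
  that fall outside the domain.\<close>

definition cut :: "real => (real \<times> real => real) => real \<times> real => real" where
 "cut T f z = (if z \<in> tdomain l \<inter> {z. snd z <= T} then f z else 0)"

lemma cut_in: "z \<in> tdomain l ==> snd z <= T ==> cut T f z = f z"
 by (simp add: cut_def)

lemma cut_bm: "continuous_on (tdomain l) f ==> bm (cut T f)"
 unfolding cut_def
 by (rule bm_continuous_on_compact[OF tdomain_compact[OF l_cont] continuous_on_subset[OF _ Int_lower1]])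
   (use l_bound in auto)

lemma tdomain_below: "(x, t) \<in> tdomain l ==> 0 <= y ==> y <= x ==> (y, t) \<in> tdomain l"
 by (simp add: tdomain_iff)

lemma tdomain_le_L: "(x, t) \<in> tdomain l ==> 0 <= x \<and> x <= L \<and> 0 <= t"
 using l_bound[of t] by (simp add: tdomain_iff)

lemma borel_fst_snd [measurable]: "(fst :: real \<times> real => real) \<in> borel_measurable borel" "(snd :: real \<times> real => real) \<in> borel_measurable borel"
 by (intro borel_contI continuous_intros)+

lemma bm_fst: "bm f ==> bm (\<lambda>z::real\<times>real. f (fst z))" for f :: "real => real"
 by (rule bm_comp[OF _ borel_fst_snd(1)])

lemma bm_pair_swap: "bm f ==> bm (\<lambda>y. f (x, y))" "bm f ==> bm (\<lambda>y. f (y, x))" for f :: "real \<times> real => real"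
 by (rule bm_pair2 bm_pair1, assumption)+

lemma source_cut_bm:
 assumes "\<And>j. bm (p j)" "\<And>j. bm (r j)"
 shows "bm (source p r i)"
 unfolding source_def by (intro bm_sum bm_add bm_mult bm_fst T_bm assms)

lemma W_continuous: "sol p r W ==> continuous_on {0..} (W k)"
 by (rule DERIV_continuous_on, rule solD(5)) auto

lemma source_cut:
 "z \<in> tdomain l ==> snd z <= T ==> source (\<lambda>j. cut T (p j)) (\<lambda>j. cut T (r j)) i z = source p r i z"
 unfolding source_def by (simp add: cut_in)

text \<open>The kernels are merely bounded, so \<open>beta\<close> cannot be treated as a continuous
  function; measurability comes from joint measurability of the integrands. The limit
  \<open>min (fst z) L\<close> keeps the range of integration bounded.\<close>

lemma beta_cut_bm:
 assumes sol: "sol p r W"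
 shows "bm (cut T (beta p r W i))"
proof -
 have pc: "bm (cut T (p j))" "bm (cut T (r j))" for j by (rule cut_bm[OF solD(1)[OF sol]], rule cut_bm[OF solD(2)[OF sol]])
 have mm: "(\<lambda>w::(real\<times>real)\<times>real. (fst (fst w), snd w)) \<in> borel_measurable borel"
   "(\<lambda>w::(real\<times>real)\<times>real. (snd w, snd (fst w))) \<in> borel_measurable borel"
  by (intro borel_contI continuous_intros)+
 have I: "bm (\<lambda>z. integral {0..min (fst z) L} (\<lambda>y. K (fst z, y) * f (y, snd z)))" if "bm K" "bm f" for K f :: "real \<times> real => real"
 proof -
  have "bm (\<lambda>w. K (fst (fst w), snd w) * f (snd w, snd (fst w)))"
   by (intro bm_mult bm_comp[OF that(1) mm(1)] bm_comp[OF that(2) mm(2)])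
  from bm_integral_param[OF this, of "\<lambda>_. 0" "\<lambda>z. min (fst z) L" 0 L] show ?thesis by simp
 qed
 have Wb: "bm (\<lambda>z::real\<times>real. if snd z \<in> {0..T} then W k (snd z) else 0)" for k
 proof -
  have "bm (\<lambda>t. if t \<in> {0..T} then W k t else 0)"
   by (intro bm_continuous_on_compact continuous_on_subset[OF W_continuous[OF sol]]) auto
  from bm_comp[OF this borel_fst_snd(2)] show ?thesis .
 qed
 have "bm (\<lambda>z. indicator (tdomain l \<inter> {z. snd z <= T}) z * (cut T (r i) z
   - (\<Sum>j\<in>UNIV. integral {0..min (fst z) L} (\<lambda>y. F i j (fst z, y) * cut T (p j) (y, snd z)))
   - (\<Sum>j\<in>UNIV. integral {0..min (fst z) L} (\<lambda>y. N i j (fst z, y) * cut T (r j) (y, snd z)))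
   - (\<Sum>k\<in>UNIV. lam i k (fst z) * (if snd z \<in> {0..T} then W k (snd z) else 0))))"
  by (intro bm_mult bm_diff bm_sum I K_bm pc bm_fst lam_bm Wb bm_indicator borel_closed closed_Int tdomain_closed l_cont closed_Collect_le continuous_intros)
 moreover have "(\<lambda>z. indicator (tdomain l \<inter> {z. snd z <= T}) z * (cut T (r i) z
   - (\<Sum>j\<in>UNIV. integral {0..min (fst z) L} (\<lambda>y. F i j (fst z, y) * cut T (p j) (y, snd z)))
   - (\<Sum>j\<in>UNIV. integral {0..min (fst z) L} (\<lambda>y. N i j (fst z, y) * cut T (r j) (y, snd z)))
   - (\<Sum>k\<in>UNIV. lam i k (fst z) * (if snd z \<in> {0..T} then W k (snd z) else 0)))) = cut T (beta p r W i)"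
 proof
  fix z :: "real \<times> real"
  obtain x t where z: "z = (x, t)" by fastforce
  show "indicator (tdomain l \<inter> {z. snd z <= T}) z * (cut T (r i) z
   - (\<Sum>j\<in>UNIV. integral {0..min (fst z) L} (\<lambda>y. F i j (fst z, y) * cut T (p j) (y, snd z)))
   - (\<Sum>j\<in>UNIV. integral {0..min (fst z) L} (\<lambda>y. N i j (fst z, y) * cut T (r j) (y, snd z)))
   - (\<Sum>k\<in>UNIV. lam i k (fst z) * (if snd z \<in> {0..T} then W k (snd z) else 0))) = cut T (beta p r W i) z"
  proof (cases "(x, t) \<in> tdomain l \<and> t <= T")
   case True
   then have b: "0 <= x" "x <= L" "0 <= t" using tdomain_le_L by auto
   have "integral {0..x} (\<lambda>y. K (x, y) * cut T f (y, t)) = integral {0..x} (\<lambda>y. K (x, y) * f (y, t))" for K f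
    by (rule integral_cong) (use True tdomain_below in \<open>auto simp: cut_in\<close>)
   then show ?thesis using True b unfolding z by (simp add: cut_in min_absorb1 beta_def)
  next
   case False
   then show ?thesis unfolding z by (auto simp: cut_def)
  qed
 qed
 ultimately show ?thesis by (simp only:)
qed

lemma lambda_char:
 assumes st: "s <= t" and dom: "\<And>u. u \<in> {s..t} ==> 0 <= \<Psi> i (c - u) \<and> \<Psi> i (c - u) <= L"
 shows "((\<lambda>u. - (q i (\<Psi> i (c - u)) * lam' i k (\<Psi> i (c - u)))) has_integral (lam i k (\<Psi> i (c - t)) - lam i k (\<Psi> i (c - s)))) {s..t}"
proof -
 have d: "((\<lambda>u. \<Psi> i (c - u)) has_real_derivative - q i (\<Psi> i (c - u))) (at u)" for u
 proof -
  have "((\<lambda>s. c - s) has_real_derivative -1) (at u)" by (auto intro!: derivative_eq_intros)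
  from DERIV_chain2[where f="\<Psi> i" and g="\<lambda>s. c - s", OF \<Psi>_deriv this] show ?thesis by simp
 qed
 have "((\<lambda>u. lam' i k (\<Psi> i (c - u)) * - (- q i (\<Psi> i (c - u)))) has_integral integral {\<Psi> i (c - t)..\<Psi> i (c - s)} (lam' i k)) {s..t}"
 proof (rule bm_substitution_neg[OF lam_bm(2) st d])
  show "continuous_on {s..t} (\<lambda>u. - q i (\<Psi> i (c - u)))"
   by (intro continuous_intros continuous_on_compose2[OF q_cont] continuous_on_compose2[OF \<Psi>_continuous[of UNIV]]) auto
 qed (use q_pos in \<open>auto simp: less_imp_le\<close>)
 moreover have "integral {\<Psi> i (c - t)..\<Psi> i (c - s)} (lam' i k) = lam i k (\<Psi> i (c - s)) - lam i k (\<Psi> i (c - t))"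
  by (rule integral_unique, rule lam_int) (use dom[of t] dom[of s] st in auto)
 ultimately have "((\<lambda>u. - (lam' i k (\<Psi> i (c - u)) * - (- q i (\<Psi> i (c - u))))) has_integral - (lam i k (\<Psi> i (c - s)) - lam i k (\<Psi> i (c - t)))) {s..t}"
  using has_integral_neg by metis
 then show ?thesis by (simp add: mult.commute)
qed

lemma sum_2': "(\<Sum>j\<in>UNIV. f j) = f (1::2) + f 2" for f :: "2 => real"
 by (simp add: sum_2)

text \<open>Each part of \<open>beta\<close> is differentiated along the left-going characteristic,
  and the kernel equations make the contributions fit: inside the integrals only
  \<open>TA i i\<close> times the Volterra terms survives, the values at \<open>y = x\<close> reduce
  the source to \<open>TA i i * r i\<close>, those at \<open>y = 0\<close> combine with the boundary
  relation for \<open>p\<close>, and the equation for \<open>lam\<close> absorbs the dynamics of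
  \<open>W\<close>. What is left over at the origin is \<open>g\<close> applied to
  \<open>beta\<close>. Positivity of the position keeps the interval of integration nondegenerate,
  as the Reynolds rule requires.\<close>

lemma beta_char_pos:
 assumes sol: "sol p r W" and u: "0 <= u1" "u1 <= u2"
  and dom: "\<And>s. s \<in> {u1..u2} ==> (\<Psi> i (c - s), s) \<in> tdomain l" and pos: "\<And>s. s \<in> {u1..u2} ==> 0 < \<Psi> i (c - s)"
 shows "((\<lambda>v. TA i i (\<Psi> i (c - v)) * beta p r W i (\<Psi> i (c - v), v) + (\<Sum>j\<in>UNIV. g i j (\<Psi> i (c - v)) * beta p r W j (0, v)))
   has_integral (beta p r W i (\<Psi> i (c - u2), u2) - beta p r W i (\<Psi> i (c - u1), u1))) {u1..u2}"
proof -
 define X where "X s = \<Psi> i (c - s)" for s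
 define P where "P j = cut u2 (p j)" for j
 define R where "R j = cut u2 (r j)" for j
 define S where "S = source P R"
 have PR: "bm (P j)" "bm (R j)" for j unfolding P_def R_def
  by (rule cut_bm[OF solD(1)[OF sol]], rule cut_bm[OF solD(2)[OF sol]])
 have Sbm: "bm (S j)" for j unfolding S_def by (rule source_cut_bm) (rule PR)+
 \<comment> \<open>\<open>- q j * hF j\<close> and \<open>- q j * hN j\<close> are the derivatives
   of \<open>F i j * q j\<close> and \<open>N i j * q j\<close> along the characteristics of the
   kernels.\<close>
 define hF where "hF j z = (\<Sum>k\<in>UNIV. (F i k z + N i k z) * TB k j (snd z)) - TA i i (fst z) * F i j z" for j z
 define hN where "hN j z = (\<Sum>k\<in>UNIV. (F i k z + N i k z) * TA k j (snd z)) - TA i i (fst z) * N i j z" for j z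
 have bm_snd: "bm (\<lambda>z::real\<times>real. f (snd z))" if "bm f" for f :: "real => real" by (rule bm_comp[OF that borel_fst_snd(2)])
 have hb: "bm (hF j)" "bm (hN j)" for j unfolding hF_def hN_def
  by (intro bm_diff bm_sum bm_mult bm_add K_bm bm_fst bm_snd T_bm)+
 have dX: "(X s, s) \<in> tdomain l" if "s \<in> {u1..u2}" for s using dom[OF that] by (simp add: X_def)
 have XL: "0 <= X s" "X s <= L" if "s \<in> {u1..u2}" for s using tdomain_le_L[OF dX[OF that]] by auto
 have inP: "P j z = p j z" "R j z = r j z" "S j z = source p r j z" if "z \<in> tdomain l" "snd z <= u2" for j z
  using that unfolding P_def R_def S_def by (simp_all add: cut_in source_cut)
 have pcl: "0 < X s" if "s \<in> {u1..u2}" for s using pos[OF that] by (simp add: X_def)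
 have V: "((\<lambda>v. integral {0..X v} (\<lambda>y. K i j (X v, y) * S j (y, v) - hK j (X v, y) * f' j (y, v))
       + e * q j 0 * K i j (X v, 0) * f' j (0, v) - (q i (X v) + e * q j (X v)) * K i j (X v, X v) * f' j (X v, v))
     has_integral (integral {0..X u2} (\<lambda>y. K i j (X u2, y) * f' j (y, u2)) - integral {0..X u1} (\<lambda>y. K i j (X u1, y) * f' j (y, u1)))) {u1..u2}"
  if A: "(e, K, T, f, f', hK) \<in> {(1, F, TB, p, P, hF), (- 1, N, TA, r, R, hN)}" for e K T f f' hK j
 proof (rule volterra_term[where i=i and ?c0.0=c, OF u(2) _ _ _ _ Sbm _ X_def pcl])
  show "e = 1 \<or> e = - 1" "bm (K i j)" "bm (hK j)" "bm (f' j)" using A K_bm hb PR by auto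
  show "(\<forall>x. 0 <= q i x + e * q j x) \<or> (\<forall>x. q i x + e * q j x <= 0)"
   using A q_pos q_sep exhaust_2[of i] exhaust_2[of j] by (auto simp: add_nonneg_nonneg less_imp_le)
  fix d s t assume st: "u1 <= s" "s <= t" "t <= u2" and reg: "\<And>v. v \<in> {s..t} ==> 0 <= \<Psi> j (d + e * v) \<and> \<Psi> j (d + e * v) <= X v"
  have A': "(e, K, T) \<in> {(1, F, TB), (- 1, N, TA)}" using A by auto
  have reg': "0 <= \<Psi> j (d + e * v) \<and> \<Psi> j (d + e * v) <= \<Psi> i (c - v) \<and> \<Psi> i (c - v) <= L" if "v \<in> {s..t}" for v
   using reg[OF that] XL[of v] that st by (simp add: X_def)
  have hK: "hK j z = (\<Sum>k\<in>UNIV. (F i k z + N i k z) * T k j (snd z)) - TA i i (fst z) * K i j z" for z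
   using A by (auto simp: hF_def hN_def)
  from K_char[OF A' st(2) reg']
  show "((\<lambda>v. - (q j (\<Psi> j (d + e * v)) * hK j (X v, \<Psi> j (d + e * v)))) has_integral
      (K i j (X t, \<Psi> j (d + e * t)) * q j (\<Psi> j (d + e * t)) - K i j (X s, \<Psi> j (d + e * s)) * q j (\<Psi> j (d + e * s)))) {s..t}"
   by (simp add: hK X_def)
  have dp: "(\<Psi> j (d + e * v), v) \<in> tdomain l" if "v \<in> {s..t}" for v
   by (rule tdomain_below[OF dX]) (use reg[OF that] that st in auto)
  have f': "f' j z = f j z" if "z \<in> tdomain l" "snd z <= u2" for z using A inP[OF that] by auto
  have "((\<lambda>v. source p r j (\<Psi> j (d + e * v), v)) has_integral (f j (\<Psi> j (d + e * t), t) - f j (\<Psi> j (d + e * s), s))) {s..t}"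
   using A solD(3)[OF sol st(2), of j d] solD(4)[OF sol st(2), of j d] dp by auto
  then have "((\<lambda>v. S j (\<Psi> j (d + e * v), v)) has_integral (f j (\<Psi> j (d + e * t), t) - f j (\<Psi> j (d + e * s), s))) {s..t}"
   by (rule has_integral_eq[rotated]) (use dp inP(3) st in auto)
  then show "((\<lambda>v. S j (\<Psi> j (d + e * v), v)) has_integral (f' j (\<Psi> j (d + e * t), t) - f' j (\<Psi> j (d + e * s), s))) {s..t}"
   using dp f' st by simp
 qed
 note VF = V[OF insertI1]
 note VN = V[OF insertI2[OF insertI1]]
 define dW where "dW k v = (\<Sum>m\<in>UNIV. Am k m * W m v) + 2 * (\<Sum>j\<in>UNIV. Bm k j * r j (0, v))" for k v
 have cr0: "continuous_on {u1..u2} (\<lambda>v. r j (0, v))" for j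
  by (rule continuous_on_compose2[OF solD(2)[OF sol]])
    (use u l_bound in \<open>auto simp: tdomain_iff less_imp_le intro!: continuous_intros\<close>)
 have cdW: "continuous_on {u1..u2} (dW k)" for k
  unfolding dW_def by (intro continuous_intros cr0 continuous_on_subset[OF W_continuous[OF sol]]) (use u in auto)
 have VL: "((\<lambda>v. - (q i (X v) * lam' i k (X v)) * W k v + lam i k (X v) * (if v \<in> {u1..u2} then dW k v else 0)) has_integral
   (lam i k (X u2) * W k u2 - lam i k (X u1) * W k u1)) {u1..u2}" for k
 proof (rule has_integral_product_rule[OF u(2)])
  have mX: "X \<in> borel_measurable borel" unfolding X_def
   by (intro borel_contI continuous_on_compose2[OF \<Psi>_continuous[of UNIV]] continuous_intros) auto
  show "bm (\<lambda>v. - (q i (X v) * lam' i k (X v)))"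
   by (intro bm_uminus bm_mult bm_comp[OF q_bm mX] bm_comp[OF lam_bm(2) mX])
  show "bm (\<lambda>v. if v \<in> {u1..u2} then dW k v else 0)" by (rule bm_continuous_on_compact[OF compact_Icc cdW])
  fix s t assume st: "u1 <= s" "s <= t" "t <= u2"
  show "((\<lambda>v. - (q i (X v) * lam' i k (X v))) has_integral lam i k (X t) - lam i k (X s)) {s..t}"
   unfolding X_def by (rule lambda_char[OF st(2)]) (use XL st in \<open>auto simp: X_def\<close>)
  have "(dW k has_integral W k t - W k s) {s..t}"
  proof (rule fundamental_theorem_of_calculus[OF st(2)])
   fix v assume "v \<in> {s..t}"
   then have "(W k has_real_derivative dW k v) (at v within {s..t})"
    unfolding dW_def using u st by (intro DERIV_subset[OF solD(5)[OF sol]]) auto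
   then show "(W k has_vector_derivative dW k v) (at v within {s..t})"
    by (simp add: has_real_derivative_iff_has_vector_derivative)
  qed
  then show "((\<lambda>v. if v \<in> {u1..u2} then dW k v else 0) has_integral W k t - W k s) {s..t}"
   by (rule has_integral_eq[rotated]) (use st in auto)
 qed
 have Vr: "((\<lambda>v. source p r i (X v, v)) has_integral r i (X u2, u2) - r i (X u1, u1)) {u1..u2}"
  unfolding X_def by (rule solD(4)[OF sol u(2) dom])
 have beta_eq: "beta p r W i (X s, s) = r i (X s, s) - (\<Sum>j\<in>UNIV. integral {0..X s} (\<lambda>y. F i j (X s, y) * P j (y, s)))
    - (\<Sum>j\<in>UNIV. integral {0..X s} (\<lambda>y. N i j (X s, y) * R j (y, s))) - (\<Sum>k\<in>UNIV. lam i k (X s) * W k s)"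
  if s: "s \<in> {u1..u2}" for s
 proof -
  have "integral {0..X s} (\<lambda>y. F i j (X s, y) * P j (y, s)) = integral {0..X s} (\<lambda>y. F i j (X s, y) * p j (y, s))"
   "integral {0..X s} (\<lambda>y. N i j (X s, y) * R j (y, s)) = integral {0..X s} (\<lambda>y. N i j (X s, y) * r j (y, s))" for j
   using s by (auto intro!: integral_cong simp: inP tdomain_below[OF dX[OF s]])
  then show ?thesis by (simp add: beta_def)
 qed
 obtain Z where Z: "negligible Z" and ZC: "\<And>x i. x \<in> {0..L} - Z ==>
    (\<forall>j. (q i x + q j x) * F i j (x, x) = - TB i j x) \<and>
    (\<forall>j. j \<noteq> i \<longrightarrow> (q i x - q j x) * N i j (x, x) = - TA i j x) \<and>
    (\<forall>j. N i j (x, 0) * q j 0 = - (F i j (x, 0) * q j 0) + 2 * (\<Sum>k\<in>UNIV. lam i k x * Bm k j) + g i j x) \<and>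
    (\<forall>k. q i x * lam' i k x = (\<Sum>m\<in>UNIV. lam i m x * Am m k) - TA i i x * lam i k x
      + (\<Sum>j\<in>UNIV. F i j (x, 0) * q j 0 * Cm j k) - (\<Sum>j\<in>UNIV. g i j x * lam j k 0))"
 proof (rule exE[OF bc], elim conjE, goal_cases)
  case (1 Z)
  show ?case by (rule 1(1)[OF 1(2) spec[OF bspec[OF 1(3)]]])
 qed
 \<comment> \<open>The times at which the characteristic meets the exceptional set: the image of a
   negligible set under a differentiable map.\<close>
 define Z' where "Z' = (\<lambda>x. c - \<Phi> i x) ` Z"
 have Z': "negligible Z'" unfolding Z'_def
 proof (rule negligible_differentiable_image_negligible[OF _ Z])
  show "(\<lambda>x. c - \<Phi> i x) differentiable_on Z"
  proof -
   have "\<Phi> i differentiable at x" for x using \<Phi>_deriv real_differentiable_def by blast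
   then show ?thesis unfolding differentiable_on_def
    by (auto intro!: differentiable_diff intro: differentiable_at_withinI)
  qed
 qed simp
 have XZ: "X v \<notin> Z" if "v \<notin> Z'" for v
 proof
  assume "X v \<in> Z"
  then have "c - \<Phi> i (X v) \<in> Z'" unfolding Z'_def by (rule imageI)
  then show False using that by (simp add: X_def)
 qed
 have key: "TA i i (X v) * beta p r W i (X v, v) + (\<Sum>j\<in>UNIV. g i j (X v) * beta p r W j (0, v))
   = source p r i (X v, v)
   - (\<Sum>j\<in>UNIV. integral {0..X v} (\<lambda>y. F i j (X v, y) * S j (y, v) - hF j (X v, y) * P j (y, v))
       + 1 * q j 0 * F i j (X v, 0) * P j (0, v) - (q i (X v) + 1 * q j (X v)) * F i j (X v, X v) * P j (X v, v))
   - (\<Sum>j\<in>UNIV. integral {0..X v} (\<lambda>y. N i j (X v, y) * S j (y, v) - hN j (X v, y) * R j (y, v))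
       + (-1) * q j 0 * N i j (X v, 0) * R j (0, v) - (q i (X v) + (-1) * q j (X v)) * N i j (X v, X v) * R j (X v, v))
   - (\<Sum>k\<in>UNIV. - (q i (X v) * lam' i k (X v)) * W k v + lam i k (X v) * (if v \<in> {u1..u2} then dW k v else 0))"
  if v: "v \<in> {u1..u2} - Z'" for v
 proof -
  define x where "x = X v"
  have vu: "v \<in> {u1..u2}" and x: "x \<in> {0..L} - Z" using v XL XZ by (auto simp: x_def)
  have xd: "(x, v) \<in> tdomain l" using dX[OF vu] by (simp add: x_def)
  have xd0: "(0, v) \<in> tdomain l" using tdomain_below[OF xd, of 0] x by simp
  note ZC = ZC[OF x]
  have atx: "P j (x, v) = p j (x, v)" "R j (x, v) = r j (x, v)" "P j (0, v) = p j (0, v)" "R j (0, v) = r j (0, v)" for j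
   using inP xd xd0 vu by auto
  define IF where "IF j = integral {0..x} (\<lambda>y. F i j (x, y) * P j (y, v))" for j
  define IN where "IN j = integral {0..x} (\<lambda>y. N i j (x, y) * R j (y, v))" for j
  \<comment> \<open>Summed over \<open>j\<close> and over both kernels, the products of kernels with
    \<open>TA\<close> and \<open>TB\<close> coming from the source and from the kernel equations
    cancel pointwise, except for the diagonal terms.\<close>
  have a: "(\<Sum>j\<in>UNIV. integral {0..x} (\<lambda>y. F i j (x, y) * S j (y, v) - hF j (x, y) * P j (y, v)))
    + (\<Sum>j\<in>UNIV. integral {0..x} (\<lambda>y. N i j (x, y) * S j (y, v) - hN j (x, y) * R j (y, v)))
   = TA i i x * ((\<Sum>j\<in>UNIV. IF j) + (\<Sum>j\<in>UNIV. IN j))"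
  proof -
   have b1: "bm (\<lambda>y. F i j (x, y) * S j (y, v) - hF j (x, y) * P j (y, v))" "bm (\<lambda>y. N i j (x, y) * S j (y, v) - hN j (x, y) * R j (y, v))"
    "bm (\<lambda>y. F i j (x, y) * P j (y, v))" "bm (\<lambda>y. N i j (x, y) * R j (y, v))" for j
    by (intro bm_diff bm_mult bm_pair_swap K_bm hb Sbm PR)+
   have i1: "((\<lambda>y. (\<Sum>j\<in>UNIV. F i j (x, y) * S j (y, v) - hF j (x, y) * P j (y, v)) + (\<Sum>j\<in>UNIV. N i j (x, y) * S j (y, v) - hN j (x, y) * R j (y, v)))
    has_integral ((\<Sum>j\<in>UNIV. integral {0..x} (\<lambda>y. F i j (x, y) * S j (y, v) - hF j (x, y) * P j (y, v)))
    + (\<Sum>j\<in>UNIV. integral {0..x} (\<lambda>y. N i j (x, y) * S j (y, v) - hN j (x, y) * R j (y, v))))) {0..x}"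
    by (intro has_integral_add has_integral_sum finite bm_has_integral b1)
   have i2: "((\<lambda>y. TA i i x * ((\<Sum>j\<in>UNIV. F i j (x, y) * P j (y, v)) + (\<Sum>j\<in>UNIV. N i j (x, y) * R j (y, v))))
    has_integral TA i i x * ((\<Sum>j\<in>UNIV. IF j) + (\<Sum>j\<in>UNIV. IN j))) {0..x}"
    unfolding IF_def IN_def by (intro has_integral_mult_right has_integral_add has_integral_sum finite bm_has_integral b1)
   have "(\<Sum>j\<in>UNIV. F i j (x, y) * S j (y, v) - hF j (x, y) * P j (y, v)) + (\<Sum>j\<in>UNIV. N i j (x, y) * S j (y, v) - hN j (x, y) * R j (y, v))
     = TA i i x * ((\<Sum>j\<in>UNIV. F i j (x, y) * P j (y, v)) + (\<Sum>j\<in>UNIV. N i j (x, y) * R j (y, v)))" for y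
    unfolding S_def source_def hF_def hN_def sum_2' fst_conv snd_conv by (simp add: algebra_simps)
   then show ?thesis using i1 i2 by (simp only: has_integral_unique)
  qed
  \<comment> \<open>The two conditions on \<open>y = x\<close> remove everything but the diagonal
    entry of \<open>TA\<close> from the source; for \<open>j = i\<close> the factor
    \<open>q i - q j\<close> in front of \<open>N\<close> vanishes.\<close>
  have b: "source p r i (x, v) + (\<Sum>j\<in>UNIV. (q i x + q j x) * F i j (x, x) * p j (x, v)) + (\<Sum>j\<in>UNIV. (q i x - q j x) * N i j (x, x) * r j (x, v))
    = TA i i x * r i (x, v)"
  proof -
   have "(q i x - q j x) * N i j (x, x) = (if j = i then 0 else - TA i j x)" for j using ZC[of i] by auto
   moreover have "(q i x + q j x) * F i j (x, x) = - TB i j x" for j using ZC[of i] by blast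
   ultimately show ?thesis unfolding source_def fst_conv using exhaust_2[of i] by (auto simp: sum_2')
  qed
  define CW where "CW j = (\<Sum>k\<in>UNIV. Cm j k * W k v)" for j
  define LB where "LB j = (\<Sum>k\<in>UNIV. lam i k x * Bm k j)" for j
  define LW where "LW j = (\<Sum>k\<in>UNIV. lam j k 0 * W k v)" for j
  define AW where "AW = (\<Sum>k\<in>UNIV. \<Sum>m\<in>UNIV. lam i m x * Am m k * W k v)"
  have e1: "(\<Sum>k\<in>UNIV. q i x * lam' i k x * W k v) = AW - TA i i x * (\<Sum>k\<in>UNIV. lam i k x * W k v)
    + (\<Sum>j\<in>UNIV. F i j (x, 0) * q j 0 * CW j) - (\<Sum>j\<in>UNIV. g i j x * LW j)"
  proof -
   have "q i x * lam' i k x * W k v = (\<Sum>m\<in>UNIV. lam i m x * Am m k * W k v) - TA i i x * (lam i k x * W k v)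
    + (F i 1 (x, 0) * q 1 0 * (Cm 1 k * W k v) + F i 2 (x, 0) * q 2 0 * (Cm 2 k * W k v)) - (g i 1 x * (lam 1 k 0 * W k v) + g i 2 x * (lam 2 k 0 * W k v))" for k
   proof -
    have "q i x * lam' i k x = (\<Sum>m\<in>UNIV. lam i m x * Am m k) - TA i i x * lam i k x
      + (\<Sum>j\<in>UNIV. F i j (x, 0) * q j 0 * Cm j k) - (\<Sum>j\<in>UNIV. g i j x * lam j k 0)" using ZC[of i] by blast
    then have "q i x * lam' i k x * W k v = ((\<Sum>m\<in>UNIV. lam i m x * Am m k) - TA i i x * lam i k x
      + (\<Sum>j\<in>UNIV. F i j (x, 0) * q j 0 * Cm j k) - (\<Sum>j\<in>UNIV. g i j x * lam j k 0)) * W k v" by (simp only:)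
    also have "... = (\<Sum>m\<in>UNIV. lam i m x * Am m k) * W k v - TA i i x * (lam i k x * W k v)
    + (F i 1 (x, 0) * q 1 0 * (Cm 1 k * W k v) + F i 2 (x, 0) * q 2 0 * (Cm 2 k * W k v)) - (g i 1 x * (lam 1 k 0 * W k v) + g i 2 x * (lam 2 k 0 * W k v))"
     unfolding sum_2' by (simp add: algebra_simps)
    finally show ?thesis unfolding sum_distrib_right .
   qed
   then show ?thesis unfolding AW_def CW_def LW_def sum_2'
    by (simp add: sum.distrib sum_subtractf sum_distrib_left)
  qed
  have e2: "(\<Sum>k\<in>UNIV. lam i k x * dW k v) = AW + 2 * (\<Sum>j\<in>UNIV. LB j * r j (0, v))"
  proof -
   have "(\<Sum>k\<in>UNIV. lam i k x * (\<Sum>m\<in>UNIV. Am k m * W m v)) = AW"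
    unfolding AW_def sum_distrib_left by (subst sum.swap) (simp add: mult.assoc)
   moreover have "(\<Sum>k\<in>UNIV. lam i k x * (2 * (\<Sum>j\<in>UNIV. Bm k j * r j (0, v)))) = 2 * (\<Sum>j\<in>UNIV. LB j * r j (0, v))"
    unfolding LB_def sum_2' by (simp add: sum_distrib_left sum_distrib_right sum.distrib algebra_simps)
   ultimately show ?thesis unfolding dW_def distrib_left sum.distrib by simp
  qed
  \<comment> \<open>The boundary relation for \<open>p\<close> turns the contribution of
    \<open>F\<close> at \<open>y = 0\<close> into \<open>W\<close> and \<open>r\<close>; the
    condition on \<open>N i j (x, 0)\<close> is designed for the resulting coefficient of
    \<open>r\<close>.\<close>
  have c: "- q j 0 * F i j (x, 0) * p j (0, v) + q j 0 * N i j (x, 0) * r j (0, v) = - (F i j (x, 0) * q j 0 * CW j) + 2 * (LB j * r j (0, v)) + g i j x * r j (0, v)" for j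
  proof -
   have p0: "p j (0, v) = CW j - r j (0, v)" unfolding CW_def using vu u by (intro solD(6)[OF sol]) auto
   have "N i j (x, 0) * q j 0 = - (F i j (x, 0) * q j 0) + 2 * LB j + g i j x" using ZC[of i] unfolding LB_def by blast
   then have N0: "N i j (x, 0) * q j 0 * r j (0, v) = (- (F i j (x, 0) * q j 0) + 2 * LB j + g i j x) * r j (0, v)" by simp
   show ?thesis unfolding p0 using N0 by (simp add: algebra_simps)
  qed
  have b0: "beta p r W j (0, v) = r j (0, v) - LW j" for j unfolding beta_def LW_def by simp
  have bx: "beta p r W i (x, v) = r i (x, v) - (\<Sum>j\<in>UNIV. IF j) - (\<Sum>j\<in>UNIV. IN j) - (\<Sum>k\<in>UNIV. lam i k x * W k v)"
   using beta_eq[OF vu] unfolding IF_def IN_def x_def .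
  have rhs: "(\<Sum>k\<in>UNIV. - (q i x * lam' i k x) * W k v + lam i k x * (if v \<in> {u1..u2} then dW k v else 0))
    = - (\<Sum>k\<in>UNIV. q i x * lam' i k x * W k v) + (\<Sum>k\<in>UNIV. lam i k x * dW k v)"
   using vu by (simp add: sum.distrib sum_negf sum_subtractf)
  show ?thesis
   unfolding x_def[symmetric] atx rhs e1 e2 bx b0 using a b c[of 1] c[of 2] unfolding sum_2'
   by (simp add: algebra_simps)
 qed
 have "((\<lambda>v. TA i i (X v) * beta p r W i (X v, v) + (\<Sum>j\<in>UNIV. g i j (X v) * beta p r W j (0, v)))
   has_integral (beta p r W i (X u2, u2) - beta p r W i (X u1, u1))) {u1..u2}"
 proof (rule has_integral_spike[OF Z' key])
  have "u1 \<in> {u1..u2}" "u2 \<in> {u1..u2}" using u by auto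
  show "((\<lambda>v. source p r i (X v, v)
   - (\<Sum>j\<in>UNIV. integral {0..X v} (\<lambda>y. F i j (X v, y) * S j (y, v) - hF j (X v, y) * P j (y, v))
       + 1 * q j 0 * F i j (X v, 0) * P j (0, v) - (q i (X v) + 1 * q j (X v)) * F i j (X v, X v) * P j (X v, v))
   - (\<Sum>j\<in>UNIV. integral {0..X v} (\<lambda>y. N i j (X v, y) * S j (y, v) - hN j (X v, y) * R j (y, v))
       + (-1) * q j 0 * N i j (X v, 0) * R j (0, v) - (q i (X v) + (-1) * q j (X v)) * N i j (X v, X v) * R j (X v, v))
   - (\<Sum>k\<in>UNIV. - (q i (X v) * lam' i k (X v)) * W k v + lam i k (X v) * (if v \<in> {u1..u2} then dW k v else 0)))
   has_integral (beta p r W i (X u2, u2) - beta p r W i (X u1, u1))) {u1..u2}"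
   unfolding beta_eq[OF \<open>u1 \<in> {u1..u2}\<close>] beta_eq[OF \<open>u2 \<in> {u1..u2}\<close>]
   unfolding sum_2' sum_4
   by (rule has_integral_eq_rhs[OF has_integral_diff[OF has_integral_diff[OF has_integral_diff[OF Vr
      has_integral_add[OF VF[of 1] VF[of 2]]] has_integral_add[OF VN[of 1] VN[of 2]]]
      has_integral_add[OF has_integral_add[OF has_integral_add[OF VL[of 1] VL[of 2]] VL[of 3]] VL[of 4]]]]) simp
 qed
 then show ?thesis unfolding X_def .
qed

lemma lam_continuous: "continuous_on {0..L} (lam i k)"
proof -
 obtain B where B: "0 <= B" "\<And>x. \<bar>lam' i k x\<bar> <= B" using bm_bound[OF lam_bm(2)] by blast
 show ?thesis
 proof (rule continuous_on_ordered_lipschitz[OF B(1)])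
  fix s t assume "0 <= s" "s <= t" "t <= L"
  then show "\<bar>lam i k t - lam i k s\<bar> <= B * (t - s)"
   using has_integral_bound[OF B(1), of "lam' i k" "lam i k t - lam i k s" s t] lam_int[of s t i k] B(2) by simp
 qed
qed

text \<open>Positions decrease strictly along the characteristic, so the position can be 0 only at
  the last time. There the identity is the limit of the previous one: the Volterra terms disappear
  with the length of their interval, and the other parts of \<open>beta\<close> are
  continuous.\<close>

lemma beta_char:
 assumes sol: "sol p r W" and u: "0 <= u1" "u1 <= u2"
  and dom: "\<And>s. s \<in> {u1..u2} ==> (\<Psi> i (c - s), s) \<in> tdomain l"
 shows "((\<lambda>v. TA i i (\<Psi> i (c - v)) * beta p r W i (\<Psi> i (c - v), v) + (\<Sum>j\<in>UNIV. g i j (\<Psi> i (c - v)) * beta p r W j (0, v)))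
   has_integral (beta p r W i (\<Psi> i (c - u2), u2) - beta p r W i (\<Psi> i (c - u1), u1))) {u1..u2}"
proof -
 define X where "X s = \<Psi> i (c - s)" for s
 consider "u1 = u2" | "0 < X u2" | "u1 < u2" "X u2 = 0"
  using u dom[of u2] tdomain_le_L[of "X u2" u2] unfolding X_def by fastforce
 then show ?thesis
 proof cases
  case 1
  then show ?thesis by (simp add: has_integral_refl)
 next
  case 2
  have "0 < \<Psi> i (c - s)" if "s \<in> {u1..u2}" for s
  proof -
   have "X u2 <= \<Psi> i (c - s)" using that by (simp add: X_def)
   then show ?thesis using 2 by linarith
  qed
  then show ?thesis by (intro beta_char_pos[OF sol u] dom) auto
 next
  case 3
  let ?f = "\<lambda>v. TA i i (X v) * beta p r W i (X v, v) + (\<Sum>j\<in>UNIV. g i j (X v) * beta p r W j (0, v))"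
  let ?F = "\<lambda>v. beta p r W i (X v, v)"
  have dX: "(X s, s) \<in> tdomain l" if "s \<in> {u1..u2}" for s using dom[OF that] by (simp add: X_def)
  have cX: "continuous_on S X" for S unfolding X_def
   by (intro continuous_on_compose2[OF \<Psi>_continuous[of UNIV]] continuous_intros) auto
  have mX: "X \<in> borel_measurable borel" by (rule borel_contI[OF cX])
  have mm: "(\<lambda>v. (X v, v)) \<in> borel_measurable borel" "(\<lambda>v. (0::real, v::real)) \<in> borel_measurable borel"
   by (intro borel_contI continuous_intros cX)+
  have "bm (\<lambda>v. TA i i (X v) * cut u2 (beta p r W i) (X v, v) + (\<Sum>j\<in>UNIV. g i j (X v) * cut u2 (beta p r W j) (0, v)))"
   by (intro bm_add bm_mult bm_sum bm_comp[OF T_bm(1) mX] bm_comp[OF g_bm mX] bm_comp[OF beta_cut_bm[OF sol] mm(1)] bm_comp[OF beta_cut_bm[OF sol] mm(2)])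
  then have fint: "?f integrable_on {u1..u2}"
  proof (rule integrable_eq[OF bm_integrable_on])
   fix v assume v: "v \<in> {u1..u2}"
   have "(0, v) \<in> tdomain l" by (rule tdomain_below[OF dX[OF v]]) (use dX[OF v] in \<open>auto simp: tdomain_iff\<close>)
   then show "TA i i (X v) * cut u2 (beta p r W i) (X v, v) + (\<Sum>j\<in>UNIV. g i j (X v) * cut u2 (beta p r W j) (0, v)) = ?f v"
    using dX[OF v] v by (simp add: cut_in)
  qed
  define a where "a n = u2 - (u2 - u1) / real (Suc n)" for n
  have a: "u1 <= a n" "a n < u2" for n
  proof -
   have "(u2 - u1) / real (Suc n) <= (u2 - u1) / 1" using 3 by (intro divide_left_mono) auto
   then show "u1 <= a n" unfolding a_def by simp
   show "a n < u2" unfolding a_def using 3 by simp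
  qed
  have ain: "a n \<in> {u1..u2}" for n using a[of n] by auto
  have "(\<lambda>n. u2 - (u2 - u1) / real (Suc n)) \<longlonglongrightarrow> u2 - 0"
   by (intro tendsto_intros LIMSEQ_Suc[OF lim_const_over_n])
  then have alim: "a \<longlonglongrightarrow> u2" unfolding a_def[abs_def] by simp
  have Xlim: "(\<lambda>n. X (a n)) \<longlonglongrightarrow> X u2"
   by (rule continuous_on_tendsto_compose[OF cX[of UNIV] alim]) auto
  have eq: "integral {u1..a n} ?f = ?F (a n) - ?F u1" for n
   unfolding X_def
  proof (rule integral_unique, rule beta_char_pos[OF sol u(1) a(1)])
   fix s assume s: "s \<in> {u1..a n}"
   show "(\<Psi> i (c - s), s) \<in> tdomain l" by (rule dom) (use s a[of n] in auto)
   have "X u2 < \<Psi> i (c - s)" using s a[of n] by (simp add: X_def)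
   then show "0 < \<Psi> i (c - s)" using 3 by simp
  qed
  have L1: "(\<lambda>n. integral {u1..a n} ?f) \<longlonglongrightarrow> integral {u1..u2} ?f"
   by (rule continuous_on_tendsto_compose[OF indefinite_integral_continuous_1[OF fint] alim]) (use ain u in auto)
  have vz: "(\<lambda>n. integral {0..X (a n)} (\<lambda>y. K (X (a n), y) * f (y, a n))) \<longlonglongrightarrow> 0"
   if K: "bm K" and fc: "continuous_on (tdomain l) f" for K f :: "real \<times> real => real"
  proof -
   obtain B where B: "0 <= B" "\<And>x. \<bar>K x\<bar> <= B" using bm_bound[OF K] by blast
   obtain D where D: "0 <= D" "\<And>x. \<bar>cut u2 f x\<bar> <= D" using bm_bound[OF cut_bm[OF fc]] by blast
   show ?thesis
   proof (rule Lim_null_comparison)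
    show "(\<lambda>n. B * D * X (a n)) \<longlonglongrightarrow> 0" using tendsto_mult_right_zero[of "\<lambda>n. X (a n)" sequentially "B * D"] Xlim 3 by simp
    have "\<bar>integral {0..X (a n)} (\<lambda>y. K (X (a n), y) * f (y, a n))\<bar> <= B * D * X (a n)" for n
    proof -
     have "integral {0..X (a n)} (\<lambda>y. K (X (a n), y) * f (y, a n)) = integral {0..X (a n)} (\<lambda>y. K (X (a n), y) * cut u2 f (y, a n))"
      using ain[of n] by (intro integral_cong) (auto simp: cut_in tdomain_below[OF dX[OF ain]])
     moreover have "\<bar>integral {0..X (a n)} (\<lambda>y. K (X (a n), y) * cut u2 f (y, a n))\<bar> <= (B * D) * (X (a n) - 0)"
     proof (rule integral_bound_real)
      show "0 <= X (a n)" using dX[OF ain[of n]] by (simp add: tdomain_iff)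
      show "(\<lambda>y. K (X (a n), y) * cut u2 f (y, a n)) integrable_on {0..X (a n)}"
       by (intro bm_integrable_on bm_mult bm_pair_swap K cut_bm fc)
      show "\<bar>K (X (a n), y) * cut u2 f (y, a n)\<bar> <= B * D" for y
       unfolding abs_mult by (intro mult_mono B D) auto
     qed
     ultimately show ?thesis by simp
    qed
    then show "\<forall>\<^sub>F n in sequentially. norm (integral {0..X (a n)} (\<lambda>y. K (X (a n), y) * f (y, a n))) <= B * D * X (a n)"
     by simp
   qed
  qed
  have rl: "(\<lambda>n. r i (X (a n), a n)) \<longlonglongrightarrow> r i (X u2, u2)"
   by (rule continuous_on_tendsto_compose[OF solD(2)[OF sol] tendsto_Pair[OF Xlim alim]]) (use dX ain u in auto)
  have ll: "(\<lambda>n. lam i k (X (a n))) \<longlonglongrightarrow> lam i k (X u2)" for k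
   by (rule continuous_on_tendsto_compose[OF lam_continuous Xlim]) (use tdomain_le_L[OF dX] ain u in auto)
  have wl: "(\<lambda>n. W k (a n)) \<longlonglongrightarrow> W k u2" for k
  proof (rule continuous_on_tendsto_compose[OF W_continuous[OF sol] alim])
   have "0 <= a n" for n using a(1)[of n] u by linarith
   then show "\<forall>\<^sub>F n in sequentially. a n \<in> {0..}" by simp
  qed (use u in auto)
  have "(\<lambda>n. ?F (a n)) \<longlonglongrightarrow> r i (X u2, u2) - (\<Sum>j\<in>(UNIV::2 set). 0) - (\<Sum>j\<in>(UNIV::2 set). 0) - (\<Sum>k\<in>UNIV. lam i k (X u2) * W k u2)"
   unfolding beta_def fst_conv snd_conv
   by (intro tendsto_diff tendsto_sum tendsto_mult rl ll wl vz K_bm solD(1)[OF sol] solD(2)[OF sol])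
  then have L2: "(\<lambda>n. ?F (a n)) \<longlonglongrightarrow> ?F u2" using 3 by (simp add: beta_def)
  have "integral {u1..u2} ?f = ?F u2 - ?F u1"
   by (rule LIMSEQ_unique[OF L1]) (unfold eq, intro tendsto_diff L2 tendsto_const)
  then have "(?f has_integral ?F u2 - ?F u1) {u1..u2}" using integrable_integral[OF fint] by (simp only:)
  then show ?thesis unfolding X_def .
 qed
qed

end

section \<open>Energy estimates\<close>

lemma bm_cauchy_schwarz:
 fixes f :: "real => real"
 assumes f: "bm f" and ab: "a <= b"
 shows "(integral {a..b} (\<lambda>x. \<bar>f x\<bar>))\<^sup>2 <= (b - a) * integral {a..b} (\<lambda>x. (f x)\<^sup>2)"
proof (cases "a = b")
 case False
 define I where "I = integral {a..b} (\<lambda>x. \<bar>f x\<bar>)"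
 \<comment> \<open>\<open>m\<close> is the mean of \<open>\<bar>f x\<bar>\<close>; the integral of
   the square of \<open>\<bar>f x\<bar> - m\<close> is nonnegative, and this is the claim.\<close>
 define m where "m = I / (b - a)"
 have ba: "0 < b - a" using ab False by simp
 have "((\<lambda>x. (f x)\<^sup>2 - 2 * m * \<bar>f x\<bar> + m\<^sup>2) has_integral (integral {a..b} (\<lambda>x. (f x)\<^sup>2) - 2 * m * I + m\<^sup>2 * (b - a))) {a..b}"
  unfolding I_def using ab has_integral_const_real[of "m\<^sup>2" a b]
  by (intro has_integral_add has_integral_diff has_integral_mult_right bm_has_integral bm_power bm_abs f) (simp add: mult.commute)
 then have "0 <= integral {a..b} (\<lambda>x. (f x)\<^sup>2) - 2 * m * I + m\<^sup>2 * (b - a)"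
 proof (rule has_integral_nonneg)
  fix x
  have "0 <= (\<bar>f x\<bar> - m)\<^sup>2" by simp
  then show "0 <= (f x)\<^sup>2 - 2 * m * \<bar>f x\<bar> + m\<^sup>2" by (simp add: power2_diff algebra_simps)
 qed
 moreover have e: "m * (b - a) = I" unfolding m_def using ba by simp
 have "(b - a) * (2 * m * I) = 2 * (m * (b - a)) * I" "(b - a) * (m\<^sup>2 * (b - a)) = (m * (b - a)) * (m * (b - a))"
  by (simp_all add: power2_eq_square)
 then have "(b - a) * (2 * m * I) = 2 * I\<^sup>2" "(b - a) * (m\<^sup>2 * (b - a)) = I\<^sup>2"
  unfolding e by (simp_all add: power2_eq_square)
 ultimately have "0 <= (b - a) * integral {a..b} (\<lambda>x. (f x)\<^sup>2) - 2 * I\<^sup>2 + I\<^sup>2"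
  using mult_nonneg_nonneg[of "b - a" "integral {a..b} (\<lambda>x. (f x)\<^sup>2) - 2 * m * I + m\<^sup>2 * (b - a)"] ba
  by (simp add: distrib_left right_diff_distrib)
 then show ?thesis unfolding I_def by simp
qed simp

lemma bm_integral_mono:
 fixes f g :: "real => real"
 assumes "bm f" "bm g" "\<And>x. x \<in> {a..b} ==> f x <= g x"
 shows "integral {a..b} f <= integral {a..b} g"
 by (rule integral_le) (use assms bm_integrable_on in auto)

lemma bm_integral_nonneg:
 fixes f :: "real => real"
 assumes "bm f" "\<And>x. 0 <= f x" shows "0 <= integral {a..b} f"
 by (rule integral_nonneg) (use assms bm_integrable_on in auto)

lemma bm_integral_le_support:
 fixes f :: "real => real"
 assumes f: "bm f" "\<And>x. 0 <= f x" and z: "\<And>x. x \<notin> {u..v} ==> f x = 0"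
 shows "integral {a..b} f <= integral {u..v} f"
proof -
 have "integral {a..b} f <= integral {min a u..max b v} f"
  by (rule integral_subset_le) (use f bm_integrable_on in auto)
 also have "... = integral {u..v} f"
  by (rule bm_integral_shrink[OF f(1) z]) auto
 finally show ?thesis .
qed

text \<open>Applied to maps from a point or a time to the foot of its characteristic: an integral
  over feet costs only a lower bound \<open>c\<close> for the derivative of that map.\<close>

lemma bm_integral_substitution_le:
 fixes f g g' :: "real => real"
 assumes f: "bm f" "\<And>x. 0 <= f x" and z: "\<And>x. x \<notin> {u..v} ==> f x = 0"
  and g: "\<And>x. (g has_real_derivative g' x) (at x)" "continuous_on UNIV g'" and c: "0 < c" "\<And>x. c <= g' x"
 shows "integral {a..b} (\<lambda>x. f (g x)) <= integral {u..v} f / c"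
proof (cases "a <= b")
 case True
 have gm: "g \<in> borel_measurable borel"
  by (rule borel_contI, rule DERIV_continuous_on_at[OF g(1)])
 have nn: "0 <= g' x" for x using c(1) c(2)[of x] by linarith
 have s: "((\<lambda>x. f (g x) * g' x) has_integral integral {g a..g b} f) {a..b}"
  by (rule bm_substitution[OF f(1) True g(1) continuous_on_subset[OF g(2)] nn]) auto
 have "integral {a..b} (\<lambda>x. f (g x)) * c <= integral {g a..g b} f"
 proof (rule has_integral_le[OF has_integral_mult_left[OF bm_has_integral[OF bm_comp[OF f(1) gm]]] s])
  show "f (g x) * c <= f (g x) * g' x" for x by (intro mult_left_mono c f)
 qed
 also have "... <= integral {u..v} f" by (rule bm_integral_le_support[OF f z])
 finally show ?thesis using c(1) by (simp add: le_divide_eq)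
next
 case False
 then show ?thesis using bm_integral_nonneg[OF f] c(1) by simp
qed

lemma power2_sum2_le: "(a + b)\<^sup>2 <= 2 * (a\<^sup>2 + b\<^sup>2)" for a b :: real
 using sum_squares_bound[of a b] by (simp add: power2_sum)

lemma power2_sum3_le: "(a + b + c)\<^sup>2 <= 3 * (a\<^sup>2 + b\<^sup>2 + c\<^sup>2)" for a b c :: real
 using sum_squares_bound[of a b] sum_squares_bound[of a c] sum_squares_bound[of b c]
 by (simp add: power2_eq_square algebra_simps)

lemma power2_abs_le: "\<bar>x\<bar> <= y ==> x\<^sup>2 <= y\<^sup>2" for x y :: real
 by (metis abs_ge_zero power2_abs power_mono)

text \<open>One constant serves for all data; \<open>1 <= M\<close> allows \<open>M\<close> to be
  replaced by its square where powers are collected.\<close>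

locale kernel_bounds = kernel_system +
 fixes M :: real
 assumes M1: "1 <= M"
  and TA_le: "\<And>i j x. \<bar>TA i j x\<bar> <= M" and TB_le: "\<And>i j x. \<bar>TB i j x\<bar> <= M"
  and F_le: "\<And>i j z. \<bar>F i j z\<bar> <= M" and N_le: "\<And>i j z. \<bar>N i j z\<bar> <= M"
  and lam_le: "\<And>i k x. \<bar>lam i k x\<bar> <= M" and g_le: "\<And>i j x. \<bar>g i j x\<bar> <= M"
  and Am_le: "\<And>k m. \<bar>Am k m\<bar> <= M" and Bm_le: "\<And>k j. \<bar>Bm k j\<bar> <= M" and Cm_le: "\<And>j k. \<bar>Cm j k\<bar> <= M"
begin

lemma M0: "0 <= M" using M1 by simp

lemma origin_in: "0 <= t ==> (0, t) \<in> tdomain l"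
 using l_bound[of t] by (simp add: tdomain_iff)

lemma beta_origin: "beta p r W j (0, t) = r j (0, t) - (\<Sum>k\<in>UNIV. lam j k 0 * W k t)"
 by (simp add: beta_def)

lemma r_origin_continuous:
 assumes "sol p r W" shows "continuous_on {0..} (\<lambda>t. r j (0, t))"
 by (rule continuous_on_compose2[OF solD(2)[OF assms]]) (auto simp: origin_in intro!: continuous_intros)

lemma beta_origin_continuous:
 assumes "sol p r W" shows "continuous_on {0..} (\<lambda>t. beta p r W j (0, t))"
 unfolding beta_origin by (intro continuous_intros r_origin_continuous[OF assms] W_continuous[OF assms])

text \<open>The size of what drives component \<open>i\<close> through \<open>g\<close>: nothing for
  component 1, the trace of component 1 for component 2.\<close>

definition coupling :: "field => field => (4 => real => real) => 2 => real => real" where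
 "coupling p r W i t = (if i = 1 then 0 else \<bar>beta p r W 1 (0, t)\<bar>)"

lemma coupling_integrable:
 assumes "sol p r W" "0 <= s" shows "coupling p r W i integrable_on {s..t}"
 unfolding coupling_def
 by (cases "i = 1") (use assms in \<open>auto intro!: integrable_continuous_real continuous_intros continuous_on_subset[OF beta_origin_continuous[OF assms(1)]]\<close>)

lemma coupling_nonneg: "0 <= coupling p r W i t"
 by (simp add: coupling_def)

text \<open>Along one characteristic only the same component of \<open>beta\<close> and the trace of
  component 1 occur, so Gronwall in time closes the estimate.\<close>

lemma beta_gronwall:
 assumes sol: "sol p r W" and st: "0 <= s" "s <= t"
  and dom: "\<And>u. u \<in> {s..t} ==> (\<Psi> i (c - u), u) \<in> tdomain l"
 shows "\<bar>beta p r W i (\<Psi> i (c - t), t)\<bar> <= (\<bar>beta p r W i (\<Psi> i (c - s), s)\<bar> + M * integral {s..t} (coupling p r W i)) * exp (M * (t - s))"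
proof -
 define f where "f u = \<bar>beta p r W i (\<Psi> i (c - u), u)\<bar>" for u
 have mm: "(\<lambda>u. (\<Psi> i (c - u), u)) \<in> borel_measurable borel"
  by (intro borel_contI continuous_intros continuous_on_compose2[OF \<Psi>_continuous[of UNIV]]) auto
 have "bm (\<lambda>u. \<bar>cut t (beta p r W i) (\<Psi> i (c - u), u)\<bar>)"
  by (intro bm_abs bm_comp[OF beta_cut_bm[OF sol] mm])
 then have fint: "f integrable_on {a..b}" if "s <= a" "b <= t" for a b
  by (rule integrable_eq[OF bm_integrable_on]) (use dom that in \<open>auto simp: f_def cut_in\<close>)
 have "f t <= (\<bar>beta p r W i (\<Psi> i (c - s), s)\<bar> + M * integral {s..t} (coupling p r W i)) * exp (M * (t - s))"
 proof (rule gronwall[OF fint[OF order_refl order_refl] M0])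
  fix u assume u: "u \<in> {s..t}"
  have hi: "((\<lambda>u. TA i i (\<Psi> i (c - u)) * beta p r W i (\<Psi> i (c - u), u) + (\<Sum>j\<in>UNIV. g i j (\<Psi> i (c - u)) * beta p r W j (0, u)))
   has_integral (beta p r W i (\<Psi> i (c - u), u) - beta p r W i (\<Psi> i (c - s), s))) {s..u}"
   by (rule beta_char[OF sol st(1)]) (use u dom in auto)
  have ri: "((\<lambda>u. M * f u + M * coupling p r W i u) has_integral (M * integral {s..u} f + M * integral {s..u} (coupling p r W i))) {s..u}"
   by (intro has_integral_add has_integral_mult_right integrable_integral fint coupling_integrable[OF sol st(1)]) (use u in auto)
  have "\<bar>beta p r W i (\<Psi> i (c - u), u) - beta p r W i (\<Psi> i (c - s), s)\<bar> <= M * integral {s..u} f + M * integral {s..u} (coupling p r W i)"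
  proof -
   have "norm (integral {s..u} (\<lambda>u. TA i i (\<Psi> i (c - u)) * beta p r W i (\<Psi> i (c - u), u) + (\<Sum>j\<in>UNIV. g i j (\<Psi> i (c - u)) * beta p r W j (0, u))))
     <= integral {s..u} (\<lambda>u. M * f u + M * coupling p r W i u)"
   proof (rule integral_norm_bound_integral[OF has_integral_integrable[OF hi] has_integral_integrable[OF ri]])
    fix v
    have "\<bar>TA i i (\<Psi> i (c - v)) * beta p r W i (\<Psi> i (c - v), v)\<bar> <= M * f v"
     unfolding abs_mult f_def by (intro mult_right_mono TA_le) auto
    moreover have "\<bar>\<Sum>j\<in>UNIV. g i j (\<Psi> i (c - v)) * beta p r W j (0, v)\<bar> <= M * coupling p r W i v"
    proof (cases "i = 1")
     case True
     then show ?thesis by (simp add: g_zero coupling_def)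
    next
     case False
     then have i: "i = 2" using exhaust_2[of i] by auto
     have "\<bar>g 2 1 (\<Psi> 2 (c - v)) * beta p r W 1 (0, v)\<bar> <= M * \<bar>beta p r W 1 (0, v)\<bar>"
      unfolding abs_mult by (intro mult_right_mono g_le) auto
     then show ?thesis unfolding i by (simp add: sum_2' g_zero coupling_def)
    qed
    ultimately show "norm (TA i i (\<Psi> i (c - v)) * beta p r W i (\<Psi> i (c - v), v) + (\<Sum>j\<in>UNIV. g i j (\<Psi> i (c - v)) * beta p r W j (0, v))) <= M * f v + M * coupling p r W i v"
     unfolding real_norm_def by linarith
   qed
   then show ?thesis unfolding integral_unique[OF hi] integral_unique[OF ri] by simp
  qed
  moreover have "M * integral {s..u} (coupling p r W i) <= M * integral {s..t} (coupling p r W i)"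
   by (intro mult_left_mono M0 integral_subset_le coupling_integrable[OF sol st(1)] coupling_nonneg) (use u coupling_nonneg in auto)
  ultimately show "f u <= \<bar>beta p r W i (\<Psi> i (c - s), s)\<bar> + M * integral {s..t} (coupling p r W i) + M * integral {s..u} f"
   unfolding f_def by linarith
 qed (use st in auto)
 then show ?thesis by (simp add: f_def)
qed

text \<open>The boundary may move faster or slower than the characteristic, so the path can cross it
  several times; only the part after the last contact is kept.\<close>

lemma characteristic_backward:
 assumes xt: "(x, t) \<in> tdomain l" and s0: "0 <= s0" "s0 <= t"
 obtains s where "s \<in> {s0..t}" "\<And>u. u \<in> {s..t} ==> (\<Psi> i (\<Phi> i x + t - u), u) \<in> tdomain l"
  "s = s0 \<or> \<Psi> i (\<Phi> i x + t - s) = l s"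
proof -
 define X where "X s = \<Psi> i (\<Phi> i x + t - s)" for s
 define d where "d s = X s - l s" for s
 have cX: "continuous_on S X" for S unfolding X_def
  by (intro continuous_on_compose2[OF \<Psi>_continuous[of UNIV]] continuous_intros) auto
 have cd: "continuous_on {s0..t} d" unfolding d_def
  by (intro continuous_intros cX continuous_on_subset[OF l_cont]) (use s0 in auto)
 have X0: "0 <= X s" if "s <= t" for s
 proof -
  have "0 <= \<Phi> i x" using xt by (simp add: tdomain_iff)
  then have "s <= \<Phi> i x + t" using that by linarith
  then show ?thesis by (simp add: X_def)
 qed
 have dt: "d t <= 0" using xt by (simp add: d_def X_def tdomain_iff)
 \<comment> \<open>Times at which the path is on or beyond the boundary. By the intermediate value
   theorem it is on the boundary at the supremum, and it is inside from then on.\<close>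
 define S where "S = {s0..t} \<inter> d -` {0..}"
 show ?thesis
 proof (cases "S = {}")
  case True
  then have "X s <= l s" if "s \<in> {s0..t}" for s using that by (force simp: S_def d_def)
  then show ?thesis using X0 s0 by (intro that[of s0]) (auto simp: tdomain_iff X_def)
 next
  case False
  have "closed S" unfolding S_def by (rule continuous_closed_preimage[OF cd]) auto
  moreover have bdd: "bdd_above S" unfolding S_def by (auto intro!: bdd_aboveI)
  ultimately have sS: "Sup S \<in> S" using False by (intro closed_contains_Sup)
  define s where "s = Sup S"
  have s: "s \<in> {s0..t}" "0 <= d s" using sS by (auto simp: S_def s_def)
  obtain z where z: "s <= z" "z <= t" "d z = 0"
   using IVT2'[of d t 0 s] s dt continuous_on_subset[OF cd, of "{s..t}"] by auto
  have "z \<in> S" using z s by (auto simp: S_def)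
  then have "z <= s" using bdd by (simp add: s_def cSup_upper)
  then have ds: "d s = 0" using z by auto
  have le: "d u <= 0" if "u \<in> {s..t}" for u
  proof (cases "u = s")
   case False
   then have "u \<notin> S" using that cSup_upper[OF _ bdd, of u] by (auto simp: s_def)
   then show ?thesis using that s by (auto simp: S_def)
  qed (use ds in simp)
  show ?thesis
  proof (rule that[of s])
   show "(\<Psi> i (\<Phi> i x + t - u), u) \<in> tdomain l" if "u \<in> {s..t}" for u
    using le[OF that] X0[of u] that s s0 by (auto simp: tdomain_iff d_def X_def)
   show "s = s0 \<or> \<Psi> i (\<Phi> i x + t - s) = l s" using ds by (simp add: d_def X_def)
  qed (use s in auto)
 qed
qed

text \<open>The backward path ends either at time \<open>s0\<close> or on the moving boundary, where
  \<open>beta\<close> vanishes by the control law. Both cases are covered by the truncated value at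
  the foot prolonged to time \<open>s0\<close>, which is zero when that foot lies outside the
  domain.\<close>

lemma beta_bound:
 assumes sol: "sol p r W" and xt: "(x, t) \<in> tdomain l" and s0: "0 <= s0" "s0 <= t" and T: "s0 <= T"
 shows "\<bar>beta p r W i (x, t)\<bar> <= (\<bar>cut T (beta p r W i) (\<Psi> i (\<Phi> i x + t - s0), s0)\<bar> + M * integral {s0..t} (coupling p r W i)) * exp (M * (t - s0))"
proof -
 obtain s where s: "s \<in> {s0..t}" "\<And>u. u \<in> {s..t} ==> (\<Psi> i (\<Phi> i x + t - u), u) \<in> tdomain l"
  "s = s0 \<or> \<Psi> i (\<Phi> i x + t - s) = l s"
  by (rule characteristic_backward[OF xt s0, of i]) blast
 have st: "0 <= s" "s <= t" using s(1) s0 by auto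
 have "\<bar>beta p r W i (\<Psi> i (\<Phi> i x + t - t), t)\<bar> <= (\<bar>beta p r W i (\<Psi> i (\<Phi> i x + t - s), s)\<bar> + M * integral {s..t} (coupling p r W i)) * exp (M * (t - s))"
  by (rule beta_gronwall[OF sol st s(2)])
 also have "... <= (\<bar>cut T (beta p r W i) (\<Psi> i (\<Phi> i x + t - s0), s0)\<bar> + M * integral {s0..t} (coupling p r W i)) * exp (M * (t - s0))"
 proof (rule mult_mono)
  have "integral {s..t} (coupling p r W i) <= integral {s0..t} (coupling p r W i)"
   by (intro integral_subset_le coupling_integrable[OF sol] coupling_nonneg) (use s(1) s0 coupling_nonneg in auto)
  then have 1: "M * integral {s..t} (coupling p r W i) <= M * integral {s0..t} (coupling p r W i)" by (rule mult_left_mono[OF _ M0])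
  have 2: "\<bar>beta p r W i (\<Psi> i (\<Phi> i x + t - s), s)\<bar> <= \<bar>cut T (beta p r W i) (\<Psi> i (\<Phi> i x + t - s0), s0)\<bar>"
   using s(3)
  proof
   assume e: "s = s0"
   have "(\<Psi> i (\<Phi> i x + t - s0), s0) \<in> tdomain l" using s(2)[of s0] st e by auto
   then show ?thesis using e T by (simp add: cut_in)
  next
   assume "\<Psi> i (\<Phi> i x + t - s) = l s"
   then show ?thesis using solD(7)[OF sol st(1)] by simp
  qed
  show "\<bar>beta p r W i (\<Psi> i (\<Phi> i x + t - s), s)\<bar> + M * integral {s..t} (coupling p r W i)
    <= \<bar>cut T (beta p r W i) (\<Psi> i (\<Phi> i x + t - s0), s0)\<bar> + M * integral {s0..t} (coupling p r W i)"
   using 1 2 by linarith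
  show "exp (M * (t - s)) <= exp (M * (t - s0))" using s(1) M0 by (simp add: mult_left_mono)
  have "0 <= integral {s0..t} (coupling p r W i)"
   by (intro integral_nonneg coupling_integrable[OF sol s0(1)] coupling_nonneg)
  then show "0 <= \<bar>cut T (beta p r W i) (\<Psi> i (\<Phi> i x + t - s0), s0)\<bar> + M * integral {s0..t} (coupling p r W i)"
   using M0 by simp
 qed simp
 finally show ?thesis by simp
qed

lemma cut_beyond: "L < x ==> cut T f (x, t) = 0"
 using tdomain_le_L by (force simp: cut_def)

text \<open>The crossing times of the two components in succession, with slack 1 for strict
  inequalities.\<close>

definition T0 :: real where "T0 = \<Phi> 1 L + \<Phi> 2 L + 1"

lemma T0_pos: "0 < T0" "0 < \<Phi> i L"
proof -
 show p: "0 < \<Phi> i L" for i using L0 by simp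
 show "0 < T0" unfolding T0_def using p[of 1] p[of 2] by linarith
qed

text \<open>Prolonged backward for more than one crossing time, a left-going characteristic has its
  foot beyond \<open>L\<close>, where the truncation is zero. Component 1 has no driving term, so it
  vanishes; once its trace is gone, the same argument applies to component 2.\<close>

lemma beta_vanishes:
 assumes sol: "sol p r W" and xt: "(x, t) \<in> tdomain l" and t: "T0 <= t"
 shows "beta p r W i (x, t) = 0"
proof -
 have x0: "0 <= x" if "(x, t) \<in> tdomain l" for x t using that by (simp add: tdomain_iff)
 have z: "cut s0 (beta p r W i) (\<Psi> i (\<Phi> i x + t - s0), s0) = 0" if "(x, t) \<in> tdomain l" "\<Phi> i L < t - s0" for x t s0 i
 proof (rule cut_beyond)
  have "\<Phi> i L < \<Phi> i x + t - s0" using x0[OF that(1)] that(2) \<Phi>_nonneg_iff[of i x] by linarith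
  then show "L < \<Psi> i (\<Phi> i x + t - s0)" using \<Psi>_less_iff[of i "\<Phi> i L"] by simp
 qed
 have b1: "beta p r W 1 (x, t) = 0" if xt: "(x, t) \<in> tdomain l" "\<Phi> 1 L < t" for x t
 proof -
  have "\<bar>beta p r W 1 (x, t)\<bar> <= (\<bar>cut 0 (beta p r W 1) (\<Psi> 1 (\<Phi> 1 x + t - 0), 0)\<bar> + M * integral {0..t} (coupling p r W 1)) * exp (M * (t - 0))"
   by (rule beta_bound[OF sol xt(1)]) (use xt in \<open>auto simp: tdomain_iff\<close>)
  also have "... = 0" using z[OF xt(1), of 1 0] xt(2) by (simp add: coupling_def[abs_def])
  finally show ?thesis by simp
 qed
 show ?thesis
 proof (cases "i = 1")
  case True
  then show ?thesis using b1[OF xt] t T0_pos(2)[of 2] unfolding T0_def by auto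
 next
  case False
  then have i: "i = 2" using exhaust_2[of i] by auto
  \<comment> \<open>Half of the slack in \<open>T0\<close> is spent on each component.\<close>
  define s0 where "s0 = \<Phi> 1 L + 1/2"
  have s0: "0 <= s0" "s0 <= t" "\<Phi> 2 L < t - s0" "\<Phi> 1 L < s0"
   using t T0_pos(2)[of 1] T0_pos(2)[of 2] unfolding s0_def T0_def by linarith+
  have "integral {s0..t} (coupling p r W 2) = integral {s0..t} (\<lambda>_. 0)"
   by (rule integral_cong) (use b1[OF origin_in] s0 in \<open>auto simp: coupling_def\<close>)
  moreover have "\<bar>beta p r W 2 (x, t)\<bar> <= (\<bar>cut s0 (beta p r W 2) (\<Psi> 2 (\<Phi> 2 x + t - s0), s0)\<bar> + M * integral {s0..t} (coupling p r W 2)) * exp (M * (t - s0))"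
   by (rule beta_bound[OF sol xt s0(1,2) order_refl])
  ultimately show ?thesis using z[OF xt s0(3)] i by simp
 qed
qed

section \<open>L2 estimates for the transformed state and the boundary state\<close>

definition wsum :: "(4 => real => real) => real => real" where
 "wsum W t = (\<Sum>k\<in>UNIV. \<bar>W k t\<bar>)"

lemma wsum_nonneg: "0 <= wsum W t"
 by (simp add: wsum_def sum_nonneg)

lemma sum_abs_wsum: "\<bar>\<Sum>k\<in>UNIV. c k * W k t\<bar> <= M * wsum W t" if "\<And>k. \<bar>c k\<bar> <= M"
proof -
 have "\<bar>\<Sum>k\<in>UNIV. c k * W k t\<bar> <= (\<Sum>k\<in>UNIV. \<bar>c k * W k t\<bar>)" by (rule sum_abs)
 also have "... <= (\<Sum>k\<in>UNIV. M * \<bar>W k t\<bar>)"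
  by (intro sum_mono) (simp add: abs_mult that mult_right_mono)
 finally show ?thesis by (simp add: wsum_def sum_distrib_left)
qed

definition zsum :: "real => field => real \<times> real => real" where
 "zsum T p z = (\<Sum>j\<in>UNIV. \<bar>cut T (p j) z\<bar>)"

lemma zsum_nonneg: "0 <= zsum T p z"
 by (simp add: zsum_def sum_nonneg)

lemma zsum_bm: "(\<And>j. bm (cut T (p j))) ==> bm (zsum T p)"
 unfolding zsum_def by (intro bm_sum bm_abs)

lemma sol_bm:
 assumes "sol p r W"
 shows "bm (cut T (p j))" "bm (cut T (r j))" "bm (cut T (beta p r W j))" "bm (zsum T p)" "bm (zsum T r)" "bm (zsum T (beta p r W))"
 using cut_bm[OF solD(1)[OF assms]] cut_bm[OF solD(2)[OF assms]] beta_cut_bm[OF assms] by (auto intro: zsum_bm)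

lemma cut_bm_slice: "bm (cut T f) ==> bm (\<lambda>x. cut T f (x, t))"
 by (rule bm_pair_swap(2))

lemma beta_minus_r:
 assumes sol: "sol p r W" and xt: "(x, t) \<in> tdomain l" "t <= T"
 shows "\<bar>beta p r W i (x, t) - r i (x, t)\<bar> <= M * integral {0..x} (\<lambda>y. zsum T p (y, t)) + M * integral {0..x} (\<lambda>y. zsum T r (y, t)) + M * wsum W t"
proof -
 have I: "\<bar>\<Sum>j\<in>UNIV. integral {0..x} (\<lambda>y. K j (x, y) * f j (y, t))\<bar> <= M * integral {0..x} (\<lambda>y. zsum T f (y, t))"
  if K: "\<And>j. bm (K j)" "\<And>j z. \<bar>K j z\<bar> <= M" and f: "\<And>j. bm (cut T (f j))" for K f :: "2 => real \<times> real => real"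
 proof -
  have "\<bar>integral {0..x} (\<lambda>y. K j (x, y) * f j (y, t))\<bar> <= M * integral {0..x} (\<lambda>y. \<bar>cut T (f j) (y, t)\<bar>)" for j
  proof -
   have e: "integral {0..x} (\<lambda>y. K j (x, y) * f j (y, t)) = integral {0..x} (\<lambda>y. K j (x, y) * cut T (f j) (y, t))"
    using xt(2) by (intro integral_cong) (auto simp: cut_in tdomain_below[OF xt(1)])
   have "norm (integral {0..x} (\<lambda>y. K j (x, y) * cut T (f j) (y, t))) <= integral {0..x} (\<lambda>y. M * \<bar>cut T (f j) (y, t)\<bar>)"
    by (rule integral_norm_bound_integral)
      (auto intro!: bm_integrable_on bm_mult bm_pair_swap K f bm_const bm_abs cut_bm_slice mult_right_mono simp: abs_mult)
   then show ?thesis unfolding e by simp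
  qed
  then have "\<bar>\<Sum>j\<in>UNIV. integral {0..x} (\<lambda>y. K j (x, y) * f j (y, t))\<bar> <= (\<Sum>j\<in>UNIV. M * integral {0..x} (\<lambda>y. \<bar>cut T (f j) (y, t)\<bar>))"
   by (intro order_trans[OF sum_abs] sum_mono)
  also have "... = M * integral {0..x} (\<lambda>y. zsum T f (y, t))"
   unfolding zsum_def sum_distrib_left[symmetric]
   by (subst integral_sum) (auto intro!: bm_integrable_on bm_abs cut_bm_slice f)
  finally show ?thesis .
 qed
 have "\<bar>\<Sum>k\<in>UNIV. lam i k x * W k t\<bar> <= M * wsum W t" by (rule sum_abs_wsum[OF lam_le])
 then show ?thesis
  using I[of "F i" p] I[of "N i" r] K_bm F_le N_le sol_bm[OF sol] unfolding beta_def fst_conv snd_conv by fastforce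
qed

definition en :: "field => field => (4 => real => real) => real => real" where
 "en p r W t = integral {0..l t} (\<lambda>x. \<Sum>j\<in>UNIV. (p j (x, t))\<^sup>2 + (r j (x, t))\<^sup>2) + (\<Sum>k\<in>UNIV. (W k t)\<^sup>2)"

text \<open>The interval is fixed: truncation makes this the squared norm over the moving interval
  for times in \<open>{0..T}\<close>, and keeps it measurable in time.\<close>

definition sq :: "real => field => real => real" where
 "sq T p t = integral {0..L} (\<lambda>x. \<Sum>j\<in>UNIV. (cut T (p j) (x, t))\<^sup>2)"

lemma sq_nonneg: "(\<And>j. bm (cut T (p j))) ==> 0 <= sq T p t"
 unfolding sq_def by (intro bm_integral_nonneg bm_sum bm_power cut_bm_slice) (auto intro: sum_nonneg)

lemma wsum_sq: "(wsum W t)\<^sup>2 <= 4 * (\<Sum>k\<in>UNIV. (W k t)\<^sup>2)"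
proof -
 have "(a + b + c + d)\<^sup>2 <= 4 * (a\<^sup>2 + b\<^sup>2 + c\<^sup>2 + d\<^sup>2)" for a b c d :: real
  using sum_squares_bound[of a b] sum_squares_bound[of a c] sum_squares_bound[of b c]
   sum_squares_bound[of a d] sum_squares_bound[of b d] sum_squares_bound[of c d]
  by (simp add: power2_eq_square algebra_simps)
 from this[of "\<bar>W 1 t\<bar>" "\<bar>W 2 t\<bar>" "\<bar>W 3 t\<bar>" "\<bar>W 4 t\<bar>"] show ?thesis by (simp add: wsum_def sum_4)
qed

lemma sum_sq_le_wsum: "(\<Sum>k\<in>UNIV. (W k t)\<^sup>2) <= (wsum W t)\<^sup>2"
proof -
 have "(\<Sum>k\<in>UNIV. (W k t)\<^sup>2) <= (\<Sum>k\<in>UNIV. \<bar>W k t\<bar> * wsum W t)"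
 proof (rule sum_mono)
  fix k
  have "\<bar>W k t\<bar> <= wsum W t" unfolding wsum_def by (rule member_le_sum) auto
  then have "\<bar>W k t\<bar> * \<bar>W k t\<bar> <= \<bar>W k t\<bar> * wsum W t" by (rule mult_left_mono) simp
  then show "(W k t)\<^sup>2 <= \<bar>W k t\<bar> * wsum W t" by (simp add: power2_eq_square)
 qed
 then show ?thesis by (simp add: wsum_def power2_eq_square sum_distrib_right)
qed

lemma en_eq:
 assumes sol: "sol p r W" and t: "0 <= t" "t <= T"
 shows "en p r W t = sq T p t + sq T r t + (\<Sum>k\<in>UNIV. (W k t)\<^sup>2)"
proof -
 have "bm (\<lambda>x. \<Sum>j\<in>UNIV. (cut T (p j) (x, t))\<^sup>2 + (cut T (r j) (x, t))\<^sup>2)"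
  by (intro bm_sum bm_add bm_power cut_bm_slice sol_bm[OF sol])
 then have "integral {0..L} (\<lambda>x. \<Sum>j\<in>UNIV. (cut T (p j) (x, t))\<^sup>2 + (cut T (r j) (x, t))\<^sup>2)
   = integral {0..l t} (\<lambda>x. \<Sum>j\<in>UNIV. (cut T (p j) (x, t))\<^sup>2 + (cut T (r j) (x, t))\<^sup>2)"
  by (rule bm_integral_shrink) (use t l_bound[of t] in \<open>auto simp: cut_def tdomain_iff\<close>)
 also have "... = integral {0..l t} (\<lambda>x. \<Sum>j\<in>UNIV. (p j (x, t))\<^sup>2 + (r j (x, t))\<^sup>2)"
  using t by (intro integral_cong sum.cong) (auto simp: cut_in tdomain_iff)
 finally have "integral {0..l t} (\<lambda>x. \<Sum>j\<in>UNIV. (p j (x, t))\<^sup>2 + (r j (x, t))\<^sup>2) = sq T p t + sq T r t"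
  unfolding sq_def sum.distrib
  by (subst (asm) integral_add) (auto intro!: bm_integrable_on bm_sum bm_power cut_bm_slice sol_bm[OF sol])
 then show ?thesis unfolding en_def by simp
qed

lemma zsum_sq: "(zsum T p z)\<^sup>2 <= 2 * (\<Sum>j\<in>UNIV. (cut T (p j) z)\<^sup>2)"
 using power2_sum2_le[of "\<bar>cut T (p 1) z\<bar>" "\<bar>cut T (p 2) z\<bar>"] by (simp add: zsum_def sum_2')

lemma zsum_L1:
 assumes p: "\<And>j. bm (cut T (p j))" and x: "x <= L"
 shows "0 <= integral {0..x} (\<lambda>y. zsum T p (y, t))" "integral {0..x} (\<lambda>y. zsum T p (y, t)) <= integral {0..L} (\<lambda>y. zsum T p (y, t))"
  "(integral {0..L} (\<lambda>y. zsum T p (y, t)))\<^sup>2 <= 2 * L * sq T p t" "integral {0..L} (\<lambda>y. (zsum T p (y, t))\<^sup>2) <= 2 * sq T p t"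
proof -
 have b: "bm (\<lambda>y. zsum T p (y, t))" by (intro bm_pair_swap(2) zsum_bm p)
 show "0 <= integral {0..x} (\<lambda>y. zsum T p (y, t))" by (intro bm_integral_nonneg b zsum_nonneg)
 show "integral {0..x} (\<lambda>y. zsum T p (y, t)) <= integral {0..L} (\<lambda>y. zsum T p (y, t))"
  using x by (intro integral_subset_le bm_integrable_on b zsum_nonneg) (auto simp: zsum_nonneg)
 have "integral {0..L} (\<lambda>y. (zsum T p (y, t))\<^sup>2) <= integral {0..L} (\<lambda>y. 2 * (\<Sum>j\<in>UNIV. (cut T (p j) (y, t))\<^sup>2))"
  by (intro bm_integral_mono bm_power b bm_mult bm_const bm_sum cut_bm_slice p zsum_sq)
 then show 4: "integral {0..L} (\<lambda>y. (zsum T p (y, t))\<^sup>2) <= 2 * sq T p t" unfolding sq_def by simp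
 have "(integral {0..L} (\<lambda>y. \<bar>zsum T p (y, t)\<bar>))\<^sup>2 <= (L - 0) * integral {0..L} (\<lambda>y. (zsum T p (y, t))\<^sup>2)"
  using L0 by (intro bm_cauchy_schwarz b) auto
 also have "... <= (L - 0) * (2 * sq T p t)" using L0 by (intro mult_left_mono 4) auto
 finally show "(integral {0..L} (\<lambda>y. zsum T p (y, t)))\<^sup>2 <= 2 * L * sq T p t" using zsum_nonneg by simp
qed

text \<open>The Volterra terms are bounded by L1 norms and these by L2 norms over an interval of
  length \<open>L\<close>; the numerical constants are rounded up.\<close>

lemma beta_sq:
 assumes sol: "sol p r W" and t: "0 <= t" "t <= T"
 shows "sq T (beta p r W) t <= (6 + 100 * M\<^sup>2 * L * (L + 1)) * en p r W t"
proof -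
 define A where "A = integral {0..L} (\<lambda>y. zsum T p (y, t)) + integral {0..L} (\<lambda>y. zsum T r (y, t))"
 note z1 = zsum_L1[where p=p and T=T and t=t, OF sol_bm(1)[OF sol]] and z2 = zsum_L1[where p=r and T=T and t=t, OF sol_bm(2)[OF sol]]
 have A: "0 <= A" "A\<^sup>2 <= 4 * L * (sq T p t + sq T r t)"
 proof -
  show "0 <= A" unfolding A_def using z1(1)[of L] z2(1)[of L] by simp
  show "A\<^sup>2 <= 4 * L * (sq T p t + sq T r t)"
   unfolding A_def using power2_sum2_le[of "integral {0..L} (\<lambda>y. zsum T p (y, t))" "integral {0..L} (\<lambda>y. zsum T r (y, t))"] z1(3)[of L] z2(3)[of L]
   by (simp add: algebra_simps)
 qed
 have pt: "(cut T (beta p r W j) (x, t))\<^sup>2 <= 3 * (cut T (r j) (x, t))\<^sup>2 + 3 * M\<^sup>2 * A\<^sup>2 + 3 * M\<^sup>2 * (wsum W t)\<^sup>2" for j x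
 proof (cases "(x, t) \<in> tdomain l")
  case True
  have "\<bar>beta p r W j (x, t) - r j (x, t)\<bar> <= M * integral {0..x} (\<lambda>y. zsum T p (y, t)) + M * integral {0..x} (\<lambda>y. zsum T r (y, t)) + M * wsum W t"
   by (rule beta_minus_r[OF sol True t(2)])
  moreover have "M * integral {0..x} (\<lambda>y. zsum T p (y, t)) + M * integral {0..x} (\<lambda>y. zsum T r (y, t)) <= M * A"
   unfolding A_def distrib_left using z1(2)[of x] z2(2)[of x] tdomain_le_L[OF True] M0
   by (intro add_mono mult_left_mono) auto
  ultimately have "\<bar>beta p r W j (x, t)\<bar> <= \<bar>r j (x, t)\<bar> + M * A + M * wsum W t" by linarith
  from order_trans[OF power2_abs_le[OF this] power2_sum3_le] show ?thesis
   using True t by (simp add: cut_in power_mult_distrib algebra_simps)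
 qed (simp add: cut_def)
 have "sq T (beta p r W) t <= integral {0..L} (\<lambda>x. 3 * (\<Sum>j\<in>UNIV. (cut T (r j) (x, t))\<^sup>2) + (6 * M\<^sup>2 * A\<^sup>2 + 6 * M\<^sup>2 * (wsum W t)\<^sup>2))"
  unfolding sq_def
  by (intro bm_integral_mono bm_sum bm_add bm_mult bm_const bm_power cut_bm_slice sol_bm[OF sol])
    (use pt[of 1] pt[of 2] in \<open>simp add: sum_2' algebra_simps, smt (verit)\<close>)
 also have "... = 3 * sq T r t + L * (6 * M\<^sup>2 * A\<^sup>2 + 6 * M\<^sup>2 * (wsum W t)\<^sup>2)"
 proof (rule integral_unique)
  show "((\<lambda>x. 3 * (\<Sum>j\<in>UNIV. (cut T (r j) (x, t))\<^sup>2) + (6 * M\<^sup>2 * A\<^sup>2 + 6 * M\<^sup>2 * (wsum W t)\<^sup>2)) has_integral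
   3 * sq T r t + L * (6 * M\<^sup>2 * A\<^sup>2 + 6 * M\<^sup>2 * (wsum W t)\<^sup>2)) {0..L}"
   unfolding sq_def using has_integral_const_real[of "6 * M\<^sup>2 * A\<^sup>2 + 6 * M\<^sup>2 * (wsum W t)\<^sup>2" 0 L] L0
   by (intro has_integral_add has_integral_mult_right bm_has_integral bm_sum bm_power cut_bm_slice sol_bm[OF sol]) (simp add: mult.commute)
 qed
 also have "... <= 3 * sq T r t + L * (6 * M\<^sup>2 * (4 * L * (sq T p t + sq T r t)) + 6 * M\<^sup>2 * (4 * (\<Sum>k\<in>UNIV. (W k t)\<^sup>2)))"
  using A(2) wsum_sq[of W t] L0 by (intro add_mono mult_left_mono order_refl) auto
 also have "... <= (6 + 100 * M\<^sup>2 * L * (L + 1)) * en p r W t"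
 proof -
  define S where "S = (\<Sum>k\<in>UNIV. (W k t)\<^sup>2)"
  define a where "a = M\<^sup>2 * L * L"
  define b where "b = M\<^sup>2 * L"
  have nn: "0 <= S" "0 <= a" "0 <= b" "0 <= sq T p t" "0 <= sq T r t"
   unfolding S_def a_def b_def using L0 sq_nonneg[OF sol_bm(1)[OF sol]] sq_nonneg[OF sol_bm(2)[OF sol]] by (auto intro: sum_nonneg)
  have "3 * sq T r t + L * (6 * M\<^sup>2 * (4 * L * (sq T p t + sq T r t)) + 6 * M\<^sup>2 * (4 * S))
    = 3 * sq T r t + 24 * (a * sq T p t) + 24 * (a * sq T r t) + 24 * (b * S)" unfolding a_def b_def by (simp add: algebra_simps)
  also have "... <= 6 * (sq T p t + sq T r t + S) + 100 * (a * sq T p t + a * sq T r t + a * S) + 100 * (b * sq T p t + b * sq T r t + b * S)"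
  proof -
   have "3 * y + 24 * u + 24 * v + 24 * w <= 6 * (x + y + z) + 100 * (u + v + u') + 100 * (v' + w' + w)"
    if "0 <= x" "0 <= y" "0 <= z" "0 <= u" "0 <= v" "0 <= u'" "0 <= v'" "0 <= w'" "0 <= w" for x y z u v w u' v' w' :: real
    using that by simp
   from this[OF nn(4,5,1) mult_nonneg_nonneg[OF nn(2) nn(4)] mult_nonneg_nonneg[OF nn(2) nn(5)] mult_nonneg_nonneg[OF nn(2) nn(1)]
    mult_nonneg_nonneg[OF nn(3) nn(4)] mult_nonneg_nonneg[OF nn(3) nn(5)] mult_nonneg_nonneg[OF nn(3) nn(1)]]
   show ?thesis .
  qed
  also have "... = (6 + 100 * M\<^sup>2 * L * (L + 1)) * (sq T p t + sq T r t + S)" unfolding a_def b_def by (simp add: algebra_simps)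
  finally show ?thesis unfolding en_eq[OF sol t] S_def .
 qed
 finally show ?thesis .
qed

text \<open>Traces are needed because \<open>W\<close> and the waves entering at the origin are
  driven by values at \<open>x = 0\<close>, which the energy at a single time does not
  control.\<close>

definition tr :: "real => field => 2 => real" where
 "tr T f i = integral {0..T} (\<lambda>u. (cut T (f i) (0, u))\<^sup>2)"

lemma cut_bm_origin: "bm (cut T f) ==> bm (\<lambda>t. cut T f (x, t))"
 by (rule bm_pair_swap(1))

lemma tr_nonneg: "bm (cut T (f i)) ==> 0 <= tr T f i"
 unfolding tr_def by (intro bm_integral_nonneg bm_power cut_bm_origin) auto

lemma coupling_sq:
 assumes sol: "sol p r W" and t: "0 <= t" "t <= T"
 shows "(integral {0..t} (coupling p r W i))\<^sup>2 <= (if i = 1 then 0 else T * tr T (beta p r W) 1)"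
proof (cases "i = 1")
 case True
 then show ?thesis by (simp add: coupling_def[abs_def])
next
 case False
 have b: "bm (\<lambda>u. cut T (beta p r W 1) (0, u))" by (rule cut_bm_origin[OF sol_bm(3)[OF sol]])
 have "integral {0..t} (coupling p r W i) <= integral {0..T} (coupling p r W i)"
  by (intro integral_subset_le coupling_integrable[OF sol]) (use t coupling_nonneg in auto)
 also have "... = integral {0..T} (\<lambda>u. \<bar>cut T (beta p r W 1) (0, u)\<bar>)"
  by (rule integral_cong) (use False origin_in in \<open>auto simp: coupling_def cut_in\<close>)
 finally have "(integral {0..t} (coupling p r W i))\<^sup>2 <= (integral {0..T} (\<lambda>u. \<bar>cut T (beta p r W 1) (0, u)\<bar>))\<^sup>2"
  by (intro power_mono integral_nonneg coupling_integrable[OF sol] coupling_nonneg) auto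
 also have "... <= (T - 0) * tr T (beta p r W) 1" unfolding tr_def
  by (rule bm_cauchy_schwarz[OF b]) (use t in auto)
 finally show ?thesis using False by simp
qed

text \<open>\<open>\<Psi> i (\<Phi> i x + t)\<close> is the foot at time 0 of the left-going
  characteristic through \<open>(x, t)\<close>. Squaring costs a factor 2 and doubles the exponent;
  the driving term enters through Cauchy-Schwarz.\<close>

lemma beta_point_sq:
 assumes sol: "sol p r W" and xt: "(x, t) \<in> tdomain l" "t <= T"
 shows "(beta p r W i (x, t))\<^sup>2 <= 2 * exp (2 * M * T) *
  ((cut T (beta p r W i) (\<Psi> i (\<Phi> i x + t), 0))\<^sup>2 + M\<^sup>2 * (if i = 1 then 0 else T * tr T (beta p r W) 1))"
proof -
 have t: "0 <= t" using xt by (simp add: tdomain_iff)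
 let ?f = "cut T (beta p r W i) (\<Psi> i (\<Phi> i x + t), 0)" and ?G = "integral {0..t} (coupling p r W i)"
 have "\<bar>beta p r W i (x, t)\<bar> <= (\<bar>?f\<bar> + M * ?G) * exp (M * t)"
  using beta_bound[OF sol xt(1), of 0 T i] t xt(2) by simp
 then have "(beta p r W i (x, t))\<^sup>2 <= ((\<bar>?f\<bar> + M * ?G) * exp (M * t))\<^sup>2" by (rule power2_abs_le)
 also have "... = (\<bar>?f\<bar> + M * ?G)\<^sup>2 * exp (2 * M * t)" by (simp add: power_mult_distrib exp_double[symmetric] mult.assoc)
 also have "... <= (2 * (\<bar>?f\<bar>\<^sup>2 + (M * ?G)\<^sup>2)) * exp (2 * M * T)"
  using xt(2) M0 t by (intro mult_mono power2_sum2_le) (auto simp: mult_left_mono)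
 also have "... <= (2 * (?f\<^sup>2 + M\<^sup>2 * (if i = 1 then 0 else T * tr T (beta p r W) 1))) * exp (2 * M * T)"
  using coupling_sq[OF sol t xt(2), of i]
  by (intro mult_right_mono mult_left_mono add_mono) (auto simp: power_mult_distrib intro: mult_left_mono)
 finally show ?thesis by (simp only: mult_ac)
qed

lemma slice_le_sq:
 assumes "\<And>j. bm (cut T (f j))"
 shows "integral {0..L} (\<lambda>x. (cut T (f i) (x, t))\<^sup>2) <= sq T f t"
 unfolding sq_def
proof (intro bm_integral_mono bm_power bm_sum cut_bm_slice assms)
 fix x show "(cut T (f i) (x, t))\<^sup>2 <= (\<Sum>j\<in>UNIV. (cut T (f j) (x, t))\<^sup>2)" by (rule member_le_sum) auto
qed

lemma cut_outside: "x \<notin> {0..L} ==> cut T f (x, t) = 0"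
 using tdomain_le_L[of x t] by (auto simp: cut_def)

lemma foot_deriv: "((\<lambda>x. \<Psi> i (\<Phi> i x + a)) has_real_derivative q i (\<Psi> i (\<Phi> i x + a)) * (1 / q i x)) (at x)"
 by (rule DERIV_chain2[where f="\<Psi> i" and g="\<lambda>x. \<Phi> i x + a", OF \<Psi>_deriv]) (auto intro!: derivative_eq_intros \<Phi>_deriv)

text \<open>The derivative of the foot with respect to \<open>x\<close> is the speed at the foot
  divided by the speed at \<open>x\<close>, at least \<open>qa / qb\<close>.\<close>

lemma foot_integral_le:
 assumes f: "bm f" "\<And>x. 0 <= f x" "\<And>x. x \<notin> {0..L} ==> f x = 0"
 shows "integral {0..L} (\<lambda>x. f (\<Psi> i (\<Phi> i x + a))) <= qb / qa * integral {0..L} f"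
proof -
 have "integral {0..L} (\<lambda>x. f (\<Psi> i (\<Phi> i x + a))) <= integral {0..L} f / (qa / qb)"
 proof (rule bm_integral_substitution_le[OF f foot_deriv])
  show "continuous_on UNIV (\<lambda>x. q i (\<Psi> i (\<Phi> i x + a)) * (1 / q i x))"
   by (intro continuous_intros continuous_on_compose2[OF q_cont] continuous_on_compose2[OF \<Psi>_continuous[of UNIV]] \<Phi>_continuous) (auto simp: q_ne)
  show "0 < qa / qb" using qa qb by simp
  show "qa / qb <= q i (\<Psi> i (\<Phi> i x + a)) * (1 / q i x)" for x
   using frac_le[of "q i (\<Psi> i (\<Phi> i x + a))" qa "q i x" qb] q_ge q_le q_pos qa by (simp add: less_imp_le)
 qed
 then show ?thesis using qa qb by (simp add: field_simps)
qed

text \<open>A value at the origin at time \<open>u\<close> goes back to the foot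
  \<open>\<Psi> i u\<close> at time 0, and this foot moves with speed at least \<open>qa\<close> as
  \<open>u\<close> varies; so the trace is bounded by the initial L2 norm. For component 2 the trace
  of component 1 enters as well.\<close>

lemma tr_beta:
 assumes sol: "sol p r W" and T: "0 <= T"
 shows "tr T (beta p r W) i <= 2 * exp (2 * M * T) * (sq T (beta p r W) 0 / qa + T * M\<^sup>2 * (if i = 1 then 0 else T * tr T (beta p r W) 1))"
proof -
 let ?K = "M\<^sup>2 * (if i = 1 then 0 else T * tr T (beta p r W) 1)" and ?f = "\<lambda>y. (cut T (beta p r W i) (y, 0))\<^sup>2"
 have fb: "bm ?f" by (intro bm_power cut_bm_slice sol_bm[OF sol])
 have mP: "\<Psi> i \<in> borel_measurable borel" by (rule borel_contI[OF \<Psi>_continuous])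
 have "tr T (beta p r W) i <= integral {0..T} (\<lambda>u. 2 * exp (2 * M * T) * (?f (\<Psi> i u) + ?K))"
  unfolding tr_def[of T _ i]
 proof (intro bm_integral_mono bm_power cut_bm_origin sol_bm[OF sol] bm_mult bm_const bm_add bm_comp[OF cut_bm_slice[OF sol_bm(3)[OF sol]] mP])
  fix u assume u: "u \<in> {0..T}"
  then show "(cut T (beta p r W i) (0, u))\<^sup>2 <= 2 * exp (2 * M * T) * (?f (\<Psi> i u) + ?K)"
   using beta_point_sq[OF sol origin_in[of u], of T i] by (simp add: cut_in origin_in \<Phi>_0)
 qed
 also have "... = 2 * exp (2 * M * T) * (integral {0..T} (\<lambda>u. ?f (\<Psi> i u)) + T * ?K)"
 proof (rule integral_unique)
  show "((\<lambda>u. 2 * exp (2 * M * T) * (?f (\<Psi> i u) + ?K)) has_integral 2 * exp (2 * M * T) * (integral {0..T} (\<lambda>u. ?f (\<Psi> i u)) + T * ?K)) {0..T}"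
   using has_integral_const_real[of ?K 0 T] T
   by (intro has_integral_mult_right has_integral_add bm_has_integral bm_comp[OF fb mP]) (simp add: mult.commute)
 qed
 also have "integral {0..T} (\<lambda>u. ?f (\<Psi> i u)) <= integral {0..L} ?f / qa"
 proof (rule bm_integral_substitution_le[OF fb _ _ \<Psi>_deriv _ qa])
  show "continuous_on UNIV (\<lambda>x. q i (\<Psi> i x))"
   by (intro continuous_on_compose2[OF q_cont] \<Psi>_continuous) auto
 qed (auto simp: cut_outside q_ge)
 also have "integral {0..L} ?f / qa <= sq T (beta p r W) 0 / qa"
  using slice_le_sq[where f="beta p r W" and T=T and i=i and t=0, OF sol_bm(3)[OF sol]] qa by (simp add: divide_right_mono)
 finally show ?thesis by (simp add: mult.assoc)
qed

text \<open>The driving term is nonnegative, so adding it for component 1 too gives one estimate for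
  both components.\<close>

lemma sq_beta:
 assumes sol: "sol p r W" and t: "0 <= t" "t <= T"
 shows "sq T (beta p r W) t <= 2 * exp (2 * M * T) * (2 * (qb / qa) * sq T (beta p r W) 0 + 2 * L * M\<^sup>2 * (T * tr T (beta p r W) 1))"
proof -
 have "integral {0..L} (\<lambda>x. (cut T (beta p r W i) (x, t))\<^sup>2) <= 2 * exp (2 * M * T) * (qb / qa * sq T (beta p r W) 0 + L * M\<^sup>2 * (T * tr T (beta p r W) 1))" for i
 proof -
  let ?K = "M\<^sup>2 * (T * tr T (beta p r W) 1)" and ?f = "\<lambda>y. (cut T (beta p r W i) (y, 0))\<^sup>2"
  have K0: "0 <= T * tr T (beta p r W) 1" using t tr_nonneg[OF sol_bm(3)[OF sol]] by simp
  have fb: "bm ?f" by (intro bm_power cut_bm_slice sol_bm[OF sol])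
  have mP: "(\<lambda>x. \<Psi> i (\<Phi> i x + t)) \<in> borel_measurable borel"
   by (intro borel_contI continuous_intros continuous_on_compose2[OF \<Psi>_continuous[of UNIV]] \<Phi>_continuous) auto
  have "integral {0..L} (\<lambda>x. (cut T (beta p r W i) (x, t))\<^sup>2) <= integral {0..L} (\<lambda>x. 2 * exp (2 * M * T) * (?f (\<Psi> i (\<Phi> i x + t)) + ?K))"
  proof (intro bm_integral_mono bm_power cut_bm_slice sol_bm[OF sol] bm_mult bm_const bm_add bm_comp[OF cut_bm_slice[OF sol_bm(3)[OF sol]] mP])
   fix x
   show "(cut T (beta p r W i) (x, t))\<^sup>2 <= 2 * exp (2 * M * T) * (?f (\<Psi> i (\<Phi> i x + t)) + ?K)"
   proof (cases "(x, t) \<in> tdomain l")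
    case True
    have "(beta p r W i (x, t))\<^sup>2 <= 2 * exp (2 * M * T) * (?f (\<Psi> i (\<Phi> i x + t)) + M\<^sup>2 * (if i = 1 then 0 else T * tr T (beta p r W) 1))"
     by (rule beta_point_sq[OF sol True t(2)])
    also have "... <= 2 * exp (2 * M * T) * (?f (\<Psi> i (\<Phi> i x + t)) + ?K)"
     using K0 by (intro mult_left_mono add_left_mono) auto
    finally show ?thesis using True t by (simp add: cut_in)
   qed (use K0 in \<open>simp add: cut_def[of _ _ "(x, t)"]\<close>)
  qed
  also have "... = 2 * exp (2 * M * T) * (integral {0..L} (\<lambda>x. ?f (\<Psi> i (\<Phi> i x + t))) + L * ?K)"
  proof (rule integral_unique)
   show "((\<lambda>x. 2 * exp (2 * M * T) * (?f (\<Psi> i (\<Phi> i x + t)) + ?K)) has_integral 2 * exp (2 * M * T) * (integral {0..L} (\<lambda>x. ?f (\<Psi> i (\<Phi> i x + t))) + L * ?K)) {0..L}"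
    using has_integral_const_real[of ?K 0 L] L0
    by (intro has_integral_mult_right has_integral_add bm_has_integral bm_comp[OF fb mP]) (simp add: mult.commute)
  qed
  also have "integral {0..L} (\<lambda>x. ?f (\<Psi> i (\<Phi> i x + t))) <= qb / qa * integral {0..L} ?f"
   by (rule foot_integral_le[OF fb]) (auto simp: cut_outside)
  also have "qb / qa * integral {0..L} ?f <= qb / qa * sq T (beta p r W) 0"
   using slice_le_sq[where f="beta p r W" and T=T and i=i and t=0, OF sol_bm(3)[OF sol]] qa qb by (intro mult_left_mono) auto
  finally show ?thesis by (simp add: mult.assoc)
 qed
 from add_mono[OF this[of 1] this[of 2]]
 have "integral {0..L} (\<lambda>x. (cut T (beta p r W 1) (x, t))\<^sup>2) + integral {0..L} (\<lambda>x. (cut T (beta p r W 2) (x, t))\<^sup>2)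
   <= 2 * exp (2 * M * T) * (2 * (qb / qa) * sq T (beta p r W) 0 + 2 * L * M\<^sup>2 * (T * tr T (beta p r W) 1))"
  by (simp add: algebra_simps)
 moreover have "sq T (beta p r W) t = integral {0..L} (\<lambda>x. (cut T (beta p r W 1) (x, t))\<^sup>2) + integral {0..L} (\<lambda>x. (cut T (beta p r W 2) (x, t))\<^sup>2)"
  unfolding sq_def sum_2' by (rule integral_add) (intro bm_integrable_on bm_power cut_bm_slice sol_bm[OF sol])+
 ultimately show ?thesis by simp
qed

text \<open>At the origin \<open>r\<close> is \<open>beta\<close> plus a linear combination of
  \<open>W\<close>, so the equation for \<open>W\<close> closes up to forcing by the trace of
  \<open>beta\<close>, and Gronwall applies.\<close>

lemma wsum_bound:
 assumes sol: "sol p r W" and t: "0 <= t" "t <= T"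
 shows "wsum W t <= (wsum W 0 + 8 * M * integral {0..T} (\<lambda>u. zsum T (beta p r W) (0, u))) * exp (20 * M\<^sup>2 * T)"
proof -
 let ?z = "\<lambda>u. zsum T (beta p r W) (0, u)"
 have zb: "bm ?z" by (rule bm_pair_swap(1)[OF sol_bm(6)[OF sol]])
 have wc: "continuous_on {0..} (wsum W)" unfolding wsum_def by (intro continuous_intros W_continuous[OF sol])
 have wi: "wsum W integrable_on {a..b}" if "0 <= a" for a b
  by (intro integrable_continuous_real continuous_on_subset[OF wc]) (use that in auto)
 have T: "0 <= T" using t by simp
 have MM: "M <= M\<^sup>2" using M1 M0 by (simp add: power2_eq_square mult_le_cancel_left1)
 define dW where "dW k u = (\<Sum>m\<in>UNIV. Am k m * W m u) + 2 * (\<Sum>j\<in>UNIV. Bm k j * r j (0, u))" for k u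
 \<comment> \<open>The 5 consists of 1 from \<open>Am\<close>, using \<open>M <= M\<^sup>2\<close>,
   and 4 from the feedback through \<open>Bm\<close> and \<open>lam\<close>. Summing over the four
   components gives the 20 and the 8 of the statement.\<close>
 have dWb: "\<bar>dW k u\<bar> <= 5 * M\<^sup>2 * wsum W u + 2 * M * ?z u" if u: "u \<in> {0..T}" for k u
 proof -
  have "\<bar>Bm k j * r j (0, u)\<bar> <= M * (\<bar>cut T (beta p r W j) (0, u)\<bar> + M * wsum W u)" for j
  proof -
   have "r j (0, u) = cut T (beta p r W j) (0, u) + (\<Sum>k\<in>UNIV. lam j k 0 * W k u)"
    using u beta_origin[of p r W j u] by (simp add: cut_in origin_in)
   then have "\<bar>r j (0, u)\<bar> <= \<bar>cut T (beta p r W j) (0, u)\<bar> + M * wsum W u"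
    using sum_abs_wsum[where c="\<lambda>k. lam j k 0" and W=W and t=u, OF lam_le] by linarith
   then show ?thesis unfolding abs_mult by (intro mult_mono Bm_le M0) auto
  qed
  from this[of 1] this[of 2] have "\<bar>\<Sum>j\<in>UNIV. Bm k j * r j (0, u)\<bar> <= M * ?z u + 2 * (M * (M * wsum W u))"
   unfolding sum_2' zsum_def by (simp add: distrib_left)
  moreover have "\<bar>\<Sum>m\<in>UNIV. Am k m * W m u\<bar> <= M * wsum W u" by (rule sum_abs_wsum[OF Am_le])
  moreover have "M * wsum W u <= M\<^sup>2 * wsum W u" by (intro mult_right_mono MM wsum_nonneg)
  ultimately show ?thesis unfolding dW_def by (simp add: power2_eq_square)
 qed
 have "wsum W t <= (wsum W 0 + 8 * M * integral {0..T} ?z) * exp (20 * M\<^sup>2 * (t - 0))"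
 proof (rule gronwall[of _ 0 T])
  fix v assume v: "v \<in> {0..T}"
  have Wk: "\<bar>W k v\<bar> <= \<bar>W k 0\<bar> + (5 * M\<^sup>2 * integral {0..v} (wsum W) + 2 * M * integral {0..v} ?z)" for k
  proof -
   have h1: "(dW k has_integral (W k v - W k 0)) {0..v}"
   proof (rule fundamental_theorem_of_calculus)
    fix u assume "u \<in> {0..v}"
    then have "(W k has_real_derivative dW k u) (at u within {0..v})"
     unfolding dW_def using v by (intro DERIV_subset[OF solD(5)[OF sol]]) auto
    then show "(W k has_vector_derivative dW k u) (at u within {0..v})"
     by (simp add: has_real_derivative_iff_has_vector_derivative)
   qed (use v in auto)
   have h2: "((\<lambda>u. 5 * M\<^sup>2 * wsum W u + 2 * M * ?z u) has_integral (5 * M\<^sup>2 * integral {0..v} (wsum W) + 2 * M * integral {0..v} ?z)) {0..v}"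
    by (intro has_integral_add has_integral_mult_right integrable_integral wi bm_integrable_on zb) auto
   have "norm (integral {0..v} (dW k)) <= integral {0..v} (\<lambda>u. 5 * M\<^sup>2 * wsum W u + 2 * M * ?z u)"
    by (rule integral_norm_bound_integral[OF has_integral_integrable[OF h1] has_integral_integrable[OF h2]]) (use dWb v in auto)
   then show ?thesis unfolding integral_unique[OF h1] integral_unique[OF h2] by simp
  qed
  have "wsum W v <= wsum W 0 + 4 * E" if "\<And>k. \<bar>W k v\<bar> <= \<bar>W k 0\<bar> + E" for E
   using that[of 1] that[of 2] that[of 3] that[of 4] by (simp add: wsum_def sum_4)
  from this[OF Wk] have "wsum W v <= wsum W 0 + 4 * (5 * M\<^sup>2 * integral {0..v} (wsum W) + 2 * M * integral {0..v} ?z)" .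
  moreover have "M * integral {0..v} ?z <= M * integral {0..T} ?z"
   by (intro mult_left_mono M0 integral_subset_le bm_integrable_on zb) (use v zsum_nonneg in auto)
  ultimately show "wsum W v <= wsum W 0 + 8 * M * integral {0..T} ?z + 20 * M\<^sup>2 * integral {0..v} (wsum W)" by (simp add: algebra_simps)
 qed (use t wi in auto)
 also have "... <= (wsum W 0 + 8 * M * integral {0..T} ?z) * exp (20 * M\<^sup>2 * T)"
 proof (rule mult_left_mono)
  show "exp (20 * M\<^sup>2 * (t - 0)) <= exp (20 * M\<^sup>2 * T)" using t by (simp add: mult_left_mono)
  show "0 <= wsum W 0 + 8 * M * integral {0..T} ?z"
   using wsum_nonneg[of W 0] M0 bm_integral_nonneg[OF zb zsum_nonneg] by (simp add: add_nonneg_nonneg)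
 qed
 finally show ?thesis .
qed

text \<open>The constant of the Volterra inversion below: the factors \<open>2 * M\<close> count the
  two components of \<open>r\<close>, and the exponential is the Gronwall factor over an interval of
  length \<open>L\<close>.\<close>

definition Kv :: real where "Kv = 2 * M + 2 * M * exp (2 * M * L) * (1 + 2 * M * L)"

lemma Kv0: "0 <= Kv" unfolding Kv_def using M0 L0 by simp

text \<open>Solved for \<open>r\<close>, the definition of \<open>beta\<close> is a Volterra
  equation of the second kind in \<open>x\<close> at a fixed time. Gronwall is applied to the
  indefinite integral of \<open>zsum T r\<close>, and the outcome is inserted once more to return to
  point values.\<close>

lemma volterra_bound:
 assumes sol: "sol p r W" and xt: "(x, t) \<in> tdomain l" "t <= T"
 shows "zsum T r (x, t) <= zsum T (beta p r W) (x, t)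
   + Kv * (integral {0..x} (\<lambda>y. zsum T (beta p r W) (y, t)) + integral {0..x} (\<lambda>y. zsum T p (y, t)) + wsum W t)"
proof -
 let ?zb = "\<lambda>y. zsum T (beta p r W) (y, t)" and ?zp = "\<lambda>y. zsum T p (y, t)" and ?zr = "\<lambda>y. zsum T r (y, t)"
 have bms: "bm ?zb" "bm ?zp" "bm ?zr" by (intro bm_pair_swap(2) sol_bm[OF sol])+
 have x: "0 <= x" "x <= L" using tdomain_le_L[OF xt(1)] by auto
 have pt: "?zr y <= ?zb y + 2 * M * (integral {0..x} ?zp + wsum W t) + 2 * M * integral {0..y} ?zr" if y: "y \<in> {0..x}" for y
 proof -
  have yd: "(y, t) \<in> tdomain l" using tdomain_below[OF xt(1)] y by auto
  have "integral {0..y} ?zp <= integral {0..x} ?zp"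
   by (intro integral_subset_le bm_integrable_on bms) (use y zsum_nonneg in auto)
  then have m: "M * integral {0..y} ?zp <= M * integral {0..x} ?zp" by (rule mult_left_mono[OF _ M0])
  have "\<bar>r j (y, t)\<bar> <= \<bar>beta p r W j (y, t)\<bar> + (M * integral {0..x} ?zp + M * integral {0..y} ?zr + M * wsum W t)" for j
   using beta_minus_r[OF sol yd xt(2), of j] m by linarith
  from this[of 1] this[of 2] show ?thesis
   using yd xt(2) by (simp add: zsum_def sum_2' cut_in algebra_simps)
 qed
 define A where "A = integral {0..x} ?zb + L * (2 * M * (integral {0..x} ?zp + wsum W t))"
 have nn: "0 <= 2 * M * (integral {0..x} ?zp + wsum W t)"
  using M0 wsum_nonneg[of W t] bm_integral_nonneg[OF bms(2) zsum_nonneg] by (intro mult_nonneg_nonneg add_nonneg_nonneg) auto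
 have ci: "continuous_on {0..x} (\<lambda>y. integral {0..y} ?zr)"
  by (rule indefinite_integral_continuous_1[OF bm_integrable_on[OF bms(3)]])
 have "integral {0..x} ?zr <= A * exp (2 * M * (x - 0))"
 proof (rule gronwall[of "\<lambda>y. integral {0..y} ?zr" 0 x])
  show "(\<lambda>y. integral {0..y} ?zr) integrable_on {0..x}" by (rule integrable_continuous_real[OF ci])
  fix v assume v: "v \<in> {0..x}"
  have h: "((\<lambda>y. ?zb y + 2 * M * (integral {0..x} ?zp + wsum W t) + 2 * M * integral {0..y} ?zr) has_integral
    (integral {0..v} ?zb + v * (2 * M * (integral {0..x} ?zp + wsum W t)) + 2 * M * integral {0..v} (\<lambda>y. integral {0..y} ?zr))) {0..v}"
   using has_integral_const_real[of "2 * M * (integral {0..x} ?zp + wsum W t)" 0 v] v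
   by (intro has_integral_add has_integral_mult_right bm_has_integral bms integrable_integral integrable_continuous_real continuous_on_subset[OF ci]) (auto simp: mult.commute)
  have "integral {0..v} ?zr <= integral {0..v} ?zb + v * (2 * M * (integral {0..x} ?zp + wsum W t)) + 2 * M * integral {0..v} (\<lambda>y. integral {0..y} ?zr)"
   by (rule has_integral_le[OF bm_has_integral[OF bms(3)] h]) (use pt v in auto)
  also have "... <= A + 2 * M * integral {0..v} (\<lambda>y. integral {0..y} ?zr)"
   unfolding A_def using v x
   by (intro add_right_mono add_mono integral_subset_le bm_integrable_on bms mult_right_mono nn) (auto simp: zsum_nonneg)
  finally show "integral {0..v} ?zr <= A + 2 * M * integral {0..v} (\<lambda>y. integral {0..y} ?zr)" .
 qed (use M0 x in auto)
 also have "... <= A * exp (2 * M * L)"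
 proof (rule mult_left_mono)
  show "exp (2 * M * (x - 0)) <= exp (2 * M * L)" using x M0 by (simp add: mult_left_mono)
  show "0 <= A" unfolding A_def using nn L0 bm_integral_nonneg[OF bms(1) zsum_nonneg] by (intro add_nonneg_nonneg mult_nonneg_nonneg[OF _ nn]) auto
 qed
 finally have rho: "integral {0..x} ?zr <= A * exp (2 * M * L)" .
 define S where "S = integral {0..x} ?zb + integral {0..x} ?zp + wsum W t"
 define V where "V = integral {0..x} ?zp + wsum W t"
 have SV: "V <= S" "integral {0..x} ?zb <= S" "0 <= V" "0 <= S"
  unfolding S_def V_def using bm_integral_nonneg[OF bms(1) zsum_nonneg, of 0 x] bm_integral_nonneg[OF bms(2) zsum_nonneg, of 0 x] wsum_nonneg[of W t] by auto
 have "A <= S + 2 * M * L * S"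
 proof -
  have "L * (2 * M * V) <= L * (2 * M * S)" using SV L0 M0 by (intro mult_left_mono) auto
  then show ?thesis unfolding A_def V_def[symmetric] using SV by (simp add: mult_ac)
 qed
 then have "2 * M * (A * exp (2 * M * L)) <= 2 * M * ((S + 2 * M * L * S) * exp (2 * M * L))"
  using M0 by (intro mult_left_mono mult_right_mono) auto
 moreover have "2 * M * integral {0..x} ?zr <= 2 * M * (A * exp (2 * M * L))" using rho M0 by (intro mult_left_mono) auto
 moreover have "2 * M * V <= 2 * M * S" using SV M0 by (intro mult_left_mono) auto
 ultimately have "?zr x <= ?zb x + 2 * M * S + 2 * M * ((S + 2 * M * L * S) * exp (2 * M * L))"
  using pt[of x] x unfolding V_def[symmetric] by auto
 then show ?thesis unfolding S_def[symmetric] Kv_def by (simp add: algebra_simps)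
qed

lemma sq_r:
 assumes sol: "sol p r W" and t: "0 <= t" "t <= T"
 shows "sq T r t <= 4 * sq T (beta p r W) t + 6 * Kv\<^sup>2 * L * (2 * L * sq T (beta p r W) t + 2 * L * sq T p t + (wsum W t)\<^sup>2)"
proof -
 note zb = zsum_L1[where p="beta p r W" and T=T and t=t, OF sol_bm(3)[OF sol]]
 note zp = zsum_L1[where p=p and T=T and t=t, OF sol_bm(1)[OF sol]]
 let ?zb = "\<lambda>y. zsum T (beta p r W) (y, t)" and ?zp = "\<lambda>y. zsum T p (y, t)" and ?zr = "\<lambda>y. zsum T r (y, t)"
 have bms: "bm ?zb" "bm ?zp" "bm ?zr" by (intro bm_pair_swap(2) sol_bm[OF sol])+
 define Q where "Q = 2 * L * sq T (beta p r W) t + 2 * L * sq T p t + (wsum W t)\<^sup>2"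
 define c where "c = 6 * Kv\<^sup>2 * Q"
 have c0: "0 <= c" unfolding c_def Q_def using L0 sq_nonneg[where p="beta p r W", OF sol_bm(3)[OF sol]] sq_nonneg[where p=p, OF sol_bm(1)[OF sol]]
  by (intro mult_nonneg_nonneg add_nonneg_nonneg) auto
 have pt: "(?zr x)\<^sup>2 <= 2 * (?zb x)\<^sup>2 + c" for x
 proof (cases "(x, t) \<in> tdomain l")
  case True
  define S where "S = integral {0..L} ?zb + integral {0..L} ?zp + wsum W t"
  have S2: "S\<^sup>2 <= 3 * Q"
   unfolding S_def Q_def using power2_sum3_le[of "integral {0..L} ?zb" "integral {0..L} ?zp" "wsum W t"] zb(3)[of L] zp(3)[of L] by auto
  have "integral {0..x} ?zb + integral {0..x} ?zp + wsum W t <= S"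
   unfolding S_def using zb(2)[of x] zp(2)[of x] tdomain_le_L[OF True] by auto
  then have "Kv * (integral {0..x} ?zb + integral {0..x} ?zp + wsum W t) <= Kv * S" by (rule mult_left_mono[OF _ Kv0])
  then have "?zr x <= ?zb x + Kv * S" using volterra_bound[OF sol True t(2)] by linarith
  then have "(?zr x)\<^sup>2 <= (?zb x + Kv * S)\<^sup>2" by (intro power_mono zsum_nonneg)
  also have "... <= 2 * ((?zb x)\<^sup>2 + (Kv * S)\<^sup>2)" by (rule power2_sum2_le)
  also have "... <= 2 * (?zb x)\<^sup>2 + c"
   unfolding c_def using mult_left_mono[OF S2, of "Kv\<^sup>2"] by (simp add: power_mult_distrib algebra_simps)
  finally show ?thesis .
 next
  case False
  then show ?thesis using c0 by (simp add: zsum_def cut_def)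
 qed
 have "sq T r t <= integral {0..L} (\<lambda>x. 2 * (?zb x)\<^sup>2 + c)"
  unfolding sq_def
 proof (intro bm_integral_mono bm_sum bm_power cut_bm_slice sol_bm[OF sol] bm_add bm_mult bm_const bms)
  fix x
  have "(\<Sum>j\<in>UNIV. (cut T (r j) (x, t))\<^sup>2) <= (?zr x)\<^sup>2"
   unfolding zsum_def sum_2' by (simp add: power2_sum)
  then show "(\<Sum>j\<in>UNIV. (cut T (r j) (x, t))\<^sup>2) <= 2 * (?zb x)\<^sup>2 + c" using pt[of x] by linarith
 qed
 also have "... = 2 * integral {0..L} (\<lambda>x. (?zb x)\<^sup>2) + L * c"
 proof (rule integral_unique)
  show "((\<lambda>x. 2 * (?zb x)\<^sup>2 + c) has_integral 2 * integral {0..L} (\<lambda>x. (?zb x)\<^sup>2) + L * c) {0..L}"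
   using has_integral_const_real[of c 0 L] L0
   by (intro has_integral_add has_integral_mult_right bm_has_integral bm_power bms) (simp add: mult.commute)
 qed
 also have "... <= 4 * sq T (beta p r W) t + L * c" using zb(4)[of L] by simp
 finally show ?thesis unfolding c_def Q_def by (simp add: mult_ac)
qed

section \<open>Estimates along right-going characteristics\<close>

lemma \<Psi>_slope: "v <= s ==> \<Psi> i (c + v) <= \<Psi> i (c + s) - qa * (s - v)"
proof -
 assume "v <= s"
 then have "\<Psi> i (c + v) - qa * v <= \<Psi> i (c + s) - qa * s"
 proof (rule DERIV_nonneg_imp_nondecreasing[of v s "\<lambda>v. \<Psi> i (c + v) - qa * v"])
  fix x
  have "((\<lambda>v. \<Psi> i (c + v)) has_real_derivative q i (\<Psi> i (c + x)) * 1) (at x)"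
   by (rule DERIV_chain2[where f="\<Psi> i" and g="\<lambda>v. c + v", OF \<Psi>_deriv]) (auto intro!: derivative_eq_intros)
  then have "((\<lambda>v. \<Psi> i (c + v) - qa * v) has_real_derivative q i (\<Psi> i (c + x)) - qa) (at x)"
   by (auto intro!: derivative_eq_intros)
  moreover have "0 <= q i (\<Psi> i (c + x)) - qa" using q_ge by simp
  ultimately show "\<exists>y. ((\<lambda>v. \<Psi> i (c + v) - qa * v) has_real_derivative y) (at x) \<and> 0 <= y" by blast
 qed
 then show ?thesis by (simp add: algebra_simps)
qed

text \<open>The boundary recedes more slowly than right-going characteristics, so these never enter through it.\<close>

lemma right_characteristic_in:
 assumes xt: "(x, t) \<in> tdomain l" and s: "0 <= s" "t - \<Phi> i x <= s" "s <= t"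
 shows "(\<Psi> i (\<Phi> i x - t + s), s) \<in> tdomain l"
proof -
 have "\<Psi> i (\<Phi> i x - t + s) <= \<Psi> i (\<Phi> i x - t + t) - qa * (t - s)" by (rule \<Psi>_slope[OF s(3)])
 also have "... <= l t - qa * (t - s)" using xt by (simp add: tdomain_iff)
 also have "... <= l t - mh * (t - s)" using mh s(3) by (simp add: mult_right_mono)
 also have "... <= l s" using l_lip[OF s(1,3)] by simp
 finally show ?thesis using s by (simp add: tdomain_iff)
qed

definition zz :: "real => field => field => real \<times> real => real" where
 "zz T p r z = zsum T p z + zsum T r z"

lemma zz_nonneg: "0 <= zz T p r z"
 by (simp add: zz_def zsum_nonneg)

lemma zz_bm: "sol p r W ==> bm (zz T p r)"
 unfolding zz_def[abs_def] using sol_bm by (intro bm_add) blast+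

lemma zz_path_bm:
 assumes "sol p r W" shows "bm (\<lambda>s. zz T p r (\<Psi> i (c + s), s))"
 by (rule bm_comp[OF zz_bm[OF assms]])
   (intro borel_contI continuous_intros continuous_on_compose2[OF \<Psi>_continuous[of UNIV]], auto)

lemma source_le:
 assumes "z \<in> tdomain l" "snd z <= T"
 shows "\<bar>source p r i z\<bar> <= M * zz T p r z"
proof -
 have "\<bar>source p r i z\<bar> <= (\<Sum>j\<in>UNIV. \<bar>TA i j (fst z) * r j z\<bar> + \<bar>TB i j (fst z) * p j z\<bar>)"
  unfolding source_def by (intro order_trans[OF sum_abs] sum_mono abs_triangle_ineq)
 also have "... <= (\<Sum>j\<in>UNIV. M * \<bar>r j z\<bar> + M * \<bar>p j z\<bar>)"
  unfolding abs_mult by (intro sum_mono add_mono mult_right_mono TA_le TB_le) auto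
 also have "... = M * zz T p r z"
  unfolding zz_def zsum_def using assms by (simp add: cut_in sum_2' algebra_simps)
 finally show ?thesis .
qed

lemma p_bound:
 assumes sol: "sol p r W" and xt: "(x, t) \<in> tdomain l" "t <= T" and s: "0 <= s" "t - \<Phi> i x <= s" "s <= t"
 shows "\<bar>p i (x, t)\<bar> <= \<bar>p i (\<Psi> i (\<Phi> i x - t + s), s)\<bar> + M * integral {s..t} (\<lambda>v. zz T p r (\<Psi> i (\<Phi> i x - t + v), v))"
proof -
 have dom: "(\<Psi> i (\<Phi> i x - t + v), v) \<in> tdomain l" if "v \<in> {s..t}" for v
  by (rule right_characteristic_in[OF xt(1)]) (use that s in auto)
 have h: "((\<lambda>u. source p r i (\<Psi> i (\<Phi> i x - t + u), u)) has_integral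
   (p i (\<Psi> i (\<Phi> i x - t + t), t) - p i (\<Psi> i (\<Phi> i x - t + s), s))) {s..t}"
  by (rule solD(3)[OF sol s(3) dom])
 have "norm (integral {s..t} (\<lambda>u. source p r i (\<Psi> i (\<Phi> i x - t + u), u))) <= integral {s..t} (\<lambda>v. M * zz T p r (\<Psi> i (\<Phi> i x - t + v), v))"
 proof (rule integral_norm_bound_integral[OF has_integral_integrable[OF h]])
  show "(\<lambda>v. M * zz T p r (\<Psi> i (\<Phi> i x - t + v), v)) integrable_on {s..t}"
   by (intro bm_integrable_on bm_mult bm_const zz_path_bm[OF sol])
  show "norm (source p r i (\<Psi> i (\<Phi> i x - t + v), v)) <= M * zz T p r (\<Psi> i (\<Phi> i x - t + v), v)" if "v \<in> {s..t}" for v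
   using source_le[OF dom[OF that], of T p r i] that xt(2) by simp
 qed
 then show ?thesis unfolding integral_unique[OF h] by simp
qed

text \<open>At the origin \<open>p\<close> is a combination of \<open>W\<close> minus
  \<open>r\<close>, and \<open>r\<close> is \<open>beta\<close> plus a combination of
  \<open>W\<close>.\<close>

lemma tr_p:
 assumes sol: "sol p r W" and T: "0 <= T" and w: "\<And>t. t \<in> {0..T} ==> wsum W t <= w"
 shows "tr T p i <= 8 * M\<^sup>2 * T * w\<^sup>2 + 2 * tr T (beta p r W) i"
proof -
 have b: "bm (\<lambda>u. cut T (beta p r W i) (0, u))" by (rule cut_bm_origin[OF sol_bm(3)[OF sol]])
 have "tr T p i <= integral {0..T} (\<lambda>u. 8 * M\<^sup>2 * w\<^sup>2 + 2 * (cut T (beta p r W i) (0, u))\<^sup>2)"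
  unfolding tr_def
 proof (intro bm_integral_mono bm_power cut_bm_origin sol_bm[OF sol] bm_mult bm_const bm_add)
  fix u assume u: "u \<in> {0..T}"
  have "p i (0, u) = (\<Sum>k\<in>UNIV. Cm i k * W k u) - r i (0, u)" using u by (intro solD(6)[OF sol]) auto
  moreover have "r i (0, u) = beta p r W i (0, u) + (\<Sum>k\<in>UNIV. lam i k 0 * W k u)" by (simp add: beta_origin)
  moreover have "\<bar>\<Sum>k\<in>UNIV. Cm i k * W k u\<bar> <= M * wsum W u" by (rule sum_abs_wsum[OF Cm_le])
  moreover have "\<bar>\<Sum>k\<in>UNIV. lam i k 0 * W k u\<bar> <= M * wsum W u" by (rule sum_abs_wsum[OF lam_le])
  moreover have "M * wsum W u <= M * w" by (intro mult_left_mono M0 w u)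
  ultimately have "\<bar>p i (0, u)\<bar> <= 2 * (M * w) + \<bar>beta p r W i (0, u)\<bar>" by linarith
  from order_trans[OF power2_abs_le[OF this] power2_sum2_le]
  show "(cut T (p i) (0, u))\<^sup>2 <= 8 * M\<^sup>2 * w\<^sup>2 + 2 * (cut T (beta p r W i) (0, u))\<^sup>2"
   using u by (simp add: cut_in origin_in power_mult_distrib)
 qed
 also have "... = T * (8 * M\<^sup>2 * w\<^sup>2) + 2 * tr T (beta p r W) i"
 proof (rule integral_unique)
  show "((\<lambda>u. 8 * M\<^sup>2 * w\<^sup>2 + 2 * (cut T (beta p r W i) (0, u))\<^sup>2) has_integral T * (8 * M\<^sup>2 * w\<^sup>2) + 2 * tr T (beta p r W) i) {0..T}"
   unfolding tr_def using has_integral_const_real[of "8 * M\<^sup>2 * w\<^sup>2" 0 T] T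
   by (intro has_integral_add has_integral_mult_right bm_has_integral bm_power b) (simp add: mult.commute)
 qed
 finally show ?thesis by (simp add: mult_ac)
qed

text \<open>A right-going characteristic comes either from time 0 or from \<open>x = 0\<close>. Both
  candidate feet are added, truncated to the domain, which avoids a case distinction when the bound
  is integrated over \<open>x\<close>.\<close>

lemma p_point_sq:
 assumes sol: "sol p r W" and xt: "(x, t) \<in> tdomain l" "t <= T"
 shows "(p i (x, t))\<^sup>2 <= 3 * ((cut T (p i) (\<Psi> i (\<Phi> i x + - t), 0))\<^sup>2 + (cut T (p i) (0, t - \<Phi> i x))\<^sup>2
   + M\<^sup>2 * T * integral {0..t} (\<lambda>v. (zz T p r (\<Psi> i (\<Phi> i x + (- t + v)), v))\<^sup>2))"
proof -
 have t: "0 <= t" "0 <= x" "0 <= \<Phi> i x" using xt by (auto simp: tdomain_iff)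
 \<comment> \<open>The later of time 0 and the time at which the path leaves
   \<open>x = 0\<close>.\<close>
 define s where "s = max 0 (t - \<Phi> i x)"
 have s: "0 <= s" "t - \<Phi> i x <= s" "s <= t" using t by (auto simp: s_def)
 let ?z = "\<lambda>v. zz T p r (\<Psi> i (\<Phi> i x - t + v), v)"
 have zb: "bm ?z" by (rule zz_path_bm[OF sol])
 have foot: "\<bar>p i (\<Psi> i (\<Phi> i x - t + s), s)\<bar> <= \<bar>cut T (p i) (\<Psi> i (\<Phi> i x + - t), 0)\<bar> + \<bar>cut T (p i) (0, t - \<Phi> i x)\<bar>"
 proof (cases "t <= \<Phi> i x")
  case True
  then have "s = 0" by (simp add: s_def)
  then have "(\<Psi> i (\<Phi> i x - t), 0) \<in> tdomain l" using right_characteristic_in[OF xt(1) s] by simp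
  then show ?thesis using \<open>s = 0\<close> t xt(2) by (simp add: cut_in)
 next
  case False
  then have "s = t - \<Phi> i x" by (simp add: s_def)
  have "\<Psi> i (\<Phi> i x - t + s) = 0" using \<open>s = t - \<Phi> i x\<close> by simp
  moreover have "cut T (p i) (0, s) = p i (0, s)" using s xt(2) by (intro cut_in origin_in) auto
  ultimately show ?thesis using \<open>s = t - \<Phi> i x\<close> by simp
 qed
 have I: "integral {s..t} ?z <= integral {0..t} ?z"
  using s by (intro integral_subset_le bm_integrable_on zb) (auto intro: zz_nonneg)
 have I2: "(integral {0..t} ?z)\<^sup>2 <= T * integral {0..t} (\<lambda>v. (?z v)\<^sup>2)"
 proof -
  have "(integral {0..t} (\<lambda>v. \<bar>?z v\<bar>))\<^sup>2 <= (t - 0) * integral {0..t} (\<lambda>v. (?z v)\<^sup>2)"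
   by (rule bm_cauchy_schwarz[OF zb t(1)])
  also have "... <= T * integral {0..t} (\<lambda>v. (?z v)\<^sup>2)"
   using xt(2) by (intro mult_right_mono bm_integral_nonneg bm_power zb) auto
  finally show ?thesis using zz_nonneg by simp
 qed
 have "\<bar>p i (x, t)\<bar> <= \<bar>cut T (p i) (\<Psi> i (\<Phi> i x + - t), 0)\<bar> + \<bar>cut T (p i) (0, t - \<Phi> i x)\<bar> + M * integral {0..t} ?z"
  using p_bound[OF sol xt s] foot mult_left_mono[OF I M0] by linarith
 from order_trans[OF power2_abs_le[OF this] power2_sum3_le]
 have "(p i (x, t))\<^sup>2 <= 3 * ((cut T (p i) (\<Psi> i (\<Phi> i x + - t), 0))\<^sup>2 + (cut T (p i) (0, t - \<Phi> i x))\<^sup>2 + M\<^sup>2 * (integral {0..t} ?z)\<^sup>2)"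
  by (simp add: power_mult_distrib)
 also have "... <= 3 * ((cut T (p i) (\<Psi> i (\<Phi> i x + - t), 0))\<^sup>2 + (cut T (p i) (0, t - \<Phi> i x))\<^sup>2 + M\<^sup>2 * (T * integral {0..t} (\<lambda>v. (?z v)\<^sup>2)))"
  by (intro mult_left_mono add_left_mono I2) auto
 finally show ?thesis by (simp add: algebra_simps)
qed

lemma sq_bm:
 assumes "\<And>j. bm (cut T (f j))" shows "bm (sq T f)"
proof -
 have "bm (\<lambda>z. \<Sum>j\<in>UNIV. (cut T (f j) (snd z, fst z))\<^sup>2)" by (intro bm_sum bm_power bm_swap assms)
 from bm_integral_param[OF this, of "\<lambda>_. 0" "\<lambda>_. L" 0 L] show ?thesis unfolding sq_def[abs_def] by simp
qed

text \<open>The contributions are the initial values, the values entering at \<open>x = 0\<close>,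
  and the source. Each is integrated over \<open>x\<close> by passing to feet, for the source after
  exchanging the order of integration; the result is ready for Gronwall in \<open>t\<close>.\<close>

lemma sq_p:
 assumes sol: "sol p r W" and t: "0 <= t" "t <= T"
 shows "sq T p t <= 6 * (qb / qa) * sq T p 0 + 3 * qb * (tr T p 1 + tr T p 2)
   + 24 * M\<^sup>2 * T * (qb / qa) * integral {0..t} (\<lambda>s. sq T p s + sq T r s)"
proof -
 have T: "0 <= T" using t by simp
 have I: "integral {0..L} (\<lambda>x. (cut T (p i) (x, t))\<^sup>2) <= 3 * ((qb / qa) * sq T p 0 + qb * tr T p i
   + M\<^sup>2 * T * ((qb / qa) * integral {0..t} (\<lambda>s. 4 * (sq T p s + sq T r s))))" for i
 proof -
  let ?f = "\<lambda>x. (cut T (p i) (x, 0))\<^sup>2" and ?h = "\<lambda>u. (cut T (p i) (0, u))\<^sup>2"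
  let ?g = "\<lambda>x v. (zz T p r (\<Psi> i (\<Phi> i x + (- t + v)), v))\<^sup>2"
  have mP: "(\<lambda>x. \<Psi> i (\<Phi> i x + a)) \<in> borel_measurable borel" for a
   by (intro borel_contI continuous_intros continuous_on_compose2[OF \<Psi>_continuous[of UNIV]] \<Phi>_continuous) auto
  have mPhi: "(\<lambda>x. t - \<Phi> i x) \<in> borel_measurable borel"
   by (intro borel_contI continuous_intros \<Phi>_continuous)
  have mz: "(\<lambda>z. (\<Psi> i (\<Phi> i (fst z) + (- t + snd z)), snd z)) \<in> borel_measurable borel"
   by (intro borel_contI continuous_intros continuous_on_compose2[OF \<Psi>_continuous[of UNIV]] continuous_on_compose2[OF \<Phi>_continuous[of UNIV]]) auto
  have gb: "bm (\<lambda>z. ?g (fst z) (snd z))" by (intro bm_power bm_comp[OF zz_bm[OF sol] mz])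
  have fb: "bm (\<lambda>x. ?f (\<Psi> i (\<Phi> i x + - t)))" by (intro bm_power bm_comp[OF cut_bm_slice[OF sol_bm(1)[OF sol]] mP])
  have hb: "bm (\<lambda>x. ?h (t - \<Phi> i x))" by (intro bm_power bm_comp[OF cut_bm_origin[OF sol_bm(1)[OF sol]] mPhi])
  have Gb: "bm (\<lambda>x. integral {0..t} (?g x))"
   using bm_integral_param[OF gb, of "\<lambda>_. 0" "\<lambda>_. t" 0 t] by simp
  have "integral {0..L} (\<lambda>x. (cut T (p i) (x, t))\<^sup>2) <= integral {0..L} (\<lambda>x. 3 * (?f (\<Psi> i (\<Phi> i x + - t)) + ?h (t - \<Phi> i x) + M\<^sup>2 * T * integral {0..t} (?g x)))"
  proof (rule bm_integral_mono)
   show "bm (\<lambda>x. (cut T (p i) (x, t))\<^sup>2)" by (intro bm_power cut_bm_slice sol_bm[OF sol])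
   show "bm (\<lambda>x. 3 * (?f (\<Psi> i (\<Phi> i x + - t)) + ?h (t - \<Phi> i x) + M\<^sup>2 * T * integral {0..t} (?g x)))"
    by (rule bm_mult[OF bm_const bm_add[OF bm_add[OF fb hb] bm_mult[OF bm_const Gb]]])
   fix x
   show "(cut T (p i) (x, t))\<^sup>2 <= 3 * (?f (\<Psi> i (\<Phi> i x + - t)) + ?h (t - \<Phi> i x) + M\<^sup>2 * T * integral {0..t} (?g x))"
   proof (cases "(x, t) \<in> tdomain l")
    case True
    then show ?thesis using p_point_sq[OF sol True t(2), of i] t by (simp add: cut_in)
   next
    case False
    have "0 <= integral {0..t} (?g x)" by (intro bm_integral_nonneg) (use bm_pair2[OF gb, of x] in auto)
    then show ?thesis using False T by (simp add: cut_def[of _ _ "(x, t)"] add_nonneg_nonneg)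
   qed
  qed
  also have "... = 3 * (integral {0..L} (\<lambda>x. ?f (\<Psi> i (\<Phi> i x + - t))) + integral {0..L} (\<lambda>x. ?h (t - \<Phi> i x)) + M\<^sup>2 * T * integral {0..L} (\<lambda>x. integral {0..t} (?g x)))"
   by (rule integral_unique) (intro has_integral_mult_right has_integral_add bm_has_integral fb hb Gb)
  also have "... <= 3 * ((qb / qa) * sq T p 0 + qb * tr T p i + M\<^sup>2 * T * ((qb / qa) * integral {0..t} (\<lambda>s. 4 * (sq T p s + sq T r s))))"
  proof (intro mult_left_mono add_mono)
   have "integral {0..L} (\<lambda>x. ?f (\<Psi> i (\<Phi> i x + - t))) <= qb / qa * integral {0..L} ?f"
    by (rule foot_integral_le) (auto simp: cut_outside intro!: bm_power cut_bm_slice sol_bm[OF sol])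
   also have "... <= qb / qa * sq T p 0"
    using qa qb by (intro mult_left_mono slice_le_sq sol_bm[OF sol]) auto
   finally show "integral {0..L} (\<lambda>x. ?f (\<Psi> i (\<Phi> i x + - t))) <= qb / qa * sq T p 0" .
   \<comment> \<open>The entry time \<open>t - \<Phi> i x\<close> decreases in \<open>x\<close>,
     while the substitution lemma needs an increasing map; hence the reflection
     \<open>y \<mapsto> - y\<close>.\<close>
   have "integral {0..L} (\<lambda>x. (\<lambda>y. ?h (- y)) (\<Phi> i x - t)) <= integral {- T..0} (\<lambda>y. ?h (- y)) / (1 / qb)"
   proof (rule bm_integral_substitution_le)
    show "bm (\<lambda>y. ?h (- y))" by (intro bm_power bm_comp[OF cut_bm_origin[OF sol_bm(1)[OF sol]]]) auto
    show "((\<lambda>x. \<Phi> i x - t) has_real_derivative 1 / q i x) (at x)" for x by (auto intro!: derivative_eq_intros \<Phi>_deriv)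
    show "continuous_on UNIV (\<lambda>x. 1 / q i x)" by (intro continuous_intros q_cont) (auto simp: q_ne)
    show "1 / qb <= 1 / q i x" for x using q_le q_pos qb by (simp add: frac_le)
    show "?h (- y) = 0" if "y \<notin> {- T..0}" for y using that by (auto simp: cut_def tdomain_iff)
   qed (use qb in auto)
   also have "integral {- T..0} (\<lambda>y. ?h (- y)) = tr T p i"
    unfolding tr_def using Henstock_Kurzweil_Integration.integral_reflect_real[where f="?h" and a=0 and b=T] by simp
   finally show "integral {0..L} (\<lambda>x. ?h (t - \<Phi> i x)) <= qb * tr T p i" by (simp add: mult.commute)
   have "integral {0..L} (\<lambda>x. integral {0..t} (?g x)) = integral {0..t} (\<lambda>v. integral {0..L} (\<lambda>x. ?g x v))"
    using bm_fubini[OF gb, of 0 L 0 t] by simp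
   also have "... <= integral {0..t} (\<lambda>v. qb / qa * (4 * (sq T p v + sq T r v)))"
   proof (rule bm_integral_mono)
    show "bm (\<lambda>v. integral {0..L} (\<lambda>x. ?g x v))"
     using bm_integral_param[OF bm_swap[OF gb], of "\<lambda>_. 0" "\<lambda>_. L" 0 L] by simp
    show "bm (\<lambda>v. qb / qa * (4 * (sq T p v + sq T r v)))"
     by (intro bm_mult bm_add bm_const sq_bm sol_bm[OF sol])
    fix v
    have zb: "bm (\<lambda>y. zz T p r (y, v))" by (rule bm_pair_swap(2)[OF zz_bm[OF sol]])
    have g1: "integral {0..L} (\<lambda>x. ?g x v) <= qb / qa * integral {0..L} (\<lambda>y. (zz T p r (y, v))\<^sup>2)"
    proof (rule foot_integral_le)
     show "bm (\<lambda>y. (zz T p r (y, v))\<^sup>2)" by (rule bm_power[OF zb])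
     show "(zz T p r (y, v))\<^sup>2 = 0" if "y \<notin> {0..L}" for y
      unfolding zz_def zsum_def using that by (simp add: cut_outside)
    qed simp
    have "integral {0..L} (\<lambda>y. (zz T p r (y, v))\<^sup>2) <= integral {0..L} (\<lambda>y. 2 * ((zsum T p (y, v))\<^sup>2 + (zsum T r (y, v))\<^sup>2))"
     unfolding zz_def by (intro bm_integral_mono power2_sum2_le bm_power bm_add bm_mult bm_const bm_pair_swap(2) sol_bm[OF sol])
    also have "... = 2 * (integral {0..L} (\<lambda>y. (zsum T p (y, v))\<^sup>2) + integral {0..L} (\<lambda>y. (zsum T r (y, v))\<^sup>2))"
     by (rule integral_unique) (intro has_integral_mult_right has_integral_add bm_has_integral bm_power bm_pair_swap(2) sol_bm[OF sol])
    also have "... <= 4 * (sq T p v + sq T r v)"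
     using zsum_L1(4)[where p=p and T=T and t=v, OF sol_bm(1)[OF sol] order_refl] zsum_L1(4)[where p=r and T=T and t=v, OF sol_bm(2)[OF sol] order_refl] by simp
    finally have "integral {0..L} (\<lambda>y. (zz T p r (y, v))\<^sup>2) <= 4 * (sq T p v + sq T r v)" .
    from order_trans[OF g1 mult_left_mono[OF this]]
    show "integral {0..L} (\<lambda>x. ?g x v) <= qb / qa * (4 * (sq T p v + sq T r v))"
     using qa qb by simp
   qed
   finally show "integral {0..L} (\<lambda>x. integral {0..t} (?g x)) <= qb / qa * integral {0..t} (\<lambda>s. 4 * (sq T p s + sq T r s))" by simp
  qed (use T in auto)
  finally show ?thesis .
 qed
 have "sq T p t = integral {0..L} (\<lambda>x. (cut T (p 1) (x, t))\<^sup>2) + integral {0..L} (\<lambda>x. (cut T (p 2) (x, t))\<^sup>2)"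
  unfolding sq_def sum_2' by (rule integral_add) (intro bm_integrable_on bm_power cut_bm_slice sol_bm[OF sol])+
 also have "... <= 3 * ((qb / qa) * sq T p 0 + qb * tr T p 1 + M\<^sup>2 * T * ((qb / qa) * integral {0..t} (\<lambda>s. 4 * (sq T p s + sq T r s))))
   + 3 * ((qb / qa) * sq T p 0 + qb * tr T p 2 + M\<^sup>2 * T * ((qb / qa) * integral {0..t} (\<lambda>s. 4 * (sq T p s + sq T r s))))"
  by (intro add_mono I)
 also have "integral {0..t} (\<lambda>s. 4 * (sq T p s + sq T r s)) = 4 * integral {0..t} (\<lambda>s. sq T p s + sq T r s)"
  by (rule integral_mult_right)
 finally show ?thesis by (simp add: algebra_simps)
qed

end

section \<open>Growth on bounded time intervals and decay at late times\<close>

lemma integral_exp_le: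
 fixes k a b :: real
 assumes "0 < k" "a <= b"
 shows "(\<lambda>v. exp (k * (v - b))) integrable_on {a..b}" "integral {a..b} (\<lambda>v. exp (k * (v - b))) <= 1 / k"
proof -
 have h: "((\<lambda>v. exp (k * (v - b))) has_integral (exp (k * (b - b)) / k - exp (k * (a - b)) / k)) {a..b}"
 proof (rule fundamental_theorem_of_calculus[OF assms(2)])
  fix x
  have "((\<lambda>v. exp (k * (v - b)) / k) has_real_derivative exp (k * (x - b))) (at x within {a..b})"
   using assms(1) by (auto intro!: derivative_eq_intros)
  then show "((\<lambda>v. exp (k * (v - b)) / k) has_vector_derivative exp (k * (x - b))) (at x within {a..b})"
   by (simp add: has_real_derivative_iff_has_vector_derivative)
 qed
 then show "(\<lambda>v. exp (k * (v - b))) integrable_on {a..b}" by blast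
 show "integral {a..b} (\<lambda>v. exp (k * (v - b))) <= 1 / k"
  unfolding integral_unique[OF h] using assms(1) by simp
qed

lemma mult_le_trans: "x <= k * y ==> y <= C * e ==> 0 <= k ==> x <= (k * C) * e" for x y k C e :: real
 using mult_left_mono[of y "C * e" k] by (simp add: mult_ac)

context kernel_bounds
begin

lemma en_nonneg: "sol p r W ==> 0 <= t ==> 0 <= en p r W t"
 unfolding en_eq[OF _ _ order_refl]
 by (intro add_nonneg_nonneg sq_nonneg sum_nonneg sol_bm) auto

text \<open>Each quantity is bounded by those already known: \<open>beta\<close> depends on its own
  initial values only, \<open>W\<close> also on the trace of \<open>beta\<close>, the trace of
  \<open>p\<close> on both, and \<open>r\<close> on \<open>beta\<close>, \<open>W\<close> and
  \<open>p\<close>. After \<open>r\<close> has been eliminated, Gronwall yields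
  \<open>p\<close>.\<close>

lemma en_growth:
 assumes T: "0 <= T"
 obtains C where "0 <= C" "\<And>p r W t. sol p r W ==> t \<in> {0..T} ==> en p r W t <= C * en p r W 0"
proof -
 define E where "E = exp (2 * M * T)"
 define G where "G = exp (20 * M\<^sup>2 * T)"
 \<comment> \<open>In units of the initial energy: \<open>c1\<close> bounds \<open>beta\<close> at
   time 0, \<open>c2\<close> and \<open>c3\<close> its two traces, \<open>c4\<close>
   \<open>beta\<close> at later times, \<open>c5\<close> the square of \<open>wsum W\<close>,
   \<open>c6\<close> the traces of \<open>p\<close>, and \<open>c8\<close> \<open>p\<close> itself;
   \<open>a\<close> and \<open>b\<close> are the coefficients of the energy and of \<open>p\<close>
   in the bound for \<open>r\<close>.\<close>
 define c1 where "c1 = 6 + 100 * M\<^sup>2 * L * (L + 1)"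
 define c2 where "c2 = 2 * E * (c1 / qa)"
 define c3 where "c3 = 2 * E * (c1 / qa + T * M\<^sup>2 * (T * c2))"
 define c4 where "c4 = 2 * E * (2 * (qb / qa) * c1 + 2 * L * M\<^sup>2 * (T * c2))"
 define c5 where "c5 = 2 * (4 + (8 * M)\<^sup>2 * (T * (2 * (c2 + c3)))) * G\<^sup>2"
 define c6 where "c6 = 2 * (8 * M\<^sup>2 * T * c5) + 2 * (c2 + c3)"
 define a where "a = 4 * c4 + 6 * Kv\<^sup>2 * L * (2 * L * c4 + c5)"
 define b where "b = 6 * Kv\<^sup>2 * L * (2 * L)"
 define k where "k = 24 * M\<^sup>2 * T * (qb / qa)"
 define c7 where "c7 = 6 * (qb / qa) + 3 * qb * c6 + k * T * a"
 define c8 where "c8 = c7 * exp (k * (1 + b) * T)"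
 have E: "0 <= E" "0 <= G" unfolding E_def G_def by auto
 note pos = E T M0 L0 qa qb Kv0
 have c1: "0 <= c1" unfolding c1_def using pos by simp
 have c2: "0 <= c2" unfolding c2_def using pos c1 by simp
 have c3: "0 <= c3" unfolding c3_def using pos c1 c2 by simp
 have c4: "0 <= c4" unfolding c4_def using pos c1 c2 by simp
 have c5: "0 <= c5" unfolding c5_def using pos c3 c2 by simp
 have c6: "0 <= c6" unfolding c6_def using pos c3 c2 c5 by simp
 have a: "0 <= a" unfolding a_def using pos c4 c5 by simp
 have b: "0 <= b" unfolding b_def using pos by simp
 have k: "0 <= k" unfolding k_def using pos by simp
 have c7: "0 <= c7" unfolding c7_def using pos c6 k a by simp
 have c8: "0 <= c8" unfolding c8_def using c7 by simp
 show thesis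
 proof (rule that[of "(1 + b) * c8 + a + c5"])
  show "0 <= (1 + b) * c8 + a + c5" using a b c8 c5 by simp
  fix p r W t assume sol: "sol p r W" and "t \<in> {0..T}"
  then have t: "0 <= t" "t <= T" by auto
  define e where "e = en p r W 0"
  have e: "0 <= e" unfolding e_def by (rule en_nonneg[OF sol order_refl])
  let ?B = "beta p r W"
  have h1: "sq T ?B 0 <= c1 * e" unfolding c1_def e_def by (rule beta_sq[OF sol order_refl T])
  have h2: "tr T ?B 1 <= c2 * e"
  proof -
   have "tr T ?B 1 <= (2 * E / qa) * sq T ?B 0" using tr_beta[OF sol T, of 1] by (simp add: E_def)
   from mult_le_trans[OF this h1] pos show ?thesis by (simp add: c2_def)
  qed
  have h3: "tr T ?B 2 <= c3 * e"
  proof -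
   have "tr T ?B 2 <= 2 * E * (sq T ?B 0 / qa + T * M\<^sup>2 * (T * tr T ?B 1))" using tr_beta[OF sol T, of 2] by (simp add: E_def)
   also have "... <= 2 * E * (c1 * e / qa + T * M\<^sup>2 * (T * (c2 * e)))"
    by (intro mult_left_mono add_mono divide_right_mono h1 h2) (use pos in auto)
   finally show ?thesis by (simp add: c3_def algebra_simps)
  qed
  have h4: "sq T ?B s <= c4 * e" if "s \<in> {0..T}" for s
  proof -
   have "sq T ?B s <= 2 * E * (2 * (qb / qa) * sq T ?B 0 + 2 * L * M\<^sup>2 * (T * tr T ?B 1))"
    using sq_beta[OF sol, of s T] that by (simp add: E_def)
   also have "... <= 2 * E * (2 * (qb / qa) * (c1 * e) + 2 * L * M\<^sup>2 * (T * (c2 * e)))"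
    by (intro mult_left_mono add_mono h1 h2) (use pos in auto)
   finally show ?thesis by (simp add: c4_def algebra_simps)
  qed
  define w where "w = sqrt (c5 * e)"
  have w2: "w\<^sup>2 = c5 * e" using c5 e by (simp add: w_def)
  have ws: "(wsum W s)\<^sup>2 <= c5 * e" if "s \<in> {0..T}" for s
  proof -
   let ?I = "integral {0..T} (\<lambda>u. zsum T ?B (0, u))"
   have zb: "bm (\<lambda>u. zsum T ?B (0, u))" by (rule bm_pair_swap(1)[OF sol_bm(6)[OF sol]])
   have "?I\<^sup>2 <= T * integral {0..T} (\<lambda>u. (zsum T ?B (0, u))\<^sup>2)"
    using bm_cauchy_schwarz[OF zb T] by (simp add: zsum_nonneg)
   also have "... <= T * integral {0..T} (\<lambda>u. 2 * ((cut T (?B 1) (0, u))\<^sup>2 + (cut T (?B 2) (0, u))\<^sup>2))"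
    using zsum_sq[of T ?B] unfolding sum_2'
    by (intro mult_left_mono T bm_integral_mono bm_power zb bm_mult bm_const bm_add cut_bm_origin sol_bm[OF sol]) auto
   also have "integral {0..T} (\<lambda>u. 2 * ((cut T (?B 1) (0, u))\<^sup>2 + (cut T (?B 2) (0, u))\<^sup>2)) = 2 * (tr T ?B 1 + tr T ?B 2)"
    unfolding tr_def
    by (rule integral_unique) (intro has_integral_mult_right has_integral_add bm_has_integral bm_power cut_bm_origin sol_bm[OF sol])
   also have "T * (2 * (tr T ?B 1 + tr T ?B 2)) <= T * (2 * (c2 * e + c3 * e))"
    using h2 h3 T by (intro mult_left_mono add_mono) auto
   finally have I: "?I\<^sup>2 <= T * (2 * (c2 + c3)) * e" by (simp add: algebra_simps)
   have w0: "(wsum W 0)\<^sup>2 <= 4 * e"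
   proof -
    have "(\<Sum>k\<in>UNIV. (W k 0)\<^sup>2) <= e"
     unfolding e_def en_eq[OF sol order_refl T] using sq_nonneg[of T p 0] sq_nonneg[of T r 0] sol_bm[OF sol] by simp
    then show ?thesis using wsum_sq[of W 0] by simp
   qed
   have "\<bar>wsum W s\<bar> <= (wsum W 0 + 8 * M * ?I) * G"
    using wsum_bound[OF sol, of s T] that wsum_nonneg[of W s] by (simp add: G_def)
   from power2_abs_le[OF this] have "(wsum W s)\<^sup>2 <= (wsum W 0 + 8 * M * ?I)\<^sup>2 * G\<^sup>2" by (simp add: power_mult_distrib)
   also have "... <= (2 * ((wsum W 0)\<^sup>2 + (8 * M * ?I)\<^sup>2)) * G\<^sup>2"
    by (intro mult_right_mono power2_sum2_le) auto
   also have "... <= (2 * (4 * e + (8 * M)\<^sup>2 * (T * (2 * (c2 + c3)) * e))) * G\<^sup>2"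
    unfolding power_mult_distrib[of "8 * M" ?I] by (intro mult_right_mono mult_left_mono add_mono w0 I) auto
   finally show ?thesis by (simp add: c5_def algebra_simps)
  qed
  have wle: "wsum W s <= w" if "s \<in> {0..T}" for s
   unfolding w_def using real_sqrt_le_mono[OF ws[OF that]] wsum_nonneg[of W s] by simp
  have h6: "tr T p 1 + tr T p 2 <= c6 * e"
  proof -
   have "tr T p i <= 8 * M\<^sup>2 * T * (c5 * e) + 2 * tr T ?B i" for i
    using tr_p[OF sol T wle, of i] unfolding w2 by simp
   from this[of 1] this[of 2] h2 h3 show ?thesis by (simp add: c6_def algebra_simps)
  qed
  have hr: "sq T r s <= a * e + b * sq T p s" if "s \<in> {0..T}" for s
  proof -
   have "sq T r s <= 4 * sq T ?B s + 6 * Kv\<^sup>2 * L * (2 * L * sq T ?B s + 2 * L * sq T p s + (wsum W s)\<^sup>2)"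
    using sq_r[OF sol, of s T] that by simp
   also have "... <= 4 * (c4 * e) + 6 * Kv\<^sup>2 * L * (2 * L * (c4 * e) + 2 * L * sq T p s + c5 * e)"
    by (intro mult_left_mono add_mono h4 ws that order_refl) (use pos in auto)
   finally show ?thesis by (simp add: a_def b_def algebra_simps)
  qed
  have pb: "bm (sq T p)" "bm (sq T r)" by (intro sq_bm sol_bm[OF sol])+
  have hp: "sq T p s <= c8 * e" if s: "s \<in> {0..T}" for s
  proof -
   have G: "sq T p s <= (c7 * e) * exp (k * (1 + b) * (s - 0))"
   proof (rule gronwall[of "sq T p" 0 T])
    show "sq T p integrable_on {0..T}" by (rule bm_integrable_on[OF pb(1)])
    show "0 <= k * (1 + b)" using k b by simp
    fix t assume t: "t \<in> {0..T}"
    have "sq T p t <= 6 * (qb / qa) * sq T p 0 + 3 * qb * (tr T p 1 + tr T p 2) + k * integral {0..t} (\<lambda>s. sq T p s + sq T r s)"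
     unfolding k_def by (rule sq_p[OF sol]) (use t in auto)
    also have "... <= 6 * (qb / qa) * e + 3 * qb * (c6 * e) + k * (T * (a * e) + (1 + b) * integral {0..t} (sq T p))"
    proof (intro add_mono mult_left_mono h6)
     show "sq T p 0 <= e"
      unfolding e_def en_eq[OF sol order_refl T] using sq_nonneg[of T r 0] sol_bm[OF sol] by (simp add: sum_nonneg)
     have "integral {0..t} (\<lambda>s. sq T p s + sq T r s) <= integral {0..t} (\<lambda>s. a * e + (1 + b) * sq T p s)"
      by (intro bm_integral_mono bm_add bm_mult bm_const pb) (use hr t in \<open>auto simp: algebra_simps\<close>)
     also have "... = t * (a * e) + (1 + b) * integral {0..t} (sq T p)"
     proof (rule integral_unique)
      show "((\<lambda>s. a * e + (1 + b) * sq T p s) has_integral t * (a * e) + (1 + b) * integral {0..t} (sq T p)) {0..t}"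
       using has_integral_const_real[of "a * e" 0 t] t
       by (intro has_integral_add has_integral_mult_right bm_has_integral pb) (simp add: mult.commute)
     qed
     also have "t * (a * e) <= T * (a * e)" using t a e by (intro mult_right_mono) auto
     finally show "integral {0..t} (\<lambda>s. sq T p s + sq T r s) <= T * (a * e) + (1 + b) * integral {0..t} (sq T p)" by simp
    qed (use pos k in auto)
    finally show "sq T p t <= c7 * e + k * (1 + b) * integral {0..t} (sq T p)" by (simp add: c7_def algebra_simps)
   qed (use s in auto)
   also have "... <= (c7 * e) * exp (k * (1 + b) * T)"
    using s k b c7 e by (intro mult_left_mono) (auto intro: mult_left_mono)
   finally show ?thesis by (simp add: c8_def mult_ac)
  qed
  have tT: "t \<in> {0..T}" using t by simp
  have "en p r W t <= c8 * e + (a * e + b * (c8 * e)) + c5 * e"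
   unfolding en_eq[OF sol t]
  proof (intro add_mono hp[OF tT])
   show "sq T r t <= a * e + b * (c8 * e)"
    using hr[OF tT] mult_left_mono[OF hp[OF tT] b] by simp
   show "(\<Sum>k\<in>UNIV. (W k t)\<^sup>2) <= c5 * e" using sum_sq_le_wsum[of W t] ws[OF tT] by simp
  qed
  then show "en p r W t <= ((1 + b) * c8 + a + c5) * en p r W 0" unfolding e_def by (simp add: algebra_simps)
 qed
qed

text \<open>The closed-loop matrix: when \<open>beta\<close> vanishes at the origin,
  \<open>r\<close> there equals \<open>lam\<close> at 0 applied to \<open>W\<close>.\<close>

definition Acl :: "4 => 4 => real" where
 "Acl k m = Am k m + 2 * (\<Sum>j\<in>UNIV. Bm k j * lam j m 0)"

definition flow :: "real => (4 => real => real) => bool" where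
 "flow t0 W \<longleftrightarrow> (\<forall>k. \<forall>t\<ge>t0. (W k has_real_derivative (\<Sum>m\<in>UNIV. Acl k m * W m t)) (at t within {t0..}))"

lemma sol_flow:
 assumes sol: "sol p r W" shows "flow T0 W"
 unfolding flow_def
proof (intro allI impI)
 fix k t assume t: "T0 <= t"
 then have t0: "0 <= t" using T0_pos by simp
 have r: "r j (0, t) = (\<Sum>m\<in>UNIV. lam j m 0 * W m t)" for j
  using beta_vanishes[OF sol origin_in[OF t0] t, of j] by (simp add: beta_origin)
 have "(\<Sum>m\<in>UNIV. Am k m * W m t) + 2 * (\<Sum>j\<in>UNIV. Bm k j * r j (0, t)) = (\<Sum>m\<in>UNIV. Acl k m * W m t)"
  unfolding r Acl_def sum_2' sum_4 by (simp add: algebra_simps)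
 then have "(W k has_real_derivative (\<Sum>m\<in>UNIV. Acl k m * W m t)) (at t within {0..})"
  using solD(5)[OF sol t0, of k] by simp
 then show "(W k has_real_derivative (\<Sum>m\<in>UNIV. Acl k m * W m t)) (at t within {T0..})"
  by (rule has_field_derivative_subset) (use T0_pos in auto)
qed

text \<open>A right-going characteristic crosses the domain in time at most \<open>L / qa\<close>,
  so from \<open>T1\<close> on it has entered at \<open>x = 0\<close> no earlier than
  \<open>T0\<close>.\<close>

definition T1 :: real where "T1 = T0 + L / qa"

text \<open>A supremum estimate with weight \<open>exp (- \<Lambda> * x + w * t)\<close>. The factor
  in \<open>t\<close> extracts the decay. The factor in \<open>x\<close> makes the coupling small:
  the paths of \<open>p\<close> and the Volterra integrals of \<open>r\<close> use only smaller
  \<open>x\<close>, so integration gains \<open>1 / \<Lambda>\<close>. For the chosen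
  \<open>\<Lambda>\<close> at most half of the supremum returns and is absorbed.\<close>

lemma late_bound:
 assumes sol: "sol p r W" and sigma: "0 <= w" and A: "0 <= A" "\<And>t. T0 <= t ==> wsum W t <= A * exp (- w * t)"
  and te: "T1 <= te" and x: "(x, te) \<in> tdomain l"
  and E: "E = exp (w * L / qa)" and Lam: "\<Lambda> = 2 * (2 * M * E / qa + Kv) + 1"
 shows "zz te p r (x, te) <= 2 * (4 * M * E + Kv) * A * exp (\<Lambda> * L) * exp (- w * te)"
proof -
 \<comment> \<open>The region is closed under the two moves of the proof, back along right-going
   characteristics to \<open>x = 0\<close> and to smaller \<open>x\<close> at the same time; these
   characteristics have all entered at or after \<open>T0\<close>. The bound by \<open>te\<close>
   makes the weighted supremum finite.\<close>
 define R where "R = {z \<in> tdomain l. snd z <= te \<and> T0 + fst z / qa <= snd z}"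
 define f where "f z = exp (- \<Lambda> * fst z + w * snd z) * zz te p r z" for z :: "real \<times> real"
 define S where "S = (SUP z\<in>R. f z)"
 have E0: "0 < E" "1 <= E" using sigma L0 qa by (auto simp: E)
 have Lam0: "1 <= \<Lambda>" unfolding Lam using M0 E0 qa Kv0 by simp
 obtain B where B: "0 <= B" "\<And>z. \<bar>zz te p r z\<bar> <= B" using bm_bound[OF zz_bm[OF sol]] by blast
 have bdd: "bdd_above (f ` R)"
 proof (rule bdd_aboveI2)
  fix z assume z: "z \<in> R"
  have "- \<Lambda> * fst z + w * snd z <= 0 + w * te"
   using z Lam0 sigma by (intro add_mono mult_left_mono) (auto simp: R_def tdomain_def)
  then have "f z <= exp (w * te) * B" unfolding f_def using B(2)[of z] zz_nonneg[of te p r z] by (intro mult_mono) auto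
  then show "f z <= exp (w * te) * B" .
 qed
 have fS: "f z <= S" if "z \<in> R" for z unfolding S_def by (rule cSUP_upper[OF that bdd])
 have xr: "(x, te) \<in> R"
 proof -
  have "x <= L" using tdomain_le_L[OF x] by simp
  then have "x / qa <= L / qa" using qa by (simp add: divide_right_mono)
  then show ?thesis using x te by (simp add: R_def T1_def)
 qed
 have zS: "zz te p r (y, s) <= S * exp (\<Lambda> * y - w * s)" if "(y, s) \<in> R" for y s
 proof -
  have "exp (\<Lambda> * y - w * s) * f (y, s) = (exp (\<Lambda> * y - w * s) * exp (- \<Lambda> * y + w * s)) * zz te p r (y, s)"
   unfolding f_def by (simp only: mult.assoc fst_conv snd_conv)
  also have "exp (\<Lambda> * y - w * s) * exp (- \<Lambda> * y + w * s) = 1" unfolding exp_add[symmetric] by simp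
  finally have "exp (\<Lambda> * y - w * s) * f (y, s) = zz te p r (y, s)" by simp
  moreover have "exp (\<Lambda> * y - w * s) * f (y, s) <= exp (\<Lambda> * y - w * s) * S" by (intro mult_left_mono fS that) simp
  ultimately show ?thesis by (simp add: mult.commute)
 qed
 have S0: "0 <= S" using fS[OF xr] zz_nonneg[of te p r "(x, te)"] unfolding f_def by (meson mult_nonneg_nonneg exp_ge_zero order_trans)
 have main: "f (y, t) <= (4 * M * E + Kv) * A + S * (2 * M * E / qa + Kv) / \<Lambda>" if yt: "(y, t) \<in> R" for y t
 proof -
  have dom: "(y, t) \<in> tdomain l" and tt: "t <= te" "T0 + y / qa <= t" using yt by (auto simp: R_def)
  have y: "0 <= y" "y <= L" using dom tdomain_le_L[OF dom] by (auto simp: tdomain_iff)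
  have yq: "y / qa <= L / qa" using y qa by (simp add: divide_right_mono)
  have tT0: "T0 <= t" using tt divide_nonneg_pos[OF y(1) qa] by linarith
  have pp: "\<bar>p i (y, t)\<bar> <= exp (- w * t) * (2 * M * E * A + M * S * E * exp (\<Lambda> * y) / (\<Lambda> * qa))" for i
  proof -
   define s where "s = t - \<Phi> i y"
   have "\<Phi> i 0 <= \<Phi> i y" using y by simp
   then have Phi: "0 <= \<Phi> i y" using \<Phi>_0 by simp
   have slope: "\<Psi> i (\<Phi> i y - t + v) <= y - qa * (t - v)" if "v <= t" for v
    using \<Psi>_slope[OF that, of i "\<Phi> i y - t"] by simp
   have st: "s <= t" using Phi by (simp add: s_def)
   have sy: "t - y / qa <= s"
   proof -
    have "0 <= y - qa * (t - s)" using slope[OF st] by (simp add: s_def)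
    then have "t - s <= y / qa" using qa by (simp add: field_simps)
    then show ?thesis by simp
   qed
   have sT0: "T0 <= s" using sy tt by simp
   have s0: "0 <= s" using sT0 T0_pos by simp
   have inR: "(\<Psi> i (\<Phi> i y - t + v), v) \<in> R" if v: "v \<in> {s..t}" for v
   proof -
    have "(\<Psi> i (\<Phi> i y - t + v), v) \<in> tdomain l"
     by (rule right_characteristic_in[OF dom]) (use v s0 s_def in auto)
    moreover have "\<Psi> i (\<Phi> i y - t + v) / qa <= (y - qa * (t - v)) / qa"
     using slope[of v] v qa by (intro divide_right_mono) auto
    then have "\<Psi> i (\<Phi> i y - t + v) / qa <= y / qa - (t - v)" using qa by (simp add: diff_divide_distrib)
    ultimately show ?thesis using v tt by (simp add: R_def)
   qed
   \<comment> \<open>\<open>E\<close> pays for the delay, at most \<open>L / qa\<close>, between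
     entry at the origin and time \<open>t\<close>.\<close>
   have late: "exp (- w * v) <= exp (- w * t) * E" if v: "v \<in> {s..t}" for v
   proof -
    have "t - v <= L / qa" using v sy yq by simp
    then have "w * (t - v) <= w * (L / qa)" using sigma by (rule mult_left_mono)
    then show ?thesis unfolding E exp_add[symmetric] by (simp add: algebra_simps)
   qed
   let ?z = "\<lambda>v. zz te p r (\<Psi> i (\<Phi> i y - t + v), v)"
   have I: "integral {s..t} ?z <= S * E * exp (- w * t) * exp (\<Lambda> * y) * (1 / (\<Lambda> * qa))"
   proof -
    have k: "0 < \<Lambda> * qa" using Lam0 qa by simp
    have "integral {s..t} ?z <= integral {s..t} (\<lambda>v. S * E * exp (- w * t) * exp (\<Lambda> * y) * exp (\<Lambda> * qa * (v - t)))"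
    proof (rule integral_le)
     show "?z integrable_on {s..t}" by (rule bm_integrable_on[OF zz_path_bm[OF sol]])
     show "(\<lambda>v. S * E * exp (- w * t) * exp (\<Lambda> * y) * exp (\<Lambda> * qa * (v - t))) integrable_on {s..t}"
      by (rule integrable_on_mult_right[OF integral_exp_le(1)[OF k st]])
     fix v assume v: "v \<in> {s..t}"
     let ?y = "\<Psi> i (\<Phi> i y - t + v)"
     have "?z v <= S * exp (\<Lambda> * ?y - w * v)" by (rule zS[OF inR[OF v]])
     also have "... = S * (exp (\<Lambda> * ?y) * exp (- w * v))" by (simp add: exp_add[symmetric])
     also have "... <= S * (exp (\<Lambda> * (y - qa * (t - v))) * (exp (- w * t) * E))"
      using slope[of v] v Lam0 by (intro mult_left_mono mult_mono late S0) auto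
     also have "exp (\<Lambda> * (y - qa * (t - v))) = exp (\<Lambda> * y) * exp (\<Lambda> * qa * (v - t))"
      unfolding exp_add[symmetric] by (simp add: algebra_simps)
     finally show "?z v <= S * E * exp (- w * t) * exp (\<Lambda> * y) * exp (\<Lambda> * qa * (v - t))" by (simp add: mult_ac)
    qed
    also have "... = S * E * exp (- w * t) * exp (\<Lambda> * y) * integral {s..t} (\<lambda>v. exp (\<Lambda> * qa * (v - t)))"
     by (rule integral_mult_right)
    also have "... <= S * E * exp (- w * t) * exp (\<Lambda> * y) * (1 / (\<Lambda> * qa))"
     using S0 E0 by (intro mult_left_mono integral_exp_le(2)[OF k st]) auto
    finally show ?thesis .
   qed
   have foot: "\<bar>p i (\<Psi> i (\<Phi> i y - t + s), s)\<bar> <= 2 * M * (A * (exp (- w * t) * E))"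
   proof -
    have "\<Psi> i (\<Phi> i y - t + s) = 0" by (simp add: s_def)
    moreover have "p i (0, s) = (\<Sum>k\<in>UNIV. Cm i k * W k s) - r i (0, s)" by (rule solD(6)[OF sol s0])
    moreover have "r i (0, s) = (\<Sum>k\<in>UNIV. lam i k 0 * W k s)"
     using beta_vanishes[OF sol origin_in[OF s0] sT0, of i] by (simp add: beta_origin)
    moreover have "\<bar>\<Sum>k\<in>UNIV. Cm i k * W k s\<bar> <= M * wsum W s" by (rule sum_abs_wsum[OF Cm_le])
    moreover have "\<bar>\<Sum>k\<in>UNIV. lam i k 0 * W k s\<bar> <= M * wsum W s" by (rule sum_abs_wsum[OF lam_le])
    ultimately have "\<bar>p i (\<Psi> i (\<Phi> i y - t + s), s)\<bar> <= 2 * (M * wsum W s)" by simp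
    also have "M * wsum W s <= M * (A * (exp (- w * t) * E))"
     using order_trans[OF A(2)[OF sT0] mult_left_mono[OF late A(1)]] st M0 by (intro mult_left_mono) auto
    finally show ?thesis by simp
   qed
   have "\<bar>p i (y, t)\<bar> <= \<bar>p i (\<Psi> i (\<Phi> i y - t + s), s)\<bar> + M * integral {s..t} ?z"
    by (rule p_bound[OF sol dom tt(1) s0 _ st]) (simp add: s_def)
   also have "... <= 2 * M * (A * (exp (- w * t) * E)) + M * (S * E * exp (- w * t) * exp (\<Lambda> * y) * (1 / (\<Lambda> * qa)))"
    by (intro add_mono foot mult_left_mono I M0)
   finally show ?thesis by (simp add: algebra_simps)
  qed
  have zp: "zsum te p (y, t) = \<bar>p 1 (y, t)\<bar> + \<bar>p 2 (y, t)\<bar>"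
   unfolding zsum_def sum_2' using dom tt by (simp add: cut_in)
  have rr: "zsum te r (y, t) <= exp (- w * t) * (Kv * (S * exp (\<Lambda> * y) / \<Lambda> + A))"
  proof -
   have b0: "zsum te (beta p r W) (y', t) = 0" if "y' \<in> {0..y}" for y'
   proof -
    have "(y', t) \<in> tdomain l" using dom that by (simp add: tdomain_iff)
    then show ?thesis unfolding zsum_def using beta_vanishes[OF sol _ tT0] tt by (simp add: cut_in)
   qed
   have bI: "integral {0..y} (\<lambda>y'. zsum te (beta p r W) (y', t)) = 0"
    using integral_cong[of "{0..y}" "\<lambda>y'. zsum te (beta p r W) (y', t)" "\<lambda>_. 0"] b0 by simp
   have pI: "integral {0..y} (\<lambda>y'. zsum te p (y', t)) <= S * exp (- w * t) * exp (\<Lambda> * y) * (1 / \<Lambda>)"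
   proof -
    have k: "0 < \<Lambda>" using Lam0 by simp
    have "integral {0..y} (\<lambda>y'. zsum te p (y', t)) <= integral {0..y} (\<lambda>y'. S * exp (- w * t) * exp (\<Lambda> * y) * exp (\<Lambda> * (y' - y)))"
    proof (rule integral_le)
     show "(\<lambda>y'. zsum te p (y', t)) integrable_on {0..y}" by (rule bm_integrable_on[OF bm_pair_swap(2)[OF sol_bm(4)[OF sol]]])
     show "(\<lambda>y'. S * exp (- w * t) * exp (\<Lambda> * y) * exp (\<Lambda> * (y' - y))) integrable_on {0..y}"
      by (rule integrable_on_mult_right[OF integral_exp_le(1)[OF k y(1)]])
     fix y' assume y': "y' \<in> {0..y}"
     have "y' / qa <= y / qa" using y' qa by (simp add: divide_right_mono)
     then have "(y', t) \<in> R" using y' dom tt by (simp add: R_def tdomain_iff)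
     from zS[OF this] zsum_nonneg[of te r "(y', t)"]
     have "zsum te p (y', t) <= S * exp (\<Lambda> * y' - w * t)" by (simp add: zz_def)
     also have "exp (\<Lambda> * y' - w * t) = exp (- w * t) * exp (\<Lambda> * y) * exp (\<Lambda> * (y' - y))"
      unfolding exp_add[symmetric] by (simp add: algebra_simps)
     finally show "zsum te p (y', t) <= S * exp (- w * t) * exp (\<Lambda> * y) * exp (\<Lambda> * (y' - y))" by (simp add: mult_ac)
    qed
    also have "... = S * exp (- w * t) * exp (\<Lambda> * y) * integral {0..y} (\<lambda>y'. exp (\<Lambda> * (y' - y)))"
     by (rule integral_mult_right)
    also have "... <= S * exp (- w * t) * exp (\<Lambda> * y) * (1 / \<Lambda>)"
     using S0 by (intro mult_left_mono integral_exp_le(2)[OF k y(1)]) auto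
    finally show ?thesis .
   qed
   have "zsum te r (y, t) <= Kv * (integral {0..y} (\<lambda>y'. zsum te p (y', t)) + wsum W t)"
    using volterra_bound[OF sol dom tt(1)] b0[of y] y bI by simp
   also have "... <= Kv * (S * exp (- w * t) * exp (\<Lambda> * y) * (1 / \<Lambda>) + A * exp (- w * t))"
    by (intro mult_left_mono add_mono pI A(2) tT0 Kv0)
   finally show ?thesis by (simp add: algebra_simps)
  qed
  have e1: "exp (- \<Lambda> * y) <= 1" using Lam0 y by simp
  have add3: "a <= e * u ==> b <= e * u ==> c <= e * v ==> a + b + c <= e * (2 * u + v)" for a b c e u v :: real
   by (simp add: algebra_simps)
  have "zz te p r (y, t) <= exp (- w * t) * (2 * (2 * M * E * A + M * S * E * exp (\<Lambda> * y) / (\<Lambda> * qa)) + Kv * (S * exp (\<Lambda> * y) / \<Lambda> + A))"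
   unfolding zz_def zp by (rule add3[OF pp pp rr])
  also have "... = exp (- w * t) * ((4 * M * E + Kv) * A + exp (\<Lambda> * y) * (S * (2 * M * E / qa + Kv) / \<Lambda>))"
   using qa Lam0 by (simp add: field_simps)
  finally have z: "zz te p r (y, t) <= exp (- w * t) * ((4 * M * E + Kv) * A + exp (\<Lambda> * y) * (S * (2 * M * E / qa + Kv) / \<Lambda>))" .
  have "f (y, t) <= exp (- \<Lambda> * y + w * t) * (exp (- w * t) * ((4 * M * E + Kv) * A + exp (\<Lambda> * y) * (S * (2 * M * E / qa + Kv) / \<Lambda>)))"
   unfolding f_def fst_conv snd_conv by (intro mult_left_mono z) simp
  also have "... = exp (- \<Lambda> * y) * ((4 * M * E + Kv) * A + exp (\<Lambda> * y) * (S * (2 * M * E / qa + Kv) / \<Lambda>))"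
   unfolding mult.assoc[symmetric] exp_add[symmetric] by simp
  also have "... = exp (- \<Lambda> * y) * ((4 * M * E + Kv) * A) + (S * (2 * M * E / qa + Kv) / \<Lambda>)"
  proof -
   have "exp (- \<Lambda> * y) * (a + exp (\<Lambda> * y) * b) = exp (- \<Lambda> * y) * a + (exp (- \<Lambda> * y) * exp (\<Lambda> * y)) * b" for a b
    by (simp only: distrib_left mult.assoc)
   moreover have "exp (- \<Lambda> * y) * exp (\<Lambda> * y) = 1" unfolding exp_add[symmetric] by simp
   ultimately show ?thesis by (simp only: mult_1)
  qed
  also have "... <= 1 * ((4 * M * E + Kv) * A) + (S * (2 * M * E / qa + Kv) / \<Lambda>)"
   using e1 M0 E0 Kv0 A by (intro add_mono mult_right_mono) auto
  finally show ?thesis by simp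
 qed
 have "(SUP z\<in>R. f z) <= (4 * M * E + Kv) * A + S * (2 * M * E / qa + Kv) / \<Lambda>"
  proof (rule cSUP_least)
  show "R \<noteq> {}" using xr by blast
  show "f z <= (4 * M * E + Kv) * A + S * (2 * M * E / qa + Kv) / \<Lambda>" if "z \<in> R" for z
   using main[of "fst z" "snd z"] that by simp
 qed
 then have "S <= (4 * M * E + Kv) * A + S * (2 * M * E / qa + Kv) / \<Lambda>" by (simp only: S_def)
 \<comment> \<open>\<open>\<Lambda>\<close> exceeds twice the numerator, so \<open>S\<close>
   reappears with a factor at most 1/2. Subtracting it is legitimate because \<open>S\<close> is a
   genuine finite supremum, by \<open>bdd\<close>.\<close>
 moreover have "S * (2 * M * E / qa + Kv) / \<Lambda> <= S * (1 / 2)"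
 proof -
  have "(2 * M * E / qa + Kv) / \<Lambda> <= 1 / 2" using Lam0 unfolding pos_divide_le_eq[OF less_le_trans[OF zero_less_one Lam0]] Lam by simp
  from mult_left_mono[OF this S0] show ?thesis by simp
 qed
 ultimately have S: "S <= 2 * ((4 * M * E + Kv) * A)" by linarith
 have "zz te p r (x, te) <= S * exp (\<Lambda> * x - w * te)" by (rule zS[OF xr])
 also have "... <= 2 * ((4 * M * E + Kv) * A) * (exp (\<Lambda> * L) * exp (- w * te))"
 proof (rule mult_mono[OF S])
  have "\<Lambda> * x <= \<Lambda> * L" using Lam0 tdomain_le_L[OF x] by (intro mult_left_mono) auto
  then show "exp (\<Lambda> * x - w * te) <= exp (\<Lambda> * L) * exp (- w * te)" unfolding exp_add[symmetric] by simp
 qed (use M0 E0 Kv0 A in auto)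
 finally show ?thesis by (simp add: mult_ac)
qed

text \<open>Until \<open>T1\<close> the growth estimate suffices, at the price of
  \<open>exp (2 * w * T1)\<close>. Afterwards the pointwise bound is squared and integrated, which
  doubles the rate, and \<open>wsum W T0\<close> is bounded through the growth estimate.\<close>

lemma en_decay:
 assumes sigma: "0 <= w"
  and D: "0 <= D" "\<And>W t. flow T0 W ==> T0 <= t ==> wsum W t <= D * exp (- w * (t - T0)) * wsum W T0"
 obtains C where "0 <= C" "\<And>p r W t. sol p r W ==> 0 <= t ==> en p r W t <= C * exp (- 2 * w * t) * en p r W 0"
proof -
 have T1: "0 <= T1" "T0 <= T1" using T0_pos qa L0 by (auto simp: T1_def)
 obtain C1 where C1: "0 <= C1" "\<And>p r W t. sol p r W ==> t \<in> {0..T1} ==> en p r W t <= C1 * en p r W 0"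
  using en_growth[OF T1(1)] by metis
 define E where "E = exp (w * L / qa)"
 define \<Lambda> where "\<Lambda> = 2 * (2 * M * E / qa + Kv) + 1"
 define K where "K = 2 * (4 * M * E + Kv) * exp (\<Lambda> * L)"
 define c where "c = (L * K\<^sup>2 + 1) * (D * exp (w * T0))\<^sup>2 * (4 * C1)"
 have c0: "0 <= c" unfolding c_def using L0 C1(1) by simp
 show thesis
 proof (rule that[of "C1 * exp (2 * w * T1) + c"])
  show "0 <= C1 * exp (2 * w * T1) + c" using C1(1) c0 by simp
  fix p r W t assume sol: "sol p r W" and t: "0 <= (t::real)"
  have e0: "0 <= en p r W 0" by (rule en_nonneg[OF sol order_refl])
  show "en p r W t <= (C1 * exp (2 * w * T1) + c) * exp (- 2 * w * t) * en p r W 0"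
  proof (cases "t <= T1")
   case True
   then have "en p r W t <= C1 * en p r W 0" using t by (intro C1(2)[OF sol]) auto
   also have "... <= (C1 * (exp (2 * w * T1) * exp (- 2 * w * t))) * en p r W 0"
   proof -
    have "2 * w * t <= 2 * w * T1" using True sigma by (simp add: mult_left_mono)
    then have "1 <= exp (2 * w * T1) * exp (- 2 * w * t)" unfolding exp_add[symmetric] by simp
    from mult_left_mono[OF this C1(1)] show ?thesis by (intro mult_right_mono e0) simp
   qed
   also have "... <= (C1 * exp (2 * w * T1) + c) * exp (- 2 * w * t) * en p r W 0"
    using c0 e0 by (intro mult_right_mono) (auto simp: algebra_simps)
   finally show ?thesis .
  next
   case False
   then have te: "T1 <= t" by simp
   define A where "A = D * exp (w * T0) * wsum W T0"
   have A0: "0 <= A" unfolding A_def using D(1) wsum_nonneg by simp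
   have A: "wsum W s <= A * exp (- w * s)" if "T0 <= s" for s
   proof -
    have "wsum W s <= D * exp (- w * (s - T0)) * wsum W T0" by (rule D(2)[OF sol_flow[OF sol] that])
    also have "exp (- w * (s - T0)) = exp (w * T0) * exp (- w * s)" unfolding exp_add[symmetric] by (simp add: algebra_simps)
    finally show ?thesis unfolding A_def by (simp add: mult_ac)
   qed
   have A2: "A\<^sup>2 <= (D * exp (w * T0))\<^sup>2 * (4 * (C1 * en p r W 0))"
   proof -
    have "(\<Sum>k\<in>UNIV. (W k T0)\<^sup>2) <= en p r W T0"
     unfolding en_eq[OF sol less_imp_le[OF T0_pos(1)] order_refl]
     using sq_nonneg[of T0 p T0] sq_nonneg[of T0 r T0] sol_bm[OF sol] by simp
    also have "... <= C1 * en p r W 0" using T0_pos T1 by (intro C1(2)[OF sol]) auto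
    finally have "(wsum W T0)\<^sup>2 <= 4 * (C1 * en p r W 0)" using wsum_sq[of W T0] by simp
    from mult_left_mono[OF this, of "(D * exp (w * T0))\<^sup>2"] show ?thesis unfolding A_def power_mult_distrib by simp
   qed
   define Z where "Z = K * A * exp (- w * t)"
   have zle: "zz t p r (x, t) <= Z" if x: "(x, t) \<in> tdomain l" for x
    using late_bound[OF sol sigma A0 A te x E_def \<Lambda>_def] unfolding Z_def K_def by (simp add: mult_ac)
   have zb: "bm (zz t p r)" by (rule zz_bm[OF sol])
   have sqs: "sq t p t + sq t r t <= L * Z\<^sup>2"
   proof -
    have "sq t p t + sq t r t = integral {0..L} (\<lambda>x. (\<Sum>j\<in>UNIV. (cut t (p j) (x, t))\<^sup>2) + (\<Sum>j\<in>UNIV. (cut t (r j) (x, t))\<^sup>2))"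
     unfolding sq_def by (rule integral_add[symmetric]) (intro bm_integrable_on bm_sum bm_power cut_bm_slice sol_bm[OF sol])+
    also have "... <= integral {0..L} (\<lambda>x. Z\<^sup>2)"
    proof (rule bm_integral_mono)
     show "bm (\<lambda>x. (\<Sum>j\<in>UNIV. (cut t (p j) (x, t))\<^sup>2) + (\<Sum>j\<in>UNIV. (cut t (r j) (x, t))\<^sup>2))"
      by (intro bm_add bm_sum bm_power cut_bm_slice sol_bm[OF sol])
     fix x
     show "(\<Sum>j\<in>UNIV. (cut t (p j) (x, t))\<^sup>2) + (\<Sum>j\<in>UNIV. (cut t (r j) (x, t))\<^sup>2) <= Z\<^sup>2"
     proof (cases "(x, t) \<in> tdomain l")
      case True
      have sq4: "a\<^sup>2 + b\<^sup>2 + (c\<^sup>2 + d\<^sup>2) <= (\<bar>a\<bar> + \<bar>b\<bar> + (\<bar>c\<bar> + \<bar>d\<bar>))\<^sup>2" for a b c d :: real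
      proof -
       have "a\<^sup>2 + b\<^sup>2 <= (\<bar>a\<bar> + \<bar>b\<bar>)\<^sup>2" for a b :: real by (simp add: power2_sum)
       from this[of a b] this[of c d] this[of "\<bar>a\<bar> + \<bar>b\<bar>" "\<bar>c\<bar> + \<bar>d\<bar>"] show ?thesis by simp
      qed
      have "(\<Sum>j\<in>UNIV. (cut t (p j) (x, t))\<^sup>2) + (\<Sum>j\<in>UNIV. (cut t (r j) (x, t))\<^sup>2) <= (zz t p r (x, t))\<^sup>2"
       unfolding zz_def zsum_def sum_2' by (rule sq4)
      also have "... <= Z\<^sup>2" using zle[OF True] zz_nonneg by (intro power_mono) auto
      finally show ?thesis .
     qed (simp add: cut_def)
    qed (rule bm_const)
    also have "... = L * Z\<^sup>2" using L0 by simp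
    finally show ?thesis .
   qed
   have "en p r W t <= L * Z\<^sup>2 + (A * exp (- w * t))\<^sup>2"
    unfolding en_eq[OF sol t order_refl]
    using sqs sum_sq_le_wsum[of W t] power_mono[OF A wsum_nonneg, of t 2] te T1 by fastforce
   also have "... = (L * K\<^sup>2 + 1) * exp (- 2 * w * t) * A\<^sup>2"
   proof -
    have "exp (- 2 * w * t) = (exp (- w * t))\<^sup>2" by (simp add: power2_eq_square exp_add[symmetric])
    then show ?thesis unfolding Z_def by (simp add: power_mult_distrib algebra_simps)
   qed
   also have "... <= (L * K\<^sup>2 + 1) * exp (- 2 * w * t) * ((D * exp (w * T0))\<^sup>2 * (4 * (C1 * en p r W 0)))"
    by (rule mult_left_mono[OF A2]) (use L0 in simp)
   also have "... = c * exp (- 2 * w * t) * en p r W 0" unfolding c_def by (simp add: mult_ac)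
   also have "... <= (C1 * exp (2 * w * T1) + c) * exp (- 2 * w * t) * en p r W 0"
    using C1(1) e0 by (intro mult_right_mono) auto
   finally show ?thesis .
  qed
 qed
qed

end

section \<open>Plant and kernel data\<close>

lemma AE_lebesgue_on_negligible:
 fixes S :: "'a::euclidean_space set"
 assumes "AE x in lebesgue_on S. P x" "S \<in> sets lebesgue"
 obtains Z where "negligible Z" "\<And>x. x \<in> S - Z ==> P x"
proof -
 have "AE x in lebesgue. x \<in> S \<longrightarrow> P x" using assms by (subst (asm) AE_restrict_space_iff) auto
 then obtain N where N: "{x \<in> space lebesgue. \<not> (x \<in> S \<longrightarrow> P x)} \<subseteq> N" "N \<in> null_sets lebesgue"
  by (auto simp: eventually_ae_filter)
 show thesis
  by (rule that[of N]) (use N in \<open>auto simp: negligible_iff_null_sets\<close>)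
qed

lemma negligible_AE_lebesgue_on:
 fixes S :: "'a::euclidean_space set"
 assumes "negligible Z" "\<And>x. x \<in> S - Z ==> P x" "S \<in> sets lebesgue"
 shows "AE x in lebesgue_on S. P x"
proof -
 have "AE x in lebesgue. x \<in> S \<longrightarrow> P x"
  by (rule AE_I'[of Z]) (use assms in \<open>auto simp: negligible_iff_null_sets\<close>)
 then show ?thesis using assms(3) by (subst AE_restrict_space_iff) auto
qed

text \<open>\<open>g\<close> is an everywhere defined representative of \<open>f\<close> on
  \<open>{0..L}\<close>. The exceptional set is explicit, because its preimages under
  characteristics have to be taken.\<close>

definition version :: "real => (real => real) => (real => real) => bool" where
 "version L f g \<longleftrightarrow> bm g \<and> (\<exists>Z. negligible Z \<and> (\<forall>x\<in>{0..L} - Z. f x = g x))"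

lemma version_combine:
 assumes f: "version L f f'" and g: "version L g g'" and h: "\<And>u v :: real => real. bm u ==> bm v ==> bm (\<lambda>x. h (u x) (v x))"
 shows "version L (\<lambda>x. h (f x) (g x)) (\<lambda>x. h (f' x) (g' x))"
proof -
 obtain Z1 Z2 where Z: "negligible Z1" "\<forall>x\<in>{0..L} - Z1. f x = f' x" "negligible Z2" "\<forall>x\<in>{0..L} - Z2. g x = g' x"
  using f g unfolding version_def by blast
 then have "negligible (Z1 \<union> Z2)" "\<forall>x\<in>{0..L} - (Z1 \<union> Z2). h (f x) (g x) = h (f' x) (g' x)" by (auto intro: negligible_Un)
 then have "\<exists>Z. negligible Z \<and> (\<forall>x\<in>{0..L} - Z. h (f x) (g x) = h (f' x) (g' x))" by blast
 moreover have "bm (\<lambda>x. h (f' x) (g' x))" by (rule h[of f' g']) (use f g in \<open>auto simp: version_def\<close>)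
 ultimately show ?thesis by (simp add: version_def)
qed

lemmas version_add = version_combine[where h="(+)", OF _ _ bm_add]
 and version_diff = version_combine[where h="(-)", OF _ _ bm_diff]
 and version_mult = version_combine[where h="(*)", OF _ _ bm_mult]

lemma bm_clamp:
 fixes f :: "real => real"
 assumes "continuous_on {0..L} f" "0 <= L"
 shows "continuous_on UNIV (\<lambda>x. f (max 0 (min L x)))" "bm (\<lambda>x. f (max 0 (min L x)))"
proof -
 have c: "(\<lambda>x. max 0 (min L x)) ` UNIV \<subseteq> {0..L}" using assms(2) by auto
 show cont: "continuous_on UNIV (\<lambda>x. f (max 0 (min L x)))"
  by (rule continuous_on_compose2[OF assms(1) _ c]) (intro continuous_intros)
 obtain B where B: "\<And>x. x \<in> {0..L} ==> norm (f x) <= B"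
  using compact_imp_bounded[OF compact_continuous_image[OF assms(1) compact_Icc]] unfolding bounded_iff by blast
 show "bm (\<lambda>x. f (max 0 (min L x)))"
  by (rule bmI[OF borel_contI[OF cont], of B]) (use B c in \<open>auto simp: image_subset_iff\<close>)
qed

lemma version_continuous: "continuous_on {0..L} f ==> 0 <= L ==> version L f (\<lambda>x. f (max 0 (min L x)))"
 unfolding version_def by (intro conjI bm_clamp exI[of _ "{}"]) auto

text \<open>A Lebesgue measurable function agrees almost everywhere with a Borel one; clipping to
  the known bound makes the latter bounded everywhere without changing it where the two
  agree.\<close>

lemma version_exists:
 assumes m: "f \<in> borel_measurable (lebesgue_on {0..L})" and b: "bounded (f ` {0..L})"
 obtains g where "version L f g"
proof -
 obtain B where B: "\<And>x. x \<in> {0..L} ==> \<bar>f x\<bar> <= B" using b unfolding bounded_iff by (auto simp del: atLeastAtMost_iff)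
 have "(\<lambda>x. if x \<in> {0..L} then f x else 0) \<in> borel_measurable lebesgue"
  by (rule borel_measurable_if_I[OF m]) auto
 then obtain g where g: "g \<in> borel_measurable lborel" "AE x in lborel. (if x \<in> {0..L} then f x else 0) = g x"
  using completion_ex_borel_measurable_real by blast
 define g' where "g' x = max (- B) (min B (g x))" for x
 have gm: "g \<in> borel_measurable borel" using g(1) by simp
 have "bm g'"
  by (rule bmI[where B="\<bar>B\<bar>"]) (use gm in \<open>auto simp: g'_def[abs_def] max_def min_def\<close>)
 moreover obtain N where N: "{x \<in> space lborel. \<not> (if x \<in> {0..L} then f x else 0) = g x} \<subseteq> N" "N \<in> null_sets lborel"
  using g(2) unfolding eventually_ae_filter by blast
 have "negligible N" using N(2) by (simp add: negligible_iff_null_sets null_sets_completionI)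
 moreover have "f x = g' x" if x: "x \<in> {0..L} - N" for x
 proof -
  have "f x = g x" using N(1) x by (auto split: if_splits)
  then show ?thesis using B[of x] x by (simp add: g'_def abs_le_iff max_def min_def)
 qed
 ultimately show thesis by (intro that[of g']) (auto simp: version_def)
qed

text \<open>The derivative \<open>1 / q\<close> is at least \<open>1 / qb\<close>, so the
  antiderivative grows at least linearly in both directions and is onto.\<close>

lemma antiderivative_bijection:
 fixes q :: "real => real"
 assumes qc: "continuous_on UNIV q" and qa: "0 < qa" "\<And>x. qa <= q x" and qb: "\<And>x. q x <= qb"
 obtains \<Phi> \<Psi> where "\<And>x. (\<Phi> has_real_derivative 1 / q x) (at x)" "\<Phi> 0 = 0" "\<And>x. \<Psi> (\<Phi> x) = x" "\<And>y. \<Phi> (\<Psi> y) = y"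
proof -
 have pos: "0 < q x" for x using qa(1) qa(2)[of x] by linarith
 have qb0: "0 < qb" using pos[of 0] qb[of 0] by linarith
 have "isCont (\<lambda>x. 1 / q x) x" for x
  using qc pos[of x] by (intro continuous_intros) (auto simp: continuous_on_eq_continuous_at)
 then have "\<exists>F. \<forall>x. -\<infinity> < ereal x \<longrightarrow> ereal x < \<infinity> \<longrightarrow> (F has_vector_derivative 1 / q x) (at x)"
  by (intro einterval_antiderivative) auto
 then obtain F where F: "\<And>x. (F has_vector_derivative 1 / q x) (at x)" by auto
 define \<Phi> where "\<Phi> x = F x - F 0" for x
 have d: "(\<Phi> has_real_derivative 1 / q x) (at x)" for x
  using F[of x] unfolding \<Phi>_def[abs_def] has_real_derivative_iff_has_vector_derivative
  by (auto intro!: derivative_eq_intros)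
 have Phi0: "\<Phi> 0 = 0" by (simp add: \<Phi>_def)
 have mono: "\<Phi> x < \<Phi> y" if "x < y" for x y
  by (rule DERIV_pos_imp_increasing[OF that]) (use d pos in \<open>auto intro!: exI\<close>)
 have inj: "inj \<Phi>" by (rule linorder_injI) (use mono less_imp_neq in blast)
 have ge: "(y - x) / qb <= \<Phi> y - \<Phi> x" if "x <= y" for x y
 proof -
  have "\<Phi> x - x / qb <= \<Phi> y - y / qb"
  proof (rule DERIV_nonneg_imp_nondecreasing[OF that, of "\<lambda>u. \<Phi> u - u / qb"])
   fix u
   have "((\<lambda>u. \<Phi> u - u / qb) has_real_derivative 1 / q u - 1 / qb) (at u)"
    using qb0 by (auto intro!: derivative_eq_intros d)
   moreover have "0 <= 1 / q u - 1 / qb" using qb[of u] pos[of u] by (simp add: frac_le)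
   ultimately show "\<exists>y. ((\<lambda>u. \<Phi> u - u / qb) has_real_derivative y) (at u) \<and> 0 <= y" by blast
  qed
  then show ?thesis by (simp add: diff_divide_distrib)
 qed
 have surj: "\<exists>x. \<Phi> x = y" for y
 proof -
  have a: "\<Phi> (- (qb * \<bar>y\<bar>)) <= y" "y <= \<Phi> (qb * \<bar>y\<bar>)"
   using ge[of "- (qb * \<bar>y\<bar>)" 0] ge[of 0 "qb * \<bar>y\<bar>"] qb0 Phi0 by auto
  have "- (qb * \<bar>y\<bar>) <= qb * \<bar>y\<bar>" using qb0 by simp
  from IVT'[OF a this] show ?thesis
   using DERIV_continuous_on_at[OF d] by blast
 qed
 show thesis
 proof (rule that[of \<Phi> "inv \<Phi>", OF d Phi0])
  show "inv \<Phi> (\<Phi> x) = x" for x using inj by simp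
  show "\<Phi> (inv \<Phi> y) = y" for y using surj[of y] by (intro f_inv_into_f) blast
 qed
qed

section \<open>Speeds, coefficients and moving boundary of the plant\<close>

locale plant_data =
 fixes P :: plant and Mlo Mhi :: real
 assumes SA: "standing_assumptions P Mlo Mhi"
begin

abbreviation "L \<equiv> Lmax P"
abbreviation "l \<equiv> bdry P"

text \<open>Component 1 belongs to \<open>u\<close> and component 2 to \<open>w\<close>, the order
  of the diagonal of \<open>Qmat\<close>.\<close>

definition dd :: "2 => real => real" where "dd i = (if i = 1 then d6 P else d1 P)"

text \<open>Projection to \<open>{0..L}\<close>, which extends data on the interval to the line by
  their end values and preserves continuity.\<close>

definition clamp :: "real => real" where "clamp x = max 0 (min L x)"

lemmas SA_1 = SA[unfolded standing_assumptions_def]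
lemmas SA_4 = SA_1[THEN conjunct2, THEN conjunct2, THEN conjunct2]
lemmas SA_7 = SA_4[THEN conjunct2, THEN conjunct2, THEN conjunct2]
lemmas SAD = SA_1[THEN conjunct1] SA_1[THEN conjunct2, THEN conjunct1] SA_1[THEN conjunct2, THEN conjunct2, THEN conjunct1]
 SA_4[THEN conjunct1] SA_4[THEN conjunct2, THEN conjunct1] SA_4[THEN conjunct2, THEN conjunct2, THEN conjunct1]
 SA_7[THEN conjunct1] SA_7[THEN conjunct2, THEN conjunct2, THEN conjunct1] SA_7[THEN conjunct2, THEN conjunct2, THEN conjunct2]

lemma dd_12 [simp]: "dd 1 = d6 P" "dd 2 = d1 P"
 by (simp_all add: dd_def)

lemma l_bound: "0 <= t ==> 0 < l t \<and> l t <= L"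
 using SAD(5) by blast

lemma L_pos: "0 < L"
 using l_bound[of 0] by simp

lemma clamp_in: "clamp x \<in> {0..L}"
 using L_pos by (auto simp: clamp_def)

lemma clamp_id [simp]: "0 <= x ==> x <= L ==> clamp x = x"
 by (auto simp: clamp_def)

lemma dd_C1: "C1_on_interval 0 L (dd i)"
 using SAD(2,3) by (simp add: dd_def)

definition dd' :: "2 => real => real" where
 "dd' i = (SOME f'. continuous_on {0..L} f' \<and> (\<forall>x\<in>{0..L}. (dd i has_real_derivative f' x) (at x within {0..L})))"

lemma dd': "continuous_on {0..L} (dd' i)" "x \<in> {0..L} ==> (dd i has_real_derivative dd' i x) (at x within {0..L})"
 using someI_ex[OF dd_C1[of i, unfolded C1_on_interval_def]] unfolding dd'_def by blast+

lemma dd_cont: "continuous_on {0..L} (dd i)"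
 using dd'(2) by (intro DERIV_continuous_on)

lemma dd_pos: "x \<in> {0..L} ==> 0 < dd i x"
 using SAD(4) by (simp add: dd_def)

lemma dd_ne: "x \<in> {0..L} ==> dd 1 x \<noteq> dd 2 x"
 using SAD(4) by (simp add: eq_commute[of "d6 P x"])

definition q :: "2 => real => real" where "q i x = sqrt (dd i (clamp x))"

definition qd :: "2 => real => real" where "qd i x = dd' i (clamp x) / (2 * q i x)"

lemma sqrt_dd_cont: "continuous_on {0..L} (\<lambda>x. sqrt (dd i x))"
 by (intro continuous_intros dd_cont)

lemma q_cont: "continuous_on UNIV (q i)"
 using bm_clamp(1)[OF sqrt_dd_cont[of i]] L_pos by (simp add: q_def[abs_def] clamp_def)

lemma q_pos: "0 < q i x"
 using dd_pos[OF clamp_in] by (simp add: q_def)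

lemma q_sqrt: "x \<in> {0..L} ==> q i x = sqrt (dd i x)"
 by (simp add: q_def)

lemma q_range: obtains qa qb where "0 < qa" "Mhi < qa" "\<And>i x. qa <= q i x" "\<And>i x. q i x <= qb"
proof -
 have "\<exists>a b. 0 < a \<and> Mhi < a \<and> (\<forall>x. a <= q i x \<and> q i x <= b)" for i
 proof -
  have ne: "{0..L} \<noteq> {}" using L_pos by simp
  obtain x0 where x0: "x0 \<in> {0..L}" "\<And>x. x \<in> {0..L} ==> sqrt (dd i x0) <= sqrt (dd i x)"
   using continuous_attains_inf[OF compact_Icc ne sqrt_dd_cont[of i]] by blast
  obtain x1 where x1: "\<And>x. x \<in> {0..L} ==> sqrt (dd i x) <= sqrt (dd i x1)"
   using continuous_attains_sup[OF compact_Icc ne sqrt_dd_cont[of i]] by blast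
  have "Mhi < sqrt (dd i x0)" using SAD(8) x0(1) by (simp add: dd_def)
  then show ?thesis using dd_pos[OF x0(1), of i] x0(2)[OF clamp_in] x1[OF clamp_in] unfolding q_def
   by (intro exI[of _ "sqrt (dd i x0)"] exI[of _ "sqrt (dd i x1)"]) auto
 qed
 then obtain a b where ab: "\<And>i. 0 < a i \<and> Mhi < a i \<and> (\<forall>x. a i <= q i x \<and> q i x <= b i)" by metis
 have le: "min (a 1) (a 2) <= a i" "b i <= max (b 1) (b 2)" for i :: 2 using exhaust_2[of i] by auto
 show thesis
 proof (rule that[of "min (a 1) (a 2)" "max (b 1) (b 2)"])
  show "min (a 1) (a 2) <= q i x" "q i x <= max (b 1) (b 2)" for i x
   using ab[of i] le[of i] order_trans by blast+
 qed (use ab in auto)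
qed

text \<open>The speeds differ everywhere, so by the intermediate value theorem they are ordered the
  same way everywhere; this gives \<open>q i - q j\<close> its constant sign.\<close>

lemma q_sep: "(\<forall>x. q 1 x < q 2 x) \<or> (\<forall>x. q 2 x < q 1 x)"
proof (rule ccontr)
 assume "\<not> ?thesis"
 then obtain x y where xy: "q 2 x - q 1 x <= 0" "0 <= q 2 y - q 1 y" by (auto simp: not_less)
 have ne: "q 2 z - q 1 z \<noteq> 0" for z using dd_ne[OF clamp_in[of z]] by (simp add: q_def)
 have c: "continuous_on S (\<lambda>z. q 2 z - q 1 z)" for S
  by (rule continuous_on_subset[OF continuous_on_diff[OF q_cont q_cont]]) simp
 have "\<exists>z. q 2 z - q 1 z = 0"
 proof (cases "x <= y")
  case True from IVT'[OF xy this c] show ?thesis by blast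
 next
  case False
  then have "y <= x" by simp
  from IVT2'[OF xy this c] show ?thesis by blast
 qed
 then show False using ne by blast
qed

lemma qd_cont: "continuous_on UNIV (qd i)"
 unfolding qd_def
 using bm_clamp(1)[OF dd'(1)[of i]] L_pos q_pos[of i]
 by (intro continuous_intros q_cont) (auto simp: clamp_def less_imp_neq[symmetric])

lemma qd_bm: "bm (qd i)"
proof -
 have e: "qd i = (\<lambda>x. qd i (max 0 (min L x)))"
  using L_pos by (auto simp: qd_def[abs_def] q_def clamp_def fun_eq_iff)
 show ?thesis by (subst e) (rule bm_clamp(2)[OF continuous_on_subset[OF qd_cont]], use L_pos in auto)
qed

lemma sqrt_deriv_within: "x \<in> {0..L} ==> ((\<lambda>x. sqrt (dd i x)) has_real_derivative qd i x) (at x within {0..L})"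
 using dd_pos[of x i] dd'(2)[of x i]
 by (auto intro!: derivative_eq_intros simp: qd_def q_def field_simps)

lemma sqrt_d6'_eq: "x \<in> {0..L} ==> sqrt_d6' P x = qd 1 x" and sqrt_d1'_eq: "x \<in> {0..L} ==> sqrt_d1' P x = qd 2 x"
 using sqrt_deriv_within[of x 1] sqrt_deriv_within[of x 2] L_pos
 unfolding sqrt_d6'_def sqrt_d1'_def has_real_derivative_iff_has_vector_derivative
 by (auto intro!: vector_derivative_within_closed_interval)

lemma q_deriv: "0 < x ==> x < L ==> (q i has_real_derivative qd i x) (at x)"
proof -
 assume x: "0 < x" "x < L"
 have "((\<lambda>x. sqrt (dd i x)) has_real_derivative qd i x) (at x within {0..L})" using x by (intro sqrt_deriv_within) auto
 then have "((\<lambda>x. sqrt (dd i x)) has_real_derivative qd i x) (at x)"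
  using at_within_interior[of x "{0..L}"] x by simp
 then show ?thesis
  by (rule has_field_derivative_transform_within_open[of _ _ _ "{0<..<L}"]) (use x in \<open>auto simp: q_def\<close>)
qed

lemma Ta_version: "\<exists>g. version L (\<lambda>x. Ta P x $ i $ j) g"
 and Tb_version: "\<exists>g. version L (\<lambda>x. Tb P x $ i $ j) g"
proof -
 note L0 = less_imp_le[OF L_pos]
 let ?v = "\<lambda>f. \<exists>g. version L f g"
 have d: "?v d" if "d \<in> {d1 P, d2 P, d3 P, d4 P, d5 P, d6 P, d7 P, d8 P, d9 P, d10 P}" for d
  using bspec[OF SAD(1) that] version_exists[of d L] by blast
 have dv: "?v (d2 P)" "?v (d3 P)" "?v (d4 P)" "?v (d5 P)" "?v (d7 P)" "?v (d8 P)" "?v (d9 P)" "?v (d10 P)"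
  by (rule d, simp)+
 have c: "?v f" if "continuous_on {0..L} f" for f using version_continuous[OF that L0] by blast
 have inv0: "?v (\<lambda>x. 1 / (2 * sqrt (dd k x)))" for k
  by (rule c) (use dd_pos[of _ k] in \<open>force intro!: continuous_intros sqrt_dd_cont\<close>)
 have inv: "?v (\<lambda>x. 1 / (2 * sqrt (d6 P x)))" "?v (\<lambda>x. 1 / (2 * sqrt (d1 P x)))" "?v (\<lambda>x. 1 / 2)"
  using inv0[of 1] inv0[of 2] c[OF continuous_on_const, of "1 / 2"] by simp_all
 have qd: "?v (qd k)" for k by (rule c[OF continuous_on_subset[OF qd_cont]]) simp
 have half: "?v (\<lambda>x. qd k x * (1 / 2))" for k using version_mult qd inv(3) by fast
 have mul: "?v f ==> ?v g ==> ?v (\<lambda>x. f x * g x)" and add: "?v f ==> ?v g ==> ?v (\<lambda>x. f x + g x)"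
  and dif: "?v f ==> ?v g ==> ?v (\<lambda>x. f x - g x)" for f g
  using version_mult version_add version_diff by fast+
 have cong: "?v f" if "?v g" "\<And>x. x \<in> {0..L} ==> f x = g x" for f g
  using that unfolding version_def by (metis Diff_iff)
 have S1: "?v (s1 P)"
  by (rule cong[OF dif[OF mul[OF dv(6) inv(1)] half[of 1]]])
    (use dd_pos[of _ 1] in \<open>force simp: s1_def sqrt_d6'_eq field_simps\<close>)
 have S2: "?v (s2 P)"
  by (rule cong[OF dif[OF mul[OF dv(1) inv(2)] half[of 2]]])
    (use dd_pos[of _ 2] in \<open>force simp: s2_def sqrt_d1'_eq field_simps\<close>)
 note h = mul[OF _ inv(3)]
 show "?v (\<lambda>x. Ta P x $ i $ j)"
  using exhaust_2[of i] exhaust_2[of j]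
   add[OF S1 h[OF dv(8)]] add[OF mul[OF dv(5) inv(2)] h[OF dv(7)]] add[OF mul[OF dv(2) inv(1)] h[OF dv(4)]] add[OF S2 h[OF dv(3)]]
  by (auto simp: Ta_def)
 show "?v (\<lambda>x. Tb P x $ i $ j)"
  using exhaust_2[of i] exhaust_2[of j]
   dif[OF h[OF dv(8)] S1] dif[OF h[OF dv(7)] mul[OF dv(5) inv(2)]] dif[OF h[OF dv(4)] mul[OF dv(2) inv(1)]] dif[OF h[OF dv(3)] S2]
  by (auto simp: Tb_def)
qed

lemma l_deriv: "0 <= t ==> \<exists>m\<le>Mhi. (l has_real_derivative m) (at t within {0..})"
proof -
 assume "0 <= t"
 then show "\<exists>m\<le>Mhi. (l has_real_derivative m) (at t within {0..})" using SAD(7) by fastforce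
qed

lemma l_cont: "continuous_on {0..} l"
 using l_deriv DERIV_continuous unfolding continuous_on_eq_continuous_within by fastforce

text \<open>One-sided: right-going characteristics must outrun an advancing boundary, while its
  retreat may be arbitrarily fast.\<close>

lemma l_lip:
 assumes "0 <= s" "s <= t" shows "l t - l s <= Mhi * (t - s)"
proof (cases "s < t")
 case True
 obtain m where m: "\<And>u. 0 <= u ==> m u <= Mhi \<and> (l has_real_derivative m u) (at u within {0..})"
  using l_deriv by metis
 have "\<exists>u\<in>{s<..<t}. l t - l s = (\<lambda>h. m u * h) (t - s)"
 proof (rule mvt_simple[OF True])
  fix u assume "s <= u" "u <= t"
  then have "(l has_real_derivative m u) (at u within {s..t})"
   using m[of u] assms(1) by (auto intro: has_field_derivative_subset)
  then show "(l has_derivative (\<lambda>h. m u * h)) (at u within {s..t})" by (simp add: has_field_derivative_def)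
 qed
 then obtain u where "u \<in> {s<..<t}" "l t - l s = m u * (t - s)" by blast
 then show ?thesis using m[of u] assms(1) by (auto intro: mult_right_mono)
qed (use assms in simp)

end

section \<open>Kernel equations along characteristics\<close>

locale plant_speeds = plant_data P Mlo Mhi + sp: speeds "plant_data.q P" \<Phi> \<Psi> qa qb "Lmax P"
 for P Mlo Mhi \<Phi> \<Psi> qa qb
begin

text \<open>The map \<open>u \<mapsto> \<Psi> j (d + b * u)\<close> has a differentiable inverse, so
  it pulls negligible sets back to negligible sets. This carries almost-everywhere identities over
  to every single characteristic.\<close>

lemma speed_preimage_negligible:
 assumes Z: "negligible Z" and e: "b = 1 \<or> b = - 1"
 shows "negligible {u. \<Psi> j (d + b * u) \<in> Z}"
proof -
 have "negligible ((\<lambda>x. b * (\<Phi> j x - d)) ` Z)"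
 proof (rule negligible_differentiable_image_negligible[OF _ Z])
  show "(\<lambda>x. b * (\<Phi> j x - d)) differentiable_on Z"
   unfolding differentiable_on_def
  proof
   fix x
   have "((\<lambda>x. b * (\<Phi> j x - d)) has_real_derivative b * (1 / q j x)) (at x within Z)"
    by (auto intro!: derivative_eq_intros has_field_derivative_at_within[OF sp.\<Phi>_deriv])
   then show "(\<lambda>x. b * (\<Phi> j x - d)) differentiable at x within Z"
    unfolding has_field_derivative_def differentiable_def by blast
  qed
 qed simp
 moreover have "{u. \<Psi> j (d + b * u) \<in> Z} \<subseteq> (\<lambda>x. b * (\<Phi> j x - d)) ` Z"
 proof
  fix u assume "u \<in> {u. \<Psi> j (d + b * u) \<in> Z}"
  moreover have "u = b * (\<Phi> j (\<Psi> j (d + b * u)) - d)" using e by auto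
  ultimately show "u \<in> (\<lambda>x. b * (\<Phi> j x - d)) ` Z" by blast
 qed
 ultimately show ?thesis by (rule negligible_subset)
qed

lemma path_deriv: "((\<lambda>u. \<Psi> i (c + a * u)) has_real_derivative a * q i (\<Psi> i (c + a * u))) (at u)"
proof -
 have "((\<lambda>u. \<Psi> i (c + a * u)) has_real_derivative q i (\<Psi> i (c + a * u)) * a) (at u)"
  by (rule DERIV_chain2[where f="\<Psi> i" and g="\<lambda>u. c + a * u", OF sp.\<Psi>_deriv]) (auto intro!: derivative_eq_intros)
 then show ?thesis by (simp add: mult.commute)
qed

lemma path_cont: "continuous_on X (\<lambda>u. \<Psi> i (c + a * u))"
 by (intro DERIV_continuous_on_at[OF path_deriv])

text \<open>\<open>transport_solution\<close> follows characteristics along which \<open>X\<close>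
  increases, whereas here the first coordinate belongs to a left-going path; hence the reversal of
  time about \<open>t\<close>.\<close>

lemma transport_backward:
 assumes tr: "transport_solution L a b K h"
  and ab: "\<And>x. x \<in> {0..L} ==> a x = q i x" "\<And>y. y \<in> {0..L} ==> b y = - e * q j y"
  and st: "s <= t" and dom: "\<And>u. u \<in> {s..t} ==> 0 <= \<Psi> j (d + e * u) \<and> \<Psi> j (d + e * u) <= \<Psi> i (c - u) \<and> \<Psi> i (c - u) <= L"
 shows "((\<lambda>u. h (\<Psi> i (c - u)) (\<Psi> j (d + e * u))) has_integral
   (K (\<Psi> i (c - s)) (\<Psi> j (d + e * s)) - K (\<Psi> i (c - t)) (\<Psi> j (d + e * t)))) {s..t}"
proof -
 define X where "X \<theta> = \<Psi> i ((c - t) + 1 * \<theta>)" for \<theta>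
 define Y where "Y \<theta> = \<Psi> j ((d + e * t) + (- e) * \<theta>)" for \<theta>
 have XY: "X \<theta> = \<Psi> i (c - (t - \<theta>))" "Y \<theta> = \<Psi> j (d + e * (t - \<theta>))" for \<theta>
  by (simp_all add: X_def Y_def algebra_simps)
 have "\<forall>u\<in>{0..t - s}. (X u, Y u) \<in> triangle L \<and> (X has_real_derivative a (X u)) (at u within {0..t - s}) \<and>
      (Y has_real_derivative b (Y u)) (at u within {0..t - s})"
 proof
  fix u assume "u \<in> {0..t - s}"
  then have "t - u \<in> {s..t}" by auto
  from dom[OF this] have XY': "0 <= Y u" "Y u <= X u" "X u <= L" unfolding XY by auto
  have "(X has_real_derivative 1 * q i (X u)) (at u within {0..t - s})"
   unfolding X_def[abs_def] by (rule has_field_derivative_at_within[OF path_deriv])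
  moreover have "(Y has_real_derivative - e * q j (Y u)) (at u within {0..t - s})"
   unfolding Y_def[abs_def] by (rule has_field_derivative_at_within[OF path_deriv])
  ultimately show "(X u, Y u) \<in> triangle L \<and> (X has_real_derivative a (X u)) (at u within {0..t - s}) \<and>
      (Y has_real_derivative b (Y u)) (at u within {0..t - s})"
   using XY' ab(1)[of "X u"] ab(2)[of "Y u"] by (auto simp: triangle_def)
 qed
 then have "((\<lambda>\<theta>. h (X \<theta>) (Y \<theta>)) has_integral (K (X (t - s)) (Y (t - s)) - K (X 0) (Y 0))) (cbox 0 (t - s))"
  using tr st unfolding transport_solution_def by (auto simp: diff_ge_0_iff_ge)
 from has_integral_affinity[OF this, of "- 1" t]
 have "((\<lambda>x. h (X (t - x)) (Y (t - x))) has_integral (K (X (t - s)) (Y (t - s)) - K (X 0) (Y 0))) ((\<lambda>x. t - x) ` {0..t - s})"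
  by simp
 moreover have "(\<lambda>x. t - x) ` {0..t - s} = {s..t}" by auto
 ultimately show ?thesis unfolding XY by simp
qed

text \<open>Multiplication of the kernel by \<open>q j\<close> is decisive: the derivative of
  \<open>q j\<close> along \<open>Y\<close> cancels the term with \<open>qd j\<close>, and only the
  zero-order part \<open>Hb\<close> remains.\<close>

lemma kernel_path:
 assumes e: "k = 1 \<or> k = - 1" and tr: "transport_solution L a b K h"
  and ab: "\<And>x. x \<in> {0..L} ==> a x = q i x" "\<And>y. y \<in> {0..L} ==> b y = - k * q j y"
  and Kb: "bm Kb" "\<And>x y. (x, y) \<in> triangle L ==> K x y = Kb (x, y)"
  and Z: "negligible Z" and Hb: "bm Hb"
  and h: "\<And>x y. (x, y) \<in> triangle L ==> x \<notin> Z ==> y \<notin> Z ==> h x y = k * Kb (x, y) * qd j y + Hb (x, y)"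
  and st: "s <= t" and dom: "\<And>w. w \<in> {s..t} ==> 0 <= \<Psi> j (d + k * w) \<and> \<Psi> j (d + k * w) <= \<Psi> i (c - w) \<and> \<Psi> i (c - w) <= L"
 shows "((\<lambda>w. - (q j (\<Psi> j (d + k * w)) * Hb (\<Psi> i (c - w), \<Psi> j (d + k * w)))) has_integral
   (Kb (\<Psi> i (c - t), \<Psi> j (d + k * t)) * q j (\<Psi> j (d + k * t)) - Kb (\<Psi> i (c - s), \<Psi> j (d + k * s)) * q j (\<Psi> j (d + k * s)))) {s..t}"
proof -
 define X where "X w = \<Psi> i (c - w)" for w
 define Y where "Y w = \<Psi> j (d + k * w)" for w
 have Xc: "continuous_on UNIV X" unfolding X_def[abs_def] using path_cont[of UNIV i c "- 1"] by simp
 have Yc: "continuous_on S Y" for S unfolding Y_def[abs_def] by (rule path_cont)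
 have XY: "(\<lambda>w. (X w, Y w)) \<in> borel_measurable borel"
  by (intro borel_contI continuous_intros Xc Yc)
 have Ym: "Y \<in> borel_measurable borel" by (rule borel_contI[OF Yc])
 have tri: "(X w, Y w) \<in> triangle L" "0 <= Y w" "Y w <= L" if "w \<in> {s..t}" for w
  using dom[OF that] by (auto simp: triangle_def X_def Y_def)
 define f' where "f' w = - (k * Kb (X w, Y w) * qd j (Y w) + Hb (X w, Y w))" for w
 define g' where "g' w = k * qd j (Y w) * q j (Y w)" for w
 have fb: "bm f'" unfolding f'_def[abs_def]
  by (intro bm_uminus bm_add bm_mult bm_const bm_comp[OF Kb(1) XY] bm_comp[OF Hb XY] bm_comp[OF qd_bm Ym])
 have gb: "bm g'" unfolding g'_def[abs_def]
  by (intro bm_mult bm_const bm_comp[OF qd_bm Ym] bm_comp[OF sp.q_bm Ym])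
 define N where "N = {w. X w \<in> Z} \<union> {w. Y w \<in> Z}"
 have N: "negligible N"
  unfolding N_def X_def Y_def using speed_preimage_negligible[OF Z, of "- 1" i c] speed_preimage_negligible[OF Z e]
  by (intro negligible_Un) auto
 have fI: "(f' has_integral (Kb (X v, Y v) - Kb (X u, Y u))) {u..v}" if uv: "s <= u" "u <= v" "v <= t" for u v
 proof -
  have "((\<lambda>w. h (X w) (Y w)) has_integral (K (X u) (Y u) - K (X v) (Y v))) {u..v}"
   unfolding X_def Y_def by (rule transport_backward[OF tr ab uv(2)]) (use dom uv in auto)
  from has_integral_neg[OF this]
  have "((\<lambda>w. - h (X w) (Y w)) has_integral (Kb (X v, Y v) - Kb (X u, Y u))) {u..v}"
   using Kb(2)[OF tri(1), of u] Kb(2)[OF tri(1), of v] uv by simp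
  then show ?thesis
  proof (rule has_integral_spike[OF N, rotated])
   fix w assume "w \<in> {u..v} - N"
   then show "f' w = - h (X w) (Y w)"
    using h[OF tri(1)[of w]] uv by (auto simp: N_def f'_def)
  qed
 qed
 \<comment> \<open>\<open>q j\<close> is known to be differentiable only inside
   \<open>{0<..<L}\<close>. \<open>Y\<close> is strictly monotone, so it lies inside at interior
   times, and there the fundamental theorem asks for a derivative.\<close>
 have gI: "(g' has_integral (q j (Y v) - q j (Y u))) {u..v}" if uv: "s <= u" "u <= v" "v <= t" for u v
 proof (rule fundamental_theorem_of_calculus_interior[OF uv(2)])
  show "continuous_on {u..v} (\<lambda>x. q j (Y x))" by (rule continuous_on_compose2[OF q_cont Yc]) simp
  fix w assume tau: "w \<in> {u<..<v}"
  have mono: "Y x < Y y" if "k * x < k * y" for x y using that by (simp add: Y_def)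
  have "0 < Y w \<and> Y w < L"
  proof -
   have ends: "0 <= Y u" "0 <= Y v" "Y u <= L" "Y v <= L" using tri(2,3) uv by auto
   show ?thesis using e mono[of u w] mono[of w v] mono[of v w] mono[of w u] tau ends by auto
  qed
  then have "(q j has_real_derivative qd j (Y w)) (at (Y w))" by (intro q_deriv) auto
  from DERIV_chain2[where f="q j" and g=Y, OF this path_deriv[of j d k w, folded Y_def[abs_def]]]
  show "((\<lambda>x. q j (Y x)) has_vector_derivative g' w) (at w)"
   unfolding has_real_derivative_iff_has_vector_derivative[symmetric] g'_def Y_def by (simp add: mult_ac)
 qed
 have "((\<lambda>w. f' w * q j (Y w) + Kb (X w, Y w) * g' w) has_integral (Kb (X t, Y t) * q j (Y t) - Kb (X s, Y s) * q j (Y s))) {s..t}"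
  by (rule has_integral_product_rule[OF st fb gb fI gI])
 moreover have "(\<lambda>w. f' w * q j (Y w) + Kb (X w, Y w) * g' w) = (\<lambda>w. - (q j (Y w) * Hb (X w, Y w)))"
  by (auto simp: f'_def g'_def algebra_simps)
 ultimately show ?thesis unfolding X_def Y_def by simp
qed

end

section \<open>Kernels and matrices as everywhere defined Borel functions\<close>

locale closed_loop_data = plant_data +
 fixes \<kappa> :: "real^4^2" and F N :: "real => real => real^2^2" and lam :: "real => real^4^2"
 assumes K: "kernels P \<kappa> F N lam"
begin

lemmas K_1 = K[unfolded kernels_def]
lemmas K_4 = K_1[THEN conjunct2, THEN conjunct2, THEN conjunct2]
lemmas K_7 = K_4[THEN conjunct2, THEN conjunct2, THEN conjunct2]
lemmas KD = K_1[THEN conjunct1] K_1[THEN conjunct2, THEN conjunct1] K_1[THEN conjunct2, THEN conjunct2, THEN conjunct1]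
 K_4[THEN conjunct1] K_4[THEN conjunct2, THEN conjunct1] K_4[THEN conjunct2, THEN conjunct2, THEN conjunct1]
 K_7[THEN conjunct1] K_7[THEN conjunct2, THEN conjunct1] K_7[THEN conjunct2, THEN conjunct2, THEN conjunct1]

lemma Qmat_nth: "x \<in> {0..L} ==> Qmat P x $ i $ j = (if i = j then q i x else 0)"
 using exhaust_2[of i] exhaust_2[of j] by (auto simp: Qmat_def q_def)

lemma Qmat'_nth: "x \<in> {0..L} ==> Qmat' P x $ i $ j = (if i = j then qd i x else 0)"
 using exhaust_2[of i] exhaust_2[of j] by (auto simp: Qmat'_def sqrt_d6'_eq sqrt_d1'_eq)

lemma Ta_diag_nth: "Ta_diag P x $ i $ j = (if i = j then Ta P x $ i $ i else 0)"
 by (simp add: Ta_diag_def)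

definition TA :: "2 => 2 => real => real" where "TA i j = (SOME g. version L (\<lambda>x. Ta P x $ i $ j) g)"
definition TB :: "2 => 2 => real => real" where "TB i j = (SOME g. version L (\<lambda>x. Tb P x $ i $ j) g)"

lemma TA: "version L (\<lambda>x. Ta P x $ i $ j) (TA i j)" and TB: "version L (\<lambda>x. Tb P x $ i $ j) (TB i j)"
 using someI_ex[OF Ta_version[of i j]] someI_ex[OF Tb_version[of i j]] by (simp_all add: TA_def TB_def)

lemma T_exceptional:
 "\<exists>Z. negligible Z \<and> (\<forall>x\<in>{0..L} - Z. \<forall>i j. Ta P x $ i $ j = TA i j x \<and> Tb P x $ i $ j = TB i j x)"
proof -
 have "\<exists>Z. negligible Z \<and> (\<forall>x\<in>{0..L} - Z. Ta P x $ i $ j = TA i j x \<and> Tb P x $ i $ j = TB i j x)" for i j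
 proof -
  obtain Z1 Z2 where "negligible Z1" "\<forall>x\<in>{0..L} - Z1. Ta P x $ i $ j = TA i j x" "negligible Z2" "\<forall>x\<in>{0..L} - Z2. Tb P x $ i $ j = TB i j x"
   using TA[of i j] TB[of i j] unfolding version_def by blast
  then show ?thesis by (intro exI[of _ "Z1 \<union> Z2"]) (auto intro: negligible_Un)
 qed
 then obtain Z where Z: "\<And>i j. negligible (Z i j) \<and> (\<forall>x\<in>{0..L} - Z i j. Ta P x $ i $ j = TA i j x \<and> Tb P x $ i $ j = TB i j x)" by metis
 show ?thesis
 proof (intro exI[of _ "Z 1 1 \<union> Z 1 2 \<union> Z 2 1 \<union> Z 2 2"] conjI ballI allI)
  show "negligible (Z 1 1 \<union> Z 1 2 \<union> Z 2 1 \<union> Z 2 2)" using Z by (intro negligible_Un) auto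
  fix x and i j :: 2 assume x: "x \<in> {0..L} - (Z 1 1 \<union> Z 1 2 \<union> Z 2 1 \<union> Z 2 2)"
  then have "x \<in> {0..L} - Z i j" using exhaust_2[of i] exhaust_2[of j] by auto
  then show "Ta P x $ i $ j = TA i j x" "Tb P x $ i $ j = TB i j x" using Z[of i j] by (simp_all del: Diff_iff)
 qed
qed

text \<open>One exceptional set for all entries of both coefficient matrices.\<close>

definition Z0 :: "real set" where
 "Z0 = (SOME Z. negligible Z \<and> (\<forall>x\<in>{0..L} - Z. \<forall>i j. Ta P x $ i $ j = TA i j x \<and> Tb P x $ i $ j = TB i j x))"

lemma Z0: "negligible Z0" "x \<in> {0..L} - Z0 ==> Ta P x $ i $ j = TA i j x \<and> Tb P x $ i $ j = TB i j x"
 using someI_ex[OF T_exceptional] unfolding Z0_def by blast+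

text \<open>Both kernels are extended by zero outside the triangle, and \<open>lam\<close> by its
  end values.\<close>

definition FF :: "2 => 2 => real \<times> real => real" where "FF i j z = indicator (triangle L) z * F (fst z) (snd z) $ i $ j"
definition NN :: "2 => 2 => real \<times> real => real" where "NN i j z = indicator (triangle L) z * N (fst z) (snd z) $ i $ j"
definition ll :: "2 => 4 => real => real" where "ll i k x = lam (clamp x) $ i $ k"
definition gg :: "2 => 2 => real => real" where
 "gg i j x = (if i = 2 \<and> j = 1 then sqrt (d6 P 0) * (FF 2 1 (x, 0) + NN 2 1 (x, 0)) - (d14 P * ll 2 2 x + d16 P * ll 2 4 x) / sqrt (d6 P 0) else 0)"
definition Am :: "4 => 4 => real" where "Am k m = (Abar P - Bbar P ** C3) $ k $ m"
definition Bm :: "4 => 2 => real" where "Bm k j = Bbar P $ k $ j"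
definition Cm :: "2 => 4 => real" where "Cm j k = C3 $ j $ k"
text \<open>The differential equation for \<open>lam\<close>, solved for the derivative: this
  provides a Borel representative of the derivative, made of functions already known to be in
  \<open>bm\<close>.\<close>

definition ll' :: "2 => 4 => real => real" where
 "ll' i k x = ((\<Sum>m\<in>UNIV. ll i m x * Am m k) - TA i i x * ll i k x
      + (\<Sum>j\<in>UNIV. FF i j (x, 0) * q j 0 * Cm j k) - (\<Sum>j\<in>UNIV. gg i j x * ll j k 0)) * (1 / q i x)"

lemma tri_FF: "(x, y) \<in> triangle L ==> F x y $ i $ j = FF i j (x, y)" "(x, y) \<in> triangle L ==> N x y $ i $ j = NN i j (x, y)"
 by (simp_all add: FF_def NN_def)

lemma triangle_borel: "triangle L \<in> sets borel"
proof -
 have "closed {z :: real \<times> real. 0 <= snd z \<and> snd z <= fst z \<and> fst z <= L}"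
  by (intro closed_Collect_conj closed_Collect_le continuous_intros)
 moreover have "{z :: real \<times> real. 0 <= snd z \<and> snd z <= fst z \<and> fst z <= L} = triangle L"
  by (auto simp: triangle_def)
 ultimately show ?thesis by (simp add: borel_closed)
qed

lemma kernel_entry_bm:
 assumes m: "(\<lambda>(x, y). K x y) \<in> borel_measurable (restrict_space borel (triangle L))" and b: "bounded ((\<lambda>(x, y). K x y) ` triangle L)"
 shows "bm (\<lambda>z. indicator (triangle L) z * (K (fst z) (snd z) :: real^2^2) $ i $ j)"
proof -
 obtain B where B: "\<And>z. z \<in> triangle L ==> norm (K (fst z) (snd z)) <= B"
  using b unfolding bounded_iff by (auto simp: split_beta' simp del: split_paired_All)
 have m': "(\<lambda>z. K (fst z) (snd z)) \<in> borel_measurable (restrict_space borel (triangle L))"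
  using m by (simp add: split_beta')
 have "(\<lambda>z. K (fst z) (snd z) $ i $ j) \<in> borel_measurable (restrict_space borel (triangle L))"
  by (rule measurable_compose[OF m' borel_contI]) (intro continuous_intros)
 then have "(\<lambda>z. indicator (triangle L) z *\<^sub>R (K (fst z) (snd z) $ i $ j)) \<in> borel_measurable borel"
  using triangle_borel by (subst (asm) borel_measurable_restrict_space_iff) auto
 moreover have "\<bar>indicator (triangle L) z * K (fst z) (snd z) $ i $ j\<bar> <= \<bar>B\<bar>" for z
 proof (cases "z \<in> triangle L")
  case True
  have "\<bar>K (fst z) (snd z) $ i $ j\<bar> <= norm (K (fst z) (snd z))"
   unfolding real_norm_def[symmetric] by (rule order_trans[OF Finite_Cartesian_Product.norm_nth_le Finite_Cartesian_Product.norm_nth_le])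
  then show ?thesis using True B[OF True] by simp
 qed simp
 ultimately show ?thesis by (intro bmI[where B="\<bar>B\<bar>"]) auto
qed

lemma FF_bm: "bm (FF i j)" and NN_bm: "bm (NN i j)"
 unfolding FF_def[abs_def] NN_def[abs_def] using KD(1) by (auto intro!: kernel_entry_bm)

lemma TA_bm: "bm (TA i j)" and TB_bm: "bm (TB i j)"
 using TA[of i j] TB[of i j] by (auto simp: version_def)

lemma lam_cont: "continuous_on {0..L} lam"
proof -
 obtain lam' where l': "\<forall>x\<in>{0..L}. (lam' has_integral (lam x - lam 0)) {0..x}" using KD(8) by blast
 have "lam' integrable_on {0..L}" using bspec[OF l', of L] L_pos by auto
 from indefinite_integral_continuous_1[OF this]
 have "continuous_on {0..L} (\<lambda>x. lam 0 + integral {0..x} lam')" by (intro continuous_intros)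
 moreover have "lam 0 + integral {0..x} lam' = lam x" if "x \<in> {0..L}" for x using integral_unique[OF bspec[OF l' that]] by simp
 ultimately show ?thesis by (rule continuous_on_eq)
qed

lemma ll_bm: "bm (ll i k)"
proof -
 have "continuous_on {0..L} (\<lambda>x. lam x $ i $ k)" by (intro continuous_intros lam_cont)
 from bm_clamp(2)[OF this] show ?thesis using L_pos by (simp add: ll_def[abs_def] clamp_def)
qed

lemma slice0_bm: "bm f ==> bm (\<lambda>x. f (x, 0))" for f :: "real \<times> real => real"
 by (rule bm_pair1)

lemma gg_bm: "bm (gg i j)"
proof (cases "i = 2 \<and> j = 1")
 case True
 have "bm (\<lambda>x. sqrt (d6 P 0) * (FF 2 1 (x, 0) + NN 2 1 (x, 0)) - (d14 P * ll 2 2 x + d16 P * ll 2 4 x) * (1 / sqrt (d6 P 0)))"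
  by (intro bm_diff bm_mult bm_add bm_const slice0_bm FF_bm NN_bm ll_bm)
 then show ?thesis using True by (simp add: gg_def[abs_def])
next
 case False
 then have "gg i j = (\<lambda>x. 0)" by (auto simp: gg_def)
 then show ?thesis by simp
qed

lemma inv_q_bm: "bm (\<lambda>x. 1 / q i x)"
proof -
 have c: "continuous_on UNIV (\<lambda>x. 1 / q i x)"
  by (intro continuous_intros q_cont) (use q_pos in \<open>auto simp: less_imp_neq[symmetric]\<close>)
 have e: "(\<lambda>x. 1 / q i x) = (\<lambda>x. 1 / q i (max 0 (min L x)))"
  using L_pos by (auto simp: q_def clamp_def fun_eq_iff)
 show ?thesis by (subst e) (rule bm_clamp(2)[OF continuous_on_subset[OF c]], use L_pos in auto)
qed

lemma ll'_bm: "bm (ll' i k)"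
 unfolding ll'_def[abs_def]
 by (intro bm_mult[OF _ inv_q_bm] bm_diff bm_add bm_sum bm_mult bm_const slice0_bm FF_bm TA_bm ll_bm gg_bm)

lemma kernel_g_nth: "x \<in> {0..L} ==> kernel_g P F N lam x $ i $ j = gg i j x"
 using exhaust_2[of i] exhaust_2[of j] by (auto simp: kernel_g_def gg_def FF_def NN_def ll_def triangle_def)

lemma lam_eq: "x \<in> {0..L} ==> lam x $ i $ k = ll i k x"
 by (simp add: ll_def)

lemma origin_in_interval: "0 \<in> {0..L}" using L_pos by simp

lemma triangle_diag: "x \<in> {0..L} ==> (x, x) \<in> triangle L" "x \<in> {0..L} ==> (x, 0) \<in> triangle L"
 by (auto simp: triangle_def)

lemma boundary_conditions:
 "\<exists>Z. negligible Z \<and> (\<forall>x\<in>{0..L} - Z. \<forall>i.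
    (\<forall>j. (q i x + q j x) * FF i j (x, x) = - TB i j x) \<and>
    (\<forall>j. j \<noteq> i \<longrightarrow> (q i x - q j x) * NN i j (x, x) = - TA i j x) \<and>
    (\<forall>j. NN i j (x, 0) * q j 0 = - (FF i j (x, 0) * q j 0) + 2 * (\<Sum>k\<in>UNIV. ll i k x * Bm k j) + gg i j x) \<and>
    (\<forall>k. q i x * ll' i k x = (\<Sum>m\<in>UNIV. ll i m x * Am m k) - TA i i x * ll i k x
      + (\<Sum>j\<in>UNIV. FF i j (x, 0) * q j 0 * Cm j k) - (\<Sum>j\<in>UNIV. gg i j x * ll j k 0)))"
proof -
 have m: "{0..L} \<in> sets lebesgue" by simp
 obtain Z1 where Z1: "negligible Z1" "\<And>x. x \<in> {0..L} - Z1 ==> Qmat P x ** F x x + F x x ** Qmat P x = - Tb P x"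
  using AE_lebesgue_on_negligible[OF KD(3) m] by blast
 obtain Z2 where Z2: "negligible Z2" "\<And>x. x \<in> {0..L} - Z2 ==> Qmat P x ** N x x - N x x ** Qmat P x = Ta_diag P x - Ta P x"
  using AE_lebesgue_on_negligible[OF KD(4) m] by blast
 obtain Z3 where Z3: "negligible Z3" "\<And>x. x \<in> {0..L} - Z3 ==> N x 0 ** Qmat P 0 = - (F x 0 ** Qmat P 0) + 2 *\<^sub>R (lam x ** Bbar P) + kernel_g P F N lam x"
  using AE_lebesgue_on_negligible[OF KD(5) m] by blast
 show ?thesis
 proof (intro exI[of _ "Z0 \<union> Z1 \<union> Z2 \<union> Z3"] conjI ballI allI impI)
  show "negligible (Z0 \<union> Z1 \<union> Z2 \<union> Z3)" using Z0 Z1 Z2 Z3 by (intro negligible_Un)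
  fix x i j and k :: 4 assume x: "x \<in> {0..L} - (Z0 \<union> Z1 \<union> Z2 \<union> Z3)"
  then have x0: "x \<in> {0..L}" by blast
  have T: "Ta P x $ i $ j = TA i j x" "Tb P x $ i $ j = TB i j x" using Z0(2)[of x] x by auto
  have "(Qmat P x ** F x x + F x x ** Qmat P x) $ i $ j = - TB i j x" using Z1(2)[of x] x T by simp
  then show "(q i x + q j x) * FF i j (x, x) = - TB i j x"
   using exhaust_2[of i] exhaust_2[of j]
   by (auto simp: matrix_matrix_mult_def sum_2 Qmat_nth[OF x0] tri_FF[OF triangle_diag(1)[OF x0]] algebra_simps)
  have "(Qmat P x ** N x x - N x x ** Qmat P x) $ i $ j = Ta_diag P x $ i $ j - Ta P x $ i $ j" using Z2(2)[of x] x by simp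
  then show "(q i x - q j x) * NN i j (x, x) = - TA i j x" if "j \<noteq> i"
   using exhaust_2[of i] exhaust_2[of j] that T
   by (auto simp: matrix_matrix_mult_def sum_2 Qmat_nth[OF x0] tri_FF[OF triangle_diag(1)[OF x0]] Ta_diag_nth algebra_simps)
  have "(N x 0 ** Qmat P 0) $ i $ j = - (F x 0 ** Qmat P 0) $ i $ j + 2 * (lam x ** Bbar P) $ i $ j + gg i j x"
   using Z3(2)[of x] x kernel_g_nth[OF x0, of i j] by simp
  then show "NN i j (x, 0) * q j 0 = - (FF i j (x, 0) * q j 0) + 2 * (\<Sum>k\<in>UNIV. ll i k x * Bm k j) + gg i j x"
   using exhaust_2[of i] exhaust_2[of j]
   by (auto simp: matrix_matrix_mult_def sum_2 Qmat_nth[OF origin_in_interval] tri_FF[OF triangle_diag(2)[OF x0]] lam_eq[OF x0] Bm_def)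
  show "q i x * ll' i k x = (\<Sum>m\<in>UNIV. ll i m x * Am m k) - TA i i x * ll i k x
      + (\<Sum>j\<in>UNIV. FF i j (x, 0) * q j 0 * Cm j k) - (\<Sum>j\<in>UNIV. gg i j x * ll j k 0)"
   unfolding ll'_def using q_pos[of i x] by simp
 qed
qed

text \<open>\<open>ll'\<close> agrees off a negligible set with the derivative that the kernel
  equations provide, so both have the same integrals.\<close>

lemma ll'_integral:
 assumes "0 <= x" "x <= y" "y <= L" shows "(ll' i k has_integral (ll i k y - ll i k x)) {x..y}"
proof -
 obtain lam' where l': "\<And>x. x \<in> {0..L} ==> (lam' has_integral (lam x - lam 0)) {0..x}"
  and ae: "AE x in lebesgue_on {0..L}. Qmat P x ** lam' x - lam x ** (Abar P - Bbar P ** C3) + Ta_diag P x ** lam x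
       - F x 0 ** Qmat P 0 ** C3 + kernel_g P F N lam x ** lam 0 = 0"
  using KD(8) by blast
 obtain Z1 where Z1: "negligible Z1" "\<And>x. x \<in> {0..L} - Z1 ==> Qmat P x ** lam' x - lam x ** (Abar P - Bbar P ** C3) + Ta_diag P x ** lam x
       - F x 0 ** Qmat P 0 ** C3 + kernel_g P F N lam x ** lam 0 = 0"
  using AE_lebesgue_on_negligible[OF ae] by auto
 have eq: "ll' i k x = lam' x $ i $ k" if x: "x \<in> {0..L} - (Z0 \<union> Z1)" for x
 proof -
  have x0: "x \<in> {0..L}" using x by blast
  have T: "Ta P x $ i $ i = TA i i x" using Z0(2)[of x] x by auto
  have "(Qmat P x ** lam' x - lam x ** (Abar P - Bbar P ** C3) + Ta_diag P x ** lam x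
       - F x 0 ** Qmat P 0 ** C3 + kernel_g P F N lam x ** lam 0) $ i $ k = 0" using Z1(2)[of x] x by simp
  moreover have "(Qmat P x ** lam' x) $ i $ k = q i x * lam' x $ i $ k"
   using exhaust_2[of i] by (auto simp: matrix_matrix_mult_def sum_2 Qmat_nth[OF x0])
  moreover have "(lam x ** (Abar P - Bbar P ** C3)) $ i $ k = (\<Sum>m\<in>UNIV. ll i m x * Am m k)"
   by (simp add: matrix_matrix_mult_def lam_eq[OF x0] Am_def)
  moreover have "(Ta_diag P x ** lam x) $ i $ k = TA i i x * ll i k x"
   using exhaust_2[of i] T by (auto simp: matrix_matrix_mult_def sum_2 Ta_diag_nth lam_eq[OF x0])
  moreover have "(F x 0 ** Qmat P 0 ** C3) $ i $ k = (\<Sum>j\<in>UNIV. FF i j (x, 0) * q j 0 * Cm j k)"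
   by (simp add: matrix_matrix_mult_def sum_2 Qmat_nth[OF origin_in_interval] tri_FF[OF triangle_diag(2)[OF x0]] Cm_def)
  moreover have "(kernel_g P F N lam x ** lam 0) $ i $ k = (\<Sum>j\<in>UNIV. gg i j x * ll j k 0)"
   by (simp add: matrix_matrix_mult_def kernel_g_nth[OF x0] lam_eq[OF origin_in_interval])
  ultimately have "q i x * lam' x $ i $ k = (\<Sum>m\<in>UNIV. ll i m x * Am m k) - TA i i x * ll i k x
      + (\<Sum>j\<in>UNIV. FF i j (x, 0) * q j 0 * Cm j k) - (\<Sum>j\<in>UNIV. gg i j x * ll j k 0)" by simp
  then show ?thesis unfolding ll'_def using q_pos[of i x] by (simp add: field_simps)
 qed
 have I: "((\<lambda>x. lam' x $ i $ k) has_integral (ll i k v - ll i k 0)) {0..v}" if "v \<in> {0..L}" for v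
 proof -
  have "((\<lambda>M. M $ i $ k) \<circ> lam' has_integral (lam v - lam 0) $ i $ k) {0..v}"
   by (rule has_integral_linear[OF l'[OF that]]) (intro bounded_linear_compose[OF bounded_linear_vec_nth bounded_linear_vec_nth, unfolded o_def])
  then show ?thesis using lam_eq[OF that] lam_eq[OF origin_in_interval] by (simp add: o_def)
 qed
 have "((\<lambda>x. lam' x $ i $ k) has_integral (ll i k y - ll i k x)) {x..y}"
 proof -
  have y: "((\<lambda>x. lam' x $ i $ k) has_integral (ll i k y - ll i k 0)) {0..y}" using assms by (intro I) auto
  have x: "((\<lambda>x. lam' x $ i $ k) has_integral (ll i k x - ll i k 0)) {0..x}" using assms by (intro I) auto
  have "(\<lambda>x. lam' x $ i $ k) integrable_on {x..y}"
   using y assms(1,2) by (intro integrable_subinterval_real[OF has_integral_integrable[OF y]]) auto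
  then have h: "((\<lambda>x. lam' x $ i $ k) has_integral integral {x..y} (\<lambda>x. lam' x $ i $ k)) {x..y}" by blast
  from has_integral_combine[OF assms(1,2) x h] has_integral_unique[OF y]
  have "ll i k y - ll i k 0 = ll i k x - ll i k 0 + integral {x..y} (\<lambda>x. lam' x $ i $ k)" by blast
  then show ?thesis using h by simp
 qed
 then show ?thesis
  by (rule has_integral_spike[OF negligible_Un[OF Z0(1) Z1(1)], rotated]) (use eq assms in auto)
qed

end

text \<open>Bounds valid for all sufficiently large \<open>M\<close> can be combined freely, which
  yields a common constant for all data.\<close>

lemma bm_family_bound:
 fixes f :: "'i::finite => 'j::finite => 'a::topological_space => real"
 assumes "\<And>i j. bm (f i j)" shows "\<forall>\<^sub>F M in at_top. \<forall>i j x. \<bar>f i j x\<bar> <= M"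
proof (intro eventually_all_finite)
 fix i j
 obtain B where "\<And>x. \<bar>f i j x\<bar> <= B" using bm_bound[OF assms[of i j]] by blast
 then show "\<forall>\<^sub>F M in at_top. \<forall>x. \<bar>f i j x\<bar> <= M"
  by (intro eventually_mono[OF eventually_ge_at_top[of B]]) (use order_trans in blast)
qed

lemma vector_4_nth [simp]:
 "(vector [w, x, y, z] :: 'a::zero^4) $ 1 = w" "(vector [w, x, y, z] :: 'a::zero^4) $ 2 = x"
 "(vector [w, x, y, z] :: 'a::zero^4) $ 3 = y" "(vector [w, x, y, z] :: 'a::zero^4) $ 4 = z"
 unfolding vector_def by simp_all

lemma negligible_fst:
 assumes "negligible (Z :: real set)" shows "negligible {z :: real \<times> real. fst z \<in> Z}"
proof -
 obtain N where N: "N \<in> null_sets lborel" "Z \<subseteq> N"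
  using assms unfolding negligible_iff_null_sets null_sets_completion_iff2 by blast
 have "emeasure (lborel \<Otimes>\<^sub>M lborel) (N \<times> (UNIV :: real set)) = emeasure lborel N * emeasure lborel (UNIV :: real set)"
  using N(1) by (intro lborel.emeasure_pair_measure_Times) auto
 then have "emeasure lborel (N \<times> (UNIV :: real set)) = 0" using N(1) by (simp add: lborel_prod null_setsD1)
 moreover have "N \<times> (UNIV :: real set) \<in> sets lborel"
  using pair_measureI[OF null_setsD2[OF N(1)], of "UNIV :: real set" lborel] by (simp only: lborel_prod) simp
 ultimately have "N \<times> (UNIV :: real set) \<in> null_sets lborel" by blast
 then have "negligible (N \<times> (UNIV :: real set))" by (simp add: negligible_iff_null_sets null_sets_completionI)
 then show ?thesis by (rule negligible_subset) (use N(2) in auto)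
qed

section \<open>The closed loop as an instance of the abstract kernel system\<close>

locale closed_loop = closed_loop_data P Mlo Mhi \<kappa> F N lam + plant_speeds P Mlo Mhi \<Phi> \<Psi> qa qb
 for P Mlo Mhi \<kappa> F N lam \<Phi> \<Psi> qa qb +
 assumes Mhi: "Mhi < qa"
begin

text \<open>This is the \<open>(i, j)\<close> entry of a matrix equation read along a
  characteristic; off \<open>Z0\<close> the coefficient matrices coincide with their Borel
  representatives.\<close>

lemma kernel_entry_path:
 assumes A: "(e, K, T) \<in> {(1, FF, TB), (- 1, NN, TA)}" and st: "s <= t"
  and dom: "\<And>u. u \<in> {s..t} ==> 0 <= \<Psi> j (d + e * u) \<and> \<Psi> j (d + e * u) <= \<Psi> i (c - u) \<and> \<Psi> i (c - u) <= L"
 shows "((\<lambda>u. - (q j (\<Psi> j (d + e * u)) *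
     ((\<Sum>k\<in>UNIV. (FF i k (\<Psi> i (c - u), \<Psi> j (d + e * u)) + NN i k (\<Psi> i (c - u), \<Psi> j (d + e * u))) * T k j (\<Psi> j (d + e * u)))
      - TA i i (\<Psi> i (c - u)) * K i j (\<Psi> i (c - u), \<Psi> j (d + e * u)))))
    has_integral (K i j (\<Psi> i (c - t), \<Psi> j (d + e * t)) * q j (\<Psi> j (d + e * t)) - K i j (\<Psi> i (c - s), \<Psi> j (d + e * s)) * q j (\<Psi> j (d + e * s)))) {s..t}"
proof -
 define H where "H z = (\<Sum>k\<in>UNIV. (FF i k z + NN i k z) * T k j (snd z)) - TA i i (fst z) * K i j z" for z
 have bms: "bm (T k j)" "bm (K i j)" for k using A TA_bm TB_bm FF_bm NN_bm by auto
 have Hb: "bm H" unfolding H_def[abs_def]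
  by (intro bm_diff bm_sum bm_mult bm_add FF_bm NN_bm bms bm_comp[OF bms(1)] bm_comp[OF TA_bm] borel_contI continuous_intros)
 have xy: "x \<in> {0..L} \<and> y \<in> {0..L}" if "(x, y) \<in> triangle L" for x y using that by (auto simp: triangle_def)
 note path = kernel_path[where ?Kb = "K i j" and ?Z = Z0 and ?Hb = H, OF _ _ _ _ bms(2) _ Z0(1) Hb _ st dom]
 note entries = matrix_matrix_mult_def sum_2 Qmat'_nth Ta_diag_nth Z0(2) tri_FF H_def algebra_simps
 from A consider "e = 1" "K = FF" "T = TB" | "e = - 1" "K = NN" "T = TA" by auto
 then have "((\<lambda>u. - (q j (\<Psi> j (d + e * u)) * H (\<Psi> i (c - u), \<Psi> j (d + e * u)))) has_integral
   (K i j (\<Psi> i (c - t), \<Psi> j (d + e * t)) * q j (\<Psi> j (d + e * t)) - K i j (\<Psi> i (c - s), \<Psi> j (d + e * s)) * q j (\<Psi> j (d + e * s)))) {s..t}"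
 proof cases
  case 1
  show ?thesis
   by (rule path[OF _ KD(7)[rule_format, of i j]]) (use 1 exhaust_2[of i] exhaust_2[of j] xy in \<open>auto simp: Qmat_nth entries\<close>)
 next
  case 2
  show ?thesis
   by (rule path[OF _ KD(6)[rule_format, of i j]]) (use 2 exhaust_2[of i] exhaust_2[of j] xy in \<open>auto simp: Qmat_nth entries\<close>)
 qed
 then show ?thesis by (simp only: H_def fst_conv snd_conv)
qed

sublocale ks: kernel_system "plant_data.q P" \<Phi> \<Psi> qa qb L TA TB FF NN ll ll' gg Am Bm Cm l Mhi
proof unfold_locales
 show "bm (TA i j)" "bm (TB i j)" "bm (FF i j)" "bm (NN i j)" "bm (gg i j)" for i j
  by (rule TA_bm TB_bm FF_bm NN_bm gg_bm)+
 show "bm (ll i k)" "bm (ll' i k)" for i k by (rule ll_bm ll'_bm)+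
 show "gg 1 j x = 0" "gg 2 2 x = 0" for j x by (simp_all add: gg_def)
qed ((rule kernel_entry_path boundary_conditions ll'_integral l_cont l_bound l_lip Mhi; (assumption | blast)?)+)

lemma kernel_bounds_exist:
 obtains M where "kernel_bounds q \<Phi> \<Psi> qa qb L TA TB FF NN ll ll' gg Am Bm Cm l Mhi M"
proof -
 have "\<forall>\<^sub>F M in at_top. 1 <= M \<and> (\<forall>i j x. \<bar>TA i j x\<bar> <= M) \<and> (\<forall>i j x. \<bar>TB i j x\<bar> <= M) \<and> (\<forall>i j x. \<bar>FF i j x\<bar> <= M) \<and> (\<forall>i j x. \<bar>NN i j x\<bar> <= M) \<and>
   (\<forall>i k x. \<bar>ll i k x\<bar> <= M) \<and> (\<forall>i j x. \<bar>gg i j x\<bar> <= M) \<and> (\<forall>k m (x::real). \<bar>Am k m\<bar> <= M) \<and> (\<forall>k j (x::real). \<bar>Bm k j\<bar> <= M) \<and> (\<forall>j k (x::real). \<bar>Cm j k\<bar> <= M)"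
  by (intro eventually_conj eventually_ge_at_top bm_family_bound TA_bm TB_bm FF_bm NN_bm ll_bm gg_bm bm_const)
 from eventually_happens'[OF trivial_limit_at_top_linorder this] obtain M where M: "1 <= M \<and> (\<forall>i j x. \<bar>TA i j x\<bar> <= M) \<and> (\<forall>i j x. \<bar>TB i j x\<bar> <= M) \<and> (\<forall>i j x. \<bar>FF i j x\<bar> <= M) \<and> (\<forall>i j x. \<bar>NN i j x\<bar> <= M) \<and>
   (\<forall>i k x. \<bar>ll i k x\<bar> <= M) \<and> (\<forall>i j x. \<bar>gg i j x\<bar> <= M) \<and> (\<forall>k m (x::real). \<bar>Am k m\<bar> <= M) \<and> (\<forall>k j (x::real). \<bar>Bm k j\<bar> <= M) \<and> (\<forall>j k (x::real). \<bar>Cm j k\<bar> <= M)"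
  by (elim exE)
 show thesis by (rule that[of M], unfold_locales) (use M in \<open>simp_all del: split_paired_All\<close>)
qed

end

section \<open>Riemann coordinates\<close>

definition ft :: "motion => 2 => real => real => real" where "ft Z i = (if i = 1 then u_t Z else w_t Z)"
definition fx :: "motion => 2 => real => real => real" where "fx Z i = (if i = 1 then u_x Z else w_x Z)"

lemma ft_12 [simp]: "ft Z 1 = u_t Z" "ft Z 2 = w_t Z" "fx Z 1 = u_x Z" "fx Z 2 = w_x Z"
 by (simp_all add: ft_def fx_def)

lemma domain_tdomain: "domain P = tdomain (bdry P)"
 by (simp add: domain_def tdomain_def)

context closed_loop
begin

text \<open>The explicit factors -1 here and 1 in \<open>rr\<close> match the sign \<open>e\<close>
  of \<open>strong_path\<close>, which treats both families at once.\<close>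

definition pp :: "motion => 2 => real \<times> real => real" where
 "pp Z i z = pr (ft Z i) z + (- 1) * q i (fst z) * pr (fx Z i) z"

definition rr :: "motion => 2 => real \<times> real => real" where
 "rr Z i z = pr (ft Z i) z + 1 * q i (fst z) * pr (fx Z i) z"

definition WW :: "motion => 4 => real => real" where "WW Z k t = ode_state Z t $ k"

lemma WW_nth: "WW Z 1 t = disp_w Z 0 t" "WW Z 2 t = w_t Z 0 t" "WW Z 3 t = disp_u Z 0 t" "WW Z 4 t = u_t Z 0 t"
 by (simp_all add: WW_def ode_state_def)

lemma riemann_nth:
 assumes "x \<in> {0..L}" shows "riemann_p P Z x t $ i = pp Z i (x, t)" "riemann_r P Z x t $ i = rr Z i (x, t)"
 using exhaust_2[of i] q_sqrt[OF assms] by (auto simp: riemann_p_def riemann_r_def pp_def rr_def)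

lemmas strong_3 = strong_solution_def[THEN iffD1, THEN conjunct2, THEN conjunct2]
lemmas strong_4 = strong_3[THEN conjunct2, THEN spec, THEN mp]
lemmas strongD = strong_solution_def[THEN iffD1, THEN conjunct1] strong_solution_def[THEN iffD1, THEN conjunct2, THEN conjunct1] strong_3[THEN conjunct1]
 strong_4[THEN conjunct1] strong_4[THEN conjunct2, THEN conjunct1] strong_4[THEN conjunct2, THEN conjunct2, THEN conjunct1]
 strong_4[THEN conjunct2, THEN conjunct2, THEN conjunct2]

lemma C1_continuous:
 assumes "C1_on (domain P) f g h"
 shows "continuous_on (tdomain l) (\<lambda>z. pr g z)" "continuous_on (tdomain l) (\<lambda>z. pr h z)"
 using assms by (simp_all add: C1_on_def split_beta' domain_tdomain del: split_paired_All)

lemma strong_continuous: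
 assumes "strong_solution P F N lam Z"
 shows "continuous_on (tdomain l) (\<lambda>z. pr (ft Z i) z)" "continuous_on (tdomain l) (\<lambda>z. pr (fx Z i) z)"
 using C1_continuous[OF strongD(1)[OF assms]] C1_continuous[OF strongD(2)[OF assms]] exhaust_2[of i] by auto

lemma pp_cont:
 assumes "strong_solution P F N lam Z"
 shows "continuous_on (tdomain l) (pp Z i)" "continuous_on (tdomain l) (rr Z i)"
 unfolding pp_def[abs_def] rr_def[abs_def]
 by (intro continuous_intros strong_continuous[OF assms] continuous_on_compose2[OF q_cont]; simp)+

lemma open_domain_open: "open (open_domain P T)"
 unfolding open_domain_def by (rule below_graph_open[OF l_cont])

text \<open>\<open>TA\<close> and \<open>TB\<close> are built so that the source, written in
  \<open>p\<close> and \<open>r\<close>, equals the lower-order terms of the wave equation minus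
  \<open>q * qd * fx\<close>, the term that the variable speed produces when the second-order
  operator is factored into two transport operators.\<close>

lemma strong_wave:
 assumes S: "strong_solution P F N lam Z"
 shows "\<exists>fxx fxt ftt. \<forall>T>0. second_derivatives (open_domain P T) (fx Z i) (ft Z i) fxx fxt ftt \<and>
  (AE z in lebesgue_on (open_domain P T).
    pr ftt z = (q i (fst z))\<^sup>2 * pr fxx z + (ks.source (pp Z) (rr Z) i z + q i (fst z) * qd i (fst z) * pr (fx Z i) z))"
proof -
 obtain wxx wxt wtt uxx uxt utt where D: "\<forall>T>0.
    second_derivatives (open_domain P T) (w_x Z) (w_t Z) wxx wxt wtt \<and>
    second_derivatives (open_domain P T) (u_x Z) (u_t Z) uxx uxt utt \<and>
    (AE (x, t) in lebesgue_on (open_domain P T).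
      wtt x t = d1 P x * wxx x t + d2 P x * w_x Z x t + d3 P x * u_x Z x t
            + d4 P x * w_t Z x t + d5 P x * u_t Z x t \<and>
      utt x t = d6 P x * uxx x t + d7 P x * w_x Z x t + d8 P x * u_x Z x t
            + d9 P x * w_t Z x t + d10 P x * u_t Z x t)"
  using strongD(3)[OF S] by (elim exE)
 have eq: "AE z in lebesgue_on (open_domain P T).
   pr wtt z = (q 2 (fst z))\<^sup>2 * pr wxx z + (ks.source (pp Z) (rr Z) 2 z + q 2 (fst z) * qd 2 (fst z) * w_x Z (fst z) (snd z)) \<and>
   pr utt z = (q 1 (fst z))\<^sup>2 * pr uxx z + (ks.source (pp Z) (rr Z) 1 z + q 1 (fst z) * qd 1 (fst z) * u_x Z (fst z) (snd z))"
  if T: "0 < T" for T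
 proof -
  have m: "open_domain P T \<in> sets lebesgue" using open_domain_open by auto
  have "AE (x, t) in lebesgue_on (open_domain P T).
      wtt x t = d1 P x * wxx x t + d2 P x * w_x Z x t + d3 P x * u_x Z x t
            + d4 P x * w_t Z x t + d5 P x * u_t Z x t \<and>
      utt x t = d6 P x * uxx x t + d7 P x * w_x Z x t + d8 P x * u_x Z x t
            + d9 P x * w_t Z x t + d10 P x * u_t Z x t"
   using D T by blast
  moreover have "AE z in lebesgue_on (open_domain P T). fst z \<notin> Z0"
   by (rule negligible_AE_lebesgue_on[OF negligible_fst[OF Z0(1)] _ m]) simp
  moreover have "AE z in lebesgue_on (open_domain P T). z \<in> open_domain P T"
   by (rule negligible_AE_lebesgue_on[OF negligible_empty _ m]) simp
  ultimately show ?thesis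
  proof eventually_elim
   case (elim z)
   obtain x t where z: "z = (x, t)" by (cases z)
   have x: "x \<in> {0..L}" using elim(3) l_bound[of t] unfolding z open_domain_def by auto
   have T: "TA i j x = Ta P x $ i $ j" "TB i j x = Tb P x $ i $ j" for i j using Z0(2)[of x] elim(2) x unfolding z by auto
   have qs: "sqrt (d6 P x) = q 1 x" "sqrt (d1 P x) = q 2 x" using q_sqrt[OF x, of 1] q_sqrt[OF x, of 2] by simp_all
   have q2: "d6 P x = (q 1 x)\<^sup>2" "d1 P x = (q 2 x)\<^sup>2" unfolding qs[symmetric] using dd_pos[OF x, of 1] dd_pos[OF x, of 2] by simp_all
   have qp: "0 < q 1 x" "0 < q 2 x" by (rule q_pos)+
   have Tv: "TA 1 1 x = s1 P x + d10 P x / 2" "TA 1 2 x = d7 P x / (2 * q 2 x) + d9 P x / 2"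
    "TA 2 1 x = d3 P x / (2 * q 1 x) + d5 P x / 2" "TA 2 2 x = s2 P x + d4 P x / 2"
    "TB 1 1 x = d10 P x / 2 - s1 P x" "TB 1 2 x = d9 P x / 2 - d7 P x / (2 * q 2 x)"
    "TB 2 1 x = d5 P x / 2 - d3 P x / (2 * q 1 x)" "TB 2 2 x = d4 P x / 2 - s2 P x"
    unfolding T Ta_def Tb_def qs by simp_all
   have sv: "s1 P x = (d8 P x - q 1 x * qd 1 x) / (2 * q 1 x)" "s2 P x = (d2 P x - q 2 x * qd 2 x) / (2 * q 2 x)"
    unfolding s1_def s2_def qs sqrt_d6'_eq[OF x] sqrt_d1'_eq[OF x] by simp_all
   have src: "ks.source (pp Z) (rr Z) 1 z + q 1 x * qd 1 x * u_x Z x t = d7 P x * w_x Z x t + d8 P x * u_x Z x t + d9 P x * w_t Z x t + d10 P x * u_t Z x t"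
    "ks.source (pp Z) (rr Z) 2 z + q 2 x * qd 2 x * w_x Z x t = d2 P x * w_x Z x t + d3 P x * u_x Z x t + d4 P x * w_t Z x t + d5 P x * u_t Z x t"
    unfolding ks.source_def sum_2 z pp_def rr_def fst_conv snd_conv Tv sv ft_12 using qp by (simp_all add: field_simps)
   show ?case using elim(1) src q2 unfolding z by simp
  qed
 qed
 show ?thesis
 proof (cases "i = 1")
  case True
  show ?thesis by (rule exI[of _ uxx], rule exI[of _ uxt], rule exI[of _ utt]) (use D eq True in \<open>auto elim: eventually_mono\<close>)
 next
  case False
  then have i: "i = 2" using exhaust_2[of i] by auto
  show ?thesis by (rule exI[of _ wxx], rule exI[of _ wxt], rule exI[of _ wtt]) (use D eq i in \<open>auto elim: eventually_mono\<close>)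
 qed
qed

lemma strong_path:
 assumes S: "strong_solution P F N lam Z" and eps: "e = 1 \<or> e = - 1"
  and st: "s <= t" and seg: "\<And>u. u \<in> {s..t} ==> (\<Psi> i (c - e * u), u) \<in> tdomain l"
 shows "((\<lambda>u. ks.source (pp Z) (rr Z) i (\<Psi> i (c - e * u), u)) has_integral
  ((\<lambda>z. pr (ft Z i) z + e * q i (fst z) * pr (fx Z i) z) (\<Psi> i (c - e * t), t) -
   (\<lambda>z. pr (ft Z i) z + e * q i (fst z) * pr (fx Z i) z) (\<Psi> i (c - e * s), s))) {s..t}"
proof -
 obtain fxx fxt ftt where D0: "\<forall>T>0. second_derivatives (open_domain P T) (fx Z i) (ft Z i) fxx fxt ftt \<and>
  (AE z in lebesgue_on (open_domain P T).
    pr ftt z = (q i (fst z))\<^sup>2 * pr fxx z + (ks.source (pp Z) (rr Z) i z + q i (fst z) * qd i (fst z) * pr (fx Z i) z))"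
  using strong_wave[OF S, of i] by (elim exE)
 note D = D0[rule_format, THEN conjunct1] D0[rule_format, THEN conjunct2]
 \<comment> \<open>The source is a sum of four products, \<open>TA\<close> with \<open>r\<close> and
   \<open>TB\<close> with \<open>p\<close>, indexed here by 0 to 3.\<close>
 let ?A = "\<lambda>n::nat. if n = 0 then TA i 1 else if n = 1 then TA i 2 else if n = 2 then TB i 1 else TB i 2"
 let ?f = "\<lambda>n::nat. if n = 0 then rr Z 1 else if n = 1 then rr Z 2 else if n = 2 then pp Z 1 else pp Z 2"
 show ?thesis
 proof (rule strong_characteristic[where l=l and L=L and \<Phi>="\<Phi> i" and q="q i" and qa=qa and q'="qd i" and fx="fx Z i" and ft="ft Z i"
    and fxx=fxx and fxt=fxt and ftt=ftt and J="{0,1,2,3}" and A="?A" and f="?f"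
    and k="\<lambda>z. ks.source (pp Z) (rr Z) i z + q i (fst z) * qd i (fst z) * pr (fx Z i) z",
    OF l_cont _ sp.\<Phi>_deriv q_cont sp.qa sp.q_ge sp.\<Psi>\<Phi> sp.\<Phi>\<Psi> _ continuous_on_subset[OF qd_cont] eps
    D(1)[unfolded open_domain_def] D(2)[unfolded open_domain_def] strong_continuous(2)[OF S] strong_continuous(1)[OF S] refl])
  show "l t <= L" if "0 <= t" for t using l_bound[OF that] by simp
  show "\<forall>x\<in>{0<..<L}. (q i has_real_derivative qd i x) (at x)" using q_deriv by auto
  show "bm (?A j)" for j by (simp add: TA_bm TB_bm)
  show "continuous_on (tdomain l) (?f j)" for j using pp_cont[OF S] by simp
  show "ks.source (pp Z) (rr Z) i z = (\<Sum>j\<in>{0, 1, 2, 3}. ?A j (fst z) * ?f j z)" for z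
   unfolding ks.source_def by (simp add: sum_2)
 qed (use st seg in auto)
qed

text \<open>At the origin each slope is \<open>r\<close> minus the velocity, divided by the speed.
  Eliminating the slopes changes the drift from \<open>Abar P\<close> to
  \<open>Abar P - Bbar P ** C3\<close> and makes twice \<open>Bbar P\<close> the input matrix for
  \<open>r\<close>.\<close>

lemma state_deriv:
 assumes S: "strong_solution P F N lam Z" and t: "0 <= t"
 shows "(WW Z k has_real_derivative (\<Sum>m\<in>UNIV. Am k m * WW Z m t) + 2 * (\<Sum>j\<in>UNIV. Bm k j * rr Z j (0, t))) (at t within {0..})"
proof -
 have disp: "((\<lambda>t. f 0 t) has_real_derivative h 0 t) (at t within {0..})" if C: "C1_on (domain P) f g h" for f g h
 proof -
  have in_dom: "(0, s) \<in> domain P" if "0 <= s" for s using l_bound[OF that] that by (auto simp: domain_def)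
  have d: "((\<lambda>(x, t). f x t) has_derivative (\<lambda>(v, k). g 0 t * v + h 0 t * k)) (at (0, t) within domain P)"
   using bspec[OF conjunct1[OF C[unfolded C1_on_def]] in_dom[OF t]] by simp
  have p: "((\<lambda>s::real. (0::real, s)) has_derivative (\<lambda>v. (0, v))) (at t within {0..})"
   by (auto intro!: derivative_eq_intros)
  have "((\<lambda>(x, t). f x t) has_derivative (\<lambda>(v, k). g 0 t * v + h 0 t * k)) (at (0, t) within (\<lambda>s. (0, s)) ` {0..})"
   by (rule has_derivative_subset[OF d]) (use in_dom in auto)
  from has_derivative_in_compose[OF p this]
  show ?thesis by (simp add: has_field_derivative_def)
 qed
 have q0: "sqrt (d6 P 0) = q 1 0" "sqrt (d1 P 0) = q 2 0"
  by (simp_all only: q_sqrt[OF origin_in_interval] dd_12)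
 have "k = 1 \<or> k = 2 \<or> k = 3 \<or> k = 4" by (rule exhaust_4)
 moreover have "(WW Z 1 has_real_derivative w_t Z 0 t) (at t within {0..})" "(WW Z 3 has_real_derivative u_t Z 0 t) (at t within {0..})"
  using disp[OF strongD(1)[OF S]] disp[OF strongD(2)[OF S]] unfolding WW_nth[abs_def] by simp_all
 moreover have "(WW Z 2 has_real_derivative d11 P * w_t Z 0 t + d12 P * w_x Z 0 t + d13 P * u_t Z 0 t + d14 P * u_x Z 0 t) (at t within {0..})"
  "(WW Z 4 has_real_derivative d15 P * u_t Z 0 t + d16 P * u_x Z 0 t + d17 P * w_t Z 0 t + d18 P * w_x Z 0 t) (at t within {0..})"
  using strongD(4,5)[OF S t] unfolding WW_nth[abs_def] by simp_all
 moreover have "(\<Sum>m\<in>UNIV. Am 1 m * WW Z m t) + 2 * (\<Sum>j\<in>UNIV. Bm 1 j * rr Z j (0, t)) = w_t Z 0 t"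
  "(\<Sum>m\<in>UNIV. Am 3 m * WW Z m t) + 2 * (\<Sum>j\<in>UNIV. Bm 3 j * rr Z j (0, t)) = u_t Z 0 t"
  "(\<Sum>m\<in>UNIV. Am 2 m * WW Z m t) + 2 * (\<Sum>j\<in>UNIV. Bm 2 j * rr Z j (0, t)) = d11 P * w_t Z 0 t + d12 P * w_x Z 0 t + d13 P * u_t Z 0 t + d14 P * u_x Z 0 t"
  "(\<Sum>m\<in>UNIV. Am 4 m * WW Z m t) + 2 * (\<Sum>j\<in>UNIV. Bm 4 j * rr Z j (0, t)) = d15 P * u_t Z 0 t + d16 P * u_x Z 0 t + d17 P * w_t Z 0 t + d18 P * w_x Z 0 t"
  using q_pos[of 1 0] q_pos[of 2 0] unfolding Am_def Bm_def
  by (simp_all add: sum_4 sum_2 matrix_matrix_mult_def Abar_def Bbar_def C3_def WW_nth rr_def q0(1,2) field_simps)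
 ultimately show ?thesis by (elim disjE) simp_all
qed

lemma slice_integrable:
 assumes "continuous_on (tdomain l) f" "0 <= t" shows "continuous_on {0..l t} (\<lambda>y. f (y, t))"
 by (rule continuous_on_compose2[OF assms(1)]) (use assms(2) in \<open>auto intro!: continuous_intros simp: tdomain_iff\<close>)

lemma kernel_row_integral:
 assumes f: "\<And>j. continuous_on (tdomain l) (f j)" and t: "0 <= t"
  and K: "\<And>j. bm (K j)" and v: "\<And>y. y \<in> {0..l t} ==> v y $ i = (\<Sum>j\<in>UNIV. K j (l t, y) * f j (y, t))"
 shows "((\<lambda>y. v y $ i) has_integral (\<Sum>j\<in>(UNIV::2 set). integral {0..l t} (\<lambda>y. K j (l t, y) * f j (y, t)))) {0..l t}"
proof -
 have "((\<lambda>y. K j (l t, y) * f j (y, t)) has_integral integral {0..l t} (\<lambda>y. K j (l t, y) * f j (y, t))) {0..l t}" for j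
 proof -
  let ?g = "\<lambda>y. K j (l t, y) * (f j (max 0 (min (l t) y), t))"
  have "bm ?g" using bm_clamp(2)[OF slice_integrable[OF f t], of j] l_bound[OF t]
   by (intro bm_mult bm_pair2[OF K]) auto
  then have "?g integrable_on {0..l t}" by (rule bm_integrable_on)
  then have "(\<lambda>y. K j (l t, y) * f j (y, t)) integrable_on {0..l t}"
   by (rule integrable_eq) auto
  then show ?thesis by blast
 qed
 then have "((\<lambda>y. \<Sum>j\<in>UNIV. K j (l t, y) * f j (y, t)) has_integral (\<Sum>j\<in>(UNIV::2 set). integral {0..l t} (\<lambda>y. K j (l t, y) * f j (y, t)))) {0..l t}"
  by (intro has_integral_sum) auto
 then show ?thesis by (rule has_integral_eq[rotated]) (use v in simp)
qed

lemma has_integral_vec_nth: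
 fixes v :: "real => real^2"
 assumes "\<And>i. ((\<lambda>y. v y $ i) has_integral a i) S" shows "integral S v $ i = a i"
proof -
 have "(v has_integral (\<chi> i. a i)) S"
  by (subst has_integral_componentwise_iff) (use assms in \<open>auto simp: Basis_vec_def inner_axis\<close>)
 then show ?thesis by (simp add: integral_unique)
qed

text \<open>Inserting the control law into the condition on the slope cancels \<open>d19\<close> or
  \<open>d20\<close> and the velocity, so \<open>r\<close> at the boundary equals the feedback; that
  difference is \<open>beta\<close>.\<close>

lemma beta_boundary:
 assumes S: "strong_solution P F N lam Z" and t: "0 <= t"
 shows "ks.beta (pp Z) (rr Z) (WW Z) i (l t, t) = 0"
proof -
 have lt: "l t \<in> {0..L}" using l_bound[OF t] by auto
 have tri: "(l t, y) \<in> triangle L" "y \<in> {0..L}" if "y \<in> {0..l t}" for y using that lt by (auto simp: triangle_def)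
 have fb: "feedback P F N lam Z t $ i = (\<Sum>j\<in>UNIV. integral {0..l t} (\<lambda>y. FF i j (l t, y) * pp Z j (y, t)))
   + (\<Sum>j\<in>UNIV. integral {0..l t} (\<lambda>y. NN i j (l t, y) * rr Z j (y, t))) + (\<Sum>k\<in>UNIV. ll i k (l t) * WW Z k t)" for i
 proof -
  have "integral {0..l t} (\<lambda>y. F (l t) y *v riemann_p P Z y t) $ i = (\<Sum>j\<in>UNIV. integral {0..l t} (\<lambda>y. FF i j (l t, y) * pp Z j (y, t)))" for i
   by (rule has_integral_vec_nth, rule kernel_row_integral[OF pp_cont(1)[OF S] t FF_bm])
     (simp add: matrix_vector_mult_def tri_FF[OF tri(1)] riemann_nth[OF tri(2)] del: atLeastAtMost_iff)
  moreover have "integral {0..l t} (\<lambda>y. N (l t) y *v riemann_r P Z y t) $ i = (\<Sum>j\<in>UNIV. integral {0..l t} (\<lambda>y. NN i j (l t, y) * rr Z j (y, t)))" for i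
   by (rule has_integral_vec_nth, rule kernel_row_integral[OF pp_cont(2)[OF S] t NN_bm])
     (simp add: matrix_vector_mult_def tri_FF[OF tri(1)] riemann_nth[OF tri(2)] del: atLeastAtMost_iff)
  ultimately show ?thesis
   unfolding feedback_def by (simp add: matrix_vector_mult_def lam_eq[OF lt] WW_def del: atLeastAtMost_iff)
 qed
 have ql: "sqrt (d6 P (l t)) = q 1 (l t)" "sqrt (d1 P (l t)) = q 2 (l t)"
  by (simp_all only: q_sqrt[OF lt] dd_12)
 have nz: "d19 P (l t) \<noteq> 0" "d20 P (l t) \<noteq> 0" using SAD(6) t by auto
 have ctl: "u + k * x = f" if "d \<noteq> 0" "0 < k" "x = d * (- (1 / (d * k)) * (u - f))" for u k x f d :: real
  unfolding that(3) using that(1,2) by (simp add: field_simps)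
 have "u_t Z (l t) t + q 1 (l t) * u_x Z (l t) t = feedback P F N lam Z t $ 1"
  by (rule ctl[OF nz(1) q_pos]) (use strongD(6)[OF S t] in \<open>simp add: control_U1_def ql(1)\<close>)
 moreover have "w_t Z (l t) t + q 2 (l t) * w_x Z (l t) t = feedback P F N lam Z t $ 2"
  by (rule ctl[OF nz(2) q_pos]) (use strongD(7)[OF S t] in \<open>simp add: control_U2_def ql(2)\<close>)
 ultimately have "rr Z i (l t, t) = feedback P F N lam Z t $ i"
  using exhaust_2[of i] by (auto simp: rr_def)
 then show ?thesis unfolding ks.beta_def fb by simp
qed

lemma strong_sol:
 assumes S: "strong_solution P F N lam Z"
 shows "ks.sol (pp Z) (rr Z) (WW Z)"
 unfolding ks.sol_def
proof (intro conjI allI impI)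
 fix i show "continuous_on (tdomain l) (pp Z i)" "continuous_on (tdomain l) (rr Z i)" by (rule pp_cont[OF S])+
next
 fix i c s t assume "s <= t" "\<forall>u\<in>{s..t}. (\<Psi> i (c + u), u) \<in> tdomain l"
 then show "((\<lambda>u. ks.source (pp Z) (rr Z) i (\<Psi> i (c + u), u)) has_integral (pp Z i (\<Psi> i (c + t), t) - pp Z i (\<Psi> i (c + s), s))) {s..t}"
  using strong_path[OF S, of "- 1" s t i c] by (simp add: pp_def)
next
 fix i c s t assume "s <= t" "\<forall>u\<in>{s..t}. (\<Psi> i (c - u), u) \<in> tdomain l"
 then show "((\<lambda>u. ks.source (pp Z) (rr Z) i (\<Psi> i (c - u), u)) has_integral (rr Z i (\<Psi> i (c - t), t) - rr Z i (\<Psi> i (c - s), s))) {s..t}"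
  using strong_path[OF S, of 1 s t i c] by (simp add: rr_def)
next
 fix k t assume "0 <= (t::real)"
 then show "(WW Z k has_real_derivative (\<Sum>m\<in>UNIV. Am k m * WW Z m t) + 2 * (\<Sum>j\<in>UNIV. Bm k j * rr Z j (0, t))) (at t within {0..})"
  by (rule state_deriv[OF S])
next
 fix j t assume "0 <= (t::real)"
 show "pp Z j (0, t) = (\<Sum>k\<in>UNIV. Cm j k * WW Z k t) - rr Z j (0, t)"
  using exhaust_2[of j] by (auto simp: pp_def rr_def Cm_def C3_def sum_4 WW_nth)
next
 fix i t assume "0 <= (t::real)"
 then show "ks.beta (pp Z) (rr Z) (WW Z) i (l t, t) = 0" by (rule beta_boundary[OF S])
qed

lemma energy_integral:
 assumes S: "strong_solution P F N lam Z" and t: "0 <= t"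
 shows "energy P Z t = integral {0..l t} (\<lambda>x. \<Sum>j\<in>UNIV. (ft Z j x t)\<^sup>2 + (fx Z j x t)\<^sup>2) + (\<Sum>k\<in>UNIV. (WW Z k t)\<^sup>2)"
proof -
 have c: "continuous_on {0..l t} (\<lambda>x. ft Z i x t)" "continuous_on {0..l t} (\<lambda>x. fx Z i x t)" for i
  using slice_integrable[OF strong_continuous(1)[OF S] t] slice_integrable[OF strong_continuous(2)[OF S] t] by simp_all
 have i: "((\<lambda>x. (ft Z i x t)\<^sup>2) has_integral sq_norm P (ft Z i) t) {0..l t}" "((\<lambda>x. (fx Z i x t)\<^sup>2) has_integral sq_norm P (fx Z i) t) {0..l t}" for i
  unfolding sq_norm_def by (intro integrable_integral integrable_continuous_real continuous_intros c)+
 have "((\<lambda>x. \<Sum>j\<in>UNIV. (ft Z j x t)\<^sup>2 + (fx Z j x t)\<^sup>2) has_integral (\<Sum>j\<in>UNIV. sq_norm P (ft Z j) t + sq_norm P (fx Z j) t)) {0..l t}"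
  by (intro has_integral_sum has_integral_add i) simp
 from integral_unique[OF this] show ?thesis
  unfolding energy_def by (simp add: sum_2 sum_4 WW_nth)
qed

text \<open>Pointwise, the squares of \<open>p\<close> and \<open>r\<close> add up to twice the
  squares of the velocity and of the speed times the slope, so the two energies are comparable with
  constants from \<open>qa\<close> and \<open>qb\<close>.\<close>

lemma energy_equiv:
 assumes S: "strong_solution P F N lam Z" and t: "0 <= t"
 defines "e \<equiv> integral {0..l t} (\<lambda>x. \<Sum>j\<in>UNIV. (pp Z j (x, t))\<^sup>2 + (rr Z j (x, t))\<^sup>2) + (\<Sum>k\<in>UNIV. (WW Z k t)\<^sup>2)"
 shows "energy P Z t <= (1 + 1 / qa\<^sup>2) * e" "e <= (2 + 2 * qb\<^sup>2) * energy P Z t"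
proof -
 have c: "continuous_on {0..l t} (\<lambda>x. ft Z i x t)" "continuous_on {0..l t} (\<lambda>x. fx Z i x t)"
  "continuous_on {0..l t} (\<lambda>x. pp Z i (x, t))" "continuous_on {0..l t} (\<lambda>x. rr Z i (x, t))" for i
  using slice_integrable[OF strong_continuous(1)[OF S] t] slice_integrable[OF strong_continuous(2)[OF S] t]
   slice_integrable[OF pp_cont(1)[OF S] t] slice_integrable[OF pp_cont(2)[OF S] t] by simp_all
 let ?f = "\<lambda>x. \<Sum>j\<in>(UNIV::2 set). (ft Z j x t)\<^sup>2 + (fx Z j x t)\<^sup>2"
 let ?g = "\<lambda>x. \<Sum>j\<in>(UNIV::2 set). (pp Z j (x, t))\<^sup>2 + (rr Z j (x, t))\<^sup>2"
 let ?W = "\<Sum>k\<in>UNIV. (WW Z k t)\<^sup>2"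
 have i: "?f integrable_on {0..l t}" "?g integrable_on {0..l t}"
  by (intro integrable_continuous_real continuous_intros c)+
 have W: "0 <= ?W" by (simp add: sum_nonneg)
 have qa: "0 < qa\<^sup>2" using sp.qa by simp
 have pt: "(pp Z j (x, t))\<^sup>2 + (rr Z j (x, t))\<^sup>2 = 2 * (ft Z j x t)\<^sup>2 + 2 * ((q j x)\<^sup>2 * (fx Z j x t)\<^sup>2)" for j x
  unfolding pp_def rr_def by (simp add: power2_eq_square algebra_simps)
 have q2: "qa\<^sup>2 <= (q j x)\<^sup>2" "(q j x)\<^sup>2 <= qb\<^sup>2" for j x
  using sp.q_ge sp.q_le sp.qa sp.q_pos by (intro power_mono; simp add: less_imp_le)+
 have "integral {0..l t} ?f <= integral {0..l t} (\<lambda>x. (1 + 1 / qa\<^sup>2) * ?g x)"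
 proof (rule integral_le[OF i(1) integrable_on_mult_right[OF i(2)]])
  fix x
  have "(ft Z j x t)\<^sup>2 + (fx Z j x t)\<^sup>2 <= (1 + 1 / qa\<^sup>2) * ((pp Z j (x, t))\<^sup>2 + (rr Z j (x, t))\<^sup>2)" for j
  proof -
   have a: "qa\<^sup>2 * (fx Z j x t)\<^sup>2 <= (q j x)\<^sup>2 * (fx Z j x t)\<^sup>2" by (intro mult_right_mono q2) simp
   then have "(fx Z j x t)\<^sup>2 <= (1 / qa\<^sup>2) * ((q j x)\<^sup>2 * (fx Z j x t)\<^sup>2)" using qa by (simp add: field_simps)
   also have "... <= (1 / qa\<^sup>2) * (2 * (ft Z j x t)\<^sup>2 + 2 * ((q j x)\<^sup>2 * (fx Z j x t)\<^sup>2))"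
    using qa by (intro mult_left_mono) auto
   finally have b: "(fx Z j x t)\<^sup>2 <= (1 / qa\<^sup>2) * (2 * (ft Z j x t)\<^sup>2 + 2 * ((q j x)\<^sup>2 * (fx Z j x t)\<^sup>2))" .
   have "0 <= (q j x)\<^sup>2 * (fx Z j x t)\<^sup>2" "0 <= (ft Z j x t)\<^sup>2" by simp_all
   then show ?thesis unfolding pt distrib_right mult_1 using b by linarith
  qed
  from sum_mono[of UNIV, OF this] show "?f x <= (1 + 1 / qa\<^sup>2) * ?g x" by (simp add: sum_distrib_left)
 qed
 moreover have "?W <= (1 + 1 / qa\<^sup>2) * ?W" using W qa by (simp add: distrib_right)
 ultimately show "energy P Z t <= (1 + 1 / qa\<^sup>2) * e"
  unfolding energy_integral[OF S t] e_def by (simp add: distrib_left)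
 have "integral {0..l t} ?g <= integral {0..l t} (\<lambda>x. (2 + 2 * qb\<^sup>2) * ?f x)"
 proof (rule integral_le[OF i(2) integrable_on_mult_right[OF i(1)]])
  fix x
  have "(pp Z j (x, t))\<^sup>2 + (rr Z j (x, t))\<^sup>2 <= (2 + 2 * qb\<^sup>2) * ((ft Z j x t)\<^sup>2 + (fx Z j x t)\<^sup>2)" for j
  proof -
   have "(q j x)\<^sup>2 * (fx Z j x t)\<^sup>2 <= qb\<^sup>2 * (fx Z j x t)\<^sup>2" by (intro mult_right_mono q2) simp
   moreover have "0 <= qb\<^sup>2 * (ft Z j x t)\<^sup>2" "0 <= (fx Z j x t)\<^sup>2" by simp_all
   ultimately show ?thesis unfolding pt distrib_left distrib_right mult.assoc by linarith
  qed
  from sum_mono[of UNIV, OF this] show "?g x <= (2 + 2 * qb\<^sup>2) * ?f x" by (simp add: sum_distrib_left)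
 qed
 moreover have "?W <= (2 + 2 * qb\<^sup>2) * ?W" using W by (simp add: distrib_right)
 ultimately show "e <= (2 + 2 * qb\<^sup>2) * energy P Z t"
  unfolding energy_integral[OF S t] e_def by (simp add: distrib_left)
qed

text \<open>Because \<open>lam 0 = \<kappa>\<close>, the matrix \<open>kb.Acl\<close> is the
  closed-loop matrix of the hypothesis. The energy is quadratic, so its rate is twice the rate
  \<open>s\<close> of the state.\<close>

lemma strong_decay:
 assumes sigma: "0 <= s" and H: "hurwitz (Abar P - Bbar P ** C3 + 2 *\<^sub>R (Bbar P ** \<kappa>) + s *\<^sub>R mat 1)"
 shows "\<exists>C\<ge>0. \<forall>Z t. strong_solution P F N lam Z \<longrightarrow> 0 <= t \<longrightarrow> energy P Z t <= C * exp (- 2 * s * t) * energy P Z 0"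
proof -
 obtain M where "kernel_bounds q \<Phi> \<Psi> qa qb L TA TB FF NN ll ll' gg Am Bm Cm l Mhi M"
  by (rule kernel_bounds_exist)
 then interpret kb: kernel_bounds q \<Phi> \<Psi> qa qb L TA TB FF NN ll ll' gg Am Bm Cm l Mhi M .
 let ?A = "Abar P - Bbar P ** C3 + 2 *\<^sub>R (Bbar P ** \<kappa>)"
 have Acl: "kb.Acl k m = ?A $ k $ m" for k m
  unfolding kb.Acl_def Am_def Bm_def using KD(9) lam_eq[OF origin_in_interval, symmetric]
  by (simp add: matrix_matrix_mult_def)
 obtain D where D: "0 <= D"
  "\<And>a (W :: 4 => real => real) t. (\<And>k t. a <= t ==> (W k has_real_derivative (\<Sum>m\<in>UNIV. ?A $ k $ m * W m t)) (at t within {a..})) ==>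
    a <= t ==> (\<Sum>k\<in>UNIV. \<bar>W k t\<bar>) <= D * exp (- s * (t - a)) * (\<Sum>k\<in>UNIV. \<bar>W k a\<bar>)"
  using hurwitz_decay[OF H] by blast
 have DW: "kb.wsum W t <= D * exp (- s * (t - kb.T0)) * kb.wsum W kb.T0" if "kb.flow kb.T0 W" "kb.T0 <= t" for W t
  unfolding kb.wsum_def by (rule D(2)[OF _ that(2)]) (use that(1) in \<open>simp add: kb.flow_def Acl\<close>)
 obtain C where C: "0 <= C" "\<And>p r W t. ks.sol p r W ==> 0 <= t ==> kb.en p r W t <= C * exp (- 2 * s * t) * kb.en p r W 0"
  using kb.en_decay[OF sigma D(1) DW] by blast
 define c where "c = (1 + 1 / qa\<^sup>2) * C * (2 + 2 * qb\<^sup>2)"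
 have c0: "0 <= c" unfolding c_def using C(1) by (intro mult_nonneg_nonneg add_nonneg_nonneg) auto
 have "energy P Z t <= c * exp (- 2 * s * t) * energy P Z 0" if S: "strong_solution P F N lam Z" and t: "0 <= t" for Z t
 proof -
  have "energy P Z t <= (1 + 1 / qa\<^sup>2) * kb.en (pp Z) (rr Z) (WW Z) t" unfolding kb.en_def by (rule energy_equiv(1)[OF S t])
  also have "... <= (1 + 1 / qa\<^sup>2) * (C * exp (- 2 * s * t) * kb.en (pp Z) (rr Z) (WW Z) 0)"
   by (intro mult_left_mono C(2) strong_sol S t) simp
  also have "... <= (1 + 1 / qa\<^sup>2) * (C * exp (- 2 * s * t) * ((2 + 2 * qb\<^sup>2) * energy P Z 0))"
   unfolding kb.en_def using C(1) by (intro mult_left_mono energy_equiv(2)[OF S order_refl]) auto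
  finally show ?thesis by (simp add: c_def mult_ac)
 qed
 with c0 show ?thesis by blast
qed

section \<open>Passage from strong to generalized solutions\<close>

lemma L2_on_continuous: "continuous_on {a..b} f ==> L2_on {a..b::real} f"
 unfolding L2_on_def
 by (intro conjI continuous_imp_measurable_on_sets_lebesgue continuous_imp_integrable_real continuous_intros) auto

lemma L2_on_diff:
 assumes f: "L2_on {a..b::real} f" and g: "L2_on {a..b} g"
 shows "L2_on {a..b} (\<lambda>x. f x - g x)"
proof -
 have m: "f \<in> borel_measurable (lebesgue_on {a..b})" "g \<in> borel_measurable (lebesgue_on {a..b})"
  and i: "integrable (lebesgue_on {a..b}) (\<lambda>x. (f x)\<^sup>2)" "integrable (lebesgue_on {a..b}) (\<lambda>x. (g x)\<^sup>2)"
  using f g by (auto simp: L2_on_def)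
 have "integrable (lebesgue_on {a..b}) (\<lambda>x. (f x - g x)\<^sup>2)"
 proof (rule Bochner_Integration.integrable_bound)
  show "integrable (lebesgue_on {a..b}) (\<lambda>x. 2 * ((f x)\<^sup>2 + (g x)\<^sup>2))" using i by simp
  show "(\<lambda>x. (f x - g x)\<^sup>2) \<in> borel_measurable (lebesgue_on {a..b})" using m by simp
  have "(f x - g x)\<^sup>2 <= 2 * ((f x)\<^sup>2 + (g x)\<^sup>2)" for x
   using power2_sum2_le[of "f x" "- g x"] by simp
  then show "AE x in lebesgue_on {a..b}. norm ((f x - g x)\<^sup>2) <= norm (2 * ((f x)\<^sup>2 + (g x)\<^sup>2))" by simp
 qed
 then show ?thesis using m by (simp add: L2_on_def)
qed

lemma L2_sq_integrable: "L2_on {a..b::real} f ==> (\<lambda>x. (f x)\<^sup>2) integrable_on {a..b}"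
 unfolding L2_on_def by (intro integrable_on_lebesgue_on) auto

lemma sq_norm_triangle:
 assumes f: "L2_on {0..l t} (\<lambda>x. f x t)" and g: "L2_on {0..l t} (\<lambda>x. g x t)"
 shows "sq_norm P f t <= 2 * (sq_norm P g t + sq_norm P (\<lambda>x t. g x t - f x t) t)"
  "sq_norm P g t <= 2 * (sq_norm P f t + sq_norm P (\<lambda>x t. g x t - f x t) t)"
proof -
 note i = L2_sq_integrable[OF f] L2_sq_integrable[OF g] L2_sq_integrable[OF L2_on_diff[OF g f]]
 have s: "integral {0..l t} (\<lambda>x. 2 * ((h x t)\<^sup>2 + (g x t - f x t)\<^sup>2)) = 2 * (sq_norm P h t + sq_norm P (\<lambda>x t. g x t - f x t) t)"
  if "(\<lambda>x. (h x t)\<^sup>2) integrable_on {0..l t}" for h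
  unfolding sq_norm_def using that i by (simp add: integral_add)
 have "sq_norm P f t <= integral {0..l t} (\<lambda>x. 2 * ((g x t)\<^sup>2 + (g x t - f x t)\<^sup>2))"
  unfolding sq_norm_def
 proof (rule integral_le[OF i(1)])
  show "(\<lambda>x. 2 * ((g x t)\<^sup>2 + (g x t - f x t)\<^sup>2)) integrable_on {0..l t}" by (intro integrable_on_mult_right integrable_add i)
  show "(f x t)\<^sup>2 <= 2 * ((g x t)\<^sup>2 + (g x t - f x t)\<^sup>2)" for x using power2_sum2_le[of "g x t" "f x t - g x t"] by (simp add: power2_commute)
 qed
 then show "sq_norm P f t <= 2 * (sq_norm P g t + sq_norm P (\<lambda>x t. g x t - f x t) t)" unfolding s[of g, OF i(2)] .
 have "sq_norm P g t <= integral {0..l t} (\<lambda>x. 2 * ((f x t)\<^sup>2 + (g x t - f x t)\<^sup>2))"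
  unfolding sq_norm_def
 proof (rule integral_le[OF i(2)])
  show "(\<lambda>x. 2 * ((f x t)\<^sup>2 + (g x t - f x t)\<^sup>2)) integrable_on {0..l t}" by (intro integrable_on_mult_right integrable_add i)
  show "(g x t)\<^sup>2 <= 2 * ((f x t)\<^sup>2 + (g x t - f x t)\<^sup>2)" for x using power2_sum2_le[of "f x t" "g x t - f x t"] by simp
 qed
 then show "sq_norm P g t <= 2 * (sq_norm P f t + sq_norm P (\<lambda>x t. g x t - f x t) t)" unfolding s[of f, OF i(1)] .
qed

text \<open>A quadratic form satisfies the triangle inequality up to a factor 2, here once in each
  direction.\<close>

lemma energy_triangle:
 assumes S: "strong_solution P F N lam Y" and t: "0 <= t"
  and Z: "\<forall>f\<in>{w_x Z, w_t Z, u_x Z, u_t Z}. L2_on {0..l t} (\<lambda>x. f x t)"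
 shows "energy P Z t <= 2 * (energy P Y t + energy P (motion_diff Y Z) t)" "energy P Y t <= 2 * (energy P Z t + energy P (motion_diff Y Z) t)"
proof -
 have c: "L2_on {0..l t} (\<lambda>x. ft Y i x t)" "L2_on {0..l t} (\<lambda>x. fx Y i x t)" for i
  using slice_integrable[OF strong_continuous(1)[OF S] t] slice_integrable[OF strong_continuous(2)[OF S] t] by (simp_all add: L2_on_continuous)
 have z: "L2_on {0..l t} (\<lambda>x. w_x Z x t)" "L2_on {0..l t} (\<lambda>x. w_t Z x t)" "L2_on {0..l t} (\<lambda>x. u_x Z x t)" "L2_on {0..l t} (\<lambda>x. u_t Z x t)"
  using Z by auto
 note n = sq_norm_triangle[of t "w_x Z" "w_x Y", OF z(1) c(2)[of 2, simplified]] sq_norm_triangle[of t "w_t Z" "w_t Y", OF z(2) c(1)[of 2, simplified]]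
  sq_norm_triangle[of t "u_x Z" "u_x Y", OF z(3) c(2)[of 1, simplified]] sq_norm_triangle[of t "u_t Z" "u_t Y", OF z(4) c(1)[of 1, simplified]]
 have p: "a\<^sup>2 <= 2 * (b\<^sup>2 + (b - a)\<^sup>2)" "b\<^sup>2 <= 2 * (a\<^sup>2 + (b - a)\<^sup>2)" for a b :: real
  using power2_sum2_le[of b "a - b"] power2_sum2_le[of a "b - a"] by (simp_all add: power2_commute)
 note q = p[where a="disp_w Z 0 t" and b="disp_w Y 0 t"] p[where a="disp_u Z 0 t" and b="disp_u Y 0 t"] p[where a="w_t Z 0 t" and b="w_t Y 0 t"] p[where a="u_t Z 0 t" and b="u_t Y 0 t"]
 show "energy P Z t <= 2 * (energy P Y t + energy P (motion_diff Y Z) t)"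
  using n(1,3,5,7) q(1,3,5,7) unfolding energy_def motion_diff_def motion.simps power2_abs distrib_left by linarith
 show "energy P Y t <= 2 * (energy P Z t + energy P (motion_diff Y Z) t)"
  using n(2,4,6,8) q(2,4,6,8) unfolding energy_def motion_diff_def motion.simps power2_abs distrib_left by linarith
qed

text \<open>The constant for strong solutions is the same for all of them, so the estimate passes to
  limits in the energy norm; the comparisons at time \<open>t\<close> and at time 0 cost a factor 2
  each.\<close>

lemma solution_decay:
 assumes sigma: "0 <= w" and H: "hurwitz (Abar P - Bbar P ** C3 + 2 *\<^sub>R (Bbar P ** \<kappa>) + w *\<^sub>R mat 1)"
 shows "\<exists>C\<ge>0. \<forall>Z t. closed_loop_solution P F N lam Z \<longrightarrow> 0 <= t \<longrightarrow> energy P Z t <= C * exp (- 2 * w * t) * energy P Z 0"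
proof -
 obtain C where C: "0 <= C" "\<And>Z t. strong_solution P F N lam Z ==> 0 <= t ==> energy P Z t <= C * exp (- 2 * w * t) * energy P Z 0"
  using strong_decay[OF sigma H] by blast
 have "energy P Z t <= 4 * C * exp (- 2 * w * t) * energy P Z 0" if Z: "closed_loop_solution P F N lam Z" and t: "0 <= t" for Z t
 proof -
  have L2: "\<forall>t\<ge>0. \<forall>f\<in>{w_x Z, w_t Z, u_x Z, u_t Z}. L2_on {0..l t} (\<lambda>x. f x t)"
   using Z unfolding closed_loop_solution_def by (elim conjE)
  obtain Zs :: "nat => motion" where Zs: "\<forall>n. strong_solution P F N lam (Zs n)"
   and lim: "\<forall>T\<ge>0. uniform_limit {0..T} (\<lambda>n t. energy P (motion_diff (Zs n) Z) t) (\<lambda>_. 0) sequentially"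
   using Z unfolding closed_loop_solution_def by (elim conjE exE)
  have lim': "(\<lambda>n. energy P (motion_diff (Zs n) Z) s) \<longlonglongrightarrow> 0" if "0 <= s" for s
   by (rule tendsto_uniform_limitI[OF lim[rule_format, OF that]]) (use that in simp)
  define k where "k = C * exp (- 2 * w * t)"
  have k: "0 <= k" using C(1) by (simp add: k_def)
  have le: "energy P Z t <= 2 * (k * (2 * (energy P Z 0 + energy P (motion_diff (Zs n) Z) 0)) + energy P (motion_diff (Zs n) Z) t)" for n
  proof -
   have S: "strong_solution P F N lam (Zs n)" using Zs by blast
   have chain: "a <= 2 * (b + d) ==> b <= x ==> x <= y ==> a <= 2 * (y + d)" for a b d x y :: real by simp
   show ?thesis
   proof (rule chain)
    show "energy P Z t <= 2 * (energy P (Zs n) t + energy P (motion_diff (Zs n) Z) t)"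
     by (rule energy_triangle(1)[OF S t]) (use L2 t in blast)
    show "energy P (Zs n) t <= k * energy P (Zs n) 0" unfolding k_def by (rule C(2)[OF S t])
    have "energy P (Zs n) 0 <= 2 * (energy P Z 0 + energy P (motion_diff (Zs n) Z) 0)"
     by (rule energy_triangle(2)[OF S order_refl]) (use L2 in blast)
    from mult_left_mono[OF this k] show "k * energy P (Zs n) 0 <= k * (2 * (energy P Z 0 + energy P (motion_diff (Zs n) Z) 0))" .
   qed
  qed
  have "(\<lambda>n. 2 * (k * (2 * (energy P Z 0 + energy P (motion_diff (Zs n) Z) 0)) + energy P (motion_diff (Zs n) Z) t))
    \<longlonglongrightarrow> 2 * (k * (2 * (energy P Z 0 + 0)) + 0)"
   by (intro tendsto_intros lim' t order_refl)
  from LIMSEQ_le_const[OF this] le have "energy P Z t <= 2 * (k * (2 * (energy P Z 0 + 0)) + 0)" by blast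
  then show ?thesis by (simp add: k_def)
 qed
 moreover have "0 <= 4 * C" using C(1) by simp
 ultimately show ?thesis by blast
qed

end

lemma (in closed_loop_data) stable:
 assumes sigma: "0 <= s" and H: "hurwitz (Abar P - Bbar P ** C3 + 2 *\<^sub>R (Bbar P ** \<kappa>) + s *\<^sub>R mat 1)"
 shows "\<exists>\<Upsilon>>0. exp_stable_with P F N lam \<Upsilon> s"
proof -
 obtain qa qb where qab: "0 < qa" "Mhi < qa" "\<forall>i x. qa <= q i x" "\<forall>i x. q i x <= qb" using q_range by metis
 have "\<exists>\<Phi> \<Psi>. (\<forall>x. (\<Phi> has_real_derivative 1 / q i x) (at x)) \<and> \<Phi> 0 = 0 \<and> (\<forall>x. \<Psi> (\<Phi> x) = x) \<and> (\<forall>y. \<Phi> (\<Psi> y) = y)" for i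
  by (rule antiderivative_bijection[OF q_cont[of i] qab(1) spec[OF spec[OF qab(3)]] spec[OF spec[OF qab(4)]]]) blast
 then obtain \<Phi> \<Psi> where PP: "\<And>i. (\<forall>x. (\<Phi> i has_real_derivative 1 / q i x) (at x)) \<and> \<Phi> i 0 = 0 \<and> (\<forall>x. \<Psi> i (\<Phi> i x) = x) \<and> (\<forall>y. \<Phi> i (\<Psi> i y) = y)"
  by metis
 interpret closed_loop P Mlo Mhi \<kappa> F N lam \<Phi> \<Psi> qa qb
  by unfold_locales (use qab PP L_pos q_cont q_sep in auto)
 obtain C where C: "0 <= C" "\<And>Z t. closed_loop_solution P F N lam Z ==> 0 <= t ==> energy P Z t <= C * exp (- 2 * s * t) * energy P Z 0"
  using solution_decay[OF sigma H] by blast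
 \<comment> \<open>One is added to \<open>sqrt C\<close> because the constant has to be
   positive.\<close>
 have "sqrt (energy P Z t) <= (sqrt C + 1) * sqrt (energy P Z 0) * exp (- s * t)"
  if "closed_loop_solution P F N lam Z" "0 <= t" for Z t
 proof -
  \<comment> \<open>Outside the integrable case the integral is 0 by convention, so the sign holds
    for every \<open>f\<close>.\<close>
  have "0 <= sq_norm P f 0" for f
  proof (cases "(\<lambda>x. (f x 0)\<^sup>2) integrable_on {0..l 0}")
   case True
   then show ?thesis unfolding sq_norm_def by (rule Henstock_Kurzweil_Integration.integral_nonneg) simp
  qed (simp add: sq_norm_def not_integrable_integral)
  then have e: "0 <= energy P Z 0" unfolding energy_def by (intro add_nonneg_nonneg) auto
  have "sqrt (energy P Z t) <= sqrt (C * exp (- 2 * s * t) * energy P Z 0)" by (rule real_sqrt_le_mono[OF C(2)[OF that]])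
  also have "... = sqrt C * exp (- s * t) * sqrt (energy P Z 0)"
  proof -
   have "exp (- 2 * s * t) = (exp (- s * t))\<^sup>2" by (simp add: power2_eq_square exp_add[symmetric])
   then show ?thesis by (simp add: real_sqrt_mult)
  qed
  also have "... <= (sqrt C + 1) * exp (- s * t) * sqrt (energy P Z 0)"
   using e by (intro mult_right_mono) auto
  finally show ?thesis by (simp add: mult_ac)
 qed
 then show ?thesis unfolding exp_stable_with_def using C(1)
  by (intro exI[of _ "sqrt C + 1"]) (auto simp: add_nonneg_pos)
qed

section \<open>Assignment of the decay rate\<close>

text \<open>Two decoupled second-order systems, each with characteristic polynomial
  \<open>(z + a)\<^sup>2\<close>. The position rows are forced by the plant; the velocity rows are
  chosen so that \<open>- a\<close> is the only eigenvalue.\<close>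

definition target :: "real => real^4^4" where
 "target a = vector [vector [0, 1, 0, 0], vector [- a\<^sup>2, - 2 * a, 0, 0], vector [0, 0, 0, 1], vector [0, 0, - a\<^sup>2, - 2 * a]]"

context plant_data
begin

lemma input_rows: "Bbar P $ 1 $ j = 0" "Bbar P $ 3 $ j = 0"
 using exhaust_2[of j] by (auto simp: Bbar_def)

lemma drift_rows:
 "(Abar P - Bbar P ** C3) $ 1 $ m = (if m = 2 then 1 else 0)" "(Abar P - Bbar P ** C3) $ 3 $ m = (if m = 4 then 1 else 0)"
 "(Abar P - Bbar P ** C3) $ k $ 1 = 0" "(Abar P - Bbar P ** C3) $ k $ 3 = 0"
 using exhaust_4[of m] exhaust_4[of k]
 by (auto simp: matrix_matrix_mult_def sum_2 input_rows Abar_def C3_def)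

definition inputs :: "real^2^2" where "inputs = vector [Bbar P $ 2, Bbar P $ 4]"

lemma inputs_nth: "inputs $ 1 = Bbar P $ 2" "inputs $ 2 = Bbar P $ 4"
 by (simp_all add: inputs_def)

text \<open>If \<open>y\<close> annihilates the velocity rows of \<open>Bbar P\<close>, then the \<open>y\<close>-combination of the velocities minus a
 combination of the positions is a first integral for every input, which contradicts controllability.\<close>

lemma inputs_invertible: "invertible inputs"
proof (rule ccontr)
 assume "\<not> invertible inputs"
 then have det: "inputs $ 1 $ 1 * inputs $ 2 $ 2 = inputs $ 1 $ 2 * inputs $ 2 $ 1"
  by (simp add: invertible_det_nz det_2)
 \<comment> \<open>A nonzero row vector that annihilates the singular matrix \<open>inputs\<close>
   from the left.\<close>
 have "\<exists>y1 y2. (y1 \<noteq> 0 \<or> y2 \<noteq> 0) \<and> y1 * inputs $ 1 $ 1 + y2 * inputs $ 2 $ 1 = 0 \<and> y1 * inputs $ 1 $ 2 + y2 * inputs $ 2 $ 2 = 0"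
 proof (cases "inputs $ 1 $ 1 = 0 \<and> inputs $ 2 $ 1 = 0")
  case True
  show ?thesis
  proof (cases "inputs $ 1 $ 2 = 0 \<and> inputs $ 2 $ 2 = 0")
   case True
   then show ?thesis using \<open>inputs $ 1 $ 1 = 0 \<and> inputs $ 2 $ 1 = 0\<close> by (intro exI[of _ 1] exI[of _ 0]) simp
  next
   case False
   then show ?thesis using True by (intro exI[of _ "inputs $ 2 $ 2"] exI[of _ "- inputs $ 1 $ 2"]) auto
  qed
 next
  case False
  then show ?thesis using det by (intro exI[of _ "inputs $ 2 $ 1"] exI[of _ "- inputs $ 1 $ 1"]) (auto simp: mult.commute)
 qed
 then obtain y1 y2 where y': "y1 \<noteq> 0 \<or> y2 \<noteq> 0" "y1 * inputs $ 1 $ 1 + y2 * inputs $ 2 $ 1 = 0" "y1 * inputs $ 1 $ 2 + y2 * inputs $ 2 $ 2 = 0"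
  by (elim exE conjE)
 have y: "y1 \<noteq> 0 \<or> y2 \<noteq> 0" "y1 * Bbar P $ 2 $ j + y2 * Bbar P $ 4 $ j = 0" for j
  using y' exhaust_2[of j] by (auto simp: inputs_nth)
 let ?A = "Abar P - Bbar P ** C3"
 \<comment> \<open>Chosen so that the first integral \<open>f\<close>, which is 0 at the start,
   would have to equal \<open>y1\<^sup>2 + y2\<^sup>2\<close> at time 1.\<close>
 define x1 :: "real^4" where "x1 = vector [0, y1, 0, y2]"
 have "\<exists>v x. continuous_on {0..1} v \<and> x 0 = 0 \<and> x 1 = x1 \<and>
   (\<forall>t\<in>{0..1}. (x has_vector_derivative (?A *v x t + Bbar P *v v t)) (at t within {0..1}))"
  by (rule SAD(9)[unfolded controllable_def, THEN spec[of _ 0], THEN spec[of _ x1], THEN spec[of _ 1], THEN mp, OF zero_less_one])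
 then obtain v :: "real => real^2" and x :: "real => real^4" where hx: "x 0 = 0 \<and> x 1 = x1 \<and>
   (\<forall>t\<in>{0..1}. (x has_vector_derivative (?A *v x t + Bbar P *v v t)) (at t within {0..1}))"
  by (elim exE conjE) simp
 note x = hx[THEN conjunct1] hx[THEN conjunct2, THEN conjunct1] hx[THEN conjunct2, THEN conjunct2, THEN bspec]
 have xk: "((\<lambda>t. x t $ k) has_real_derivative (?A *v x t + Bbar P *v v t) $ k) (at t within {0..1})" if "t \<in> {0..1}" for k t
  using bounded_linear.has_vector_derivative[OF bounded_linear_vec_nth x(3)[OF that], of k]
  by (simp add: has_real_derivative_iff_has_vector_derivative)
 \<comment> \<open>\<open>m1\<close> and \<open>m2\<close> are the coefficients of the velocities in
   the derivative of the \<open>y\<close>-combination; the same combination of positions, whose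
   derivatives are the velocities, cancels them.\<close>
 define m1 where "m1 = y1 * ?A $ 2 $ 2 + y2 * ?A $ 4 $ 2"
 define m2 where "m2 = y1 * ?A $ 2 $ 4 + y2 * ?A $ 4 $ 4"
 define f where "f t = y1 * x t $ 2 + y2 * x t $ 4 - (m1 * x t $ 1 + m2 * x t $ 3)" for t
 have "(f has_real_derivative 0) (at t within {0..1})" if t: "t \<in> {0..1}" for t
 proof -
  have B: "y1 * (Bbar P *v v t) $ 2 + y2 * (Bbar P *v v t) $ 4 = 0"
  proof -
   have "y1 * (Bbar P *v v t) $ 2 + y2 * (Bbar P *v v t) $ 4
     = (y1 * Bbar P $ 2 $ 1 + y2 * Bbar P $ 4 $ 1) * v t $ 1 + (y1 * Bbar P $ 2 $ 2 + y2 * Bbar P $ 4 $ 2) * v t $ 2"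
    by (simp add: matrix_vector_mult_def sum_2 algebra_simps)
   then show ?thesis by (simp only: y(2) mult_zero_left add_0_left)
  qed
  have "y1 * (?A *v x t + Bbar P *v v t) $ 2 + y2 * (?A *v x t + Bbar P *v v t) $ 4
    - (m1 * (?A *v x t + Bbar P *v v t) $ 1 + m2 * (?A *v x t + Bbar P *v v t) $ 3)
   = y1 * (?A *v x t) $ 2 + y2 * (?A *v x t) $ 4 + (y1 * (Bbar P *v v t) $ 2 + y2 * (Bbar P *v v t) $ 4)
    - (m1 * (?A *v x t + Bbar P *v v t) $ 1 + m2 * (?A *v x t + Bbar P *v v t) $ 3)"
   by (simp add: algebra_simps)
  also have "... = 0"
   unfolding B by (simp add: matrix_vector_mult_def sum_4 sum_2 drift_rows input_rows m1_def m2_def algebra_simps del: vector_minus_component)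
  finally have z: "y1 * (?A *v x t + Bbar P *v v t) $ 2 + y2 * (?A *v x t + Bbar P *v v t) $ 4
    - (m1 * (?A *v x t + Bbar P *v v t) $ 1 + m2 * (?A *v x t + Bbar P *v v t) $ 3) = 0" .
  have "(f has_real_derivative y1 * (?A *v x t + Bbar P *v v t) $ 2 + y2 * (?A *v x t + Bbar P *v v t) $ 4
    - (m1 * (?A *v x t + Bbar P *v v t) $ 1 + m2 * (?A *v x t + Bbar P *v v t) $ 3)) (at t within {0..1})"
   unfolding f_def[abs_def] by (intro DERIV_diff DERIV_add DERIV_cmult xk t)
  then show ?thesis unfolding z .
 qed
 then obtain c where "\<forall>t\<in>{0..1}. f t = c" using has_field_derivative_zero_constant[of "{0..1}" f] by auto
 then have "f 0 = f 1" by simp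
 then have "y1\<^sup>2 + y2\<^sup>2 = 0" unfolding f_def x by (simp add: x1_def power2_eq_square)
 then show False using y(1) by (simp add: sum_power2_eq_zero_iff)
qed

text \<open>Rows 1 and 3 of the drift already agree with those of \<open>target a\<close> and
  receive no input. Rows 2 and 4 are assigned by solving with the invertible matrix
  \<open>inputs\<close>; the factor 1/2 in \<open>\<kappa>\<close> compensates the 2 of the
  closed-loop matrix.\<close>

lemma gain_exists: "\<exists>\<kappa>. Abar P - Bbar P ** C3 + 2 *\<^sub>R (Bbar P ** \<kappa>) = target a"
proof -
 let ?A = "Abar P - Bbar P ** C3"
 define R :: "real^4^2" where "R = vector [target a $ 2 - ?A $ 2, target a $ 4 - ?A $ 4]"
 obtain V where V: "inputs ** V = mat 1" using inputs_invertible unfolding invertible_def by blast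
 define \<kappa> where "\<kappa> = (1 / 2) *\<^sub>R (V ** R)"
 have row: "2 * (\<Sum>j\<in>UNIV. inputs $ i $ j * \<kappa> $ j $ k) = R $ i $ k" for i k
 proof -
  have "2 * (\<Sum>j\<in>UNIV. inputs $ i $ j * \<kappa> $ j $ k) = (\<Sum>j\<in>UNIV. inputs $ i $ j * (V ** R) $ j $ k)"
   by (simp add: \<kappa>_def sum_distrib_left mult_ac)
  also have "... = (inputs ** (V ** R)) $ i $ k" by (simp add: matrix_matrix_mult_def)
  also have "inputs ** (V ** R) = R" using V by (simp add: matrix_mul_assoc)
  finally show ?thesis .
 qed
 have "(?A + 2 *\<^sub>R (Bbar P ** \<kappa>)) $ i $ k = target a $ i $ k" for i k
 proof -
  have "(?A + 2 *\<^sub>R (Bbar P ** \<kappa>)) $ i $ k = ?A $ i $ k + 2 * (\<Sum>j\<in>UNIV. Bbar P $ i $ j * \<kappa> $ j $ k)"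
   by (simp add: matrix_matrix_mult_def)
  also have "... = target a $ i $ k"
  proof -
   have "2 * (\<Sum>j\<in>UNIV. Bbar P $ 2 $ j * \<kappa> $ j $ k) = target a $ 2 $ k - ?A $ 2 $ k"
    "2 * (\<Sum>j\<in>UNIV. Bbar P $ 4 $ j * \<kappa> $ j $ k) = target a $ 4 $ k - ?A $ 4 $ k"
    using row[of 1 k] row[of 2 k] unfolding inputs_nth by (simp_all add: R_def)
   moreover have "?A $ 1 $ k = target a $ 1 $ k" "?A $ 3 $ k = target a $ 3 $ k"
    unfolding drift_rows using exhaust_4[of k] by (auto simp: target_def)
   ultimately show ?thesis using exhaust_4[of i] input_rows by (auto simp del: vector_minus_component)
  qed
  finally show ?thesis .
 qed
 then show ?thesis by (intro exI[of _ \<kappa>]) (simp add: vec_eq_iff)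
qed

end

text \<open>Eliminating the velocity from each pair of rows leaves
  \<open>(z + of_real a)\<^sup>2\<close> times the position, so for any other \<open>z\<close> both
  positions vanish, and then the velocities.\<close>

lemma target_eigenvalue:
 assumes v: "v \<noteq> 0" "map_matrix complex_of_real (target a) *v v = z *s v"
 shows "z = - of_real a"
proof (rule ccontr)
 assume z: "z \<noteq> - of_real a"
 have "(map_matrix complex_of_real (target a) *v v) $ k = z * v $ k" for k using v(2) by simp
 from this[of 1] this[of 2] this[of 3] this[of 4]
 have e: "v $ 2 = z * v $ 1" "- (of_real a)\<^sup>2 * v $ 1 - 2 * of_real a * v $ 2 = z * v $ 2"
  "v $ 4 = z * v $ 3" "- (of_real a)\<^sup>2 * v $ 3 - 2 * of_real a * v $ 4 = z * v $ 4"
  by (simp_all add: matrix_vector_mult_def sum_4 map_matrix_def target_def)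
 have sq: "(z + of_real a)\<^sup>2 * w = z * (z * w) - (- (of_real a)\<^sup>2 * w - 2 * of_real a * (z * w))" for w
  by (simp add: power2_eq_square algebra_simps)
 have "(z + of_real a)\<^sup>2 * v $ 1 = 0" "(z + of_real a)\<^sup>2 * v $ 3 = 0"
  using e(2) e(4) unfolding e(1) e(3) sq by simp_all
 moreover have "z + of_real a \<noteq> 0" using z by (simp add: add_eq_0_iff2)
 ultimately have "v $ 1 = 0" "v $ 3 = 0" by auto
 then have "v = 0" using e(1,3) by (simp add: vec_eq_iff forall_4)
 then show False using v(1) by simp
qed

lemma target_hurwitz: "s < a ==> hurwitz (target a + s *\<^sub>R mat 1)"
 unfolding hurwitz_def map_matrix_shift
proof (intro allI impI)
 fix z and v :: "complex^4" assume s: "s < a"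
  and v: "v \<noteq> 0 \<and> map_matrix complex_of_real (target a) *v v + complex_of_real s *s v = z *s v"
 then have "map_matrix complex_of_real (target a) *v v = (z - complex_of_real s) *s v"
  by (simp add: vec_eq_iff algebra_simps)
 then have "z - complex_of_real s = - of_real a" using v by (intro target_eigenvalue) auto
 then have "z = of_real (s - a)" by (simp add: algebra_simps)
 then show "Re z < 0" using s by simp
qed

theorem theorem1:
  fixes P :: plant and Mlo Mhi :: real
  assumes "standing_assumptions P Mlo Mhi"
  shows "(\<forall>\<kappa> F N lam.
            hurwitz (Abar P - Bbar P ** C3 + 2 *\<^sub>R (Bbar P ** \<kappa>)) \<and> kernels P \<kappa> F N lam \<longrightarrow>
            (\<exists>\<Upsilon>1>0. \<exists>\<sigma>1>0. exp_stable_with P F N lam \<Upsilon>1 \<sigma>1))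
       \<and> (\<forall>\<sigma>1>0. \<exists>\<kappa>.
            hurwitz (Abar P - Bbar P ** C3 + 2 *\<^sub>R (Bbar P ** \<kappa>)) \<and>
            (\<forall>F N lam. kernels P \<kappa> F N lam \<longrightarrow> (\<exists>\<Upsilon>1>0. exp_stable_with P F N lam \<Upsilon>1 \<sigma>1)))"
proof (intro conjI allI impI)
 interpret plant_data P Mlo Mhi by unfold_locales (rule assms)
 {
  fix \<kappa> F N lam
  assume a: "hurwitz (Abar P - Bbar P ** C3 + 2 *\<^sub>R (Bbar P ** \<kappa>)) \<and> kernels P \<kappa> F N lam"
  then interpret closed_loop_data P Mlo Mhi \<kappa> F N lam by unfold_locales simp
  \<comment> \<open>For an arbitrary admissible gain the rate is a margin that the Hurwitz property
    leaves.\<close>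
  obtain s where "0 < s" "hurwitz (Abar P - Bbar P ** C3 + 2 *\<^sub>R (Bbar P ** \<kappa>) + s *\<^sub>R mat 1)"
   using hurwitz_margin a by blast
  then show "\<exists>\<Upsilon>1>0. \<exists>\<sigma>1>0. exp_stable_with P F N lam \<Upsilon>1 \<sigma>1" using stable[of s] by auto
 next
  fix \<sigma> :: real assume s: "0 < \<sigma>"
  \<comment> \<open>One more than the desired rate: shifted by \<open>\<sigma>\<close>, the matrix
    still has -1 as its only eigenvalue.\<close>
  obtain \<kappa> where k: "Abar P - Bbar P ** C3 + 2 *\<^sub>R (Bbar P ** \<kappa>) = target (\<sigma> + 1)" using gain_exists by blast
  show "\<exists>\<kappa>. hurwitz (Abar P - Bbar P ** C3 + 2 *\<^sub>R (Bbar P ** \<kappa>)) \<and>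
      (\<forall>F N lam. kernels P \<kappa> F N lam \<longrightarrow> (\<exists>\<Upsilon>1>0. exp_stable_with P F N lam \<Upsilon>1 \<sigma>))"
  proof (intro exI[of _ \<kappa>] conjI allI impI)
   show "hurwitz (Abar P - Bbar P ** C3 + 2 *\<^sub>R (Bbar P ** \<kappa>))"
    using target_hurwitz[of 0 "\<sigma> + 1"] s unfolding k by simp
   fix F N lam assume "kernels P \<kappa> F N lam"
   then interpret closed_loop_data P Mlo Mhi \<kappa> F N lam by unfold_locales
   show "\<exists>\<Upsilon>1>0. exp_stable_with P F N lam \<Upsilon>1 \<sigma>"
    using stable[of \<sigma>] target_hurwitz[of \<sigma> "\<sigma> + 1"] s unfolding k by simp
  qed
 }
qed

end
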